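(* Let $n\ge1$ and let $M$ be a $Y_{r,n}^{d}$-module. Then there is a natural isomorphism of $Y_{r,n}^d$-modules $$\mathrm{Res}_{Y_{r,n}^{d}}^{Y_{r,n+1}^{d}}\mathrm{Ind}_{Y_{r,n}^{d}}^{Y_{r,n+1}^{d}}M\;\cong\; M^{\oplus rd}\oplus \mathrm{Ind}_{Y_{r,n-1}^{d}}^{Y_{r,n}^{d}}\mathrm{Res}_{Y_{r,n-1}^{d}}^{Y_{r,n}^{d}}M.$$
   Context: Let $r,d\geq 1$ be integers, $\zeta=e^{2\pi i/r}$, let $q,v_1,\ldots,v_d$ be indeterminates and $\mathcal{R}=\mathbb{Z}[\tfrac1r,\zeta][q^{\pm1},v_1^{\pm1},\ldots,v_d^{\pm1}]$. For $n\ge1$, $\mathfrak{S}_n$ acts on $\{1,\ldots,n\}$ on the right and $s_i=(i,i+1)$. The affine Yokonuma-Hecke algebra $\widehat{Y}_{r,n}$ is the associative $\mathcal{R}$-algebra generated by $t_1,\ldots,t_n,g_1,\ldots,g_{n-1},X_1^{\pm1}$ with relations: $g_ig_j=g_jg_i$ if $|i-j|\ge2$; $g_ig_{i+1}g_i=g_{i+1}g_ig_{i+1}$; $t_it_j=t_jt_i$; $g_it_j=t_{js_i}g_i$; $t_i^r=1$; $g_i^2=1+(q-q^{-1})e_ig_i$, where $e_i=\frac1r\sum_{s=0}^{r-1}t_i^st_{i+1}^{-s}$; $X_1X_1^{-1}=X_1^{-1}X_1=1$; $g_1X_1g_1X_1=X_1g_1X_1g_1$; $g_iX_1=X_1g_i$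 for $i\ge2$; $t_jX_1=X_1t_j$ for all $j$. The cyclotomic Yokonuma-Hecke algebra is $Y_{r,n}^d=\widehat{Y}_{r,n}/\mathcal{J}_d$, where $\mathcal{J}_d$ is the two-sided ideal generated by $(X_1-v_1)\cdots(X_1-v_d)$; put $Y_{r,0}^d=\mathcal{R}$. $Y_{r,n}^d$ is identified with the subalgebra of $Y_{r,n+1}^d$ generated by the generators of the same names. Modules are left modules; $\mathrm{Ind}_{Y_{r,n}^{d}}^{Y_{r,n+1}^{d}}M=Y_{r,n+1}^d\otimes_{Y_{r,n}^d}M$ and $\mathrm{Res}_{Y_{r,n}^{d}}^{Y_{r,n+1}^{d}}$ is the restriction functor. *)

theory Defs
  imports
    Complex_Main
    "HOL-Library.Poly_Mapping"
    "HOL-Library.FuncSet"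
    "HOL-Combinatorics.Transposition"
    "HOL-Algebra.QuotRing"
    "HOL-Algebra.Generated_Rings"
    "HOL-Algebra.Free_Abelian_Groups"
    "HOL-Algebra.Algebraic_Closure_Type"
begin

section \<open>Free algebras over subrings\<close>

text \<open>\<open>a word\<close> is the free monoid, written additively so that the convolution product of
  \<^theory>\<open>HOL-Library.Poly_Mapping\<close> makes \<open>a word \<Rightarrow>\<^sub>0 b\<close> the free (noncommutative)
  \<open>b\<close>-algebra.\<close>

datatype 'a word = Word (letters: "'a list")

instantiation word :: (type) monoid_add
begin
definition zero_word :: "'a word" where "zero_word = Word []"
definition plus_word :: "'a word \<Rightarrow> 'a word \<Rightarrow> 'a word"
  where "plus_word u v = Word (letters u @ letters v)"
instance by standard (auto simp: zero_word_def plus_word_def)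
end

text \<open>\<open>monoid_ring S W\<close> is the monoid ring \<open>S[W]\<close> of a submonoid \<open>W\<close> over a subring \<open>S\<close>.\<close>

definition monoid_ring :: "'b::ring_1 set \<Rightarrow> 'a::monoid_add set \<Rightarrow> ('a \<Rightarrow>\<^sub>0 'b) ring" where
  "monoid_ring S W = ring_of_type_algebra
     \<lparr>carrier := {p. (\<forall>w. Poly_Mapping.lookup p w \<in> S) \<and> Poly_Mapping.keys p \<subseteq> W}\<rparr>"


section \<open>The base ring\<close>

text \<open>An exponent vector \<open>m\<close> stands for \<open>q\<^bsup>m(0)\<^esup> v\<^sub>1\<^bsup>m(1)\<^esup> v\<^sub>2\<^bsup>m(2)\<^esup> \<dots>\<close>,
  with integer exponents.\<close>

type_synonym laurent = "(nat \<Rightarrow>\<^sub>0 int) \<Rightarrow>\<^sub>0 complex"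

definition const :: "complex \<Rightarrow> laurent" where "const c = Poly_Mapping.single 0 c"

definition lvar :: "nat \<Rightarrow> int \<Rightarrow> laurent"
  where "lvar i k = Poly_Mapping.single (Poly_Mapping.single i k) 1"

abbreviation lq :: laurent where "lq \<equiv> lvar 0 1"
abbreviation lq_inv :: laurent where "lq_inv \<equiv> lvar 0 (-1)"
abbreviation lv :: "nat \<Rightarrow> laurent" where "lv i \<equiv> lvar i 1"

definition zeta :: "nat \<Rightarrow> complex"
  where "zeta r = exp (2 * complex_of_real pi * \<i> / of_nat r)"

definition base_coeffs :: "nat \<Rightarrow> complex set"
  where "base_coeffs r = generate_ring ring_of_type_algebra {1 / of_nat r, zeta r}"

definition base_ring :: "nat \<Rightarrow> nat \<Rightarrow> laurent ring"
  where "base_ring r d = monoid_ring (base_coeffs r) {m. Poly_Mapping.keys m \<subseteq> {0..d}}"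


section \<open>Affine and cyclotomic Yokonuma-Hecke algebras\<close>

datatype gen = gen_t nat | gen_g nat | gen_X | gen_Xinv

type_synonym yh_poly = "gen word \<Rightarrow>\<^sub>0 laurent"

definition gens :: "nat \<Rightarrow> gen set" where
  "gens n = {gen_t j | j. 1 \<le> j \<and> j \<le> n} \<union> {gen_g i | i. 1 \<le> i \<and> i < n}
          \<union> (if n = 0 then {} else {gen_X, gen_Xinv})"

definition free_alg :: "nat \<Rightarrow> nat \<Rightarrow> nat \<Rightarrow> yh_poly ring" where
  "free_alg r d n = monoid_ring (carrier (base_ring r d)) {w. set (letters w) \<subseteq> gens n}"

definition scal :: "laurent \<Rightarrow> yh_poly" where "scal a = Poly_Mapping.single 0 a"

definition letter :: "gen \<Rightarrow> yh_poly" where "letter x = Poly_Mapping.single (Word [x]) 1"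

abbreviation yt :: "nat \<Rightarrow> yh_poly" where "yt j \<equiv> letter (gen_t j)"
abbreviation yg :: "nat \<Rightarrow> yh_poly" where "yg i \<equiv> letter (gen_g i)"
abbreviation yX :: yh_poly where "yX \<equiv> letter gen_X"
abbreviation yXinv :: yh_poly where "yXinv \<equiv> letter gen_Xinv"

text \<open>The generators \<open>t\<^sub>j\<close> are invertible only modulo \<open>t\<^sub>j\<^sup>r = 1\<close>, hence \<open>t\<^bsup>-s\<^esup>\<close> is
  written \<open>t\<^bsup>r-s\<^esup>\<close>.\<close>

definition ye :: "nat \<Rightarrow> nat \<Rightarrow> yh_poly" where
  "ye r i = scal (const (1 / of_nat r)) * (\<Sum>s<r. yt i ^ s * yt (i + 1) ^ (r - s))"

definition yh_relations :: "nat \<Rightarrow> nat \<Rightarrow> yh_poly set" where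
  "yh_relations r n =
     {yg i * yg j - yg j * yg i | i j.
        1 \<le> i \<and> i < n \<and> 1 \<le> j \<and> j < n \<and> (i + 2 \<le> j \<or> j + 2 \<le> i)}
   \<union> {yg i * yg (i + 1) * yg i - yg (i + 1) * yg i * yg (i + 1) | i. 1 \<le> i \<and> i + 1 < n}
   \<union> {yt i * yt j - yt j * yt i | i j. 1 \<le> i \<and> i \<le> n \<and> 1 \<le> j \<and> j \<le> n}
   \<union> {yg i * yt j - yt (Transposition.transpose i (i + 1) j) * yg i | i j.
        1 \<le> i \<and> i < n \<and> 1 \<le> j \<and> j \<le> n}
   \<union> {yt j ^ r - 1 | j. 1 \<le> j \<and> j \<le> n}
   \<union> {yg i ^ 2 - (1 + scal (lq - lq_inv) * ye r i * yg i) | i. 1 \<le> i \<and> i < n}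
   \<union> (if n = 0 then {} else {yX * yXinv - 1, yXinv * yX - 1})
   \<union> (if n < 2 then {} else {yg 1 * yX * yg 1 * yX - yX * yg 1 * yX * yg 1})
   \<union> {yg i * yX - yX * yg i | i. 2 \<le> i \<and> i < n}
   \<union> {yt j * yX - yX * yt j | j. 1 \<le> j \<and> j \<le> n}"

text \<open>The ideals below are two-sided. They are stable under scalars because the free
  algebra contains the base ring.\<close>

definition yh_ideal :: "nat \<Rightarrow> nat \<Rightarrow> nat \<Rightarrow> yh_poly set"
  where "yh_ideal r d n = genideal (free_alg r d n) (yh_relations r n)"

definition affine_YH :: "nat \<Rightarrow> nat \<Rightarrow> nat \<Rightarrow> yh_poly set ring"
  where "affine_YH r d n = free_alg r d n Quot yh_ideal r d n"

definition cyc_poly :: "nat \<Rightarrow> yh_poly"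
  where "cyc_poly d = prod_list (map (\<lambda>i. yX - scal (lv i)) [1..<d + 1])"

definition cyc_ideal :: "nat \<Rightarrow> nat \<Rightarrow> nat \<Rightarrow> yh_poly set set" where
  "cyc_ideal r d n = genideal (affine_YH r d n)
     (if n = 0 then {} else {yh_ideal r d n +>\<^bsub>free_alg r d n\<^esub> cyc_poly d})"

text \<open>For \<open>n = 0\<close> there are neither generators nor relations and \<open>cyc_YH r d 0\<close> is the base
  ring, see \<open>base_ring_iso_cyc_YH_0\<close> below.\<close>

definition cyc_YH :: "nat \<Rightarrow> nat \<Rightarrow> nat \<Rightarrow> yh_poly set set ring"
  where "cyc_YH r d n = affine_YH r d n Quot cyc_ideal r d n"

definition cyc_class :: "nat \<Rightarrow> nat \<Rightarrow> nat \<Rightarrow> yh_poly \<Rightarrow> yh_poly set set" where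
  "cyc_class r d n f =
     cyc_ideal r d n +>\<^bsub>affine_YH r d n\<^esub> (yh_ideal r d n +>\<^bsub>free_alg r d n\<^esub> f)"

text \<open>The homomorphism from level \<open>n\<close> to level \<open>n + 1\<close> sending each generator to the
  generator of the same name; it is well defined by \<open>cyc_incl_class\<close> below.\<close>

definition cyc_incl :: "nat \<Rightarrow> nat \<Rightarrow> nat \<Rightarrow> yh_poly set set \<Rightarrow> yh_poly set set" where
  "cyc_incl r d n x =
     the_elem (cyc_class r d (Suc n) ` {f \<in> carrier (free_alg r d n). cyc_class r d n f = x})"


section \<open>Left modules over noncommutative rings\<close>

locale left_module = R?: ring R + M?: abelian_group M
  for R :: "('a, 'r) ring_scheme" (structure) and M :: "('a, 'm, 'e) module_scheme" (structure) +
  assumes smult_closed [simp, intro]: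
      "\<lbrakk>a \<in> carrier R; x \<in> carrier M\<rbrakk> \<Longrightarrow> a \<odot>\<^bsub>M\<^esub> x \<in> carrier M"
    and smult_l_distr:
      "\<lbrakk>a \<in> carrier R; b \<in> carrier R; x \<in> carrier M\<rbrakk> \<Longrightarrow>
      (a \<oplus>\<^bsub>R\<^esub> b) \<odot>\<^bsub>M\<^esub> x = a \<odot>\<^bsub>M\<^esub> x \<oplus>\<^bsub>M\<^esub> b \<odot>\<^bsub>M\<^esub> x"
    and smult_r_distr:
      "\<lbrakk>a \<in> carrier R; x \<in> carrier M; y \<in> carrier M\<rbrakk> \<Longrightarrow>
      a \<odot>\<^bsub>M\<^esub> (x \<oplus>\<^bsub>M\<^esub> y) = a \<odot>\<^bsub>M\<^esub> x \<oplus>\<^bsub>M\<^esub> a \<odot>\<^bsub>M\<^esub> y"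
    and smult_assoc1:
      "\<lbrakk>a \<in> carrier R; b \<in> carrier R; x \<in> carrier M\<rbrakk> \<Longrightarrow>
      (a \<otimes>\<^bsub>R\<^esub> b) \<odot>\<^bsub>M\<^esub> x = a \<odot>\<^bsub>M\<^esub> (b \<odot>\<^bsub>M\<^esub> x)"
    and smult_one [simp]:
      "x \<in> carrier M \<Longrightarrow> \<one>\<^bsub>R\<^esub> \<odot>\<^bsub>M\<^esub> x = x"

definition lmod_hom ::
  "('a, 'r) ring_scheme \<Rightarrow> ('a, 'm, 'e) module_scheme \<Rightarrow> ('a, 'n, 'f) module_scheme \<Rightarrow> ('m \<Rightarrow> 'n) set"
  where
  "lmod_hom A M N = {f \<in> carrier M \<rightarrow> carrier N.
     (\<forall>x\<in>carrier M. \<forall>y\<in>carrier M. f (x \<oplus>\<^bsub>M\<^esub> y) = f x \<oplus>\<^bsub>N\<^esub> f y) \<and>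
     (\<forall>a\<in>carrier A. \<forall>x\<in>carrier M. f (a \<odot>\<^bsub>M\<^esub> x) = a \<odot>\<^bsub>N\<^esub> f x)}"

definition lmod_iso ::
  "('a, 'r) ring_scheme \<Rightarrow> ('a, 'm, 'e) module_scheme \<Rightarrow> ('a, 'n, 'f) module_scheme \<Rightarrow> ('m \<Rightarrow> 'n) set"
  where "lmod_iso A M N = {f \<in> lmod_hom A M N. bij_betw f (carrier M) (carrier N)}"

text \<open>The \<^typ>\<open>('a, 'm) module\<close> record inherits a multiplication and a one from
  \<^typ>\<open>'m ring\<close>; they play no role for modules and are left undefined below.\<close>

definition dir_sum :: "('a, 'm) module \<Rightarrow> ('a, 'n) module \<Rightarrow> ('a, 'm \<times> 'n) module" where
  "dir_sum M N = \<lparr>carrier = carrier M \<times> carrier N, monoid.mult = undefined, one = undefined,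
     ring.zero = (\<zero>\<^bsub>M\<^esub>, \<zero>\<^bsub>N\<^esub>),
     add = (\<lambda>x y. (fst x \<oplus>\<^bsub>M\<^esub> fst y, snd x \<oplus>\<^bsub>N\<^esub> snd y)),
     module.smult = (\<lambda>a x. (a \<odot>\<^bsub>M\<^esub> fst x, a \<odot>\<^bsub>N\<^esub> snd x))\<rparr>"

definition dir_power :: "nat \<Rightarrow> ('a, 'm) module \<Rightarrow> ('a, nat \<Rightarrow> 'm) module" where
  "dir_power k M = \<lparr>carrier = {..<k} \<rightarrow>\<^sub>E carrier M, monoid.mult = undefined, one = undefined,
     ring.zero = (\<lambda>i\<in>{..<k}. \<zero>\<^bsub>M\<^esub>),
     add = (\<lambda>x y. \<lambda>i\<in>{..<k}. x i \<oplus>\<^bsub>M\<^esub> y i),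
     module.smult = (\<lambda>a x. \<lambda>i\<in>{..<k}. a \<odot>\<^bsub>M\<^esub> x i)\<rparr>"

definition dir_power_map :: "nat \<Rightarrow> ('m \<Rightarrow> 'n) \<Rightarrow> (nat \<Rightarrow> 'm) \<Rightarrow> nat \<Rightarrow> 'n"
  where "dir_power_map k f x = (\<lambda>i\<in>{..<k}. f (x i))"


section \<open>Restriction and induction along a ring homomorphism\<close>

definition res :: "('a \<Rightarrow> 'b) \<Rightarrow> ('b, 'm) module \<Rightarrow> ('a, 'm) module" where
  "res \<phi> N = \<lparr>carrier = carrier N, monoid.mult = monoid.mult N, one = one N,
     ring.zero = \<zero>\<^bsub>N\<^esub>, add = ring.add N,
     module.smult = (\<lambda>a x. \<phi> a \<odot>\<^bsub>N\<^esub> x)\<rparr>"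

text \<open>The tensor product of \<open>B\<close> (a right \<open>A\<close>-module through \<open>\<phi>\<close>) and \<open>M\<close> over \<open>A\<close> is the
  free abelian group on pairs modulo the balancing relations.\<close>

definition tensor_relations ::
  "('a, 'r) ring_scheme \<Rightarrow> ('b, 's) ring_scheme \<Rightarrow> ('a \<Rightarrow> 'b) \<Rightarrow> ('a, 'm) module \<Rightarrow> ('b \<times> 'm \<Rightarrow>\<^sub>0 int) set"
  where
  "tensor_relations A B \<phi> M =
     {frag_of (b \<oplus>\<^bsub>B\<^esub> b', x) - frag_of (b, x) - frag_of (b', x) | b b' x.
        b \<in> carrier B \<and> b' \<in> carrier B \<and> x \<in> carrier M}
   \<union> {frag_of (b, x \<oplus>\<^bsub>M\<^esub> x') - frag_of (b, x) - frag_of (b, x') | b x x'.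
        b \<in> carrier B \<and> x \<in> carrier M \<and> x' \<in> carrier M}
   \<union> {frag_of (b \<otimes>\<^bsub>B\<^esub> \<phi> a, x) - frag_of (b, a \<odot>\<^bsub>M\<^esub> x) | b a x.
        b \<in> carrier B \<and> a \<in> carrier A \<and> x \<in> carrier M}"

definition tensor_free :: "('b, 's) ring_scheme \<Rightarrow> ('a, 'm) module \<Rightarrow> ('b \<times> 'm \<Rightarrow>\<^sub>0 int) monoid"
  where "tensor_free B M = free_Abelian_group (carrier B \<times> carrier M)"

definition tensor_kernel ::
  "('a, 'r) ring_scheme \<Rightarrow> ('b, 's) ring_scheme \<Rightarrow> ('a \<Rightarrow> 'b) \<Rightarrow> ('a, 'm) module \<Rightarrow> ('b \<times> 'm \<Rightarrow>\<^sub>0 int) set"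
  where "tensor_kernel A B \<phi> M = generate (tensor_free B M) (tensor_relations A B \<phi> M)"

definition tensor_class ::
  "('a, 'r) ring_scheme \<Rightarrow> ('b, 's) ring_scheme \<Rightarrow> ('a \<Rightarrow> 'b) \<Rightarrow> ('a, 'm) module \<Rightarrow>
    ('b \<times> 'm \<Rightarrow>\<^sub>0 int) \<Rightarrow> ('b \<times> 'm \<Rightarrow>\<^sub>0 int) set"
  where "tensor_class A B \<phi> M u = tensor_kernel A B \<phi> M #>\<^bsub>tensor_free B M\<^esub> u"

definition ind ::
  "('a, 'r) ring_scheme \<Rightarrow> ('b, 's) ring_scheme \<Rightarrow> ('a \<Rightarrow> 'b) \<Rightarrow> ('a, 'm) module \<Rightarrow>
    ('b, ('b \<times> 'm \<Rightarrow>\<^sub>0 int) set) module"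
  where
  "ind A B \<phi> M = (let T = tensor_free B M Mod tensor_kernel A B \<phi> M in
     \<lparr>carrier = carrier T, monoid.mult = undefined, one = undefined,
      ring.zero = \<one>\<^bsub>T\<^esub>, add = monoid.mult T,
      module.smult = (\<lambda>b U. \<Union>u\<in>U. tensor_class A B \<phi> M
                       (frag_extend (\<lambda>(c, x). frag_of (b \<otimes>\<^bsub>B\<^esub> c, x)) u))\<rparr>)"

text \<open>The action of induction on morphisms: \<open>ind_map A B \<phi> N f\<close> is \<open>id \<otimes> f\<close> for \<open>f\<close> with target
  module \<open>N\<close>.\<close>

definition ind_map ::
  "('a, 'r) ring_scheme \<Rightarrow> ('b, 's) ring_scheme \<Rightarrow> ('a \<Rightarrow> 'b) \<Rightarrow> ('a, 'n) module \<Rightarrow> ('m \<Rightarrow> 'n) \<Rightarrow>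
    ('b \<times> 'm \<Rightarrow>\<^sub>0 int) set \<Rightarrow> ('b \<times> 'n \<Rightarrow>\<^sub>0 int) set"
  where
  "ind_map A B \<phi> N f U =
     (\<Union>u\<in>U. tensor_class A B \<phi> N (frag_extend (\<lambda>(c, x). frag_of (c, f x)) u))"

text \<open>\<open>cyc_ind r d n\<close> and \<open>cyc_res r d n\<close> are the functors between level \<open>n\<close> and level \<open>n + 1\<close>.
  Restriction does not change maps.\<close>

definition cyc_ind ::
  "nat \<Rightarrow> nat \<Rightarrow> nat \<Rightarrow> (yh_poly set set, 'm) module \<Rightarrow>
    (yh_poly set set, (yh_poly set set \<times> 'm \<Rightarrow>\<^sub>0 int) set) module"
  where "cyc_ind r d n = ind (cyc_YH r d n) (cyc_YH r d (Suc n)) (cyc_incl r d n)"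

definition cyc_ind_map ::
  "nat \<Rightarrow> nat \<Rightarrow> nat \<Rightarrow> (yh_poly set set, 'n) module \<Rightarrow> ('m \<Rightarrow> 'n) \<Rightarrow>
    (yh_poly set set \<times> 'm \<Rightarrow>\<^sub>0 int) set \<Rightarrow> (yh_poly set set \<times> 'n \<Rightarrow>\<^sub>0 int) set"
  where "cyc_ind_map r d n = ind_map (cyc_YH r d n) (cyc_YH r d (Suc n)) (cyc_incl r d n)"

definition cyc_res ::
  "nat \<Rightarrow> nat \<Rightarrow> nat \<Rightarrow> (yh_poly set set, 'm) module \<Rightarrow> (yh_poly set set, 'm) module"
  where "cyc_res r d n = res (cyc_incl r d n)"


section \<open>Well-definedness\<close>

subsection \<open>The algebras and the maps between consecutive levels\<close>

lemma monoid_ring_simps: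
  "carrier (monoid_ring S W) = {p. (\<forall>w. Poly_Mapping.lookup p w \<in> S) \<and> Poly_Mapping.keys p \<subseteq> W}"
  "monoid.mult (monoid_ring S W) = (*)" "one (monoid_ring S W) = 1"
  "ring.zero (monoid_ring S W) = 0" "ring.add (monoid_ring S W) = (+)"
  by (simp_all add: monoid_ring_def ring_of_type_algebra_def)

lemma ring_type: "ring (ring_of_type_algebra :: 'a::ring_1 ring)"
proof -
  have "\<exists>y. x + y = 0" for x :: 'a
    using add.right_inverse by blast
  thus ?thesis
    unfolding ring_of_type_algebra_def using add.right_inverse
    by unfold_locales (auto simp: algebra_simps Units_def)
qed

lemma a_inv_type: "a_inv ring_of_type_algebra x = - (x :: 'a::ring_1)"
proof -
  interpret Q: ring "ring_of_type_algebra :: 'a ring" by (rule ring_type)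
  show ?thesis by (rule Q.minus_equality) (auto simp: ring_of_type_algebra_def)
qed

lemma lookup_times_in:
  fixes f g :: "'a::monoid_add \<Rightarrow>\<^sub>0 'b::ring_1"
  assumes S: "0 \<in> S" "\<And>x y. x \<in> S \<Longrightarrow> y \<in> S \<Longrightarrow> x + y \<in> S" "\<And>x y. x \<in> S \<Longrightarrow> y \<in> S \<Longrightarrow> x * y \<in> S"
    and "\<And>w. Poly_Mapping.lookup f w \<in> S" "\<And>w. Poly_Mapping.lookup g w \<in> S"
  shows "Poly_Mapping.lookup (f * g) w \<in> S"
proof -
  have sum_in: "sum h A \<in> S" if "\<And>a. h a \<in> S" for h :: "'c \<Rightarrow> 'b" and A
    using that by (induction A rule: infinite_finite_induct) (auto intro: S)
  have sum_in': "Sum_any h \<in> S" if "\<And>a. h a \<in> S" for h :: "'c \<Rightarrow> 'b"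
    unfolding Sum_any.expand_set by (rule sum_in) (use that in auto)
  show ?thesis unfolding lookup_mult
    by (intro sum_in' S(3) assms) (auto simp: when_def assms)
qed

lemma lookup_times_in1:
  fixes f g :: "'a::monoid_add \<Rightarrow>\<^sub>0 'b::ring_1"
  assumes "Poly_Mapping.keys f \<subseteq> W" "Poly_Mapping.keys g \<subseteq> W" "\<And>x y. x \<in> W \<Longrightarrow> y \<in> W \<Longrightarrow> x + y \<in> W"
  shows "Poly_Mapping.keys (f * g) \<subseteq> W"
  using keys_mult[of f g] assms by blast

lemma ring_monoid_ring:
  fixes S :: "'b::ring_1 set" and W :: "'a::monoid_add set"
  assumes S: "subring S ring_of_type_algebra"
    and W: "0 \<in> W" "\<And>x y. x \<in> W \<Longrightarrow> y \<in> W \<Longrightarrow> x + y \<in> W"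
  shows "subring (carrier (monoid_ring S W)) ring_of_type_algebra" "ring (monoid_ring S W)"
proof -
  interpret R: ring "ring_of_type_algebra :: 'b ring" by (rule ring_type)
  interpret P: ring "ring_of_type_algebra :: ('a \<Rightarrow>\<^sub>0 'b) ring" by (rule ring_type)
  have [simp]: "0 \<in> S" "1 \<in> S"
    and cl: "\<And>x y. x \<in> S \<Longrightarrow> y \<in> S \<Longrightarrow> x + y \<in> S" "\<And>x y. x \<in> S \<Longrightarrow> y \<in> S \<Longrightarrow> x * y \<in> S"
     "\<And>x. x \<in> S \<Longrightarrow> - x \<in> S"
    using subringE(2,3)[OF S] subringE(5-7)[OF S, unfolded a_inv_type] by (auto simp: ring_of_type_algebra_def)
  show *: "subring (carrier (monoid_ring S W)) ring_of_type_algebra"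
  proof (rule P.subringI, unfold a_inv_type, goal_cases)
    case 1 show ?case by (simp add: ring_of_type_algebra_def)
  next
    case 2 show ?case by (auto simp: monoid_ring_simps ring_of_type_algebra_def W lookup_one when_def)
  next
    case (3 h) then show ?case by (auto simp: monoid_ring_simps cl)
  next
    case (4 h1 h2) then show ?case
      using lookup_times_in[of S h1 h2] lookup_times_in1[of h1 W h2]
      by (simp add: monoid_ring_simps ring_of_type_algebra_def cl W)
  next
    case (5 h1 h2) then show ?case using keys_add[of h1 h2]
      by (auto simp: monoid_ring_simps ring_of_type_algebra_def cl lookup_add)
  qed
  from P.subring_is_ring[OF this] show "ring (monoid_ring S W)"
    by (simp add: monoid_ring_def ring_of_type_algebra_def)
qed

lemma subring_base: "subring (carrier (base_ring r d)) ring_of_type_algebra"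
  and ring_base: "ring (base_ring r d)"
proof -
  interpret R: ring "ring_of_type_algebra :: complex ring" by (rule ring_type)
  have 1: "subring (base_coeffs r) ring_of_type_algebra"
    unfolding base_coeffs_def
    by (rule R.generate_ring_is_subring) (simp add: ring_of_type_algebra_def)
  have 2: "x + y \<in> {m. Poly_Mapping.keys m \<subseteq> {0..d}}" 
    if "x \<in> {m. Poly_Mapping.keys m \<subseteq> {0..d}}" "y \<in> {m. Poly_Mapping.keys m \<subseteq> {0..d}}"
    for x y :: "nat \<Rightarrow>\<^sub>0 int"
    using that keys_add[of x y] by blast
  show "subring (carrier (base_ring r d)) ring_of_type_algebra" "ring (base_ring r d)"
    unfolding base_ring_def using ring_monoid_ring[OF 1 _ 2] by simp_all
qed

lemma subring_free: "subring (carrier (free_alg r d n)) ring_of_type_algebra"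
  and ring_free_alg: "ring (free_alg r d n)"
  unfolding free_alg_def
  by (rule ring_monoid_ring[OF subring_base]; auto simp: zero_word_def plus_word_def)+

lemma free_simps:
  "monoid.mult (free_alg r d n) = (*)" "one (free_alg r d n) = 1"
  "ring.zero (free_alg r d n) = 0" "ring.add (free_alg r d n) = (+)"
  by (simp_all add: free_alg_def monoid_ring_simps)


lemma a_inv_free:
  assumes "f \<in> carrier (free_alg r d n)"
  shows "a_inv (free_alg r d n) f = - f" "- f \<in> carrier (free_alg r d n)"
proof -
  interpret P: ring "ring_of_type_algebra :: yh_poly ring" by (rule ring_type)
  show *: "- f \<in> carrier (free_alg r d n)"
    using subringE(5)[OF subring_free assms] by (simp add: a_inv_type)
  interpret F: ring "free_alg r d n" by (rule ring_free_alg)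
  show "a_inv (free_alg r d n) f = - f"
    by (rule F.minus_equality) (use assms * in \<open>auto simp: free_simps\<close>)
qed

lemma free_closed:
  "0 \<in> carrier (free_alg r d n)" "1 \<in> carrier (free_alg r d n)"
  "f \<in> carrier (free_alg r d n) \<Longrightarrow> g \<in> carrier (free_alg r d n) \<Longrightarrow> f + g \<in> carrier (free_alg r d n)"
  "f \<in> carrier (free_alg r d n) \<Longrightarrow> g \<in> carrier (free_alg r d n) \<Longrightarrow> f * g \<in> carrier (free_alg r d n)"
  "f \<in> carrier (free_alg r d n) \<Longrightarrow> g \<in> carrier (free_alg r d n) \<Longrightarrow> f - g \<in> carrier (free_alg r d n)"
  "f \<in> carrier (free_alg r d n) \<Longrightarrow> f ^ k \<in> carrier (free_alg r d n)"
proof -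
  interpret F: ring "free_alg r d n" by (rule ring_free_alg)
  note c = F.zero_closed F.one_closed F.a_closed F.m_closed
  note c = c[unfolded free_simps]
  show "0 \<in> carrier (free_alg r d n)" "1 \<in> carrier (free_alg r d n)"
    "f \<in> carrier (free_alg r d n) \<Longrightarrow> g \<in> carrier (free_alg r d n) \<Longrightarrow> f + g \<in> carrier (free_alg r d n)"
    "f \<in> carrier (free_alg r d n) \<Longrightarrow> g \<in> carrier (free_alg r d n) \<Longrightarrow> f * g \<in> carrier (free_alg r d n)"
    using c by blast+
  show "f - g \<in> carrier (free_alg r d n)" if "f \<in> carrier (free_alg r d n)" "g \<in> carrier (free_alg r d n)"
    using c(3)[of f "-g"] a_inv_free(2)[OF that(2)] that by simp
  show "f ^ k \<in> carrier (free_alg r d n)" if "f \<in> carrier (free_alg r d n)"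
    by (induction k) (use c that in auto)
qed

lemma free_sum_closed:
  "(\<And>i. i \<in> A \<Longrightarrow> f i \<in> carrier (free_alg r d n)) \<Longrightarrow> sum f A \<in> carrier (free_alg r d n)"
  by (induction A rule: infinite_finite_induct) (auto intro: free_closed)

lemma free_prod_list_closed:
  "(\<And>f. f \<in> set fs \<Longrightarrow> f \<in> carrier (free_alg r d n)) \<Longrightarrow> prod_list fs \<in> carrier (free_alg r d n)"
  by (induction fs) (auto intro: free_closed)

lemma base_coeffs_01: "0 \<in> base_coeffs r" "1 \<in> base_coeffs r" "1 / of_nat r \<in> base_coeffs r"
proof -
  interpret R: ring "ring_of_type_algebra :: complex ring" by (rule ring_type)
  have 1: "subring (base_coeffs r) ring_of_type_algebra"
    unfolding base_coeffs_def
    by (rule R.generate_ring_is_subring) (simp add: ring_of_type_algebra_def)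
  show "0 \<in> base_coeffs r" "1 \<in> base_coeffs r"
    using subringE(2,3)[OF 1] by (auto simp: ring_of_type_algebra_def)
  show "1 / of_nat r \<in> base_coeffs r"
    unfolding base_coeffs_def by (rule generate_ring.incl) simp
qed

lemma base_mem:
  "0 \<in> carrier (base_ring r d)" "1 \<in> carrier (base_ring r d)"
  "const (1 / of_nat r) \<in> carrier (base_ring r d)"
  "i \<le> d \<Longrightarrow> lvar i k \<in> carrier (base_ring r d)"
  using base_coeffs_01
  by (auto simp: base_ring_def monoid_ring_simps const_def lvar_def lookup_single when_def lookup_one
      split: if_splits)

lemma base_diff: "a \<in> carrier (base_ring r d) \<Longrightarrow> b \<in> carrier (base_ring r d) \<Longrightarrow> a - b \<in> carrier (base_ring r d)"
  using subringE(7)[OF subring_base, of a r d "a_inv ring_of_type_algebra b"]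
     subringE(5)[OF subring_base, of b r d] by (simp add: a_inv_type) (simp add: ring_of_type_algebra_def)

lemma scal_closed: "a \<in> carrier (base_ring r d) \<Longrightarrow> scal a \<in> carrier (free_alg r d n)"
  using base_mem(1)
  by (auto simp: free_alg_def monoid_ring_simps scal_def lookup_single when_def zero_word_def split: if_splits)

lemma letter_closed: "x \<in> gens n \<Longrightarrow> letter x \<in> carrier (free_alg r d n)"
  using base_mem(1,2)
  by (auto simp: free_alg_def monoid_ring_simps letter_def lookup_single when_def split: if_splits)

lemma relations_closed: "yh_relations r n \<subseteq> carrier (free_alg r d n)"
proof -
  have T: "Transposition.transpose i (i + 1) j \<in> {1..n}" if "1 \<le> i" "i < n" "1 \<le> j" "j \<le> n" for i j
    using that by (auto simp: Transposition.transpose_def)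
  have E: "ye r i \<in> carrier (free_alg r d n)" if "1 \<le> i" "i < n" for i
    unfolding ye_def
    by (intro free_closed free_sum_closed scal_closed base_mem letter_closed)
       (use that in \<open>auto simp: gens_def\<close>)
  show ?thesis
    unfolding yh_relations_def
    by (auto split: if_splits
        intro!: free_closed letter_closed E scal_closed base_diff base_mem simp: gens_def)
       (use T in \<open>auto simp: gens_def\<close>)
qed

lemma cyc_poly_closed: "n \<noteq> 0 \<Longrightarrow> cyc_poly d \<in> carrier (free_alg r d n)"
  unfolding cyc_poly_def
  by (auto intro!: free_prod_list_closed free_closed letter_closed scal_closed base_mem simp: gens_def)

lemma gens_mono: "gens n \<subseteq> gens (Suc n)" 
  by (auto simp: gens_def)

lemma free_mono: "carrier (free_alg r d n) \<subseteq> carrier (free_alg r d (Suc n))"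
  using gens_mono by (fastforce simp: free_alg_def monoid_ring_simps)

lemma relations_mono: "yh_relations r n \<subseteq> yh_relations r (Suc n)"
proof -
  have 1: "{f i j | i j. P i j} \<subseteq> {f i j | i j. Q i j}" if "\<And>i j. P i j \<Longrightarrow> Q i j" for f :: "nat \<Rightarrow> nat \<Rightarrow> yh_poly" and P Q
    using that by blast
  have 2: "{f i | i. P i} \<subseteq> {f i | i. Q i}" if "\<And>i. P i \<Longrightarrow> Q i" for f :: "nat \<Rightarrow> yh_poly" and P Q
    using that by blast
  show ?thesis
    unfolding yh_relations_def by (intro Un_mono 1 2) auto
qed

lemma ideal_yh: "ideal (yh_ideal r d n) (free_alg r d n)"
  unfolding yh_ideal_def
  by (rule ring.genideal_ideal[OF ring_free_alg relations_closed])

lemma ring_affine: "ring (affine_YH r d n)"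
  unfolding affine_YH_def by (rule ideal.quotient_is_ring[OF ideal_yh])

lemma affine_class_hom: "(+>\<^bsub>free_alg r d n\<^esub>) (yh_ideal r d n) \<in> ring_hom (free_alg r d n) (affine_YH r d n)"
  unfolding affine_YH_def by (rule ideal.rcos_ring_hom[OF ideal_yh])

lemma ideal_cyc: "ideal (cyc_ideal r d n) (affine_YH r d n)"
  unfolding cyc_ideal_def
  by (rule ring.genideal_ideal[OF ring_affine])
     (use ring_hom_closed[OF affine_class_hom cyc_poly_closed] in auto)

lemma ring_cyc_YH: "ring (cyc_YH r d n)"
  unfolding cyc_YH_def by (rule ideal.quotient_is_ring[OF ideal_cyc])

lemma cyc_class_hom: "cyc_class r d n \<in> ring_hom (free_alg r d n) (cyc_YH r d n)"
proof -
  have "cyc_class r d n = (+>\<^bsub>affine_YH r d n\<^esub>) (cyc_ideal r d n) \<circ> (+>\<^bsub>free_alg r d n\<^esub>) (yh_ideal r d n)"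
    by (auto simp: cyc_class_def fun_eq_iff)
  also have "\<dots> \<in> ring_hom (free_alg r d n) (cyc_YH r d n)"
    by (rule ring_hom_trans[OF affine_class_hom]) (simp add: cyc_YH_def ideal.rcos_ring_hom[OF ideal_cyc])
  finally show ?thesis .
qed

lemma cyc_class_surj: "carrier (cyc_YH r d n) = cyc_class r d n ` carrier (free_alg r d n)"
  by (auto simp: cyc_YH_def affine_YH_def FactRing_def A_RCOSETS_def' cyc_class_def)

lemma cyc_class_factor:
  assumes h: "h \<in> ring_hom (free_alg r d n) S" and S: "ring S"
    and rel: "\<And>u. u \<in> yh_relations r n \<Longrightarrow> h u = \<zero>\<^bsub>S\<^esub>"
    and cyc: "n \<noteq> 0 \<Longrightarrow> h (cyc_poly d) = \<zero>\<^bsub>S\<^esub>"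
    and fg: "f \<in> carrier (free_alg r d n)" "g \<in> carrier (free_alg r d n)"
    and eq: "cyc_class r d n f = cyc_class r d n g"
  shows "h f = h g"
proof -
  let ?F = "free_alg r d n" and ?I = "yh_ideal r d n" and ?A = "affine_YH r d n" and ?J = "cyc_ideal r d n"
  interpret F: ring ?F by (rule ring_free_alg)
  interpret A: ring ?A by (rule ring_affine)
  interpret H: ring_hom_ring ?F S h by (rule ring_hom_ringI2[OF F.ring_axioms S h])
  interpret Q: ring_hom_ring ?F ?A "(+>\<^bsub>?F\<^esub>) ?I"
    by (rule ring_hom_ringI2[OF F.ring_axioms A.ring_axioms affine_class_hom])
  define K where "K = a_kernel ?F S h"
  have K: "ideal K ?F" unfolding K_def by (rule H.kernel_is_ideal)
  have memK: "u \<in> K \<longleftrightarrow> u \<in> carrier ?F \<and> h u = \<zero>\<^bsub>S\<^esub>" for u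
    unfolding K_def a_kernel_def kernel_def by simp
  have IK: "?I \<subseteq> K"
    unfolding yh_ideal_def using relations_closed[of r n d] rel
    by (intro F.genideal_minimal K) (auto simp: memK)
  have KA: "ideal ((+>\<^bsub>?F\<^esub>) ?I ` K) ?A"
    unfolding affine_YH_def by (rule F.ring_ideal_imp_quot_ideal[OF ideal_yh K])
  have cK: "n \<noteq> 0 \<Longrightarrow> cyc_poly d \<in> K"
    using cyc cyc_poly_closed[of n d r] memK by blast
  have JK: "?J \<subseteq> (+>\<^bsub>?F\<^esub>) ?I ` K"
    unfolding cyc_ideal_def
    by (rule A.genideal_minimal[OF KA]) (use cK in auto)
  define f' g' where f': "f' = ?I +>\<^bsub>?F\<^esub> f" and g': "g' = ?I +>\<^bsub>?F\<^esub> g"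
  have fg': "f' \<in> carrier ?A" "g' \<in> carrier ?A"
    unfolding f' g' using fg Q.hom_closed by blast+
  have "?J +>\<^bsub>?A\<^esub> f' = ?J +>\<^bsub>?A\<^esub> g'" using eq unfolding cyc_class_def f' g' .
  then have "f' \<ominus>\<^bsub>?A\<^esub> g' \<in> ?J"
    using A.quotient_eq_iff_same_a_r_cos[OF ideal_cyc fg'] by blast
  moreover have "f' \<ominus>\<^bsub>?A\<^esub> g' = ?I +>\<^bsub>?F\<^esub> (f \<ominus>\<^bsub>?F\<^esub> g)"
    unfolding f' g' a_minus_def using fg Q.hom_add Q.hom_a_inv F.a_inv_closed by metis
  ultimately obtain k where k: "k \<in> K" "?I +>\<^bsub>?F\<^esub> (f \<ominus>\<^bsub>?F\<^esub> g) = ?I +>\<^bsub>?F\<^esub> k"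
    using JK by auto
  have kc: "k \<in> carrier ?F" "h k = \<zero>\<^bsub>S\<^esub>" using k memK by auto
  have "(f \<ominus>\<^bsub>?F\<^esub> g) \<ominus>\<^bsub>?F\<^esub> k \<in> ?I"
    using F.quotient_eq_iff_same_a_r_cos[OF ideal_yh F.minus_closed[OF fg] kc(1)] k(2) by blast
  then have "h ((f \<ominus>\<^bsub>?F\<^esub> g) \<ominus>\<^bsub>?F\<^esub> k) = \<zero>\<^bsub>S\<^esub>" using IK memK by blast
  moreover have hm: "h (u \<ominus>\<^bsub>?F\<^esub> v) = h u \<ominus>\<^bsub>S\<^esub> h v" if "u \<in> carrier ?F" "v \<in> carrier ?F" for u v
    unfolding a_minus_def using that H.hom_add H.hom_a_inv F.a_inv_closed by metis
  ultimately have "(h f \<ominus>\<^bsub>S\<^esub> h g) \<ominus>\<^bsub>S\<^esub> h k = \<zero>\<^bsub>S\<^esub>"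
    using hm[OF F.minus_closed[OF fg] kc(1)] hm[OF fg] by metis
  then have "h f \<ominus>\<^bsub>S\<^esub> h g = \<zero>\<^bsub>S\<^esub>"
    using kc H.S.r_right_minus_eq[of "h f \<ominus>\<^bsub>S\<^esub> h g" "h k"] H.hom_closed fg H.S.minus_closed H.S.zero_closed by metis
  then show ?thesis
    using H.S.r_right_minus_eq[of "h f" "h g"] H.hom_closed fg by blast
qed

lemma cyc_class_relations:
  "u \<in> yh_relations r n \<Longrightarrow> cyc_class r d n u = \<zero>\<^bsub>cyc_YH r d n\<^esub>"
  "n \<noteq> 0 \<Longrightarrow> cyc_class r d n (cyc_poly d) = \<zero>\<^bsub>cyc_YH r d n\<^esub>"
proof -
  let ?F = "free_alg r d n" and ?I = "yh_ideal r d n" and ?A = "affine_YH r d n" and ?J = "cyc_ideal r d n"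
  interpret F: ring ?F by (rule ring_free_alg)
  interpret A: ring ?A by (rule ring_affine)
  interpret I: ideal ?I ?F by (rule ideal_yh)
  interpret J: ideal ?J ?A by (rule ideal_cyc)
  show "cyc_class r d n u = \<zero>\<^bsub>cyc_YH r d n\<^esub>" if "u \<in> yh_relations r n"
  proof -
    have "u \<in> ?I" unfolding yh_ideal_def using F.genideal_self relations_closed that by blast
    then have "?I +>\<^bsub>?F\<^esub> u = \<zero>\<^bsub>?A\<^esub>"
      using I.a_rcos_const by (simp add: affine_YH_def FactRing_def)
    then show ?thesis using J.a_rcos_const J.zero_closed
      by (simp add: cyc_class_def cyc_YH_def FactRing_def)
  qed
  show "cyc_class r d n (cyc_poly d) = \<zero>\<^bsub>cyc_YH r d n\<^esub>" if "n \<noteq> 0"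
  proof -
    have "?I +>\<^bsub>?F\<^esub> cyc_poly d \<in> ?J"
      unfolding cyc_ideal_def
      using that A.genideal_self'[OF ring_hom_closed[OF affine_class_hom cyc_poly_closed]] by simp
    then show ?thesis using J.a_rcos_const
      by (simp add: cyc_class_def cyc_YH_def FactRing_def)
  qed
qed

lemma cyc_incl_class:
  assumes f: "f \<in> carrier (free_alg r d n)"
  shows "cyc_incl r d n (cyc_class r d n f) = cyc_class r d (Suc n) f"
proof -
  have sub: "g \<in> carrier (free_alg r d n) \<Longrightarrow> g \<in> carrier (free_alg r d (Suc n))" for g
    using free_mono by blast
  note hm = ring_hom_memE[OF cyc_class_hom[of r d "Suc n"], unfolded free_simps]
  have h: "cyc_class r d (Suc n) \<in> ring_hom (free_alg r d n) (cyc_YH r d (Suc n))"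
    by (rule ring_hom_memI) (use hm sub in \<open>simp_all add: free_simps\<close>)
  have "cyc_class r d (Suc n) ` {g \<in> carrier (free_alg r d n). cyc_class r d n g = cyc_class r d n f}
        = {cyc_class r d (Suc n) f}"
  proof -
    have "cyc_class r d (Suc n) g = cyc_class r d (Suc n) f"
      if "g \<in> carrier (free_alg r d n)" "cyc_class r d n g = cyc_class r d n f" for g
    proof (rule cyc_class_factor[OF h ring_cyc_YH _ _ that(1) f that(2)])
      show "cyc_class r d (Suc n) u = \<zero>\<^bsub>cyc_YH r d (Suc n)\<^esub>" if "u \<in> yh_relations r n" for u
        using cyc_class_relations(1) relations_mono that by blast
      show "cyc_class r d (Suc n) (cyc_poly d) = \<zero>\<^bsub>cyc_YH r d (Suc n)\<^esub>"
        by (rule cyc_class_relations(2)) simp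
    qed
    then show ?thesis using f by blast
  qed
  then show ?thesis by (simp add: cyc_incl_def)
qed

lemma cyc_incl_hom: "cyc_incl r d n \<in> ring_hom (cyc_YH r d n) (cyc_YH r d (Suc n))"
proof -
  let ?c = "cyc_class r d n" and ?c' = "cyc_class r d (Suc n)"
  have sub: "f \<in> carrier (free_alg r d n) \<Longrightarrow> f \<in> carrier (free_alg r d (Suc n))" for f
    using free_mono by blast
  note h = ring_hom_memE[OF cyc_class_hom, unfolded free_simps]
  have *: "?c f \<otimes>\<^bsub>cyc_YH r d n\<^esub> ?c g = ?c (f * g)" "?c f \<oplus>\<^bsub>cyc_YH r d n\<^esub> ?c g = ?c (f + g)"
    if "f \<in> carrier (free_alg r d n)" "g \<in> carrier (free_alg r d n)" for f g
    using h that by auto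
  show ?thesis
  proof (rule ring_hom_memI)
    fix x assume "x \<in> carrier (cyc_YH r d n)"
    then show "cyc_incl r d n x \<in> carrier (cyc_YH r d (Suc n))"
      unfolding cyc_class_surj using cyc_incl_class sub by auto
  next
    fix x y assume "x \<in> carrier (cyc_YH r d n)" "y \<in> carrier (cyc_YH r d n)"
    then obtain f g where fg: "f \<in> carrier (free_alg r d n)" "g \<in> carrier (free_alg r d n)"
        "x = ?c f" "y = ?c g" unfolding cyc_class_surj by auto
    show "cyc_incl r d n (x \<otimes>\<^bsub>cyc_YH r d n\<^esub> y) = cyc_incl r d n x \<otimes>\<^bsub>cyc_YH r d (Suc n)\<^esub> cyc_incl r d n y"
     "cyc_incl r d n (x \<oplus>\<^bsub>cyc_YH r d n\<^esub> y) = cyc_incl r d n x \<oplus>\<^bsub>cyc_YH r d (Suc n)\<^esub> cyc_incl r d n y"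
      unfolding fg using fg(1,2) sub h(2,3)[of _ r d "Suc n"]
      by (auto simp: * cyc_incl_class free_closed)
  next
    show "cyc_incl r d n \<one>\<^bsub>cyc_YH r d n\<^esub> = \<one>\<^bsub>cyc_YH r d (Suc n)\<^esub>"
      using h(4)[of r d n] h(4)[of r d "Suc n"] cyc_incl_class[OF free_closed(2)] by metis
  qed
qed

lemma free_0: "carrier (free_alg r d 0) = scal ` carrier (base_ring r d)"
proof
  show "scal ` carrier (base_ring r d) \<subseteq> carrier (free_alg r d 0)"
    using scal_closed by blast
  show "carrier (free_alg r d 0) \<subseteq> scal ` carrier (base_ring r d)"
  proof
    fix p assume p: "p \<in> carrier (free_alg r d 0)"
    then have k: "Poly_Mapping.keys p \<subseteq> {0}"
      by (auto simp: free_alg_def monoid_ring_simps gens_def zero_word_def word.expand)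
    have "p = scal (Poly_Mapping.lookup p 0)"
    proof (rule poly_mapping_eqI)
      fix w show "Poly_Mapping.lookup p w = Poly_Mapping.lookup (scal (Poly_Mapping.lookup p 0)) w"
        using k by (cases "w = 0") (auto simp: scal_def lookup_single when_def in_keys_iff)
    qed
    then show "p \<in> scal ` carrier (base_ring r d)"
      using p by (auto simp: free_alg_def monoid_ring_simps)
  qed
qed

lemma scal_simps: "scal 0 = 0" "scal 1 = 1" "scal (a + b) = scal a + scal b" "scal (a * b) = scal a * scal b"
  by (simp_all add: scal_def single_add mult_single)

lemma base_ring_iso_cyc_YH_0:
  "(\<lambda>a. cyc_class r d 0 (scal a)) \<in> ring_iso (base_ring r d) (cyc_YH r d 0)"
proof -
  note h = ring_hom_memE[OF cyc_class_hom[of r d 0], unfolded free_simps]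
  have b: "monoid.mult (base_ring r d) = (*)" "ring.add (base_ring r d) = (+)" "one (base_ring r d) = 1"
    by (simp_all add: base_ring_def monoid_ring_simps)
  have "(\<lambda>a. cyc_class r d 0 (scal a)) \<in> ring_hom (base_ring r d) (cyc_YH r d 0)"
    by (rule ring_hom_memI) (use h scal_closed[of _ r d 0] in \<open>auto simp: b scal_simps\<close>)
  moreover have "bij_betw (\<lambda>a. cyc_class r d 0 (scal a)) (carrier (base_ring r d)) (carrier (cyc_YH r d 0))"
  proof (rule bij_betw_imageI)
    show "(\<lambda>a. cyc_class r d 0 (scal a)) ` carrier (base_ring r d) = carrier (cyc_YH r d 0)"
      unfolding cyc_class_surj free_0 by (simp add: image_image)
    show "inj_on (\<lambda>a. cyc_class r d 0 (scal a)) (carrier (base_ring r d))"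
    proof (rule inj_onI)
      fix a b assume ab: "a \<in> carrier (base_ring r d)" "b \<in> carrier (base_ring r d)"
        and eq: "cyc_class r d 0 (scal a) = cyc_class r d 0 (scal b)"
      have id: "(\<lambda>x. x) \<in> ring_hom (free_alg r d 0) (free_alg r d 0)"
        by (auto simp: ring_hom_def)
      have rel: "yh_relations r 0 = {}" by (auto simp: yh_relations_def)
      have "scal a = scal b"
        using cyc_class_factor[OF id ring_free_alg _ _ scal_closed[OF ab(1)] scal_closed[OF ab(2)] eq] rel
        by simp
      then show "a = b"
        unfolding scal_def by (metis lookup_single_eq)
    qed
  qed
  ultimately show ?thesis by (simp add: ring_iso_def)
qed


subsection \<open>Tensor products, restriction and direct sums\<close>

lemma tensor_class_alt: "tensor_class A B \<phi> M u = {k + u | k. k \<in> tensor_kernel A B \<phi> M}"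
  by (auto simp: tensor_class_def r_coset_def tensor_free_def)

locale base_change = left_module A M + B?: ring B
  for A :: "('a, 'r) ring_scheme" and M :: "('a, 'm) module" and B :: "('b, 's) ring_scheme" +
  fixes \<phi> :: "'a \<Rightarrow> 'b"
  assumes hom: "\<phi> \<in> ring_hom A B"
begin

abbreviation "K \<equiv> tensor_kernel A B \<phi> M"
abbreviation "cl \<equiv> tensor_class A B \<phi> M"
abbreviation "C \<equiv> carrier (tensor_free B M)"

lemma C_iff: "u \<in> C \<longleftrightarrow> Poly_Mapping.keys u \<subseteq> carrier B \<times> carrier M"
  by (simp add: tensor_free_def)

lemma C_closed: "0 \<in> C" "u \<in> C \<Longrightarrow> v \<in> C \<Longrightarrow> u + v \<in> C" "u \<in> C \<Longrightarrow> v \<in> C \<Longrightarrow> u - v \<in> C" "u \<in> C \<Longrightarrow> - u \<in> C"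
  using keys_add[of u v] keys_diff[of u v] by (auto simp: C_iff)

lemma C_of: "b \<in> carrier B \<Longrightarrow> x \<in> carrier M \<Longrightarrow> frag_of (b, x) \<in> C"
  by (simp add: C_iff)

lemma phi: "a \<in> carrier A \<Longrightarrow> \<phi> a \<in> carrier B"
  using ring_hom_closed[OF hom] .

lemma rel_C: "tensor_relations A B \<phi> M \<subseteq> C"
  unfolding tensor_relations_def
  by (auto intro!: C_closed C_of phi)

lemma subgroup_K: "subgroup K (tensor_free B M)"
  unfolding tensor_kernel_def tensor_free_def
  by (rule group.generate_is_subgroup) (use rel_C in \<open>auto simp: tensor_free_def\<close>)

lemma K_C: "K \<subseteq> C"
  using subgroup.subset[OF subgroup_K] .

lemma K_closed: "0 \<in> K" "u \<in> K \<Longrightarrow> v \<in> K \<Longrightarrow> u + v \<in> K" "u \<in> K \<Longrightarrow> - u \<in> K" "u \<in> K \<Longrightarrow> v \<in> K \<Longrightarrow> u - v \<in> K"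
proof -
  show 0: "0 \<in> K" and add: "\<And>u v. u \<in> K \<Longrightarrow> v \<in> K \<Longrightarrow> u + v \<in> K"
    using subgroup.one_closed[OF subgroup_K] subgroup.m_closed[OF subgroup_K]
    by (auto simp: tensor_free_def)
  show m: "- u \<in> K" if "u \<in> K" for u
    using that

  proof -
    assume u: "u \<in> K"
    then have "Poly_Mapping.keys u \<subseteq> carrier B \<times> carrier M" using K_C C_iff by blast
    then show "- u \<in> K"
      using subgroup.m_inv_closed[OF subgroup_K u] by (simp add: tensor_free_def)
  qed
  show "u \<in> K \<Longrightarrow> v \<in> K \<Longrightarrow> u - v \<in> K"
    using add[of u "-v"] m[of v] by simp
qed

lemma rel_K: "u \<in> tensor_relations A B \<phi> M \<Longrightarrow> u \<in> K"
  unfolding tensor_kernel_def by (rule generate.incl)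

lemma rel_K':
  "b \<in> carrier B \<Longrightarrow> b' \<in> carrier B \<Longrightarrow> x \<in> carrier M \<Longrightarrow>
    frag_of (b \<oplus>\<^bsub>B\<^esub> b', x) - frag_of (b, x) - frag_of (b', x) \<in> K"
  "b \<in> carrier B \<Longrightarrow> x \<in> carrier M \<Longrightarrow> x' \<in> carrier M \<Longrightarrow>
    frag_of (b, x \<oplus>\<^bsub>M\<^esub> x') - frag_of (b, x) - frag_of (b, x') \<in> K"
  "b \<in> carrier B \<Longrightarrow> a \<in> carrier A \<Longrightarrow> x \<in> carrier M \<Longrightarrow>
    frag_of (b \<otimes>\<^bsub>B\<^esub> \<phi> a, x) - frag_of (b, a \<odot>\<^bsub>M\<^esub> x) \<in> K"
  by (rule rel_K, unfold tensor_relations_def, blast)+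

lemma cl_mem: "v \<in> cl u \<longleftrightarrow> v - u \<in> K"
proof
  assume "v - u \<in> K"
  moreover have "v = (v - u) + u" by simp
  ultimately show "v \<in> cl u" unfolding tensor_class_alt by blast
next
  assume "v \<in> cl u"
  then obtain k where "k \<in> K" "v = k + u" unfolding tensor_class_alt by blast
  then show "v - u \<in> K" by simp
qed

lemma cl_eq: "cl u = cl v \<longleftrightarrow> u - v \<in> K"
proof
  assume *: "cl u = cl v"
  have "u \<in> cl u" unfolding cl_mem using K_closed(1) by simp
  then have "u \<in> cl v" unfolding * .
  then show "u - v \<in> K" unfolding cl_mem .
next
  assume *: "u - v \<in> K"
  have "w - u \<in> K \<longleftrightarrow> w - v \<in> K" for w
  proof
    assume "w - u \<in> K"
    from K_closed(2)[OF this *] show "w - v \<in> K" by simp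
  next
    assume "w - v \<in> K"
    from K_closed(4)[OF this *] show "w - u \<in> K" by simp
  qed
  then show "cl u = cl v" by (auto simp: cl_mem)
qed

lemma ind_simps:
  "carrier (ind A B \<phi> M) = cl ` C"
  "\<zero>\<^bsub>ind A B \<phi> M\<^esub> = cl 0"
  "cl u \<oplus>\<^bsub>ind A B \<phi> M\<^esub> cl v = cl (u + v)"
proof -
  show "carrier (ind A B \<phi> M) = cl ` C" "\<zero>\<^bsub>ind A B \<phi> M\<^esub> = cl 0"
    by (auto simp: ind_def FactGroup_def RCOSETS_def tensor_class_def r_coset_def tensor_free_def)
  have "cl u <#>\<^bsub>tensor_free B M\<^esub> cl v = cl (u + v)"
  proof (rule Set.set_eqI)
    fix w
    have "w \<in> cl u <#>\<^bsub>tensor_free B M\<^esub> cl v \<longleftrightarrow> (\<exists>k l. k \<in> K \<and> l \<in> K \<and> w = (k + u) + (l + v))"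
      unfolding set_mult_def tensor_class_alt by (auto simp: tensor_free_def)
    also have "\<dots> \<longleftrightarrow> w - (u + v) \<in> K"
    proof
      assume "\<exists>k l. k \<in> K \<and> l \<in> K \<and> w = (k + u) + (l + v)"
      then obtain k l where "k \<in> K" "l \<in> K" "w = (k + u) + (l + v)" by blast
      moreover from this have "w - (u + v) = k + l" by simp
      ultimately show "w - (u + v) \<in> K" using K_closed(2) by simp
    next
      assume "w - (u + v) \<in> K"
      moreover have "w = ((w - (u + v)) + u) + (0 + v)" by simp
      ultimately show "\<exists>k l. k \<in> K \<and> l \<in> K \<and> w = (k + u) + (l + v)" using K_closed(1) by blast
    qed
    finally show "w \<in> cl u <#>\<^bsub>tensor_free B M\<^esub> cl v \<longleftrightarrow> w \<in> cl (u + v)" by (simp add: cl_mem)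
  qed
  then show "cl u \<oplus>\<^bsub>ind A B \<phi> M\<^esub> cl v = cl (u + v)"
    by (simp add: ind_def FactGroup_def)
qed

lemma lift_kernel:
  assumes L: "\<And>u v. L (u + v) = L u + L v" and rel: "\<And>u. u \<in> tensor_relations A B \<phi> M \<Longrightarrow> L u \<in> N"
    and N: "0 \<in> N" "\<And>u v. u \<in> N \<Longrightarrow> v \<in> N \<Longrightarrow> u + v \<in> N" "\<And>u. u \<in> N \<Longrightarrow> - u \<in> N"
    and u: "u \<in> K"
  shows "L u \<in> (N :: 'z :: ab_group_add set)"
proof -
  have L0: "L 0 = 0" using L[of 0 0] by simp
  have Lm: "L (- u) = - L u" for u using L[of u "-u"] L0 by (simp add: eq_neg_iff_add_eq_0 add.commute)
  have "Poly_Mapping.keys u \<subseteq> carrier B \<times> carrier M" if "u \<in> tensor_relations A B \<phi> M" for u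
    using rel_C that C_iff by blast
  with u show ?thesis
    unfolding tensor_kernel_def tensor_free_def
    by (induction rule: generate.induct) (auto simp: L L0 Lm N rel)
qed

definition L :: "'b \<Rightarrow> ('b \<times> 'm \<Rightarrow>\<^sub>0 int) \<Rightarrow> ('b \<times> 'm \<Rightarrow>\<^sub>0 int)"
  where "L b = frag_extend (\<lambda>(c, x). frag_of (b \<otimes>\<^bsub>B\<^esub> c, x))"

lemma L_simps: "L b 0 = 0" "L b (u + v) = L b u + L b v" "L b (u - v) = L b u - L b v" "L b (frag_of (c, x)) = frag_of (b \<otimes>\<^bsub>B\<^esub> c, x)"
  by (simp_all add: L_def frag_extend_add frag_extend_diff)

lemma L_C: assumes b: "b \<in> carrier B" and u: "u \<in> C" shows "L b u \<in> C"
  using u unfolding C_iff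
proof (induction u rule: frag_induction)
  case (diff x y) then show ?case using C_closed(3)[of "L b x" "L b y"] by (simp add: L_simps C_iff)
qed (use b in \<open>auto simp: L_simps\<close>)

lemma L_K: assumes b: "b \<in> carrier B" and u: "u \<in> K" shows "L b u \<in> K"
proof (rule lift_kernel[OF L_simps(2) _ K_closed(1-3) u])
  fix v assume "v \<in> tensor_relations A B \<phi> M"
  then consider
      c c' x where "v = frag_of (c \<oplus>\<^bsub>B\<^esub> c', x) - frag_of (c, x) - frag_of (c', x)"
        "c \<in> carrier B" "c' \<in> carrier B" "x \<in> carrier M"
    | c x x' where "v = frag_of (c, x \<oplus>\<^bsub>M\<^esub> x') - frag_of (c, x) - frag_of (c, x')"
        "c \<in> carrier B" "x \<in> carrier M" "x' \<in> carrier M"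
    | c a x where "v = frag_of (c \<otimes>\<^bsub>B\<^esub> \<phi> a, x) - frag_of (c, a \<odot>\<^bsub>M\<^esub> x)"
        "c \<in> carrier B" "a \<in> carrier A" "x \<in> carrier M"
    unfolding tensor_relations_def by blast
  then show "L b v \<in> K"
  proof cases
    case 1 then show ?thesis
      using rel_K'(1)[of "b \<otimes>\<^bsub>B\<^esub> c" "b \<otimes>\<^bsub>B\<^esub> c'" x] b by (simp add: L_simps B.r_distr)
  next
    case 2 then show ?thesis
      using rel_K'(2)[of "b \<otimes>\<^bsub>B\<^esub> c" x x'] b by (simp add: L_simps)
  next
    case 3 then show ?thesis
      using rel_K'(3)[of "b \<otimes>\<^bsub>B\<^esub> c" a x] b by (simp add: L_simps B.m_assoc phi)
  qed
qed

lemma smult_cl: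
  assumes b: "b \<in> carrier B"
  shows "b \<odot>\<^bsub>ind A B \<phi> M\<^esub> cl u = cl (L b u)"
proof -
  have "b \<odot>\<^bsub>ind A B \<phi> M\<^esub> cl u = (\<Union>v\<in>cl u. cl (L b v))"
    by (simp add: ind_def L_def)
  moreover have "cl (L b v) = cl (L b u)" if "v \<in> cl u" for v
    using L_K[OF b, of "v - u"] that by (simp add: cl_eq cl_mem L_simps)
  moreover have "u \<in> cl u" using K_closed(1) by (simp add: cl_mem)
  ultimately show ?thesis by blast
qed

lemma left_module_ind: "left_module B (ind A B \<phi> M)"
proof -
  let ?I = "ind A B \<phi> M"
  note I = ind_simps(1,2)
  have ag: "abelian_group ?I"
  proof (rule abelian_groupI)
    fix x assume "x \<in> carrier ?I"
    then obtain u where u: "u \<in> C" "x = cl u" unfolding I by blast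
    show "\<exists>y\<in>carrier ?I. y \<oplus>\<^bsub>?I\<^esub> x = \<zero>\<^bsub>?I\<^esub>"
      by (rule bexI[of _ "cl (- u)"]) (use u C_closed(4) in \<open>simp_all only: ind_simps, auto\<close>)
    show "\<zero>\<^bsub>?I\<^esub> \<oplus>\<^bsub>?I\<^esub> x = x" unfolding u I ind_simps(3) by simp
    fix y assume "y \<in> carrier ?I"
    then obtain v where v: "v \<in> C" "y = cl v" unfolding I by blast
    show "x \<oplus>\<^bsub>?I\<^esub> y \<in> carrier ?I" unfolding u v ind_simps using C_closed(2) u v by blast
    show "x \<oplus>\<^bsub>?I\<^esub> y = y \<oplus>\<^bsub>?I\<^esub> x" unfolding u v ind_simps by (simp only: add.commute)
    fix z assume "z \<in> carrier ?I"
    then obtain w where w: "w \<in> C" "z = cl w" unfolding I by blast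
    show "x \<oplus>\<^bsub>?I\<^esub> y \<oplus>\<^bsub>?I\<^esub> z = x \<oplus>\<^bsub>?I\<^esub> (y \<oplus>\<^bsub>?I\<^esub> z)"
      unfolding u v w ind_simps(3) by (simp only: add.assoc)
  next
    show "\<zero>\<^bsub>?I\<^esub> \<in> carrier ?I" unfolding I using C_closed(1) by blast
  qed
  have dist: "L (a \<oplus>\<^bsub>B\<^esub> b) u - (L a u + L b u) \<in> K" if "a \<in> carrier B" "b \<in> carrier B" "u \<in> C" for a b u
    using that(3) unfolding C_iff
  proof (induction u rule: frag_induction)
    case (one z)
    obtain c x where z: "z = (c, x)" "c \<in> carrier B" "x \<in> carrier M" using one by auto
    show ?case
      using rel_K'(1)[of "a \<otimes>\<^bsub>B\<^esub> c" "b \<otimes>\<^bsub>B\<^esub> c" x] z that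
      by (simp add: L_simps B.l_distr diff_diff_eq)
  next
    case (diff u v)
    have "L (a \<oplus>\<^bsub>B\<^esub> b) (u - v) - (L a (u - v) + L b (u - v)) = 
      (L (a \<oplus>\<^bsub>B\<^esub> b) u - (L a u + L b u)) - (L (a \<oplus>\<^bsub>B\<^esub> b) v - (L a v + L b v))"
      by (simp add: L_simps)
    then show ?case using K_closed(4)[OF diff] by simp
  qed (simp add: L_simps K_closed)
  have assoc: "L (a \<otimes>\<^bsub>B\<^esub> b) u = L a (L b u)" if "a \<in> carrier B" "b \<in> carrier B" "u \<in> C" for a b u
    using that(3) unfolding C_iff
    by (induction u rule: frag_induction) (use that in \<open>auto simp: L_simps B.m_assoc\<close>)
  have one: "L \<one>\<^bsub>B\<^esub> u = u" if "u \<in> C" for u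
    using that unfolding C_iff
    by (induction u rule: frag_induction) (auto simp: L_simps)
  show ?thesis
  proof (intro left_module.intro left_module_axioms.intro ag B.ring_axioms)
    fix a x assume a: "a \<in> carrier B" and "x \<in> carrier ?I"
    then obtain u where u: "u \<in> C" "x = cl u" unfolding I by blast
    show "a \<odot>\<^bsub>?I\<^esub> x \<in> carrier ?I"
      unfolding u(2) smult_cl[OF a] I using L_C[OF a u(1)] by blast
    {
      fix b assume b: "b \<in> carrier B"
      show "(a \<oplus>\<^bsub>B\<^esub> b) \<odot>\<^bsub>?I\<^esub> x = a \<odot>\<^bsub>?I\<^esub> x \<oplus>\<^bsub>?I\<^esub> b \<odot>\<^bsub>?I\<^esub> x"
        unfolding u(2) smult_cl[OF a] smult_cl[OF b] smult_cl[OF B.a_closed[OF a b]] ind_simps(3) cl_eq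
        by (rule dist[OF a b u(1)])
      show "(a \<otimes>\<^bsub>B\<^esub> b) \<odot>\<^bsub>?I\<^esub> x = a \<odot>\<^bsub>?I\<^esub> (b \<odot>\<^bsub>?I\<^esub> x)"
        unfolding u(2) smult_cl[OF a] smult_cl[OF b] smult_cl[OF B.m_closed[OF a b]] assoc[OF a b u(1)] ..
    next
      fix y assume "y \<in> carrier ?I"
      then obtain v where v: "v \<in> C" "y = cl v" unfolding I by blast
      show "a \<odot>\<^bsub>?I\<^esub> (x \<oplus>\<^bsub>?I\<^esub> y) = a \<odot>\<^bsub>?I\<^esub> x \<oplus>\<^bsub>?I\<^esub> a \<odot>\<^bsub>?I\<^esub> y"
        unfolding u(2) v(2) ind_simps(3) smult_cl[OF a] L_simps ..
    }
  next
    fix x assume "x \<in> carrier ?I"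
    then obtain u where u: "u \<in> C" "x = cl u" unfolding I by blast
    show "\<one>\<^bsub>B\<^esub> \<odot>\<^bsub>?I\<^esub> x = x"
      unfolding u(2) smult_cl[OF B.one_closed] one[OF u(1)] ..
  qed
qed

end

lemma left_module_res:
  assumes "left_module B N" "ring A" "\<phi> \<in> ring_hom A B"
  shows "left_module A (res \<phi> N)"
proof -
  interpret N: left_module B N by fact
  note h = ring_hom_memE[OF assms(3)]
  have ag: "abelian_group (res \<phi> N)"
    by (rule abelian_groupI)
       (auto simp: res_def N.M.a_ac intro: N.M.l_neg intro!: bexI[of _ "a_inv N _"])
  show ?thesis
    by (intro left_module.intro left_module_axioms.intro ag assms(2))
       (auto simp: res_def h N.smult_l_distr N.smult_r_distr N.smult_assoc1)
qed

lemma left_module_dir_sum: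
  assumes "left_module A M" "left_module A N"
  shows "left_module A (dir_sum M N)"
proof -
  interpret M: left_module A M by fact
  interpret N: left_module A N by fact
  have ag: "abelian_group (dir_sum M N)"
  proof (rule abelian_groupI)
    fix x assume "x \<in> carrier (dir_sum M N)"
    then show "\<exists>y\<in>carrier (dir_sum M N). y \<oplus>\<^bsub>dir_sum M N\<^esub> x = \<zero>\<^bsub>dir_sum M N\<^esub>"
      by (intro bexI[of _ "(a_inv M (fst x), a_inv N (snd x))"]) (auto simp: dir_sum_def M.M.l_neg N.M.l_neg)
  qed (auto simp: dir_sum_def M.M.a_ac N.M.a_ac)
  show ?thesis
    by (intro left_module.intro left_module_axioms.intro ag M.R.ring_axioms)
       (auto simp: dir_sum_def M.smult_l_distr M.smult_r_distr M.smult_assoc1 N.smult_l_distr N.smult_r_distr N.smult_assoc1)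
qed

lemma left_module_dir_power:
  assumes "left_module A M"
  shows "left_module A (dir_power k M)"
proof -
  interpret M: left_module A M by fact
  let ?P = "dir_power k M"
  have c: "carrier ?P = {..<k} \<rightarrow>\<^sub>E carrier M" by (simp add: dir_power_def)
  have mem: "x i \<in> carrier M" if "x \<in> carrier ?P" "i < k" for x i
    using that unfolding c by (auto simp: PiE_iff)
  have restr: "(\<lambda>i\<in>{..<k}. f i) \<in> carrier ?P" if "\<And>i. i < k \<Longrightarrow> f i \<in> carrier M" for f
    using that unfolding c by auto
  have ext: "x = y" if "x \<in> carrier ?P" "y \<in> carrier ?P" "\<And>i. i < k \<Longrightarrow> x i = y i" for x y
    using that unfolding c by (intro PiE_ext) auto
  have add: "x \<oplus>\<^bsub>?P\<^esub> y \<in> carrier ?P" if "x \<in> carrier ?P" "y \<in> carrier ?P" for x y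
    unfolding dir_power_def ring.simps using mem[OF that(1)] mem[OF that(2)]
    by (simp add: dir_power_def)
  have add_i: "(x \<oplus>\<^bsub>?P\<^esub> y) i = x i \<oplus>\<^bsub>M\<^esub> y i" if "i < k" for x y i
    using that by (simp add: dir_power_def)
  have zero: "\<zero>\<^bsub>?P\<^esub> \<in> carrier ?P" by (simp add: dir_power_def)
  have zero_i: "\<zero>\<^bsub>?P\<^esub> i = \<zero>\<^bsub>M\<^esub>" if "i < k" for i using that by (simp add: dir_power_def)
  have sm: "a \<odot>\<^bsub>?P\<^esub> x \<in> carrier ?P" if "a \<in> carrier A" "x \<in> carrier ?P" for a x
    using mem[OF that(2)] that(1) by (simp add: dir_power_def)
  have sm_i: "(a \<odot>\<^bsub>?P\<^esub> x) i = a \<odot>\<^bsub>M\<^esub> x i" if "i < k" for a x i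
    using that by (simp add: dir_power_def)
  have ag: "abelian_group ?P"
  proof (rule abelian_groupI)
    fix x assume x: "x \<in> carrier ?P"
    show "\<zero>\<^bsub>?P\<^esub> \<oplus>\<^bsub>?P\<^esub> x = x"
      by (rule ext) (simp_all add: add zero x add_i zero_i mem)
    have n: "(\<lambda>i\<in>{..<k}. a_inv M (x i)) \<in> carrier ?P" by (rule restr) (simp add: mem[OF x])
    show "\<exists>y\<in>carrier ?P. y \<oplus>\<^bsub>?P\<^esub> x = \<zero>\<^bsub>?P\<^esub>"
      by (rule bexI[OF _ n], rule ext) (simp_all add: add zero x add_i zero_i mem n M.M.l_neg)
    fix y assume y: "y \<in> carrier ?P"
    show "x \<oplus>\<^bsub>?P\<^esub> y \<in> carrier ?P" by (rule add[OF x y])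
    show "x \<oplus>\<^bsub>?P\<^esub> y = y \<oplus>\<^bsub>?P\<^esub> x"
      by (rule ext) (simp_all add: add x y add_i mem M.M.a_comm)
    fix z assume z: "z \<in> carrier ?P"
    show "x \<oplus>\<^bsub>?P\<^esub> y \<oplus>\<^bsub>?P\<^esub> z = x \<oplus>\<^bsub>?P\<^esub> (y \<oplus>\<^bsub>?P\<^esub> z)"
      by (rule ext) (simp_all add: add x y z add_i mem M.M.a_assoc)
  qed (rule zero)
  show ?thesis
  proof (intro left_module.intro left_module_axioms.intro ag M.R.ring_axioms sm)
    fix a x assume a: "a \<in> carrier A" and x: "x \<in> carrier ?P"
    {
      fix b assume b: "b \<in> carrier A"
      show "(a \<oplus>\<^bsub>A\<^esub> b) \<odot>\<^bsub>?P\<^esub> x = a \<odot>\<^bsub>?P\<^esub> x \<oplus>\<^bsub>?P\<^esub> b \<odot>\<^bsub>?P\<^esub> x"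
        by (rule ext) (simp_all add: add sm a b x add_i sm_i mem M.smult_l_distr)
      show "(a \<otimes>\<^bsub>A\<^esub> b) \<odot>\<^bsub>?P\<^esub> x = a \<odot>\<^bsub>?P\<^esub> (b \<odot>\<^bsub>?P\<^esub> x)"
        by (rule ext) (simp_all add: sm a b x sm_i mem M.smult_assoc1)
    next
      fix y assume y: "y \<in> carrier ?P"
      show "a \<odot>\<^bsub>?P\<^esub> (x \<oplus>\<^bsub>?P\<^esub> y) = a \<odot>\<^bsub>?P\<^esub> x \<oplus>\<^bsub>?P\<^esub> a \<odot>\<^bsub>?P\<^esub> y"
        by (rule ext) (simp_all add: add sm a x y add_i sm_i mem M.smult_r_distr)
    }
  next
    fix x assume x: "x \<in> carrier ?P"
    show "\<one>\<^bsub>A\<^esub> \<odot>\<^bsub>?P\<^esub> x = x"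
      by (rule ext) (simp_all add: sm x sm_i mem)
  qed
qed

lemma ind_map_class:
  fixes M :: "('a, 'm) module" and N :: "('a, 'n) module" and B :: "('b, 's) ring_scheme"
  assumes M: "base_change A M B \<phi>" and N: "base_change A N B \<phi>" and f: "f \<in> lmod_hom A M N"
  shows "ind_map A B \<phi> N f (tensor_class A B \<phi> M u) =
         tensor_class A B \<phi> N (frag_extend (\<lambda>(c, x). frag_of (c, f x)) u)"
proof -
  interpret M: base_change A M B \<phi> by fact
  interpret N: base_change A N B \<phi> by fact
  define F :: "('b \<times> 'm \<Rightarrow>\<^sub>0 int) \<Rightarrow> ('b \<times> 'n \<Rightarrow>\<^sub>0 int)"
    where "F = frag_extend (\<lambda>(c, x). frag_of (c, f x))"
  have F: "F (u + v) = F u + F v" "F (u - v) = F u - F v" "F (frag_of (c, x)) = frag_of (c, f x)" for u v c x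
    by (simp_all add: F_def frag_extend_add frag_extend_diff)
  have fc: "f x \<in> carrier N" if "x \<in> carrier M" for x
    using f that by (auto simp: lmod_hom_def)
  have fa: "f (x \<oplus>\<^bsub>M\<^esub> y) = f x \<oplus>\<^bsub>N\<^esub> f y" if "x \<in> carrier M" "y \<in> carrier M" for x y
    using f that unfolding lmod_hom_def by blast
  have fs: "f (a \<odot>\<^bsub>M\<^esub> x) = a \<odot>\<^bsub>N\<^esub> f x" if "a \<in> carrier A" "x \<in> carrier M" for a x
    using f that unfolding lmod_hom_def by blast
  have FK: "F v \<in> N.K" if "v \<in> M.K" for v
  proof (rule M.lift_kernel[OF F(1) _ N.K_closed(1-3) that])
    fix v assume "v \<in> tensor_relations A B \<phi> M"
    then consider
        c c' x where "v = frag_of (c \<oplus>\<^bsub>B\<^esub> c', x) - frag_of (c, x) - frag_of (c', x)"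
          "c \<in> carrier B" "c' \<in> carrier B" "x \<in> carrier M"
      | c x x' where "v = frag_of (c, x \<oplus>\<^bsub>M\<^esub> x') - frag_of (c, x) - frag_of (c, x')"
          "c \<in> carrier B" "x \<in> carrier M" "x' \<in> carrier M"
      | c a x where "v = frag_of (c \<otimes>\<^bsub>B\<^esub> \<phi> a, x) - frag_of (c, a \<odot>\<^bsub>M\<^esub> x)"
          "c \<in> carrier B" "a \<in> carrier A" "x \<in> carrier M"
      unfolding tensor_relations_def by blast
    then show "F v \<in> N.K"
    proof cases
      case 1 then show ?thesis using N.rel_K'(1)[of c c' "f x"] fc by (simp add: F)
    next
      case 2 then show ?thesis using N.rel_K'(2)[of c "f x" "f x'"] fc by (simp add: F fa)
    next
      case 3 then show ?thesis using N.rel_K'(3)[of c a "f x"] fc by (simp add: F fs)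
    qed
  qed
  have "N.cl (F v) = N.cl (F u)" if "v \<in> M.cl u" for v
    using FK[of "v - u"] that unfolding M.cl_mem N.cl_eq F(2) by blast
  moreover have "u \<in> M.cl u" using M.K_closed(1) unfolding M.cl_mem by simp
  ultimately have "(\<Union>v\<in>M.cl u. N.cl (F v)) = N.cl (F u)" by blast
  then show ?thesis by (simp add: ind_map_def F_def)
qed

lemma left_module_cyc_ind:
  "left_module (cyc_YH r d n) M \<Longrightarrow> left_module (cyc_YH r d (Suc n)) (cyc_ind r d n M)"
  unfolding cyc_ind_def
  by (intro base_change.left_module_ind base_change.intro base_change_axioms.intro ring_cyc_YH cyc_incl_hom)

lemma left_module_cyc_res:
  "left_module (cyc_YH r d (Suc n)) M \<Longrightarrow> left_module (cyc_YH r d n) (cyc_res r d n M)"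
  unfolding cyc_res_def by (rule left_module_res[OF _ ring_cyc_YH cyc_incl_hom])

end

theory Submission
  imports Defs "HOL-Library.Function_Algebras"
begin

text \<open>
Write \<open>A\<^sub>n\<close> for the cyclotomic algebra of level \<open>n\<close>.  The decomposition is a Mackey formula, and it follows
from two facts about \<open>A\<^sub>n\<^sub>-\<^sub>1 \<rightarrow> A\<^sub>n \<rightarrow> A\<^sub>n\<^sub>+\<^sub>1\<close>.  First, \<open>A\<^sub>n\<close> is a free right \<open>A\<^sub>n\<^sub>-\<^sub>1\<close>-module with a finite basis
\<open>(w\<^sub>i)\<close>.  Second, \<open>A\<^sub>n\<^sub>+\<^sub>1\<close> is a free right \<open>A\<^sub>n\<close>-module with basis \<open>z\<^sub>1, \<dots>, z\<^sub>r\<^sub>d\<close> together with the \<open>w\<^sub>i \<gamma>\<close>, where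
every \<open>z\<^sub>i\<close> commutes with \<open>A\<^sub>n\<close> and \<open>\<gamma> = g\<^sub>n\<^sup>-\<^sup>1\<close> commutes with \<open>A\<^sub>n\<^sub>-\<^sub>1\<close>.  Indeed then
\<open>A\<^sub>n\<^sub>+\<^sub>1 = \<Oplus> z\<^sub>i A\<^sub>n \<oplus> A\<^sub>n \<gamma> A\<^sub>n\<close> as a bimodule over \<open>A\<^sub>n\<close>, and \<open>a \<otimes> b \<mapsto> a \<gamma> b\<close> identifies the last summand with
\<open>A\<^sub>n \<otimes> A\<^sub>n\<close> over \<open>A\<^sub>n\<^sub>-\<^sub>1\<close>.  Tensoring with \<open>M\<close> gives the isomorphism, which is natural because it does not
refer to \<open>M\<close>.  This formal part is the locale \<open>mackey\<close> with \<open>mackey_module.\<eta>_iso\<close> and \<open>mackey.\<eta>_natural\<close>.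

The bases are explicit.  Let \<open>\<epsilon>\<^sub>j\<close> be the idempotent that projects to the eigenvalue \<open>\<zeta>\<^sup>k\<close> of \<open>t\<^sub>j\<close>.  The elements
\<open>w\<^sub>j\<^sub>,\<^sub>a\<^sub>,\<^sub>k = g\<^sub>j \<dots> g\<^sub>1 (X\<^sub>1 - v\<^sub>1) \<dots> (X\<^sub>1 - v\<^sub>a) \<epsilon>\<^sub>1 g\<^sub>1\<^sup>-\<^sup>1 \<dots> g\<^sub>n\<^sup>-\<^sup>1\<close>   (\<open>j \<le> n\<close>, \<open>a < d\<close>, \<open>k < r\<close>)
form a basis of \<open>A\<^sub>n\<^sub>+\<^sub>1\<close> over \<open>A\<^sub>n\<close>.  Those with \<open>j < n\<close> are the basis elements of the level below, multiplied by
\<open>g\<^sub>n\<^sup>-\<^sup>1\<close>.  Those with \<open>j = n\<close> need not commute with \<open>A\<^sub>n\<close>, but up to a unitriangular change they are the elements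
\<open>Y\<^sup>a \<epsilon>\<^sub>n\<^sub>+\<^sub>1\<close>, where \<open>Y = g\<^sub>n \<dots> g\<^sub>1 X\<^sub>1 g\<^sub>1 \<dots> g\<^sub>n\<close> is the Jucys--Murphy element, and these do.

Spanning is a computation: left multiplication by a generator carries \<open>w\<^sub>j\<^sub>,\<^sub>a\<^sub>,\<^sub>k\<close> into the right span of the \<open>w\<close>'s,
by the formulas \<open>t_w\<close>, \<open>g_w_eq\<close>, \<open>\<xi>_w\<close> and their companions, and the \<open>w\<^sub>n\<^sub>,\<^sub>0\<^sub>,\<^sub>k\<close> add up to \<open>1\<close>.  Independence cannot be
read off from the presentation.  Instead the same formulas are read as a definition: for each \<open>k\<close> they give operators on
the coordinate columns over \<open>A\<^sub>n\<close>, one for each generator, and these operators satisfy the defining relations of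
\<open>A\<^sub>n\<^sub>+\<^sub>1\<close>.  Most relations are checked block by block.  The two that carry the weight are
\<open>XX_YY\<close> (that is, \<open>g\<^sub>1X\<^sub>1g\<^sub>1X\<^sub>1 = X\<^sub>1g\<^sub>1X\<^sub>1g\<^sub>1\<close>) and \<open>PX_d\<close> (the cyclotomic relation); both rest on the identity \<open>X_gpg\<close> for
moving \<open>X\<^sub>1\<close> across \<open>g\<^sub>1 p(X\<^sub>1) g\<^sub>1\<^sup>-\<^sup>1\<close>.  So \<open>A\<^sub>n\<^sub>+\<^sub>1\<close> acts on columns.  Applied to the column that stands for
\<open>w\<^sub>n\<^sub>,\<^sub>0\<^sub>,\<^sub>k\<close>, the element \<open>w\<^sub>j\<^sub>,\<^sub>a\<^sub>,\<^sub>k\<close> returns the unit column with index \<open>(j, a)\<close>, and the \<open>w\<close>'s for other eigenvalues return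
zero.  Hence a vanishing combination of the \<open>w\<close>'s has vanishing coefficients (\<open>wq_indep\<close>).

The algebras are quotient rings with carrier sets.  All computations above take place instead in one ring
type, the product of all cyclotomic algebras; \<open>A\<^sub>n\<close> is the part of it that a central idempotent cuts out.
\<close>

section \<open>The defining relations in an arbitrary ring\<close>

lemma assoc_subst: "a * b = (c::'a::semigroup_mult) \<Longrightarrow> a * (b * z) = c * z"
  by (simp add: mult.assoc[symmetric])

lemma power_conj:
  fixes y :: "'a::monoid_mult"
  assumes "y * a = a' * y"
  shows "y * a ^ s = a' ^ s * y"
proof (induction s)
  case (Suc s)
  have "y * a ^ Suc s = (y * a) * a ^ s" by (simp add: mult.assoc)
  also have "\<dots> = a' * (y * a ^ s)" by (simp add: assms mult.assoc)
  finally show ?case by (simp add: Suc mult.assoc)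
qed simp

lemma commute_mult: "y * a = a * y \<Longrightarrow> y * b = b * y \<Longrightarrow> y * (a * b) = a * b * (y::'a::semigroup_mult)"
  by (metis mult.assoc)

lemma commute_diff: "y * a = a * y \<Longrightarrow> y * b = b * y \<Longrightarrow> y * (a - b) = (a - b) * (y::'a::ring)"
  by (simp add: algebra_simps)

text \<open>The relations of the algebra of level \<open>n\<close>, for elements of a ring that may be larger than the algebra:
\<open>\<xi>\<close> and \<open>\<xi>'\<close> stand for \<open>X\<^sub>1\<close> and its inverse, \<open>\<kappa>\<close> for \<open>1/r\<close>, and \<open>c\<close> for \<open>q - q\<^sup>-\<^sup>1\<close>.  The element \<open>\<kappa> * r\<close> is only required to
act as the identity on \<open>\<kappa>\<close> and \<open>c\<close>, so \<open>\<kappa>\<close> and \<open>c\<close> may live on a direct factor of the ring.\<close>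
locale yokonuma =
  fixes r d n :: nat and t g :: "nat \<Rightarrow> 'a::ring_1" and \<xi> \<xi>' :: 'a and v vi :: "nat \<Rightarrow> 'a"
    and \<kappa> c :: 'a
  assumes r_pos: "1 \<le> r" and d_pos: "1 \<le> d"
    and \<kappa>_central: "\<kappa> * y = y * \<kappa>" and c_central: "c * y = y * c"
    and v_central: "v i * y = y * v i" and vi_central: "vi i * y = y * vi i"
    and v_inv: "1 \<le> i \<Longrightarrow> i \<le> d \<Longrightarrow> vi i * v i = 1"
    and \<kappa>_r: "\<kappa> * of_nat r * \<kappa> = \<kappa>" and c_\<kappa>_r: "\<kappa> * of_nat r * c = c"
    and gg_far: "\<lbrakk>1 \<le> i; i < n; 1 \<le> j; j < n; i + 2 \<le> j \<or> j + 2 \<le> i\<rbrakk> \<Longrightarrow> g i * g j = g j * g i"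
    and braid: "\<lbrakk>1 \<le> i; i + 1 < n\<rbrakk> \<Longrightarrow> g i * g (i + 1) * g i = g (i + 1) * g i * g (i + 1)"
    and tt: "\<lbrakk>1 \<le> i; i \<le> n; 1 \<le> j; j \<le> n\<rbrakk> \<Longrightarrow> t i * t j = t j * t i"
    and gt: "\<lbrakk>1 \<le> i; i < n; 1 \<le> j; j \<le> n\<rbrakk> \<Longrightarrow> g i * t j = t (Transposition.transpose i (i + 1) j) * g i"
    and t_r: "\<lbrakk>1 \<le> j; j \<le> n\<rbrakk> \<Longrightarrow> t j ^ r = 1"
    and gsq: "\<lbrakk>1 \<le> i; i < n\<rbrakk> \<Longrightarrow>
      g i * g i = 1 + c * (\<kappa> * (\<Sum>s<r. t i ^ s * t (i + 1) ^ (r - s))) * g i"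
    and X_Xi: "\<xi> * \<xi>' = 1" and Xi_X: "\<xi>' * \<xi> = 1"
    and gXgX: "2 \<le> n \<Longrightarrow> g 1 * \<xi> * g 1 * \<xi> = \<xi> * g 1 * \<xi> * g 1"
    and gX: "\<lbrakk>2 \<le> i; i < n\<rbrakk> \<Longrightarrow> g i * \<xi> = \<xi> * g i"
    and tX: "\<lbrakk>1 \<le> j; j \<le> n\<rbrakk> \<Longrightarrow> t j * \<xi> = \<xi> * t j"
    and cyc: "prod_list (map (\<lambda>i. \<xi> - v i) [1..<d + 1]) = 0"
begin

text \<open>For commuting \<open>a\<close> and \<open>b\<close> with \<open>a\<^sup>r = b\<^sup>r = 1\<close> this is the idempotent onto the part where \<open>a\<close> and \<open>b\<close> have the same
eigenvalue; the exponent \<open>r - s\<close> replaces the exponent \<open>-s\<close> of the usual formula.  Both \<open>e\<^sub>i\<close> and the eigenvalue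
idempotents of a single \<open>t\<^sub>j\<close> are of this form.\<close>
definition avg :: "'a \<Rightarrow> 'a \<Rightarrow> 'a" where "avg a b = \<kappa> * (\<Sum>s<r. a ^ s * b ^ (r - s))"

definition e :: "nat \<Rightarrow> 'a" where "e i = avg (t i) (t (i + 1))"

text \<open>The inverse of \<open>g i\<close>, as the quadratic relation gives it.\<close>
definition gi :: "nat \<Rightarrow> 'a" where "gi i = g i - c * e i"

text \<open>The Newton basis for the parameters \<open>v\<close>: multiplication by \<open>\<xi>\<close> sends \<open>p a\<close> to \<open>p (a + 1) + v (a + 1) * p a\<close>, and the
cyclotomic relation says that \<open>p d = 0\<close>.\<close>
primrec p :: "nat \<Rightarrow> 'a" where
  "p 0 = 1"
| "p (Suc a) = p a * (\<xi> - v (Suc a))"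

lemma p_eq: "p a = prod_list (map (\<lambda>i. \<xi> - v i) [1..<a + 1])"
  by (induction a) simp_all

lemma p_d: "p d = 0" using cyc p_eq by simp

lemma mult_\<kappa>: "y * (\<kappa> * z) = \<kappa> * (y * z)"
  by (metis \<kappa>_central mult.assoc)

lemma avg_conj:
  assumes "y * a = a' * y" "y * b = b' * y"
  shows "y * avg a b = avg a' b' * y"
proof -
  have 1: "y * (a ^ s * b ^ m) = a' ^ s * b' ^ m * y" for s m
    using power_conj[OF assms(1), of s] power_conj[OF assms(2), of m] by (simp add: mult.assoc[symmetric]) (simp add: mult.assoc)
  have "y * avg a b = \<kappa> * (y * (\<Sum>s<r. a ^ s * b ^ (r - s)))"
    unfolding avg_def by (rule mult_\<kappa>)
  then show ?thesis by (simp add: sum_distrib_left sum_distrib_right 1 avg_def mult.assoc)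
qed

lemma avg_sym:
  assumes ab: "a * b = b * a" "a ^ r = 1" "b ^ r = 1"
  shows "avg a b = avg b a"
proof -
  have ab_c: "a ^ i * b ^ j = b ^ j * a ^ i" for i j
    using power_conj[OF power_conj[OF ab(1), symmetric], symmetric] by blast
  obtain m where m: "r = Suc m" using r_pos by (cases r) auto
  have "(\<Sum>s<r. a ^ s * b ^ (r - s)) = 1 + (\<Sum>s<m. a ^ Suc s * b ^ (m - s))"
    using ab by (simp only: m sum.lessThan_Suc_shift) simp
  also have "(\<Sum>s<m. a ^ Suc s * b ^ (m - s)) = (\<Sum>s<m. a ^ (m - s) * b ^ Suc s)"
    by (rule sum.reindex_bij_witness[of _ "\<lambda>s. m - Suc s" "\<lambda>s. m - Suc s"]) (auto simp: Suc_diff_Suc)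
  also have "1 + \<dots> = (\<Sum>s<r. b ^ s * a ^ (r - s))"
    using ab by (simp only: m sum.lessThan_Suc_shift) (simp add: ab_c del: power_Suc)
  finally show ?thesis by (simp add: avg_def)
qed

lemma avg_absorb:
  assumes ab: "a * b = b * a" "a ^ r = 1" "b ^ r = 1"
  shows "a * avg a b = b * avg a b"
proof -
  obtain m where m: "r = Suc m" using r_pos by (cases r) auto
  have "a * (\<Sum>s<r. a ^ s * b ^ (r - s)) = (\<Sum>s<r. a ^ Suc s * b ^ (r - s))"
    by (simp add: sum_distrib_left mult.assoc)
  also have "\<dots> = b + (\<Sum>s<m. a ^ Suc s * b ^ (Suc m - s))"
    using ab by (simp add: m)
  also have "\<dots> = (\<Sum>s<r. a ^ s * b ^ Suc (r - s))"
    using ab by (simp only: m sum.lessThan_Suc_shift) (simp add: Suc_diff_le)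
  also have "\<dots> = b * (\<Sum>s<r. a ^ s * b ^ (r - s))"
    using power_conj[OF ab(1)[symmetric]]
    by (simp add: sum_distrib_left mult.assoc[symmetric])
  finally show ?thesis unfolding avg_def by (simp only: mult_\<kappa>)
qed

lemma avg_power:
  assumes ab: "a * b = b * a" "a ^ r = 1" "b ^ r = 1"
  shows "a ^ s * avg a b = b ^ s * avg a b"
proof (induction s)
  case (Suc s)
  have "a ^ Suc s * avg a b = a * (b ^ s * avg a b)" by (simp add: Suc mult.assoc)
  also have "\<dots> = b ^ s * (a * avg a b)"
    using power_conj[OF ab(1)] by (simp add: mult.assoc[symmetric])
  also have "\<dots> = b ^ s * b * avg a b" by (simp add: avg_absorb[OF ab] mult.assoc)
  finally show ?case by (simp add: power_commutes)
qed simp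

text \<open>Behind \<open>avg a b\<close> the elements \<open>a\<close> and \<open>b\<close> act alike, so they may be exchanged in any other average.\<close>
lemma avg_replace:
  assumes ab: "a * b = b * a" "a ^ r = 1" "b ^ r = 1"
    and x: "a * x = x * a" "b * x = x * b"
  shows "avg a b * avg a x = avg a b * avg b x"
proof -
  have ca: "avg a b * a = a * avg a b"
    by (rule avg_conj[symmetric]) (simp_all add: ab)
  have cb: "avg a b * b = b * avg a b"
    by (rule avg_conj[symmetric]) (simp_all add: ab)
  have *: "avg a b * a ^ s = avg a b * b ^ s" for s
    using power_conj[OF ca] power_conj[OF cb] avg_power[OF ab] by simp
  have "avg a b * avg a x = \<kappa> * (\<Sum>s<r. avg a b * a ^ s * x ^ (r - s))"
    unfolding avg_def[of a x] 
    by (simp add: mult_\<kappa> sum_distrib_left mult.assoc)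
  also have "\<dots> = \<kappa> * (\<Sum>s<r. avg a b * b ^ s * x ^ (r - s))" by (simp only: *)
  also have "\<dots> = avg a b * avg b x"
    unfolding avg_def[of b x] 
    by (simp add: mult_\<kappa> sum_distrib_left mult.assoc)
  finally show ?thesis .
qed

lemma avg_idem:
  assumes ab: "a * b = b * a" "a ^ r = 1" "b ^ r = 1"
  shows "avg a b * avg a b = avg a b"
proof -
  have cb: "avg a b * b = b * avg a b"
    by (rule avg_conj[symmetric]) (simp_all add: ab)
  have "avg a b * avg a b = avg a b * avg b b" by (rule avg_replace) (simp_all add: ab)
  also have "avg b b = \<kappa> * of_nat r"
    by (simp add: avg_def power_add[symmetric] ab)
  also have "avg a b * (\<kappa> * of_nat r) = avg a b"
  proof -
    have 1: "y * (\<kappa> * of_nat r) = \<kappa> * of_nat r * y" for y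
      by (simp only: mult_\<kappa> mult.assoc mult_of_nat_commute)
    have "\<kappa> * of_nat r * \<kappa> * S = \<kappa> * S" for S by (simp only: \<kappa>_r)
    then show ?thesis unfolding 1 unfolding avg_def by (simp only: mult.assoc)
  qed
  finally show ?thesis .
qed

lemma gt_other: "\<lbrakk>1 \<le> i; i < n; 1 \<le> j; j \<le> n; j \<noteq> i; j \<noteq> i + 1\<rbrakk> \<Longrightarrow> g i * t j = t j * g i"
  using gt[of i j] by (simp add: Transposition.transpose_def)

lemma gt_left: "\<lbrakk>1 \<le> i; i < n\<rbrakk> \<Longrightarrow> g i * t i = t (Suc i) * g i"
  using gt[of i i] by (simp add: Transposition.transpose_def)

lemma gt_right: "\<lbrakk>1 \<le> i; i < n\<rbrakk> \<Longrightarrow> g i * t (Suc i) = t i * g i"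
  using gt[of i "Suc i"] by (simp add: Transposition.transpose_def)

lemma e_sym: "\<lbrakk>1 \<le> i; i < n\<rbrakk> \<Longrightarrow> e i = avg (t (i + 1)) (t i)"
  unfolding e_def by (rule avg_sym) (simp_all add: tt t_r)

lemma g_e: "\<lbrakk>1 \<le> i; i < n\<rbrakk> \<Longrightarrow> g i * e i = e i * g i"
  using avg_conj[of "g i" "t i" "t (i + 1)" "t (i + 1)" "t i"] e_sym[of i]
  by (simp add: gt_left gt_right e_def)

lemma e_X: "\<lbrakk>1 \<le> i; i < n\<rbrakk> \<Longrightarrow> e i * \<xi> = \<xi> * e i"
  unfolding e_def by (rule avg_conj[symmetric]) (simp_all add: tX)

lemma g_sq: "\<lbrakk>1 \<le> i; i < n\<rbrakk> \<Longrightarrow> g i * g i = 1 + c * e i * g i"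
  using gsq by (simp add: e_def avg_def)

lemma g_gi: "\<lbrakk>1 \<le> i; i < n\<rbrakk> \<Longrightarrow> g i * gi i = 1"
  using commute_mult[OF c_central[symmetric] g_e, of i] g_sq[of i]
  by (simp add: gi_def algebra_simps)

lemma gi_g: "\<lbrakk>1 \<le> i; i < n\<rbrakk> \<Longrightarrow> gi i * g i = 1"
  using g_sq[of i] by (simp add: gi_def algebra_simps)

lemma p_comm:
  assumes "y * \<xi> = \<xi> * y"
  shows "y * p a = p a * y"
proof (induction a)
  case (Suc a)
  have "y * (\<xi> - v (Suc a)) = (\<xi> - v (Suc a)) * y" using assms v_central by (simp add: algebra_simps)
  then show ?case using commute_mult[OF Suc] by simp
qed simp

lemma ce_comm:
  assumes "y * e i = e i * y"
  shows "y * (c * e i) = c * e i * y"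
  using commute_mult[OF c_central[symmetric] assms] .

lemma gi_e: "\<lbrakk>1 \<le> i; i < n\<rbrakk> \<Longrightarrow> gi i * e i = e i * gi i"
  unfolding gi_def
  by (rule commute_diff[symmetric, OF _ commute_mult]) (simp_all add: g_e c_central)

lemma p_e: "\<lbrakk>1 \<le> i; i < n\<rbrakk> \<Longrightarrow> p a * e i = e i * p a"
  using p_comm[of "e i" a] e_X[of i] by simp

text \<open>How \<open>\<xi>\<close> moves across \<open>g\<^sub>1 p(\<xi>) g\<^sub>1\<^sup>-\<^sup>1\<close>.  The correction terms all come from \<open>k = c e\<^sub>1\<close>, the difference between \<open>g\<^sub>1\<close>
and its inverse, which commutes with everything in sight.\<close>
context
  fixes G G' k
  assumes n: "2 \<le> n"
  defines "G \<equiv> g 1" and "G' \<equiv> gi 1" and "k \<equiv> c * e 1"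
begin

lemma k_mv:
  "G * k = k * G" "\<xi> * k = k * \<xi>" "p a * k = k * p a" "G' * k = k * G'"
  unfolding G_def G'_def k_def using n
  by (auto intro!: ce_comm simp: g_e gi_e e_X p_e)

lemmas k_mv' = k_mv k_mv[THEN assoc_subst, unfolded mult.assoc]

lemma \<xi>_p: "\<xi> * p a = p a * \<xi>" by (rule p_comm) simp

lemmas \<xi>_p' = \<xi>_p \<xi>_p[THEN assoc_subst, unfolded mult.assoc]

lemma v_mv: "y * v i = v i * y" "y * (v i * z) = v i * (y * z)"
  by (metis v_central) (metis v_central mult.assoc)

lemma G_inv: "G' * G = 1" "G * G' = 1" 
  unfolding G_def G'_def using gi_g[of 1] g_gi[of 1] n by simp_all

lemmas G_inv' = G_inv G_inv[THEN assoc_subst, unfolded mult_1_left]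

lemma G_split: "G = G' + k" by (simp add: G_def G'_def k_def gi_def)

lemma G_braid: "G * (\<xi> * (G * \<xi>)) = \<xi> * (G * (\<xi> * G))"
  using gXgX[OF n] by (simp add: G_def mult.assoc)

lemma G_braid1: "\<xi> * (G * (\<xi> * G')) = G' * (\<xi> * (G * \<xi>))"
proof -
  have "G' * (G * (\<xi> * (G * \<xi>))) * G' = G' * (\<xi> * (G * (\<xi> * G))) * G'" using G_braid by simp
  then show ?thesis by (simp add: mult.assoc G_inv')
qed

lemma G_braid2: "G * (\<xi> * (G * (\<xi> * G'))) = \<xi> * (G * \<xi>)"
  by (simp add: G_braid1 G_inv')

lemma X_Z: "\<xi> * (G * (\<xi> * G')) = G * (\<xi> * (G' * \<xi>)) + k * (G * (\<xi> * \<xi>) - \<xi> * (G * \<xi>))"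
proof -
  have "G' = G - k" by (simp add: G_split)
  then show ?thesis using G_braid by (simp add: ring_distribs right_diff_distrib left_diff_distrib mult.assoc k_mv')
qed

text \<open>Induction on \<open>a\<close> by \<open>G p\<^sub>a\<^sub>+\<^sub>1 G' = (G p\<^sub>a G') (G (\<xi> - v\<^sub>a\<^sub>+\<^sub>1) G')\<close>; the case of one factor \<open>\<xi>\<close> is the braid relation
between \<open>g\<^sub>1\<close> and \<open>\<xi>\<close>, rewritten in \<open>X_Z\<close> with \<open>G' = G - k\<close>.\<close>
lemma X_gpg:
  "\<xi> * (G * (p a * G')) = G * (p a * (G' * \<xi>)) + k * (G * (p a * \<xi>) - p a * (G * \<xi>))"
proof (induction a)
  case 0
  show ?case by (simp add: G_inv')
next
  case (Suc a)
  let ?v = "v (Suc a)"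
  have 1: "\<xi> * (G * (p a * (\<xi> * G')))
    = G * (p a * (\<xi> * (G' * \<xi>))) + k * (G * (p a * (\<xi> * \<xi>)) - p a * (\<xi> * (G * \<xi>)))"
  proof -
    have "\<xi> * (G * (p a * (\<xi> * G'))) = \<xi> * (G * (p a * G')) * (G * (\<xi> * G'))"
      by (simp add: mult.assoc G_inv')
    also have "\<dots> = G * (p a * (G' * (\<xi> * (G * (\<xi> * G')))))
        + k * (G * (p a * (\<xi> * (G * (\<xi> * G')))) - p a * (G * (\<xi> * (G * (\<xi> * G')))))"
      by (simp add: Suc algebra_simps)
    also have "\<dots> = G * (p a * (G' * (G * (\<xi> * (G' * \<xi>)) + k * (G * (\<xi> * \<xi>) - \<xi> * (G * \<xi>)))))
        + k * (G * (p a * (G' * (\<xi> * (G * \<xi>)))) - p a * (\<xi> * (G * \<xi>)))"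
      by (simp only: X_Z[symmetric] G_braid2) (simp only: G_braid1)
    finally show ?thesis by (simp add: algebra_simps G_inv' k_mv')
  qed
  have 2: "\<xi> * (G * (p a * (?v * G'))) = ?v * (\<xi> * (G * (p a * G')))"
    by (simp add: v_mv)
  show ?case
    by (simp add: algebra_simps 1 2) (simp add: Suc algebra_simps v_mv)
qed

text \<open>The same identity, free of the inverse; in this form it is applied to coordinate columns.\<close>
lemma p_gX:
  "\<xi> * (G * (\<xi> * (p a * G))) = G * (\<xi> * (p a * (G * \<xi>))) + k * (\<xi> * (G * (\<xi> * p a)) - \<xi> * (p a * (G * \<xi>)))"
proof -
  have pv: "p a * \<xi> = p (Suc a) + v (Suc a) * p a" by (simp add: algebra_simps v_mv)
  have q: "\<xi> * (G * (p a * (\<xi> * G'))) = G * (p a * (\<xi> * (G' * \<xi>))) + k * (G * (p a * (\<xi> * \<xi>)) - p a * (\<xi> * (G * \<xi>)))"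
    using X_gpg[of a] X_gpg[of "Suc a"] arg_cong[OF X_gpg[of a], of "\<lambda>y. v (Suc a) * y"]
    by (simp add: algebra_simps v_mv)
  have "G' = G - k" by (simp add: G_split)
  then show ?thesis using q by (simp add: algebra_simps k_mv' \<xi>_p' del: diff_eq_eq eq_diff_eq)
      (simp add: algebra_simps)
qed

end

end

section \<open>Coordinate columns and eigenvalue idempotents\<close>

text \<open>Columns are functions, and sums of columns are rearranged as elements of an abelian group; evaluating them
at an argument would block this.\<close>
declare plus_fun_apply [simp del]

definition addmap :: "('a::plus \<Rightarrow> 'b::plus) \<Rightarrow> bool" where
  "addmap f \<longleftrightarrow> (\<forall>x y. f (x + y) = f x + f y)"

lemma addmapD: "addmap f \<Longrightarrow> f (x + y) = f x + f y" by (simp add: addmap_def)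

lemma addmap_0: "addmap (f :: 'a::ab_group_add \<Rightarrow> 'b::ab_group_add) \<Longrightarrow> f 0 = 0"
  using addmapD[of f 0 0] by simp

lemma addmap_diff: "addmap (f :: 'a::ab_group_add \<Rightarrow> 'b::ab_group_add) \<Longrightarrow> f (x - y) = f x - f y"
  using addmapD[of f "x - y" y] by simp

lemma addmap_sum: "addmap (f :: 'a::ab_group_add \<Rightarrow> 'b::ab_group_add) \<Longrightarrow> f (\<Sum>i\<in>A. h i) = (\<Sum>i\<in>A. f (h i))"
  by (induction A rule: infinite_finite_induct) (auto simp: addmap_0 addmapD)

lemma addmap_id: "addmap (\<lambda>x. x)" by (simp add: addmap_def)

definition sm :: "'a::ring \<Rightarrow> ('b \<Rightarrow> 'a) \<Rightarrow> 'b \<Rightarrow> 'a" where "sm y h = (\<lambda>a. y * h a)"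

lemma sm_simps:
  "sm y (h + h') = sm y h + sm y h'" "sm y (h - h') = sm y h - sm y h'" "sm y 0 = 0" "sm y (- h) = - sm y h"
  "sm (y + z) h = sm y h + sm z h" "sm (y - z) h = sm y h - sm z h" "sm 0 h = 0" "sm (- y) h = - sm y h"
  "sm y (sm z h) = sm (y * z) h"
  by (auto simp: sm_def fun_eq_iff algebra_simps plus_fun_apply)

lemma sm_1: "sm (1::'a::ring_1) h = h" by (simp add: sm_def)

text \<open>A column has blocks, and a block has entries: \<open>W k h\<close> is the column whose only nonzero block is \<open>h\<close>, in position
\<open>k\<close>, and \<open>u0 y\<close> is the block whose only nonzero entry is \<open>y\<close>, in position \<open>0\<close>.\<close>
definition W :: "nat \<Rightarrow> (nat \<Rightarrow> 'a) \<Rightarrow> nat \<Rightarrow> nat \<Rightarrow> 'a::zero" where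
  "W k h = (\<lambda>j. if j = k then h else (\<lambda>_. 0))"

lemma W_simps:
  fixes h :: "nat \<Rightarrow> 'a::ab_group_add"
  shows "W k (h + h') = W k h + W k h'" "W k (h - h') = W k h - W k h'" "W k 0 = 0" "W k (- h) = - W k h"
  by (auto simp: W_def fun_eq_iff plus_fun_apply)

definition u0 :: "'a \<Rightarrow> nat \<Rightarrow> 'a::ring" where "u0 y = (\<lambda>a. if a = 0 then y else 0)"

lemma u0_simps: "u0 (x + y) = u0 x + u0 y" "u0 (x - y) = u0 x - u0 y" "u0 0 = 0" "sm x (u0 y) = u0 (x * y)"
  by (auto simp: u0_def sm_def fun_eq_iff plus_fun_apply)

text \<open>A central root of unity \<open>\<omega>\<close>, to be used as an eigenvalue of the \<open>t\<^sub>j\<close>.\<close>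
locale yokonuma_eigen = yokonuma +
  fixes \<omega> :: 'a
  assumes \<omega>_central: "\<omega> * y = y * \<omega>" and \<omega>_r: "\<omega> ^ r = 1"
begin

definition \<epsilon> :: "nat \<Rightarrow> 'a" where "\<epsilon> j = avg (t j) \<omega>"

text \<open>\<open>\<pi> k = g\<^sub>k\<^sub>-\<^sub>1 \<dots> g\<^sub>1\<close> for \<open>k \<ge> 1\<close>; the value at \<open>0\<close> is a default.\<close>
primrec \<pi> :: "nat \<Rightarrow> 'a" where
  "\<pi> 0 = 1"
| "\<pi> (Suc k) = (if k = 0 then 1 else g k * \<pi> k)"

lemma mult_c: "y * (c * z) = c * (y * z)"
  by (metis c_central mult.assoc)

lemma t_\<epsilon>: "\<lbrakk>1 \<le> j; j \<le> n\<rbrakk> \<Longrightarrow> t j * \<epsilon> j = \<omega> * \<epsilon> j"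
  unfolding \<epsilon>_def by (rule avg_absorb) (simp_all add: \<omega>_central \<omega>_r t_r)

lemma t_\<epsilon>_comm: "\<lbrakk>1 \<le> j; j \<le> n; 1 \<le> i; i \<le> n\<rbrakk> \<Longrightarrow> t i * \<epsilon> j = \<epsilon> j * t i"
  unfolding \<epsilon>_def by (rule avg_conj) (simp_all add: \<omega>_central tt)

lemma \<xi>_\<epsilon>: "\<lbrakk>1 \<le> j; j \<le> n\<rbrakk> \<Longrightarrow> \<xi> * \<epsilon> j = \<epsilon> j * \<xi>"
  unfolding \<epsilon>_def by (rule avg_conj) (simp_all add: \<omega>_central tX)

lemma g_\<epsilon>: "\<lbrakk>1 \<le> i; i < n\<rbrakk> \<Longrightarrow> g i * \<epsilon> i = \<epsilon> (Suc i) * g i"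
  unfolding \<epsilon>_def by (rule avg_conj) (simp_all add: \<omega>_central gt_left)

lemma g_\<epsilon>': "\<lbrakk>1 \<le> i; i < n\<rbrakk> \<Longrightarrow> g i * \<epsilon> (Suc i) = \<epsilon> i * g i"
  unfolding \<epsilon>_def by (rule avg_conj) (simp_all add: \<omega>_central gt_right)

lemma g_\<epsilon>_other: "\<lbrakk>1 \<le> i; i < n; 1 \<le> j; j \<le> n; j \<noteq> i; j \<noteq> Suc i\<rbrakk> \<Longrightarrow> g i * \<epsilon> j = \<epsilon> j * g i"
  unfolding \<epsilon>_def by (rule avg_conj) (simp_all add: \<omega>_central gt_other)

lemma \<epsilon>_e: "\<lbrakk>1 \<le> i; i < n\<rbrakk> \<Longrightarrow> \<epsilon> j * e i = e i * \<epsilon> j" if "1 \<le> j" "j \<le> n"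
  unfolding e_def by (rule avg_conj) (use that in \<open>simp_all add: t_\<epsilon>_comm\<close>)

lemma e_\<epsilon>: assumes "1 \<le> i" "i < n" shows "e i * \<epsilon> i = \<epsilon> i * \<epsilon> (Suc i)" "e i * \<epsilon> (Suc i) = \<epsilon> i * \<epsilon> (Suc i)"
proof -
  have s: "avg \<omega> (t (Suc i)) = \<epsilon> (Suc i)"
    unfolding \<epsilon>_def by (rule avg_sym) (use assms in \<open>simp_all add: \<omega>_central \<omega>_r t_r\<close>)
  have "avg (t i) \<omega> * avg (t i) (t (Suc i)) = avg (t i) \<omega> * avg \<omega> (t (Suc i))"
    by (rule avg_replace) (use assms in \<open>simp_all add: \<omega>_central \<omega>_r t_r tt\<close>)
  then show "e i * \<epsilon> i = \<epsilon> i * \<epsilon> (Suc i)"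
    using \<epsilon>_e[of i i] assms by (simp add: s e_def \<epsilon>_def)
  have "avg (t i) (t (Suc i)) * avg (t i) \<omega> = avg (t i) (t (Suc i)) * avg (t (Suc i)) \<omega>"
    by (rule avg_replace) (use assms in \<open>simp_all add: \<omega>_central t_r tt\<close>)
  then show "e i * \<epsilon> (Suc i) = \<epsilon> i * \<epsilon> (Suc i)"
    using \<open>e i * \<epsilon> i = _\<close> by (simp add: e_def \<epsilon>_def)
qed

lemma \<epsilon>_\<epsilon>: "\<lbrakk>1 \<le> i; i \<le> n; 1 \<le> j; j \<le> n\<rbrakk> \<Longrightarrow> \<epsilon> i * \<epsilon> j = \<epsilon> j * \<epsilon> i"
  unfolding \<epsilon>_def[of j] by (rule avg_conj) (simp_all add: t_\<epsilon>_comm \<omega>_central)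

lemma g_\<pi>_far: "\<lbrakk>k < i; i < n; 1 \<le> k\<rbrakk> \<Longrightarrow> g i * \<pi> k = \<pi> k * g i"
proof (induction k)
  case (Suc k)
  then show ?case by (auto intro!: commute_mult gg_far)
qed simp

lemma \<pi>_g: "\<lbrakk>2 \<le> i; i < k; k \<le> n\<rbrakk> \<Longrightarrow> \<pi> k * g i = g (i - 1) * \<pi> k"
proof (induction k)
  case (Suc k)
  show ?case
  proof (cases "i = k")
    case False
    then have "g k * (\<pi> k * g i) = (g k * g (i - 1)) * \<pi> k" using Suc by (simp add: mult.assoc)
    also have "g k * g (i - 1) = g (i - 1) * g k" using Suc.prems False by (intro gg_far) auto
    finally show ?thesis using Suc.prems by (simp add: mult.assoc)
  next
    case True
    then obtain j where j: "k = Suc j" "1 \<le> j" using Suc.prems by (cases k) auto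
    have "\<pi> (Suc k) * g k = g (Suc j) * g j * (\<pi> j * g (Suc j))"
      using j by (simp add: mult.assoc)
    also have "\<dots> = g (Suc j) * g j * g (Suc j) * \<pi> j"
      using g_\<pi>_far[of j "Suc j"] j Suc.prems by (simp add: mult.assoc)
    also have "\<dots> = g j * g (Suc j) * g j * \<pi> j"
      using braid[of j] j Suc.prems by simp
    finally show ?thesis using j True by (simp add: mult.assoc)
  qed
qed simp

lemma \<pi>_t: "\<lbrakk>2 \<le> i; i \<le> k; k \<le> n\<rbrakk> \<Longrightarrow> \<pi> k * t i = t (i - 1) * \<pi> k"
proof (induction k)
  case (Suc k)
  show ?case
  proof (cases "i = Suc k")
    case False
    then have "g k * (\<pi> k * t i) = (g k * t (i - 1)) * \<pi> k" using Suc by (simp add: mult.assoc)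
    also have "g k * t (i - 1) = t (i - 1) * g k" using Suc.prems False by (intro gt_other) auto
    finally show ?thesis using Suc.prems False by (simp add: mult.assoc)
  next
    case True
    have c: "\<pi> j * t i = t i * \<pi> j" if "j < i" for j
      using that
    proof (induction j)
      case (Suc j)
      then show ?case using Suc.prems \<open>2 \<le> i\<close> \<open>i = _\<close> \<open>Suc k \<le> n\<close>
        by (auto intro!: commute_mult[symmetric] gt_other[symmetric])
    qed simp
    have "g k * (\<pi> k * t i) = g k * t (Suc k) * \<pi> k" using c[of k] True by (simp add: mult.assoc)
    then show ?thesis using True Suc.prems gt_right[of k] by (simp add: mult.assoc)
  qed
qed simp

lemma \<pi>_t1: "\<lbrakk>1 \<le> k; k \<le> n\<rbrakk> \<Longrightarrow> \<pi> k * t 1 = t k * \<pi> k"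
proof (induction k)
  case (Suc k)
  show ?case
  proof (cases "k = 0")
    case False
    then have "g k * (\<pi> k * t 1) = g k * t k * \<pi> k" using Suc by (simp add: mult.assoc)
    then show ?thesis using gt_left[of k] Suc.prems False by (simp add: mult.assoc)
  qed simp
qed simp

lemma \<pi>_t_far: "\<lbrakk>1 \<le> k; k < i; i \<le> n\<rbrakk> \<Longrightarrow> \<pi> k * t i = t i * \<pi> k"
proof (induction k)
  case (Suc k)
  then show ?case by (auto intro!: commute_mult[symmetric] gt_other[symmetric])
qed simp

lemma \<pi>_\<epsilon>_far: "\<lbrakk>1 \<le> k; k < i; i \<le> n\<rbrakk> \<Longrightarrow> \<pi> k * \<epsilon> i = \<epsilon> i * \<pi> k"
  unfolding \<epsilon>_def by (rule avg_conj) (simp_all add: \<pi>_t_far \<omega>_central)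

text \<open>A block \<open>h\<close> stands for \<open>\<Sum>a<d. p a \<otimes> h a\<close>.  Then \<open>xx\<close> is multiplication by \<open>\<xi>\<close> on the left factor, in the Newton basis and
modulo \<open>p d = 0\<close>, and \<open>ss\<close> multiplies the two factors together.\<close>
definition xx :: "(nat \<Rightarrow> 'a) \<Rightarrow> nat \<Rightarrow> 'a" where
  "xx h = (\<lambda>a. if a < d then (if a = 0 then 0 else h (a - 1)) + v (Suc a) * h a else 0)"

definition ss :: "(nat \<Rightarrow> 'a) \<Rightarrow> 'a" where "ss h = (\<Sum>a<d. p a * h a)"

definition VH :: "(nat \<Rightarrow> 'a) set" where "VH = {h. \<forall>a\<ge>d. h a = 0}"

definition bas :: "nat \<Rightarrow> 'a \<Rightarrow> nat \<Rightarrow> 'a" where "bas a y = (\<lambda>b. if b = a then y else 0)"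

lemma VH_closed: "0 \<in> VH" "h \<in> VH \<Longrightarrow> h' \<in> VH \<Longrightarrow> h + h' \<in> VH" "h \<in> VH \<Longrightarrow> h' \<in> VH \<Longrightarrow> h - h' \<in> VH"
  "h \<in> VH \<Longrightarrow> sm y h \<in> VH" "xx h \<in> VH" "u0 y \<in> VH" "a < d \<Longrightarrow> bas a y \<in> VH"
  using d_pos by (auto simp: VH_def sm_def xx_def u0_def bas_def plus_fun_apply)

lemma VH_sum: "h \<in> VH \<Longrightarrow> h = (\<Sum>a<d. bas a (h a))"
proof
  fix b assume "h \<in> VH"
  have "(\<Sum>a\<in>A. bas a (h a)) b = (\<Sum>a\<in>A. bas a (h a) b)" for A
    by (induction A rule: infinite_finite_induct) (auto simp: plus_fun_apply)
  then show "h b = (\<Sum>a<d. bas a (h a)) b" using \<open>h \<in> VH\<close>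
    by (auto simp: bas_def VH_def not_less)
qed

lemma VH_induct [consumes 1, case_names bas add]:
  assumes "h \<in> VH" "\<And>a y. a < d \<Longrightarrow> P (bas a y)" "\<And>h h'. P h \<Longrightarrow> P h' \<Longrightarrow> P (h + h')"
  shows "P h"
proof -
  have "P (\<Sum>a<m. bas a (h a))" if "1 \<le> m" "m \<le> d" for m
    using that
  proof (induction m)
    case (Suc m)
    then show ?case using assms(2)[of m "h m"] assms(3) by (cases "m = 0") auto
  qed simp
  from this[of d] show ?thesis using VH_sum[OF assms(1)] d_pos by simp
qed

lemma bas_0: "bas 0 y = u0 y" by (auto simp: bas_def u0_def)

lemma xx_bas: "Suc a < d \<Longrightarrow> bas (Suc a) y = xx (bas a y) - bas a (v (Suc a) * y)"
  by (auto simp: bas_def xx_def fun_eq_iff plus_fun_apply)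

text \<open>Every \<open>bas a y\<close> arises from \<open>u0 y\<close> by the operator \<open>xx\<close> and differences, because \<open>xx\<close> raises the Newton index.\<close>
lemma VH_induct_xx [consumes 1, case_names u0 xx diff]:
  assumes h: "h \<in> VH" and u0: "\<And>y. P (u0 y)" and xx: "\<And>h. h \<in> VH \<Longrightarrow> P h \<Longrightarrow> P (xx h)"
    and diff: "\<And>h h'. h \<in> VH \<Longrightarrow> h' \<in> VH \<Longrightarrow> P h \<Longrightarrow> P h' \<Longrightarrow> P (h - h')"
  shows "P h"
proof -
  have b: "P (bas a y)" if "a < d" for a y
    using that
  proof (induction a arbitrary: y)
    case 0 then show ?case by (simp add: bas_0 u0)
  next
    case (Suc a) then show ?case
      unfolding xx_bas[OF Suc.prems] by (intro diff xx VH_closed) auto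
  qed
  have "h \<in> VH \<and> P h"
    using h
  proof (induction h rule: VH_induct)
    case (bas a y) then show ?case by (simp add: b VH_closed)
  next
    case (add h h')
    have "P (0 - h')" using diff[of "u0 0" h'] add u0[of 0] VH_closed(6)[of 0] by (simp add: u0_simps)
    moreover have "0 - h' \<in> VH" using add VH_closed(1) VH_closed(3) by blast
    ultimately have "P (h - (0 - h'))" using add diff by blast
    then show ?case using add VH_closed(2)[of h h'] by simp
  qed
  then show ?thesis by simp
qed

lemma xx_simps: "xx (h + h') = xx h + xx h'" "xx (h - h') = xx h - xx h'" "xx 0 = 0" "xx (sm y h) = sm y (xx h)"
  by (auto simp: xx_def sm_def fun_eq_iff algebra_simps plus_fun_apply) (metis v_central mult.assoc)+

lemma ss_simps: "ss (h + h') = ss h + ss h'" "ss (h - h') = ss h - ss h'" "ss 0 = 0" "ss (u0 y) = y"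
proof -
  show "ss (u0 y) = y" using d_pos
    by (simp add: ss_def u0_def if_distrib[of "\<lambda>x. _ * x"] cong: if_cong)
qed (simp_all add: ss_def algebra_simps sum.distrib sum_subtractf plus_fun_apply)

lemma ss_bas: "a < d \<Longrightarrow> ss (sm y (bas a z)) = p a * (y * z)"
  by (simp add: ss_def bas_def sm_def if_distrib[of "\<lambda>x. _ * x"] cong: if_cong)

lemma ss_sm:
  assumes "y * \<xi> = \<xi> * y" shows "ss (sm y h) = y * ss h"
  unfolding ss_def sm_def sum_distrib_left
  by (rule sum.cong) (use p_comm[OF assms] in \<open>simp_all add: mult.assoc[symmetric]\<close>)

text \<open>The top entry of \<open>h\<close> is lost in \<open>xx h\<close>, but in \<open>ss\<close> it would be multiplied by \<open>p d = 0\<close>.\<close>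
lemma ss_xx: "ss (xx h) = \<xi> * ss h"
proof -
  obtain m where m: "d = Suc m" using d_pos by (cases d) auto
  have "ss (xx h) = (\<Sum>a<d. p a * (if a = 0 then 0 else h (a - 1))) + (\<Sum>a<d. p a * (v (Suc a) * h a))"
    by (simp add: ss_def xx_def distrib_left sum.distrib)
  also have "(\<Sum>a<d. p a * (if a = 0 then 0 else h (a - 1))) = (\<Sum>a<m. p (Suc a) * h a)"
    by (simp only: m sum.lessThan_Suc_shift) simp
  also have "\<dots> = (\<Sum>a<d. p (Suc a) * h a)"
    using p_d m by (simp only: m sum.lessThan_Suc) simp
  also have "\<dots> + (\<Sum>a<d. p a * (v (Suc a) * h a)) = (\<Sum>a<d. \<xi> * (p a * h a))"
    unfolding sum.distrib[symmetric]
  proof (rule sum.cong)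
    fix a
    have "p a * \<xi> = \<xi> * p a" using p_comm[of \<xi>] by simp
    then show "p (Suc a) * h a + p a * (v (Suc a) * h a) = \<xi> * (p a * h a)"
      by (simp only: p.simps algebra_simps)
  qed simp
  finally show ?thesis by (simp add: ss_def sum_distrib_left)
qed

text \<open>This is \<open>p_gX\<close>, entry by entry.\<close>
lemma ss_g:
  assumes n: "2 \<le> n" and h: "h \<in> VH"
  shows "\<xi> * (g 1 * (\<xi> * ss (sm (g 1) h))) =
    g 1 * (\<xi> * ss (sm (g 1 * \<xi>) h)) + c * e 1 * (\<xi> * (g 1 * (\<xi> * ss h)) - \<xi> * ss (sm (g 1 * \<xi>) h))"
  using h
proof (induction h rule: VH_induct)
  case (bas a y)
  have "ss (bas a y) = p a * y" using ss_bas[OF bas, of 1 y] by (simp add: sm_1)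
  then show ?case
    using arg_cong[OF p_gX[OF n, of a], of "\<lambda>z. z * y"] bas by (simp add: ss_bas algebra_simps)
next
  case (add h h')
  then show ?case by (simp add: sm_simps ss_simps distrib_left) (simp add: algebra_simps)
qed

end

section \<open>The operators of the generators on columns\<close>

context yokonuma_eigen
begin

definition VV :: "(nat \<Rightarrow> nat \<Rightarrow> 'a) set" where
  "VV = {w. (\<forall>k>n. w k = 0) \<and> (\<forall>k. w k \<in> VH)}"

definition lift :: "(nat \<Rightarrow> (nat \<Rightarrow> 'a) \<Rightarrow> 'b) \<Rightarrow> (nat \<Rightarrow> nat \<Rightarrow> 'a) \<Rightarrow> 'b::ab_group_add" where
  "lift F w = (\<Sum>k\<le>n. F k (w k))"

lemma VV_closed: "0 \<in> VV" "w \<in> VV \<Longrightarrow> w' \<in> VV \<Longrightarrow> w + w' \<in> VV" "w \<in> VV \<Longrightarrow> w' \<in> VV \<Longrightarrow> w - w' \<in> VV"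
  "k \<le> n \<Longrightarrow> h \<in> VH \<Longrightarrow> W k h \<in> VV" "w \<in> VV \<Longrightarrow> - w \<in> VV"
  using VH_closed(1) by (auto simp: VV_def W_def plus_fun_apply VH_closed zero_fun_def) (auto simp: VH_def)

lemma VV_sum_closed: "(\<And>i. i \<in> A \<Longrightarrow> f i \<in> VV) \<Longrightarrow> (\<Sum>i\<in>A. f i) \<in> VV"
  by (induction A rule: infinite_finite_induct) (auto intro: VV_closed)

lemma VV_sum: assumes "w \<in> VV" shows "w = (\<Sum>k\<le>n. W k (w k))"
proof
  fix j
  have "(\<Sum>k\<in>A. W k (w k)) j = (\<Sum>k\<in>A. W k (w k) j)" for A
    by (induction A rule: infinite_finite_induct) (auto simp: plus_fun_apply)
  then have "(\<Sum>k\<le>n. W k (w k)) j = (\<Sum>k\<le>n. if j = k then w k else 0)"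
    by (simp only: W_def zero_fun_def)
  also have "\<dots> = w j" using assms by (simp add: VV_def)
  finally show "w j = (\<Sum>k\<le>n. W k (w k)) j" ..
qed

lemma VV_ext:
  assumes "w \<in> VV" "addmap f" "addmap f'" "\<And>k h. k \<le> n \<Longrightarrow> h \<in> VH \<Longrightarrow> f (W k h) = f' (W k h)"
  shows "f w = (f' w :: 'b::ab_group_add)"
proof -
  have "f (\<Sum>k\<le>n. W k (w k)) = f' (\<Sum>k\<le>n. W k (w k))"
    unfolding addmap_sum[OF assms(2)] addmap_sum[OF assms(3)]
    by (rule sum.cong) (use assms(1,4) in \<open>auto simp: VV_def\<close>)
  then show ?thesis using VV_sum[OF assms(1)] by simp
qed

lemma lift_addmap: "(\<And>k. addmap (F k)) \<Longrightarrow> addmap (lift F)"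
  unfolding lift_def addmap_def by (simp add: sum.distrib plus_fun_apply)

lemma lift_W: "(\<And>k. addmap (F k)) \<Longrightarrow> k \<le> n \<Longrightarrow> lift F (W k h) = F k h"
proof -
  assume a: "\<And>k. addmap (F k)" and k: "k \<le> n"
  have "lift F (W k h) = (\<Sum>j\<le>n. if j = k then F k h else 0)"
    unfolding lift_def W_def zero_fun_def[symmetric]
    by (rule sum.cong) (auto simp: addmap_0[OF a])
  then show ?thesis using k by simp
qed

lemma lift_closed: "(\<And>k h. k \<le> n \<Longrightarrow> h \<in> VH \<Longrightarrow> F k h \<in> VV) \<Longrightarrow> w \<in> VV \<Longrightarrow> lift F w \<in> VV"
  unfolding lift_def by (rule VV_sum_closed) (auto simp: VV_def)

text \<open>The column \<open>w\<close> stands for \<open>\<Sum>k\<le>n. \<Sum>a<d. w\<^sub>k\<^sub>,\<^sub>a (w k a)\<close>, where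
\<open>w\<^sub>k\<^sub>,\<^sub>a = g\<^sub>k \<dots> g\<^sub>1 p\<^sub>a \<epsilon>\<^sub>1 g\<^sub>1\<^sup>-\<^sup>1 \<dots> g\<^sub>n\<^sup>-\<^sup>1\<close> is formed at level \<open>n + 1\<close> and the entries have level \<open>n\<close>.  The following
formulas are what left multiplication by \<open>t\<^sub>j\<close>, \<open>g\<^sub>i\<close> and \<open>X\<^sub>1\<close> does to such a sum; \<open>t_w\<close>, \<open>g_w_less\<close>, \<open>g_w_eq\<close>, \<open>g_w_Suc\<close>,
\<open>g_w_far\<close>, \<open>\<xi>_w_0\<close> and \<open>\<xi>_w\<close> below confirm them.  Here they serve as definitions.\<close>
definition \<tau> :: "nat \<Rightarrow> nat \<Rightarrow> 'a" where
  "\<tau> j k = (if j \<le> k then t j else if j = Suc k then \<omega> else t (j - 1))"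

definition \<beta> :: "nat \<Rightarrow> 'a" where "\<beta> k = \<epsilon> k * \<pi> k"

definition FT :: "nat \<Rightarrow> nat \<Rightarrow> (nat \<Rightarrow> 'a) \<Rightarrow> nat \<Rightarrow> nat \<Rightarrow> 'a" where
  "FT j k h = W k (sm (\<tau> j k) h)"

definition FG :: "nat \<Rightarrow> nat \<Rightarrow> (nat \<Rightarrow> 'a) \<Rightarrow> nat \<Rightarrow> nat \<Rightarrow> 'a" where
  "FG i k h = (if i < k then W k (sm (g i) h) else if i = k then W (k - 1) h + W k (sm (c * \<epsilon> k) h)
     else if i = Suc k then W i h else W k (sm (g (i - 1)) h))"

definition FX :: "nat \<Rightarrow> (nat \<Rightarrow> 'a) \<Rightarrow> nat \<Rightarrow> nat \<Rightarrow> 'a" where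
  "FX k h = (if k = 0 then W 0 (xx h)
     else W k (sm \<xi> h) + W 0 (u0 (c * \<beta> k * \<xi> * ss h) - sm (c * \<beta> k * \<xi>) h))"

text \<open>The inverse of \<open>xx\<close>: the triangular system that defines \<open>xx\<close> is solved from entry \<open>0\<close> upwards.\<close>
primrec xxi :: "(nat \<Rightarrow> 'a) \<Rightarrow> nat \<Rightarrow> 'a" where
  "xxi h 0 = vi 1 * h 0"
| "xxi h (Suc a) = (if Suc a < d then vi (Suc (Suc a)) * (h (Suc a) - xxi h a) else 0)"

text \<open>Found by solving \<open>FX\<close> for its argument: the block in position \<open>k\<close> is multiplied by \<open>\<xi>'\<close>, and the contribution that
\<open>FX\<close> then makes to block \<open>0\<close> is removed.\<close>
definition FXi :: "nat \<Rightarrow> (nat \<Rightarrow> 'a) \<Rightarrow> nat \<Rightarrow> nat \<Rightarrow> 'a" where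
  "FXi k h = (if k = 0 then W 0 (xxi h)
     else W k (sm \<xi>' h) - W 0 (xxi (u0 (c * \<beta> k * ss h) - sm (c * \<beta> k) h)))"

definition "T j = lift (FT j)"
definition "G i = lift (FG i)"
definition "XX = lift FX"
definition "XI = lift FXi"
definition S :: "'a \<Rightarrow> (nat \<Rightarrow> nat \<Rightarrow> 'a) \<Rightarrow> nat \<Rightarrow> nat \<Rightarrow> 'a" where "S y w = (\<lambda>k. sm y (w k))"

lemma xxi_add: "xxi (h + h') a = xxi h a + xxi h' a"
  by (induction a) (auto simp: plus_fun_apply algebra_simps)

lemma xxi_diff: "xxi (h - h') = xxi h - xxi h'"
proof -
  have "xxi (h - h' + h') = xxi (h - h') + xxi h'" by (rule ext) (simp only: xxi_add plus_fun_apply)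
  then show ?thesis by (simp only: diff_add_cancel eq_diff_eq)
qed

lemma xxi_sm: assumes "\<And>z. y * z = z * y" shows "xxi (sm y h) = sm y (xxi h)"
proof
  have *: "x * (y * z) = y * (x * z)" for x z using assms by (metis mult.assoc)
  fix a show "xxi (sm y h) a = sm y (xxi h) a"
    by (induction a) (auto simp: algebra_simps sm_def *)
qed

lemma xxi_VH: "xxi h \<in> VH"
proof -
  have "xxi h a = 0" if "a \<ge> d" for a using that d_pos by (cases a) auto
  then show ?thesis by (simp add: VH_def)
qed

lemma v_vi: "\<lbrakk>1 \<le> i; i \<le> d\<rbrakk> \<Longrightarrow> v i * vi i = 1"
  using v_inv v_central by metis

lemma xx_xxi: assumes "h \<in> VH" shows "xx (xxi h) = h"
proof
  fix a show "xx (xxi h) a = h a"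
  proof (cases a)
    case 0
    then show ?thesis using d_pos v_vi[of 1] by (simp add: xx_def mult.assoc[symmetric])
  next
    case (Suc b)
    then show ?thesis using assms v_vi[of "Suc (Suc b)"] by (auto simp: xx_def VH_def mult.assoc[symmetric])
  qed
qed

lemma xxi_xx: assumes "h \<in> VH" shows "xxi (xx h) = h"
proof
  fix a show "xxi (xx h) a = h a"
  proof (induction a)
    case 0
    then show ?case using d_pos v_inv[of 1] by (simp add: xx_def mult.assoc[symmetric])
  next
    case (Suc b)
    then show ?case using assms v_inv[of "Suc (Suc b)"] by (auto simp: xx_def VH_def mult.assoc[symmetric])
  qed
qed

lemma FT_add: "addmap (FT j k)" and FG_add: "addmap (FG i k)" and FX_add: "addmap (FX k)" and FXi_add: "addmap (FXi k)"
proof -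
  show "addmap (FXi k)"
  proof -
    have "xxi (h + h') = xxi h + xxi h'" for h h' by (auto simp: xxi_add plus_fun_apply)
    then show ?thesis
      by (simp add: addmap_def FXi_def W_simps u0_simps sm_simps ss_simps distrib_left xxi_diff)
  qed
qed (simp_all add: addmap_def FT_def FG_def FX_def W_simps u0_simps sm_simps ss_simps xx_simps distrib_left)

lemma addmaps: "addmap (T j)" "addmap (G i)" "addmap XX" "addmap XI" "addmap (S y)"
  unfolding T_def G_def XX_def XI_def
  by (intro lift_addmap FT_add FG_add FX_add FXi_add)+ (auto simp: addmap_def S_def sm_simps plus_fun_apply fun_eq_iff)

lemmas op_add = addmaps[THEN addmapD]
lemmas op_diff = addmaps[THEN addmap_diff]
lemmas op_0 = addmaps[THEN addmap_0]

lemma T_W: "k \<le> n \<Longrightarrow> T j (W k h) = W k (sm (\<tau> j k) h)"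
  unfolding T_def by (simp add: lift_W FT_add) (simp add: FT_def)

lemma G_W: "k \<le> n \<Longrightarrow> G i (W k h) = FG i k h"
  unfolding G_def by (simp add: lift_W FG_add)

lemma G_W_less: "\<lbrakk>k \<le> n; i < k\<rbrakk> \<Longrightarrow> G i (W k h) = W k (sm (g i) h)"
  and G_W_eq: "Suc k \<le> n \<Longrightarrow> G (Suc k) (W (Suc k) h) = W k h + W (Suc k) (sm (c * \<epsilon> (Suc k)) h)"
  and G_W_Suc: "k \<le> n \<Longrightarrow> G (Suc k) (W k h) = W (Suc k) h"
  and G_W_far: "\<lbrakk>k \<le> n; Suc k < i\<rbrakk> \<Longrightarrow> G i (W k h) = W k (sm (g (i - 1)) h)"
  by (simp_all add: G_W FG_def)

lemma XX_W0: "XX (W 0 h) = W 0 (xx h)"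
  and XX_W: "\<lbrakk>0 < k; k \<le> n\<rbrakk> \<Longrightarrow> XX (W k h) = W k (sm \<xi> h) + W 0 (u0 (c * \<beta> k * \<xi> * ss h) - sm (c * \<beta> k * \<xi>) h)"
  unfolding XX_def by (simp_all add: lift_W FX_add) (simp_all add: FX_def)

lemma XI_W0: "XI (W 0 h) = W 0 (xxi h)"
  and XI_W: "\<lbrakk>0 < k; k \<le> n\<rbrakk> \<Longrightarrow> XI (W k h) = W k (sm \<xi>' h) - W 0 (xxi (u0 (c * \<beta> k * ss h) - sm (c * \<beta> k) h))"
  unfolding XI_def by (simp_all add: lift_W FXi_add) (simp_all add: FXi_def)

lemma S_W: "S y (W k h) = W k (sm y h)"
  by (auto simp: S_def W_def sm_def fun_eq_iff)

lemma T_closed: "w \<in> VV \<Longrightarrow> T j w \<in> VV"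
  unfolding T_def by (rule lift_closed) (auto simp: FT_def intro: VV_closed VH_closed)

lemma G_closed: "\<lbrakk>i \<le> n; w \<in> VV\<rbrakk> \<Longrightarrow> G i w \<in> VV"
  unfolding G_def by (rule lift_closed) (auto simp: FG_def intro!: VV_closed VH_closed)

lemma XX_closed: "w \<in> VV \<Longrightarrow> XX w \<in> VV"
  unfolding XX_def by (rule lift_closed) (auto simp: FX_def intro!: VV_closed VH_closed)

lemma XI_closed: "w \<in> VV \<Longrightarrow> XI w \<in> VV"
  unfolding XI_def by (rule lift_closed) (auto simp: FXi_def intro!: VV_closed VH_closed xxi_VH)

lemma S_closed: "w \<in> VV \<Longrightarrow> S y w \<in> VV"
  by (auto simp: VV_def S_def sm_simps VH_closed)

lemma \<xi>'_comm: assumes "y * \<xi> = \<xi> * y" shows "y * \<xi>' = \<xi>' * y"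
proof -
  have "\<xi>' * (y * \<xi>) * \<xi>' = \<xi>' * (\<xi> * y) * \<xi>'" using assms by simp
  then show ?thesis using X_Xi Xi_X by (simp add: mult.assoc assoc_subst[OF Xi_X])
qed

lemma XX_XI: assumes "w \<in> VV" shows "XX (XI w) = w"
proof (rule VV_ext[where f = "\<lambda>w. XX (XI w)" and f' = "\<lambda>w. w"])
  fix k h assume k: "k \<le> n" and h: "h \<in> VH"
  have s: "ss (sm \<xi>' h) = \<xi>' * ss h" by (rule ss_sm) (simp add: X_Xi Xi_X)
  show "XX (XI (W k h)) = W k h"
  proof (cases "k = 0")
    case False
    have "xx (xxi (u0 (c * \<beta> k * ss h) - sm (c * \<beta> k) h)) = u0 (c * \<beta> k * ss h) - sm (c * \<beta> k) h"
      by (rule xx_xxi) (intro VH_closed h)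
    then show ?thesis using False k
      by (simp add: XI_W op_diff XX_W XX_W0 sm_simps X_Xi sm_1 s mult.assoc assoc_subst[OF X_Xi])
  qed (simp add: XI_W0 XX_W0 xx_xxi[OF h])
qed (use assms in \<open>simp_all add: addmap_def op_add\<close>)

lemma XI_XX: assumes "w \<in> VV" shows "XI (XX w) = w"
proof (rule VV_ext[where f = "\<lambda>w. XI (XX w)" and f' = "\<lambda>w. w"])
  fix k h assume k: "k \<le> n" and h: "h \<in> VH"
  have s: "ss (sm \<xi> h) = \<xi> * ss h" by (rule ss_sm) simp
  show "XI (XX (W k h)) = W k h"
  proof (cases "k = 0")
    case False
    then show ?thesis using k
      by (simp add: XI_W op_add XX_W XI_W0 sm_simps Xi_X sm_1 s mult.assoc)
  qed (simp add: XI_W0 XX_W0 xxi_xx[OF h])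
qed (use assms in \<open>simp_all add: addmap_def op_add\<close>)

lemma G_far:
  assumes "w \<in> VV" "1 \<le> i" "i \<le> n" "1 \<le> j" "j \<le> n" "i + 2 \<le> j"
  shows "G i (G j w) = G j (G i w)"
proof (rule VV_ext[where f = "\<lambda>w. G i (G j w)" and f' = "\<lambda>w. G j (G i w)"])
  fix k h assume k: "k \<le> n" and h: "h \<in> VH"
  have ce: "g l * (c * \<epsilon> m) = c * \<epsilon> m * g l" if "1 \<le> l" "l < n" "1 \<le> m" "m \<le> n" "m \<noteq> l" "m \<noteq> Suc l" for l m
    by (rule commute_mult) (use that in \<open>simp_all add: c_central g_\<epsilon>_other\<close>)
  consider "j < k" | "j = k" | "j = Suc k" | "Suc k < j" "i < k" | "Suc k < j" "i = k" | "Suc k < j" "i = Suc k"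
    | "Suc k < j" "Suc k < i" by linarith
  then show "G i (G j (W k h)) = G j (G i (W k h))"
  proof cases
    case 1
    then show ?thesis using k assms gg_far[of i j] by (simp add: G_W_less sm_simps)
  next
    case 2
    then obtain l where l: "k = Suc l" using assms by (cases k) auto
    then show ?thesis using 2 k assms ce[of i "Suc l"]
      by (simp add: G_W_less G_W_eq op_add sm_simps W_simps)
  next
    case 3
    then show ?thesis using k assms by (simp add: G_W_less G_W_Suc)
  next
    case 4
    then show ?thesis using k assms gg_far[of i "j - 1"] by (simp add: G_W_less G_W_far sm_simps)
  next
    case 5
    then obtain l where l: "k = Suc l" using assms by (cases k) auto
    then show ?thesis using 5 k assms ce[of "j - 1" "Suc l"]
      by (simp add: G_W_far G_W_eq op_add sm_simps W_simps)
  next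
    case 6
    then show ?thesis using k assms by (simp add: G_W_far G_W_Suc)
  next
    case 7
    then have "g (i - 1) * g (j - 1) = g (j - 1) * g (i - 1)" using assms by (intro gg_far) auto
    then show ?thesis using 7 k assms by (simp add: G_W_far sm_simps)
  qed
qed (use assms in \<open>simp_all add: addmap_def op_add\<close>)

text \<open>The two sides mix the blocks \<open>i - 1\<close>, \<open>i\<close> and \<open>i + 1\<close>.  Only block \<open>i + 1\<close> is not immediate: there the
two sides agree because \<open>\<epsilon> i * \<epsilon> (i + 1) = \<epsilon> i * e i\<close> turns the products of the correction
terms into the quadratic relation for \<open>g i\<close>.\<close>
lemma G_braid:
  assumes "w \<in> VV" "1 \<le> i" "i + 1 \<le> n"
  shows "G i (G (i + 1) (G i w)) = G (i + 1) (G i (G (i + 1) w))"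
proof (rule VV_ext[where f = "\<lambda>w. G i (G (i + 1) (G i w))" and f' = "\<lambda>w. G (i + 1) (G i (G (i + 1) w))"])
  fix k h assume k: "k \<le> n" and h: "h \<in> VH"
  have i: "1 \<le> i" "i < n" using assms by auto
  have ce: "g i * (c * \<epsilon> i) = c * \<epsilon> (Suc i) * g i" "g i * (c * \<epsilon> (Suc i)) = c * \<epsilon> i * g i"
    using i by (simp_all add: mult_c g_\<epsilon> g_\<epsilon>' mult.assoc)
  obtain l where l: "i = Suc l" using i by (cases i) auto
  consider "i + 1 < k" | "k = i + 1" | "k = i" | "k = l" | "k < l" using l by linarith
  then show "G i (G (i + 1) (G i (W k h))) = G (i + 1) (G i (G (i + 1) (W k h)))"
  proof cases
    case 1
    then show ?thesis using k assms braid[of i] by (simp add: G_W_less sm_simps mult.assoc)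
  next
    case 2
    have "c * \<epsilon> (Suc i) * g i * (c * \<epsilon> (Suc i)) = c * \<epsilon> (Suc i) * (c * \<epsilon> i * g i)"
      by (simp add: ce mult.assoc)
    also have "\<dots> = c * (\<epsilon> i * (c * (e i * g i)))"
    proof -
      have "\<epsilon> (Suc i) * \<epsilon> i = \<epsilon> i * e i"
        using e_\<epsilon>[OF i] \<epsilon>_e[of i i] \<epsilon>_\<epsilon>[of i "Suc i"] i by simp
      then show ?thesis
        by (metis mult_c mult.assoc)
    qed
    finally have 3: "g i * (c * \<epsilon> (Suc i)) * g i = c * \<epsilon> i + c * \<epsilon> (Suc i) * g i * (c * \<epsilon> (Suc i))"
      unfolding ce using g_sq[OF i] by (simp add: mult.assoc distrib_left)
    have 4: "g (Suc l) * (c * (\<epsilon> (Suc (Suc l)) * g (Suc l))) =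
        c * \<epsilon> (Suc l) + c * (\<epsilon> (Suc (Suc l)) * (c * (\<epsilon> (Suc l) * g (Suc l))))"
      using 3 ce(2) by (simp add: l mult.assoc)
    have "W (k - 2) (sm (g i) h) + (W (k - 1) (sm (c * \<epsilon> (k - 1) * g i) h) + W k (sm (g i * (c * \<epsilon> k) * g i) h)) =
      W (k - 2) (sm (g i) h) + (W k (sm (c * \<epsilon> (k - 1)) h) + (W (k - 1) (sm (c * \<epsilon> (k - 1) * g i) h) + W k (sm (c * \<epsilon> k * (c * \<epsilon> (k - 1) * g i)) h)))"
      using 4 by (simp add: 2 l mult.assoc sm_simps W_simps)
    then show ?thesis using 2 k assms l ce(2)
      by (simp add: G_W_less G_W_eq G_W_Suc G_W_far op_add sm_simps W_simps mult.assoc)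
  next
    case 3
    then show ?thesis using k assms l
      by (simp add: G_W_less G_W_eq G_W_Suc G_W_far op_add sm_simps W_simps ce[unfolded l])
  next
    case 4
    then show ?thesis using k assms l
      by (simp add: G_W_less G_W_eq G_W_Suc G_W_far op_add sm_simps W_simps)
  next
    case 5
    then show ?thesis using k assms l braid[of l]
      by (simp add: G_W_far sm_simps mult.assoc)
  qed
qed (use assms in \<open>simp_all add: addmap_def op_add\<close>)

lemma \<tau>_comm: "\<lbrakk>1 \<le> i; i \<le> Suc n; 1 \<le> j; j \<le> Suc n; k \<le> n\<rbrakk> \<Longrightarrow> \<tau> i k * \<tau> j k = \<tau> j k * \<tau> i k"
  by (auto simp: \<tau>_def intro!: tt \<omega>_central \<omega>_central[symmetric])

lemma \<tau>_r: "\<lbrakk>1 \<le> i; i \<le> Suc n; k \<le> n\<rbrakk> \<Longrightarrow> \<tau> i k ^ r = 1"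
  by (auto simp: \<tau>_def intro!: t_r \<omega>_r)

lemma T_T:
  assumes "w \<in> VV" "1 \<le> i" "i \<le> Suc n" "1 \<le> j" "j \<le> Suc n"
  shows "T i (T j w) = T j (T i w)"
  by (rule VV_ext[where f = "\<lambda>w. T i (T j w)" and f' = "\<lambda>w. T j (T i w)", OF assms(1)])
    (use assms in \<open>auto simp: T_W sm_simps \<tau>_comm addmap_def op_add\<close>)

lemma addmap_funpow: "addmap (f :: 'b::plus \<Rightarrow> 'b) \<Longrightarrow> addmap (f ^^ s)"
  by (induction s) (auto simp: addmap_def)

lemma Tpow_W: "k \<le> n \<Longrightarrow> (T j ^^ s) (W k h) = W k (sm (\<tau> j k ^ s) h)"
  by (induction s) (auto simp: T_W sm_simps sm_1)

lemma T_r: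
  assumes "w \<in> VV" "1 \<le> i" "i \<le> Suc n"
  shows "(T i ^^ r) w = w"
  by (rule VV_ext[where f = "T i ^^ r" and f' = "\<lambda>w. w", OF assms(1)])
    (use assms in \<open>auto simp: Tpow_W sm_1 \<tau>_r intro!: addmap_funpow addmaps addmap_id\<close>)

lemma sm_sum: "sm (\<Sum>i\<in>A. f i) h = (\<Sum>i\<in>A. sm (f i) h)"
  by (induction A rule: infinite_finite_induct) (auto simp: sm_simps)

lemma W_sum: "W k (\<Sum>i\<in>A. f i) = (\<Sum>i\<in>A. W k (f i :: nat \<Rightarrow> 'a))"
  by (induction A rule: infinite_finite_induct) (auto simp: W_simps simp del: zero_fun_apply)

definition EE :: "nat \<Rightarrow> (nat \<Rightarrow> nat \<Rightarrow> 'a) \<Rightarrow> nat \<Rightarrow> nat \<Rightarrow> 'a" where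
  "EE i w = S \<kappa> (\<Sum>s<r. (T i ^^ s) ((T (i + 1) ^^ (r - s)) w))"

lemma EE_add: "addmap (EE i)"
  by (simp add: addmap_def EE_def op_add addmapD[OF addmap_funpow[OF addmaps(1)]] sum.distrib)

lemma EE_W: "k \<le> n \<Longrightarrow> EE i (W k h) = W k (sm (avg (\<tau> i k) (\<tau> (i + 1) k)) h)"
proof -
  assume k: "k \<le> n"
  have "EE i (W k h) = S \<kappa> (\<Sum>s<r. W k (sm (\<tau> i k ^ s * \<tau> (i + 1) k ^ (r - s)) h))"
    unfolding EE_def using k by (simp add: Tpow_W sm_simps)
  then show ?thesis by (simp add: avg_def sm_sum[symmetric] W_sum[symmetric] S_W sm_simps)
qed

lemma G_T:
  assumes "w \<in> VV" "1 \<le> i" "i \<le> n" "1 \<le> j" "j \<le> Suc n"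
  shows "G i (T j w) = T (Transposition.transpose i (i + 1) j) (G i w)"
proof (rule VV_ext[where f = "\<lambda>w. G i (T j w)" and f' = "\<lambda>w. T (Transposition.transpose i (i + 1) j) (G i w)", OF assms(1)])
  fix k h assume k: "k \<le> n" and h: "h \<in> VH"
  let ?s = "Transposition.transpose i (i + 1)"
  obtain l where l: "i = Suc l" using assms by (cases i) auto
  consider "i < k" | "i = k" | "k = l" | "k < l" using l by linarith
  then show "G i (T j (W k h)) = T (?s j) (G i (W k h))"
  proof cases
    case 1
    have "g i * \<tau> j k = \<tau> (?s j) k * g i"
      using 1 k assms gt[of i j] gt_other[of i "j - 1"]
      by (auto simp: \<tau>_def Transposition.transpose_def \<omega>_central)
    then show ?thesis using 1 k by (simp add: T_W G_W_less sm_simps)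
  next
    case 2
    have 3: "\<tau> j i = \<tau> (?s j) l"
      using k assms l by (auto simp: \<tau>_def Transposition.transpose_def)
    have "\<tau> j i * (c * \<epsilon> i) = \<tau> (?s j) i * (c * \<epsilon> i)"
    proof -
      have "\<tau> j i * \<epsilon> i = \<tau> (?s j) i * \<epsilon> i"
        using assms l t_\<epsilon>[of i] by (auto simp: \<tau>_def Transposition.transpose_def)
      then show ?thesis by (simp add: mult_c)
    qed
    moreover have "\<tau> j i * (c * \<epsilon> i) = c * \<epsilon> i * \<tau> j i"
      using k assms l t_\<epsilon>_comm[of i] \<omega>_central 
      by (intro commute_mult c_central[symmetric]) (auto simp: \<tau>_def)
    ultimately have 4: "\<tau> (?s j) i * (c * \<epsilon> i) = c * \<epsilon> i * \<tau> (?s j) l" using 3 by simp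
    have kl: "k = Suc l" using 2 l by simp
    show ?thesis using 3 4 k unfolding kl l by (simp add: T_W G_W_eq sm_simps op_add W_simps)
  next
    case 3
    have "\<tau> j k = \<tau> (?s j) (Suc k)"
      using k assms l 3 by (auto simp: \<tau>_def Transposition.transpose_def)
    then show ?thesis using 3 k l assms by (simp add: T_W G_W_Suc)
  next
    case 4
    have "g (i - 1) * \<tau> j k = \<tau> (?s j) k * g (i - 1)"
      using 4 k assms l gt[of "i - 1" "j - 1"] gt_other[of "i - 1" j]
      by (auto simp: \<tau>_def Transposition.transpose_def \<omega>_central split: if_splits)
    then show ?thesis using 4 k l by (simp add: T_W G_W_far sm_simps)
  qed
qed (use assms in \<open>simp_all add: addmap_def op_add\<close>)

lemma G_sq:
  assumes "w \<in> VV" "1 \<le> i" "i \<le> n"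
  shows "G i (G i w) = w + S c (EE i (G i w))"
proof (rule VV_ext[where f = "\<lambda>w. G i (G i w)" and f' = "\<lambda>w. w + S c (EE i (G i w))", OF assms(1)])
  fix k h assume k: "k \<le> n" and h: "h \<in> VH"
  obtain l where l: "i = Suc l" using assms by (cases i) auto
  consider "i < k" | "i = k" | "k = l" | "k < l" using l by linarith
  then show "G i (G i (W k h)) = W k h + S c (EE i (G i (W k h)))"
  proof cases
    case 1
    have "avg (\<tau> i k) (\<tau> (i + 1) k) = e i" using 1 by (simp add: \<tau>_def e_def)
    then show ?thesis using 1 k assms g_sq[of i]
      by (simp add: G_W_less sm_simps EE_W S_W sm_1 W_simps mult.assoc[symmetric])
  next
    case 2
    have a: "avg (\<tau> i i) (\<tau> (i + 1) i) = \<epsilon> i" by (simp add: \<tau>_def \<epsilon>_def)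
    have "avg (\<tau> i l) (\<tau> (i + 1) l) = avg \<omega> (t i)" using l by (simp add: \<tau>_def)
    also have "\<dots> = \<epsilon> i" unfolding \<epsilon>_def using assms by (intro avg_sym) (auto simp: \<omega>_central \<omega>_r t_r)
    finally have b: "avg (\<tau> i l) (\<tau> (i + 1) l) = \<epsilon> i" .
    have kl: "k = Suc l" using 2 l by simp
    show ?thesis using a b k unfolding kl l
      by (simp add: op_add addmapD[OF EE_add] G_W_eq G_W_Suc EE_W S_W sm_simps W_simps mult.assoc)
  next
    case 3
    have "avg (\<tau> i i) (\<tau> (i + 1) i) = \<epsilon> i" by (simp add: \<tau>_def \<epsilon>_def)
    then show ?thesis using 3 k l assms
      by (simp add: G_W_eq G_W_Suc EE_W S_W sm_simps)
  next
    case 4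
    have "avg (\<tau> i k) (\<tau> (i + 1) k) = e (i - 1)" using 4 l by (simp add: \<tau>_def e_def)
    then show ?thesis using 4 k assms l g_sq[of l]
      by (simp add: G_W_far sm_simps EE_W S_W sm_1 W_simps mult.assoc[symmetric])
  qed
qed (simp_all add: addmap_def op_add addmapD[OF EE_add])

end

section \<open>The relations that involve \<open>X\<^sub>1\<close>\<close>

context yokonuma_eigen
begin

lemma g_\<beta>_less: "\<lbrakk>2 \<le> i; i < k; k \<le> n\<rbrakk> \<Longrightarrow> g (i - 1) * \<beta> k = \<beta> k * g i"
  using g_\<epsilon>_other[of "i - 1" k] \<pi>_g[of i k]
  by (simp add: \<beta>_def mult.assoc) (simp add: mult.assoc[symmetric])

lemma g_\<beta>_eq: assumes "1 \<le> k" "k < n" shows "g k * \<beta> (Suc k) = \<beta> k + c * \<beta> (Suc k) * \<epsilon> (Suc k)"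
proof -
  have "g k * \<beta> (Suc k) = g k * \<epsilon> (Suc k) * g k * \<pi> k" using assms by (simp add: \<beta>_def mult.assoc)
  also have "\<dots> = \<epsilon> k * (g k * g k) * \<pi> k" using assms by (simp add: g_\<epsilon>' mult.assoc)
  also have "\<dots> = \<beta> k + c * (\<epsilon> k * e k) * (g k * \<pi> k)"
    using g_sq[of k] assms by (simp add: distrib_left distrib_right \<beta>_def mult_c[of "\<epsilon> k"] mult.assoc)
  also have "\<epsilon> k * e k = \<epsilon> (Suc k) * \<epsilon> k"
    using e_\<epsilon>[of k] \<epsilon>_e[of k k] \<epsilon>_\<epsilon>[of k "Suc k"] assms by simp
  also have "c * (\<epsilon> (Suc k) * \<epsilon> k) * (g k * \<pi> k) = c * \<epsilon> (Suc k) * (\<epsilon> k * g k) * \<pi> k" by (simp add: mult.assoc)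
  also have "\<epsilon> k * g k = g k * \<epsilon> (Suc k)" using g_\<epsilon>' assms by simp
  finally show ?thesis using \<pi>_\<epsilon>_far[of k "Suc k"] assms by (simp add: \<beta>_def mult.assoc)
qed

lemma g_\<beta>_Suc: "\<lbrakk>1 \<le> k; k < n\<rbrakk> \<Longrightarrow> g k * \<beta> k = \<beta> (Suc k)"
  using g_\<epsilon>[of k] by (simp add: \<beta>_def mult.assoc[symmetric])

lemma g_\<beta>_far: "\<lbrakk>1 \<le> k; k < i; i < n\<rbrakk> \<Longrightarrow> g i * \<beta> k = \<beta> k * g i"
  unfolding \<beta>_def by (rule commute_mult) (simp_all add: g_\<epsilon>_other g_\<pi>_far)

lemma \<tau>_\<beta>: assumes "1 \<le> j" "j \<le> Suc n" "1 \<le> k" "k \<le> n" shows "\<tau> j 0 * \<beta> k = \<beta> k * \<tau> j k"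
proof -
  consider "j = 1" | "2 \<le> j" "j \<le> k" | "j = Suc k" | "Suc k < j" using assms by linarith
  then show ?thesis
  proof cases
    case 1
    have "\<beta> k * t 1 = \<epsilon> k * t k * \<pi> k" using assms by (simp add: \<beta>_def mult.assoc \<pi>_t1[simplified])
    also have "\<epsilon> k * t k = \<omega> * \<epsilon> k" using t_\<epsilon>_comm[of k k] t_\<epsilon>[of k] assms by simp
    finally show ?thesis using 1 assms by (simp add: \<tau>_def \<beta>_def mult.assoc)
  next
    case 2
    have "\<beta> k * t j = \<epsilon> k * t (j - 1) * \<pi> k" using assms 2 by (simp add: \<beta>_def mult.assoc \<pi>_t)
    also have "\<epsilon> k * t (j - 1) = t (j - 1) * \<epsilon> k" using t_\<epsilon>_comm[of k "j - 1"] 2 assms by simp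
    finally show ?thesis using 2 assms by (simp add: \<tau>_def \<beta>_def mult.assoc)
  next
    case 3
    then show ?thesis using assms t_\<epsilon>[of k] \<omega>_central[of "\<beta> k"]
      by (simp add: \<tau>_def \<beta>_def mult.assoc[symmetric])
  next
    case 4
    have "t (j - 1) * \<beta> k = \<beta> k * t (j - 1)"
      unfolding \<beta>_def by (rule commute_mult) (use 4 assms in \<open>auto simp: t_\<epsilon>_comm \<pi>_t_far\<close>)
    then show ?thesis using 4 assms by (simp add: \<tau>_def)
  qed
qed

lemma \<tau>_\<xi>: "\<lbrakk>1 \<le> j; j \<le> Suc n; k \<le> n\<rbrakk> \<Longrightarrow> \<tau> j k * \<xi> = \<xi> * \<tau> j k"
  by (auto simp: \<tau>_def tX \<omega>_central)

lemma c\<epsilon>_\<xi>: "\<lbrakk>1 \<le> j; j \<le> n\<rbrakk> \<Longrightarrow> c * \<epsilon> j * \<xi> = \<xi> * (c * \<epsilon> j)"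
  using commute_mult[OF c_central[symmetric], of \<xi> "\<epsilon> j"] \<xi>_\<epsilon>[of j] by simp

lemma T_XX:
  assumes "w \<in> VV" "1 \<le> j" "j \<le> Suc n"
  shows "T j (XX w) = XX (T j w)"
proof (rule VV_ext[where f = "\<lambda>w. T j (XX w)" and f' = "\<lambda>w. XX (T j w)", OF assms(1)])
  fix k h assume k: "k \<le> n" and h: "h \<in> VH"
  show "T j (XX (W k h)) = XX (T j (W k h))"
  proof (cases "k = 0")
    case True
    then show ?thesis by (simp add: T_W XX_W0 xx_simps)
  next
    case False
    have 1: "\<tau> j 0 * (c * \<beta> k * \<xi>) = c * \<beta> k * \<xi> * \<tau> j k"
    proof -
      have "\<tau> j 0 * (c * \<beta> k * \<xi>) = c * (\<tau> j 0 * \<beta> k) * \<xi>"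
        by (simp add: mult_c[of "\<tau> j 0"] mult.assoc)
      also have "\<dots> = c * \<beta> k * (\<tau> j k * \<xi>)" using \<tau>_\<beta>[of j k] False k assms by (simp add: mult.assoc)
      finally show ?thesis using \<tau>_\<xi>[of j k] k assms by (simp add: mult.assoc)
    qed
    have 2: "ss (sm (\<tau> j k) h) = \<tau> j k * ss h" using \<tau>_\<xi>[of j k] k assms by (intro ss_sm) auto
    have "\<tau> j 0 * (c * \<beta> k * \<xi> * ss h) = c * \<beta> k * \<xi> * (\<tau> j k * ss h)"
      using 1 by (simp add: mult.assoc[symmetric])
    then show ?thesis using False k assms 1 2 \<tau>_\<xi>[of j k]
      by (simp add: T_W XX_W op_add sm_simps u0_simps)
  qed
qed (simp_all add: addmap_def op_add)

lemma G_XX: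
  assumes "w \<in> VV" "2 \<le> i" "i \<le> n"
  shows "G i (XX w) = XX (G i w)"
proof (rule VV_ext[where f = "\<lambda>w. G i (XX w)" and f' = "\<lambda>w. XX (G i w)", OF assms(1)])
  fix k h assume k: "k \<le> n" and h: "h \<in> VH"
  obtain l where l: "i = Suc l" "1 \<le> l" using assms by (cases i) auto
  have "k = 0 \<or> (1 \<le> k \<and> i < k) \<or> i = k \<or> (1 \<le> k \<and> k = l) \<or> (1 \<le> k \<and> k < l)" using l by linarith
  then consider "k = 0" | "1 \<le> k" "i < k" | "k = Suc l" | "1 \<le> k" "k = l" | "1 \<le> k" "k < l"
    using l by blast
  then show "G i (XX (W k h)) = XX (G i (W k h))"
  proof cases
    case 1
    then show ?thesis using assms by (simp add: G_W_far XX_W0 xx_simps)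
  next
    case 2
    have "g (i - 1) * (c * \<beta> k * \<xi>) = c * (g (i - 1) * \<beta> k) * \<xi>"
      by (simp add: mult_c[of "g (i - Suc 0)"] mult.assoc)
    also have "\<dots> = c * \<beta> k * \<xi> * g i"
      using g_\<beta>_less[of i k] gX[of i] assms k 2 by (simp add: mult.assoc)
    finally have 3: "g (i - 1) * (c * \<beta> k * \<xi>) = c * \<beta> k * \<xi> * g i" .
    have 4: "ss (sm (g i) h) = g i * ss h" using gX[of i] 2 k assms by (intro ss_sm) auto
    have "g (i - 1) * (c * \<beta> k * \<xi> * ss h) = c * \<beta> k * \<xi> * (g i * ss h)"
      using 3 by (simp add: mult.assoc[symmetric])
    then show ?thesis using 2 k assms 3 4 gX[of i]
      by (simp add: G_W_far G_W_less XX_W op_add op_diff sm_simps u0_simps W_simps)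
  next
    case 3
    have b: "g l * (c * \<beta> (Suc l) * \<xi>) = c * \<beta> l * \<xi> + c * \<beta> (Suc l) * \<xi> * (c * \<epsilon> (Suc l))"
    proof -
      have "g l * (c * \<beta> (Suc l) * \<xi>) = c * (g l * \<beta> (Suc l)) * \<xi>"
        by (simp add: mult_c[of "g l"] mult.assoc)
      also have "\<dots> = c * \<beta> l * \<xi> + c * \<beta> (Suc l) * (c * \<epsilon> (Suc l) * \<xi>)"
        using l assms by (simp add: g_\<beta>_eq distrib_left distrib_right mult_c[of "\<beta> (Suc l)"] mult.assoc)
      finally show ?thesis using c\<epsilon>_\<xi>[of "Suc l"] l assms by (simp add: mult.assoc)
    qed
    have s: "ss (sm (c * \<epsilon> (Suc l)) h) = c * \<epsilon> (Suc l) * ss h"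
      using c\<epsilon>_\<xi>[of "Suc l"] l assms by (intro ss_sm) auto
    have "g l * (c * \<beta> (Suc l) * \<xi> * ss h) = c * \<beta> l * \<xi> * ss h + c * \<beta> (Suc l) * \<xi> * (c * \<epsilon> (Suc l) * ss h)"
      using arg_cong[OF b, of "\<lambda>z. z * ss h"] by (simp add: mult.assoc distrib_right)
    then show ?thesis using 3 k assms l b s c\<epsilon>_\<xi>[of "Suc l"]
      by (simp add: G_W_far G_W_eq XX_W op_add op_diff sm_simps u0_simps W_simps)
  next
    case 4
    have b: "g l * (c * \<beta> l * \<xi>) = c * \<beta> (Suc l) * \<xi>"
      using assoc_subst[OF g_\<beta>_Suc[of l]] 4 l assms by (simp add: mult_c[of "g l"] mult.assoc)
    then have "g l * (c * \<beta> l * \<xi> * ss h) = c * \<beta> (Suc l) * \<xi> * ss h"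
      by (simp add: mult.assoc[symmetric])
    then show ?thesis using 4 k assms l b
      by (simp add: G_W_far G_W_Suc XX_W op_add op_diff sm_simps u0_simps W_simps)
  next
    case 5
    have b: "g l * (c * \<beta> k * \<xi>) = c * \<beta> k * \<xi> * g l"
      using assoc_subst[OF g_\<beta>_far[of k l]] gX[of l] 5 l assms by (simp add: mult_c[of "g l"] mult.assoc)
    have s: "ss (sm (g l) h) = g l * ss h" using gX[of l] 5 k assms l by (intro ss_sm) auto
    have "g l * (c * \<beta> k * \<xi> * ss h) = c * \<beta> k * \<xi> * (g l * ss h)"
      using b by (simp add: mult.assoc[symmetric])
    then show ?thesis using 5 k assms l b s gX[of l]
      by (simp add: G_W_far XX_W op_add op_diff sm_simps u0_simps W_simps)
  qed
qed (simp_all add: addmap_def op_add)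

text \<open>The braid relation between \<open>g\<^sub>1\<close> and \<open>X\<^sub>1\<close> says that \<open>XX\<close> commutes with \<open>YY\<close>.\<close>
definition YY :: "(nat \<Rightarrow> nat \<Rightarrow> 'a) \<Rightarrow> nat \<Rightarrow> nat \<Rightarrow> 'a" where "YY w = G 1 (XX (G 1 w))"

lemma YY_add: "YY (x + y) = YY x + YY y" "YY (x - y) = YY x - YY y"
  by (simp_all add: YY_def op_add op_diff)

lemma YY_closed: "1 \<le> n \<Longrightarrow> w \<in> VV \<Longrightarrow> YY w \<in> VV"
  unfolding YY_def by (intro G_closed XX_closed)

lemma G1_W0: "G 1 (W 0 h) = W 1 h" using G_W_Suc[of 0 h] by simp
lemma G1_W1: "1 \<le> n \<Longrightarrow> G 1 (W 1 h) = W 0 h + W 1 (sm (c * \<epsilon> 1) h)" using G_W_eq[of 0 h] by simp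
lemma XX_W1: "1 \<le> n \<Longrightarrow> XX (W 1 h) = W 1 (sm \<xi> h) + W 0 (u0 (c * \<epsilon> 1 * \<xi> * ss h) - sm (c * \<epsilon> 1 * \<xi>) h)"
  using XX_W[of 1 h] by (simp add: \<beta>_def)

lemma YY_W0: "1 \<le> n \<Longrightarrow> YY (W 0 h) = W 0 (sm \<xi> h) + W 1 (u0 (c * \<epsilon> 1 * \<xi> * ss h))"
  unfolding YY_def G1_W0 by (simp only: XX_W1 op_add G1_W1 G1_W0) (simp add: sm_simps W_simps)

lemma YY_W2:
  assumes n: "2 \<le> n"
  shows "YY (W 2 h) = W 2 (sm (g 1 * \<xi> * g 1) h)
    + W 1 (u0 (c * \<epsilon> 2 * g 1 * \<xi> * ss (sm (g 1) h)) - sm (c * \<epsilon> 2 * g 1 * \<xi> * g 1) h)"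
proof -
  have "G 1 (W 2 h') = W 2 (sm (g 1) h')" for h' using n by (simp add: G_W_less)
  moreover have "XX (W 2 h') = W 2 (sm \<xi> h') + W 0 (u0 (c * \<epsilon> 2 * g 1 * \<xi> * ss h') - sm (c * \<epsilon> 2 * g 1 * \<xi>) h')" for h'
    using XX_W[of 2 h'] n by (simp add: \<beta>_def numeral_2_eq_2 mult.assoc)
  ultimately show ?thesis unfolding YY_def by (simp only: op_add G1_W0 sm_simps mult.assoc)
qed

lemma XX_YY_0: "1 \<le> n \<Longrightarrow> XX (YY (W 0 h)) = YY (XX (W 0 h))"
  by (simp only: YY_W0 XX_W0 op_add XX_W1)
     (simp add: sm_simps ss_simps xx_simps ss_xx W_simps u0_simps, simp add: mult.assoc c\<epsilon>_\<xi> \<xi>_\<epsilon> mult_c[of \<xi>] assoc_subst[OF \<xi>_\<epsilon>])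

text \<open>The heart of the verification.  Both sides are computed block by block; with the abbreviations \<open>q\<close> and \<open>z\<close> for the
corrections that \<open>YY\<close> and \<open>XX\<close> make to lower blocks, the blocks \<open>2\<close>, \<open>1\<close> and \<open>0\<close> agree by the facts \<open>A\<close>, \<open>B\<close> and \<open>C\<close>.
Fact \<open>B\<close> is the identity \<open>ss_g\<close>, multiplied by \<open>c * \<epsilon> 2\<close>.\<close>
lemma XX_YY_2:
  assumes n: "2 \<le> n" and h: "h \<in> VH" shows "XX (YY (W 2 h)) = YY (XX (W 2 h))"
proof -
  define k2 where "k2 = c * \<epsilon> 2"
  define k1 where "k1 = c * \<epsilon> 1"
  define G1 where "G1 = g 1"
  have kx: "k2 * \<xi> = \<xi> * k2" "k1 * \<xi> = \<xi> * k1" using c\<epsilon>_\<xi> n by (simp_all add: k1_def k2_def)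
  note kx' = kx kx[THEN assoc_subst, unfolded mult.assoc]
  have k12: "k1 * k2 = k2 * (c * e 1)"
    using e_\<epsilon>[of 1] \<epsilon>_e[of 2 1] n by (simp add: k1_def k2_def numeral_2_eq_2 mult_c[of "\<epsilon> _"] mult.assoc)
  have kk: "k1 * (\<xi> * (k2 * z)) = k2 * (c * e 1 * (\<xi> * z))" for z
  proof -
    have "k1 * (\<xi> * (k2 * z)) = k1 * k2 * (\<xi> * z)" by (simp add: kx' mult.assoc)
    then show ?thesis by (simp add: k12 mult.assoc)
  qed
  have XW2: "XX (W 2 h') = W 2 (sm \<xi> h') + W 0 (u0 (k2 * G1 * \<xi> * ss h') - sm (k2 * G1 * \<xi>) h')" for h'
    using XX_W[of 2 h'] n by (simp add: \<beta>_def numeral_2_eq_2 mult.assoc k2_def G1_def)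
  have br: "\<xi> * (G1 * (\<xi> * G1)) = G1 * (\<xi> * (G1 * \<xi>))" using gXgX n by (simp add: G1_def mult.assoc)
  have k2y: "ss (sm (k2 * G1 * \<xi> * G1) h) = k2 * G1 * \<xi> * G1 * ss h" 
    by (rule ss_sm) (simp add: mult.assoc br[symmetric] kx')
  have yy: "ss (sm (G1 * \<xi> * G1) h) = G1 * \<xi> * G1 * ss h" 
    by (rule ss_sm) (simp add: mult.assoc br[symmetric])
  have k2g: "ss (sm (k2 * G1 * \<xi>) h) = k2 * ss (sm (G1 * \<xi>) h)"
    using ss_sm[OF kx(1), of "sm (G1 * \<xi>) h"] by (simp add: sm_simps mult.assoc)
  have w1: "\<xi> * (k2 * (G1 * (\<xi> * ss (sm G1 h)))) = k2 * (G1 * (\<xi> * ss (sm (G1 * \<xi>) h)))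
      + k1 * (\<xi> * (k2 * (G1 * (\<xi> * ss h)) - k2 * ss (sm (G1 * \<xi>) h)))"
  proof -
    from kk show ?thesis unfolding G1_def
      using arg_cong[OF ss_g[OF n h], of "\<lambda>z. k2 * z"] by (simp add: distrib_left right_diff_distrib kx')
  qed
  have w0: "k2 * (G1 * (\<xi> * (G1 * (\<xi> * G1)))) - k1 * (\<xi> * (k2 * (G1 * (\<xi> * G1)))) = \<xi> * (k2 * (G1 * \<xi>))"
  proof -
    have "k2 * (G1 * (\<xi> * (G1 * (\<xi> * G1)))) - k1 * (\<xi> * (k2 * (G1 * (\<xi> * G1))))
      = k2 * (gi 1 * (\<xi> * (G1 * (\<xi> * G1))))"
    proof -
      have "gi (Suc 0) = G1 - c * e (Suc 0)" by (simp add: gi_def G1_def)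
      then show ?thesis by (simp add: kk left_diff_distrib right_diff_distrib)
    qed
    also have "\<dots> = k2 * (gi 1 * G1 * (\<xi> * (G1 * \<xi>)))" by (simp add: br mult.assoc)
    also have "gi 1 * G1 = 1" using gi_g[of 1] n by (simp add: G1_def)
    finally show ?thesis by (simp add: kx')
  qed
  have w0': "k2 * (G1 * (\<xi> * (G1 * (\<xi> * (G1 * z))))) = k1 * (\<xi> * (k2 * (G1 * (\<xi> * (G1 * z))))) + \<xi> * (k2 * (G1 * (\<xi> * z)))" for z
    using arg_cong[OF w0, of "\<lambda>x. x * z"] by (simp add: left_diff_distrib mult.assoc diff_eq_eq add.commute)
  have n1: "1 \<le> n" using n by simp
  define q where "q = u0 (k2 * G1 * \<xi> * ss (sm G1 h)) - sm (k2 * G1 * \<xi> * G1) h"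
  define z where "z = u0 (k2 * G1 * \<xi> * ss h) - sm (k2 * G1 * \<xi>) h"
  have ss_q: "ss q = k2 * (G1 * (\<xi> * ss (sm G1 h))) - k2 * (G1 * (\<xi> * (G1 * ss h)))"
    using k2y by (simp add: q_def ss_simps mult.assoc)
  have ss_z: "ss z = k2 * (G1 * (\<xi> * ss h)) - k2 * ss (sm (G1 * \<xi>) h)"
    using k2g by (simp add: z_def ss_simps mult.assoc)
  have A: "sm \<xi> (sm (G1 * \<xi> * G1) h) = sm (G1 * \<xi> * G1) (sm \<xi> h)"
    using br by (simp add: sm_simps mult.assoc)
  have B: "sm \<xi> q = (u0 (k2 * G1 * \<xi> * ss (sm G1 (sm \<xi> h))) - sm (k2 * G1 * \<xi> * G1) (sm \<xi> h))
      + u0 (k1 * \<xi> * ss z)"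
  proof -
    have "\<xi> * (k2 * (G1 * (\<xi> * G1))) = k2 * (G1 * (\<xi> * (G1 * \<xi>)))"
      unfolding br[symmetric] using kx' by simp
    then show ?thesis using w1 unfolding ss_z by (simp add: q_def u0_simps sm_simps mult.assoc)
  qed
  have C: "(u0 (k2 * G1 * \<xi> * ss (sm (G1 * \<xi> * G1) h)) - sm (k2 * G1 * \<xi>) (sm (G1 * \<xi> * G1) h))
      + (u0 (k1 * \<xi> * ss q) - sm (k1 * \<xi>) q) = sm \<xi> z"
  proof -
    have "u0 (k2 * (G1 * (\<xi> * (G1 * (\<xi> * (G1 * ss h)))))) - sm (k2 * (G1 * (\<xi> * (G1 * (\<xi> * G1))))) h
      + (u0 (k1 * (\<xi> * ss q)) - sm (k1 * \<xi>) q) = sm \<xi> z"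
      unfolding w0' w0'[of 1, simplified] ss_q by (simp add: q_def z_def u0_simps sm_simps mult.assoc right_diff_distrib)
    then show ?thesis using yy by (simp add: sm_simps mult.assoc)
  qed
  have YW2: "YY (W 2 h') = W 2 (sm (G1 * \<xi> * G1) h')
    + W 1 (u0 (k2 * G1 * \<xi> * ss (sm G1 h')) - sm (k2 * G1 * \<xi> * G1) h')" for h'
    using YY_W2[OF n] by (simp add: k2_def G1_def)
  have X1: "XX (W 1 h') = W 1 (sm \<xi> h') + W 0 (u0 (k1 * \<xi> * ss h') - sm (k1 * \<xi>) h')" for h'
    using XX_W1[OF n1] by (simp add: k1_def)
  have Y0: "YY (W 0 h') = W 0 (sm \<xi> h') + W 1 (u0 (k1 * \<xi> * ss h'))" for h'
    using YY_W0[OF n1] by (simp add: k1_def)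
  have "XX (YY (W 2 h)) = W 2 (sm \<xi> (sm (G1 * \<xi> * G1) h)) + W 1 (sm \<xi> q)
     + W 0 ((u0 (k2 * G1 * \<xi> * ss (sm (G1 * \<xi> * G1) h)) - sm (k2 * G1 * \<xi>) (sm (G1 * \<xi> * G1) h))
      + (u0 (k1 * \<xi> * ss q) - sm (k1 * \<xi>) q))"
    unfolding YW2[of h] q_def[symmetric] op_add XW2 X1 by (simp only: W_simps add_ac)
  also have "\<dots> = YY (XX (W 2 h))"
    unfolding A B C XW2[of h] z_def[symmetric] YY_add YW2 Y0 by (simp only: W_simps add_ac)
  finally show ?thesis .
qed

lemma XX_YY_1:
  assumes n: "1 \<le> n" and h: "h \<in> VH"
  shows "XX (YY (W 1 h)) = YY (XX (W 1 h))"
proof -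
  define k where "k = c * \<epsilon> 1"
  have kx: "k * \<xi> = \<xi> * k" using c\<epsilon>_\<xi>[of 1] n by (simp add: k_def)
  note kx' = kx kx[THEN assoc_subst, unfolded mult.assoc]
  have ss_k: "ss (sm k h') = k * ss h'" "ss (sm \<xi> h') = \<xi> * ss h'"
    "ss (sm (\<xi> * k) h') = \<xi> * k * ss h'" for h'
    by (rule ss_sm; simp add: kx' mult.assoc)+
  have X1: "XX (W 1 h') = W 1 (sm \<xi> h') + W 0 (u0 (k * \<xi> * ss h') - sm (k * \<xi>) h')" for h'
    using XX_W1[OF n] by (simp add: k_def)
  have Y0: "YY (W 0 h') = W 0 (sm \<xi> h') + W 1 (u0 (k * \<xi> * ss h'))" for h'
    using YY_W0[OF n] by (simp add: k_def)
  have G1: "G 1 (W 1 h') = W 0 h' + W 1 (sm k h')" for h'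
    using G1_W1[OF n] by (simp add: k_def)
  have Y1: "YY (W 1 h') = W 1 (xx h') + W 0 (sm (\<xi> * k) h') + W 1 (u0 (k * \<xi> * k * ss h'))" for h'
    unfolding YY_def G1 op_add XX_W0 G1_W0 X1
    by (simp add: sm_simps ss_k W_simps kx' mult.assoc)
  show ?thesis
    unfolding Y1 X1 YY_add Y0 op_add XX_W0
    by (simp add: sm_simps ss_simps ss_k ss_xx xx_simps u0_simps W_simps kx' mult.assoc)
qed

text \<open>Blocks beyond the second are reached from block \<open>2\<close> by \<open>G 3\<close>, \<open>G 4\<close> and so on, and these commute with both \<open>XX\<close> and \<open>YY\<close>.\<close>
lemma XX_YY:
  assumes "w \<in> VV" and n: "1 \<le> n"
  shows "XX (YY w) = YY (XX w)"
proof (rule VV_ext[where f = "\<lambda>w. XX (YY w)" and f' = "\<lambda>w. YY (XX w)", OF assms(1)])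
  fix k h assume "k \<le> n" and h: "h \<in> VH"
  then show "XX (YY (W k h)) = YY (XX (W k h))"
  proof (induction k)
    case 0
    show ?case using XX_YY_0[OF n] by simp
  next
    case (Suc k)
    consider "k = 0" | "k = 1" | "2 \<le> k" by linarith
    then show ?case
    proof cases
      case 1 then show ?thesis using XX_YY_1[OF n h] by simp
    next
      case 2 then show ?thesis using XX_YY_2[of h] Suc.prems h by (simp add: numeral_2_eq_2)
    next
      case 3
      let ?w = "W k h"
      have w: "?w \<in> VV" using Suc.prems by (intro VV_closed) auto
      have W: "W (Suc k) h = G (Suc k) ?w" using Suc.prems by (simp add: G_W_Suc)
      have GG: "G (Suc k) (G 1 x) = G 1 (G (Suc k) x)" if "x \<in> VV" for x
        using G_far[OF that, of 1 "Suc k"] Suc.prems 3 by simp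
      have GX: "G (Suc k) (XX x) = XX (G (Suc k) x)" if "x \<in> VV" for x
        using G_XX[OF that, of "Suc k"] Suc.prems 3 by simp
      have GY: "G (Suc k) (YY x) = YY (G (Suc k) x)" if "x \<in> VV" for x
        unfolding YY_def using n GG[OF that] GX[OF G_closed[OF n that]] GG[OF XX_closed[OF G_closed[OF n that]]] by simp
      have "XX (YY (G (Suc k) ?w)) = G (Suc k) (XX (YY ?w))"
        using w n by (simp add: GX GY YY_closed)
      also have "\<dots> = G (Suc k) (YY (XX ?w))" using Suc by simp
      also have "\<dots> = YY (XX (G (Suc k) ?w))" using w n by (simp add: GX GY XX_closed)
      finally show ?thesis by (simp add: W)
    qed
  qed
qed (simp_all add: addmap_def op_add YY_add)

lemma xi_braid:
  assumes "w \<in> VV" "1 \<le> n"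
  shows "G 1 (XX (G 1 (XX w))) = XX (G 1 (XX (G 1 w)))"
  using XX_YY[OF assms] by (simp add: YY_def)

text \<open>The action of \<open>(X\<^sub>1 - v\<^sub>1) \<dots> (X\<^sub>1 - v\<^sub>m)\<close>.\<close>
primrec PX :: "nat \<Rightarrow> (nat \<Rightarrow> nat \<Rightarrow> 'a) \<Rightarrow> nat \<Rightarrow> nat \<Rightarrow> 'a" where
  "PX 0 w = w"
| "PX (Suc m) w = PX m (XX w - S (v (Suc m)) w)"

lemma PX_add: "PX m (x + y) = PX m x + PX m y"
proof (induction m arbitrary: x y)
  case (Suc m)
  have "XX (x + y) - S (v (Suc m)) (x + y) = (XX x - S (v (Suc m)) x) + (XX y - S (v (Suc m)) y)"
    by (simp add: op_add)
  then show ?case by (simp only: PX.simps Suc)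
qed simp

lemma PX_addmap: "addmap (PX m)" by (simp add: addmap_def PX_add)

lemma S_W': "S y w k = sm y (w k)" by (simp add: S_def)

lemma FG_S: "(\<And>z. y * z = z * y) \<Longrightarrow> FG i k (sm y h) = S y (FG i k h)"
  and FX_S: "(\<And>z. y * z = z * y) \<Longrightarrow> FX k (sm y h) = S y (FX k h)"
  and FT_S: "(\<And>z. y * z = z * y) \<Longrightarrow> FT i k (sm y h) = S y (FT i k h)"
  and FXi_S: "(\<And>z. y * z = z * y) \<Longrightarrow> FXi k (sm y h) = S y (FXi k h)"
proof -
  assume y: "\<And>z. y * z = z * y"
  then have yz: "z * (y * z') = y * (z * z')" for z z' by (metis mult.assoc)
  have s: "ss (sm y h) = y * ss h" by (rule ss_sm) (rule y)
  have sy: "sm x (sm y h) = sm y (sm x h)" for x by (simp add: sm_simps y)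
  show "FG i k (sm y h) = S y (FG i k h)"
    by (simp only: FG_def op_add S_W sy if_distrib[of "S y"])
  show "FT i k (sm y h) = S y (FT i k h)"
    by (simp only: FT_def op_add S_W sy)
  have u: "u0 (x * (y * z)) = sm y (u0 (x * z))" for x z by (simp add: u0_simps yz)
  show "FX k (sm y h) = S y (FX k h)"
    by (simp only: FX_def s u op_add S_W sy xx_simps sm_simps(2)[symmetric] if_distrib[of "S y"])
  show "FXi k (sm y h) = S y (FXi k h)"
    by (simp only: FXi_def s u op_diff S_W sy sm_simps(2)[symmetric] xxi_sm[OF y] if_distrib[of "S y"])
qed

lemma lift_S: "(\<And>k h. F k (sm y h) = S y (F k h)) \<Longrightarrow> lift F (S y w) = S y (lift F w)"
  unfolding lift_def S_W' addmap_sum[OF addmaps(5)] by simp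

lemma ops_S:
  assumes y: "\<And>z. y * z = z * y"
  shows "T j (S y w) = S y (T j w)" "G i (S y w) = S y (G i w)" "XX (S y w) = S y (XX w)" "XI (S y w) = S y (XI w)"
  unfolding T_def G_def XX_def XI_def
  by (intro lift_S FT_S[OF y] FG_S[OF y] FX_S[OF y] FXi_S[OF y])+

lemma PX_comm:
  assumes "addmap f" "\<And>w. w \<in> VV \<Longrightarrow> f (XX w) = XX (f w)" "\<And>i w. w \<in> VV \<Longrightarrow> f (S (v i) w) = S (v i) (f w)"
    and "w \<in> VV"
  shows "f (PX m w) = PX m (f w)"
  using assms(4)
proof (induction m arbitrary: w)
  case (Suc m)
  have "XX w - S (v (Suc m)) w \<in> VV" using Suc.prems by (intro VV_closed XX_closed S_closed)
  from Suc.IH[OF this] show ?case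
    using Suc.prems by (simp only: PX.simps addmap_diff[OF assms(1)] assms(2,3))
qed simp

lemma XX_PX: "w \<in> VV \<Longrightarrow> PX m (XX w) = XX (PX m w)"
  by (rule PX_comm[symmetric]) (simp_all add: addmaps ops_S[OF v_central])

lemma S_S: "S x (S y w) = S (x * y) w" by (simp add: S_def sm_simps)

lemma PX_Suc: assumes "w \<in> VV" shows "PX (Suc m) w = XX (PX m w) - S (v (Suc m)) (PX m w)"
proof -
  have "S (v (Suc m)) (PX m w) = PX m (S (v (Suc m)) w)"
    by (rule PX_comm) (simp_all add: addmaps assms ops_S[OF v_central], simp only: S_S v_central[of _ "v _"])
  then show ?thesis using XX_PX[OF assms] by (simp add: addmap_diff[OF PX_addmap])
qed

lemma PX_W0_bas: "a < d \<Longrightarrow> PX a (W 0 (u0 y)) = W 0 (bas a y)"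
proof (induction a)
  case (Suc a)
  have "W 0 (u0 y) \<in> VV" by (intro VV_closed VH_closed) auto
  then have "PX (Suc a) (W 0 (u0 y)) = XX (W 0 (bas a y)) - S (v (Suc a)) (W 0 (bas a y))"
    using Suc by (simp only: PX_Suc)
  also have "\<dots> = W 0 (xx (bas a y) - sm (v (Suc a)) (bas a y))" by (simp add: XX_W0 S_W W_simps)
  also have "xx (bas a y) - sm (v (Suc a)) (bas a y) = bas (Suc a) y"
    using Suc.prems by (auto simp: xx_def bas_def sm_def fun_eq_iff)
  finally show ?case .
qed (simp add: bas_0)

text \<open>On the first entry of block \<open>0\<close> this holds by construction of \<open>xx\<close>, which was defined modulo \<open>p d\<close>; the other
entries follow since \<open>XX\<close> commutes with its own polynomials.\<close>
lemma PX_d_W0: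
  assumes "h \<in> VH" shows "PX d (W 0 h) = 0"
  using assms
proof (induction h rule: VH_induct_xx)
  case (u0 y)
  obtain m where m: "d = Suc m" using d_pos by (cases d) auto
  then have md: "m < d" by simp
  have "W 0 (u0 y) \<in> VV" by (intro VV_closed VH_closed) auto
  from PX_Suc[OF this, of m]
  have "PX d (W 0 (u0 y)) = XX (W 0 (bas m y)) - S (v d) (W 0 (bas m y))"
    unfolding PX_W0_bas[OF md] m[symmetric] .
  also have "\<dots> = W 0 (xx (bas m y) - sm (v d) (bas m y))" by (simp add: XX_W0 S_W W_simps)
  also have "xx (bas m y) - sm (v d) (bas m y) = 0"
  proof -
    have vd: "v (Suc m) = v d" by (simp only: m)
    have "(xx (bas m y) - sm (v d) (bas m y)) b = 0" for b
    proof (cases "b = m")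
      case True
      then show ?thesis using md vd by (cases m) (simp_all add: xx_def bas_def sm_def)
    next
      case False
      then have "b < d \<Longrightarrow> b \<noteq> 0 \<Longrightarrow> b - 1 \<noteq> m" using m by linarith
      then show ?thesis using False by (simp add: xx_def bas_def sm_def)
    qed
    then show ?thesis by (simp add: fun_eq_iff)
  qed
  finally show ?case by (simp only: W_simps)
next
  case (xx h)
  have "W 0 h \<in> VV" using xx by (intro VV_closed) auto
  then have "PX d (XX (W 0 h)) = XX (PX d (W 0 h))" by (rule XX_PX)
  then show ?case using xx by (simp only: XX_W0 op_0)
next
  case (diff h h')
  then show ?case by (simp only: W_simps addmap_diff[OF PX_addmap]) simp
qed

lemma PX_W_u0: "\<lbrakk>1 \<le> k; k \<le> n\<rbrakk> \<Longrightarrow> PX m (W k (u0 y)) = W k (u0 (p m * y))"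
proof (induction m arbitrary: y)
  case (Suc m)
  have "XX (W k (u0 y)) - S (v (Suc m)) (W k (u0 y)) = W k (u0 ((\<xi> - v (Suc m)) * y))"
    using Suc.prems by (simp add: XX_W S_W ss_simps u0_simps W_simps sm_simps left_diff_distrib)
  then show ?case using Suc by (simp add: mult.assoc)
qed simp

text \<open>The first entry is killed by \<open>p d = 0\<close> at level \<open>n\<close>.  For the induction step write \<open>W 1 (xx h)\<close> as
\<open>YY (W 1 h)\<close> minus a term that the previous cases cover; \<open>YY\<close> commutes with \<open>XX\<close>, hence with \<open>PX d\<close>, and the induction
hypothesis applies.\<close>
lemma PX_d_W1:
  assumes "h \<in> VH" and n: "1 \<le> n" shows "PX d (W 1 h) = 0"
  using assms(1)
proof (induction h rule: VH_induct_xx)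
  case (u0 y)
  then show ?case using PX_W_u0[of 1 d y] n by (simp add: p_d u0_simps W_simps del: zero_fun_apply)
next
  case (xx h)
  have 0: "W 0 h \<in> VV" "W 1 h \<in> VV" using xx n by (intro VV_closed; simp)+
  let ?k = "c * \<epsilon> 1"
  have "W 1 (xx h) = G 1 (XX (W 0 h))" by (simp only: XX_W0 G1_W0)
  also have "W 0 h = G 1 (W 1 h) - W 1 (sm ?k h)" using G1_W1[OF n, of h] by simp
  finally have 1: "W 1 (xx h) = YY (W 1 h) - G 1 (XX (W 1 (sm ?k h)))" by (simp only: op_diff YY_def)
  have "PX d (YY (W 1 h)) = YY (PX d (W 1 h))"
  proof (rule PX_comm[symmetric])
    show "addmap YY" by (simp add: addmap_def YY_add)
    show "YY (S (v i) w) = S (v i) (YY w)" for i w by (simp add: YY_def ops_S[OF v_central])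
  qed (use 0 n XX_YY in simp_all)
  then have 2: "PX d (YY (W 1 h)) = 0" using xx by (simp add: YY_def op_0 del: zero_fun_apply)
  have "G 1 (XX (W 1 h')) = W 0 (sm \<xi> h') + W 1 (u0 (?k * \<xi> * ss h'))" for h'
    unfolding XX_W1[OF n] op_add G1_W0 G1_W1[OF n] by (simp add: sm_simps W_simps)
  then have 3: "PX d (G 1 (XX (W 1 h'))) = 0" if "h' \<in> VH" for h'
    using PX_d_W0[of "sm \<xi> h'"] that VH_closed PX_W_u0[of 1 d] n
    by (simp add: PX_add p_d u0_simps W_simps del: zero_fun_apply)
  show ?case unfolding 1 addmap_diff[OF PX_addmap] using 2 3[of "sm ?k h"] xx VH_closed by simp
next
  case (diff h h')
  then show ?case by (simp only: W_simps addmap_diff[OF PX_addmap]) simp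
qed

lemma PX_d:
  assumes "w \<in> VV" shows "PX d w = 0"
proof (rule VV_ext[where f = "PX d" and f' = "\<lambda>_. 0", OF assms(1)])
  fix k h assume "k \<le> n" and h: "h \<in> VH"
  then show "PX d (W k h) = 0"
  proof (induction k)
    case 0 then show ?case by (simp add: PX_d_W0)
  next
    case (Suc k)
    show ?case
    proof (cases "k = 0")
      case True then show ?thesis using PX_d_W1 Suc.prems by simp
    next
      case False
      have w: "W k h \<in> VV" using Suc.prems by (intro VV_closed) auto
      have "PX d (G (Suc k) (W k h)) = G (Suc k) (PX d (W k h))"
        by (rule PX_comm[symmetric]) (use w False Suc.prems in \<open>simp_all add: addmaps G_XX ops_S[OF v_central]\<close>)
      then show ?thesis using Suc by (simp add: G_W_Suc op_0 del: zero_fun_apply)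
    qed
  qed
qed (simp_all add: addmap_def PX_add)

end

section \<open>Multiplying basis elements by generators\<close>

context yokonuma_eigen
begin

text \<open>\<open>L k = g\<^sub>k \<dots> g\<^sub>1\<close> and \<open>J k = g\<^sub>1\<^sup>-\<^sup>1 \<dots> g\<^sub>k\<^sup>-\<^sup>1\<close>; \<open>Y k\<close> is the Jucys--Murphy element for \<open>k \<ge> 1\<close>, with a default value at \<open>0\<close>.
The elements \<open>w m k a\<close> are the basis of level \<open>m + 1\<close> over level \<open>m\<close>, for the eigenvalue \<open>\<omega>\<close> of \<open>t\<^sub>1\<close>.\<close>
primrec L :: "nat \<Rightarrow> 'a" where "L 0 = 1" | "L (Suc k) = g (Suc k) * L k"
primrec J :: "nat \<Rightarrow> 'a" where "J 0 = 1" | "J (Suc k) = J k * gi (Suc k)"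
primrec Y :: "nat \<Rightarrow> 'a" where "Y 0 = \<xi>" | "Y (Suc k) = (if k = 0 then \<xi> else g k * Y k * g k)"

definition w :: "nat \<Rightarrow> nat \<Rightarrow> nat \<Rightarrow> 'a" where "w m k a = L k * (p a * (\<epsilon> 1 * J m))"

lemma g_L_less: "\<lbrakk>1 \<le> i; i < k; k < n\<rbrakk> \<Longrightarrow> g i * L k = L k * g (Suc i)"
proof (induction k)
  case (Suc k)
  show ?case
  proof (cases "i = k")
    case False
    then have "g i * L (Suc k) = g (Suc k) * (g i * L k)"
      using gg_far[of i "Suc k"] Suc.prems by (simp add: mult.assoc[symmetric])
    then show ?thesis using Suc False by (simp add: mult.assoc)
  next
    case True
    obtain j where j: "k = Suc j" using True Suc.prems by (cases k) auto
    have c: "g (Suc (Suc j)) * L j = L j * g (Suc (Suc j))"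
    proof -
      have "g (Suc (Suc j)) * L l = L l * g (Suc (Suc j))" if "l \<le> j" for l
        using that
      proof (induction l)
        case (Suc l)
        then show ?case using \<open>Suc k < n\<close> j by (auto intro!: commute_mult gg_far)
      qed simp
      then show ?thesis by simp
    qed
    have "g i * L (Suc k) = g (Suc j) * g (Suc (Suc j)) * g (Suc j) * L j"
      using True j by (simp add: mult.assoc)
    also have "\<dots> = g (Suc (Suc j)) * g (Suc j) * (g (Suc (Suc j)) * L j)"
      using braid[of "Suc j"] j Suc.prems by (simp add: mult.assoc[symmetric])
    finally show ?thesis using True j c by (simp add: mult.assoc)
  qed
qed simp

lemma g_L_far: "\<lbrakk>Suc k < i; i < n\<rbrakk> \<Longrightarrow> g i * L k = L k * g i"
proof (induction k)
  case (Suc k)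
  then show ?case by (auto intro!: commute_mult gg_far)
qed simp

lemma t_L_less: "\<lbrakk>1 \<le> j; j \<le> k; k < n\<rbrakk> \<Longrightarrow> t j * L k = L k * t (Suc j)"
  and t_L_eq: "k < n \<Longrightarrow> t (Suc k) * L k = L k * t 1"
  and t_L_far: "\<lbrakk>Suc k < j; j \<le> n; k < n\<rbrakk> \<Longrightarrow> t j * L k = L k * t j"
proof -
  show far: "t j * L k = L k * t j" if "Suc k < j" "j \<le> n" "k < n" for k j
    using that
  proof (induction k)
    case (Suc k)
    then show ?case by (auto intro!: commute_mult gt_other[symmetric])
  qed simp
  show "t (Suc k) * L k = L k * t 1" if "k < n" for k
    using that
  proof (induction k)
    case (Suc k)
    then show ?case using assoc_subst[OF gt_left[of "Suc k", symmetric]] by (simp add: mult.assoc)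
  qed simp
  show "t j * L k = L k * t (Suc j)" if "1 \<le> j" "j \<le> k" "k < n" for j k
    using that
  proof (induction k)
    case (Suc k)
    show ?case
    proof (cases "j = Suc k")
      case True
      then have "t j * L (Suc k) = g (Suc k) * (t (Suc (Suc k)) * L k)"
        using gt_right[of "Suc k"] Suc.prems by (simp add: mult.assoc[symmetric])
      then show ?thesis using far[of k "Suc (Suc k)"] Suc.prems True by (simp add: mult.assoc)
    next
      case False
      then have "t j * L (Suc k) = g (Suc k) * (t j * L k)"
        using gt_other[of "Suc k" j] Suc.prems by (simp add: mult.assoc[symmetric])
      then show ?thesis using Suc False by (simp add: mult.assoc)
    qed
  qed simp
qed

lemma gi_comm: "\<lbrakk>1 \<le> i; i < n; g i * y = y * g i\<rbrakk> \<Longrightarrow> gi i * y = y * gi i"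
proof -
  assume i: "1 \<le> i" "i < n" and c: "g i * y = y * g i"
  have "gi i * (g i * y) * gi i = gi i * (y * g i) * gi i" using c by simp
  then show ?thesis using i by (simp add: mult.assoc g_gi assoc_subst[OF gi_g[OF i]])
qed

lemma gi_conj: "\<lbrakk>1 \<le> i; i < n; g i * y' = y * g i\<rbrakk> \<Longrightarrow> y' * gi i = gi i * y"
proof -
  assume i: "1 \<le> i" "i < n" and c: "g i * y' = y * g i"
  have "gi i * (g i * y') * gi i = gi i * (y * g i) * gi i" using c by simp
  then show ?thesis using i by (simp add: mult.assoc g_gi assoc_subst[OF gi_g[OF i]])
qed

lemma gi_g_far: "\<lbrakk>1 \<le> i; i < n; 1 \<le> j; j < n; i + 2 \<le> j \<or> j + 2 \<le> i\<rbrakk> \<Longrightarrow> g i * gi j = gi j * g i"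
  by (rule gi_comm[symmetric]) (auto intro: gg_far)

lemma gi_braid: "\<lbrakk>1 \<le> i; Suc i < n\<rbrakk> \<Longrightarrow> g (Suc i) * (gi i * gi (Suc i)) = gi i * (gi (Suc i) * g i)"
proof -
  assume i: "1 \<le> i" "Suc i < n"
  have "g i * (g (Suc i) * g i) = g (Suc i) * (g i * g (Suc i))"
    using braid[of i] i by (simp add: mult.assoc)
  then have *: "g (Suc i) * (g i * (g (Suc i) * z)) = g i * (g (Suc i) * (g i * z))" for z
    by (metis mult.assoc)
  have "g (Suc i) * (g i * (g (Suc i) * (gi i * gi (Suc i)))) = g i"
    unfolding * using i by (simp add: assoc_subst[OF g_gi] g_gi)
  then have "gi i * (gi (Suc i) * (g (Suc i) * (g i * (g (Suc i) * (gi i * gi (Suc i)))))) = gi i * (gi (Suc i) * g i)"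
    by simp
  then show ?thesis using i by (simp add: assoc_subst[OF gi_g])
qed

lemma g_J_low: "\<lbrakk>1 \<le> i; i < m; m < n\<rbrakk> \<Longrightarrow> g (Suc i) * J m = J m * g i"
proof (induction m)
  case (Suc m)
  show ?case
  proof (cases "i = m")
    case False
    then have "g (Suc i) * J (Suc m) = J m * (g i * gi (Suc m))" using Suc by (simp add: mult.assoc[symmetric])
    also have "g i * gi (Suc m) = gi (Suc m) * g i" using Suc.prems False by (intro gi_g_far) auto
    finally show ?thesis by (simp add: mult.assoc)
  next
    case True
    then obtain l where l: "m = Suc l" using Suc.prems by (cases m) auto
    have c: "g (Suc (Suc l)) * J l' = J l' * g (Suc (Suc l))" if "l' \<le> l" for l'
      using that
    proof (induction l')
      case (Suc l')
      then show ?case using \<open>Suc m < n\<close> l by (auto intro!: commute_mult gi_g_far)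
    qed simp
    have "g (Suc i) * J (Suc m) = J l * (g (Suc (Suc l)) * (gi (Suc l) * gi (Suc (Suc l))))"
      using True l by (simp add: mult.assoc assoc_subst[OF c[of l, simplified]])
    then show ?thesis using gi_braid[of "Suc l"] True l Suc.prems by (simp add: mult.assoc)
  qed
qed simp

lemma t_J: "\<lbrakk>1 \<le> j; j \<le> m; m < n\<rbrakk> \<Longrightarrow> t (Suc j) * J m = J m * t j"
  and t_J_1: "m < n \<Longrightarrow> t 1 * J m = J m * t (Suc m)"
  and t_J_far: "\<lbrakk>Suc m < j; j \<le> n\<rbrakk> \<Longrightarrow> t j * J m = J m * t j"
proof -
  show far: "t j * J m = J m * t j" if "Suc m < j" "j \<le> n" for j m
    using that
  proof (induction m)
    case (Suc m)
    then show ?case by (auto intro!: commute_mult gi_comm[symmetric] gt_other)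
  qed simp
  show "t 1 * J m = J m * t (Suc m)" if "m < n" for m
    using that
  proof (induction m)
    case (Suc m)
    then have "t 1 * J (Suc m) = J m * (t (Suc m) * gi (Suc m))" by (simp add: mult.assoc[symmetric])
    also have "t (Suc m) * gi (Suc m) = gi (Suc m) * t (Suc (Suc m))"
      using Suc.prems by (intro gi_conj gt_left) auto
    finally show ?case by (simp add: mult.assoc)
  qed simp
  show "t (Suc j) * J m = J m * t j" if "1 \<le> j" "j \<le> m" "m < n" for j m
    using that
  proof (induction m)
    case (Suc m)
    show ?case
    proof (cases "j = Suc m")
      case False
      then have "t (Suc j) * J (Suc m) = J m * (t j * gi (Suc m))" using Suc by (simp add: mult.assoc[symmetric])
      also have "t j * gi (Suc m) = gi (Suc m) * t j" using Suc.prems False by (intro gi_comm[symmetric] gt_other) auto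
      finally show ?thesis by (simp add: mult.assoc)
    next
      case True
      then have "t (Suc j) * J (Suc m) = J m * (t (Suc (Suc m)) * gi (Suc m))"
        using far[of m "Suc (Suc m)"] Suc.prems by (simp add: mult.assoc[symmetric])
      also have "t (Suc (Suc m)) * gi (Suc m) = gi (Suc m) * t (Suc m)"
        using Suc.prems by (intro gi_conj gt_right) auto
      finally show ?thesis using True by (simp add: mult.assoc)
    qed
  qed simp
qed

lemma \<epsilon>_J: "\<lbrakk>1 \<le> j; j \<le> m; m < n\<rbrakk> \<Longrightarrow> \<epsilon> (Suc j) * J m = J m * \<epsilon> j"
  and \<epsilon>_J_1: "m < n \<Longrightarrow> \<epsilon> 1 * J m = J m * \<epsilon> (Suc m)"
  unfolding \<epsilon>_def using \<omega>_central
  by (intro avg_conj[symmetric]; simp add: t_J t_J_1[simplified])+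

lemma t_p: "\<lbrakk>1 \<le> j; j \<le> n\<rbrakk> \<Longrightarrow> t j * p a = p a * t j"
  by (rule p_comm) (rule tX)

lemma g_p: "\<lbrakk>2 \<le> i; i < n\<rbrakk> \<Longrightarrow> g i * p a = p a * g i"
  by (rule p_comm) (rule gX)

lemma t_w:
  assumes "1 \<le> j" "j \<le> Suc m" "k \<le> m" "m < n"
  shows "t j * w m k a = w m k a * \<tau> j k"
proof -
  consider "j \<le> k" | "j = Suc k" | "Suc k < j" by linarith
  then show ?thesis
  proof cases
    case 1
    then have "t j * w m k a = L k * (t (Suc j) * (p a * (\<epsilon> 1 * J m)))"
      using assms by (simp add: w_def t_L_less mult.assoc[symmetric])
    also have "\<dots> = L k * (p a * (\<epsilon> 1 * (t (Suc j) * J m)))"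
      using assms 1 by (simp add: assoc_subst[OF t_p] assoc_subst[OF t_\<epsilon>_comm] mult.assoc)
    finally show ?thesis using t_J[of j m] assms 1 by (simp add: w_def \<tau>_def mult.assoc)
  next
    case 2
    then have "t j * w m k a = L k * (t 1 * (p a * (\<epsilon> 1 * J m)))"
      using assms by (simp add: w_def t_L_eq[simplified] mult.assoc[symmetric])
    also have "\<dots> = L k * (p a * (\<epsilon> 1 * J m * \<omega>))"
      using assms 2 assoc_subst[OF t_p[of 1], of a] assoc_subst[OF t_\<epsilon>[of 1], of "J m"] \<omega>_central[of "\<epsilon> 1 * J m"]
      by (simp add: mult.assoc)
    finally show ?thesis using 2 by (simp add: w_def \<tau>_def mult.assoc)
  next
    case 3
    then obtain j' where j: "j = Suc j'" "1 \<le> j'" by (cases j) auto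
    have "t j * w m k a = L k * (t j * (p a * (\<epsilon> 1 * J m)))"
      using assms 3 by (simp add: w_def t_L_far mult.assoc[symmetric])
    also have "\<dots> = L k * (p a * (\<epsilon> 1 * (t j * J m)))"
      using assms 3 by (simp add: assoc_subst[OF t_p] assoc_subst[OF t_\<epsilon>_comm] mult.assoc)
    finally show ?thesis using t_J[of j' m] assms 3 j by (simp add: w_def \<tau>_def mult.assoc)
  qed
qed

lemma g_w_less: "\<lbrakk>1 \<le> i; i < k; k \<le> m; m < n\<rbrakk> \<Longrightarrow> g i * w m k a = w m k a * g i"
proof -
  assume i: "1 \<le> i" "i < k" "k \<le> m" "m < n"
  have "g i * w m k a = L k * (g (Suc i) * (p a * (\<epsilon> 1 * J m)))"
    using i by (simp add: w_def g_L_less mult.assoc[symmetric])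
  also have "\<dots> = L k * (p a * (\<epsilon> 1 * (g (Suc i) * J m)))"
    using i by (simp add: assoc_subst[OF g_p] assoc_subst[OF g_\<epsilon>_other] mult.assoc)
  finally show ?thesis using g_J_low[of i m] i by (simp add: w_def mult.assoc)
qed

lemma g_w_far: "\<lbrakk>Suc k < i; i \<le> m; m < n\<rbrakk> \<Longrightarrow> g i * w m k a = w m k a * g (i - 1)"
proof -
  assume i: "Suc k < i" "i \<le> m" "m < n"
  then obtain j where j: "i = Suc j" by (cases i) auto
  have "g i * w m k a = L k * (g i * (p a * (\<epsilon> 1 * J m)))"
    using i by (simp add: w_def g_L_far mult.assoc[symmetric])
  also have "\<dots> = L k * (p a * (\<epsilon> 1 * (g i * J m)))"
    using i by (simp add: assoc_subst[OF g_p] assoc_subst[OF g_\<epsilon>_other] mult.assoc)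
  finally show ?thesis using g_J_low[of j m] i j by (simp add: w_def mult.assoc)
qed

lemma g_w_Suc: "g (Suc k) * w m k a = w m (Suc k) a"
  by (simp add: w_def mult.assoc)

text \<open>The quadratic relation produces \<open>e (k + 1)\<close> on the left of \<open>w\<close>.  It compares \<open>t (k + 1)\<close> with \<open>t (k + 2)\<close>, and on \<open>w m (k + 1) a\<close> these
act by right multiplication with \<open>t (k + 1)\<close> and \<open>\<omega>\<close>; so \<open>e (k + 1)\<close> turns into \<open>\<epsilon> (k + 1)\<close> on the right.\<close>
lemma g_w_eq:
  assumes "Suc k \<le> m" "m < n"
  shows "g (Suc k) * w m (Suc k) a = w m k a + w m (Suc k) a * (c * \<epsilon> (Suc k))"
proof -
  have "e (Suc k) * w m (Suc k) a = w m (Suc k) a * \<epsilon> (Suc k)"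
    unfolding e_def
    using avg_conj[of "w m (Suc k) a" "t (Suc k)" "t (Suc k)" \<omega> "t (Suc (Suc k))"]
      t_w[of "Suc k" m "Suc k" a] t_w[of "Suc (Suc k)" m "Suc k" a] assms
    by (simp add: \<tau>_def \<epsilon>_def)
  then have "c * (e (Suc k) * w m (Suc k) a) = w m (Suc k) a * (c * \<epsilon> (Suc k))"
    by (simp add: mult_c[of "w m (Suc k) a"])
  moreover have "g (Suc k) * w m (Suc k) a = w m k a + c * (e (Suc k) * w m (Suc k) a)"
    unfolding g_w_Suc[symmetric] using g_sq[of "Suc k"] assms
    by (simp add: mult.assoc[symmetric] distrib_right) 
  ultimately show ?thesis by simp
qed

lemma \<xi>_w_0: "\<xi> * w m 0 a = w m 0 (Suc a) + v (Suc a) * w m 0 a"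
proof -
  have "\<xi> * p a = p (Suc a) + v (Suc a) * p a"
    using p_comm[of \<xi> a] v_central by (simp add: algebra_simps)
  then show ?thesis by (simp add: w_def distrib_right mult.assoc[symmetric])
qed

text \<open>Isolates the factor of \<open>J m\<close> that does not commute with \<open>\<xi>\<close>, so that \<open>X_gpg\<close> can be applied to it.\<close>
lemma J_tail:
  assumes "1 \<le> m" "m < n"
  shows "\<exists>J'. J m = gi 1 * J' \<and> \<xi> * J' = J' * \<xi> \<and> t 1 * J' = J' * t 1"
  using assms
proof (induction m)
  case (Suc m)
  show ?case
  proof (cases "m = 0")
    case True then show ?thesis by (intro exI[of _ 1]) simp
  next
    case False
    then obtain J' where J': "J m = gi 1 * J'" "\<xi> * J' = J' * \<xi>" "t 1 * J' = J' * t 1" using Suc by auto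
    have "\<xi> * gi (Suc m) = gi (Suc m) * \<xi>" using Suc.prems False by (intro gi_comm[symmetric] gX) auto
    moreover have "t 1 * gi (Suc m) = gi (Suc m) * t 1"
      using Suc.prems False by (intro gi_comm[symmetric] gt_other) auto
    ultimately show ?thesis using J'(1) commute_mult[OF J'(2)] commute_mult[OF J'(3)]
      by (intro exI[of _ "J' * gi (Suc m)"]) (simp add: mult.assoc)
  qed
qed simp

text \<open>Since \<open>\<xi>\<close> commutes with \<open>g (k + 1)\<close> for \<open>k \<ge> 1\<close>, only \<open>k = 1\<close> needs work.  There
\<open>w m 1 a = g\<^sub>1 p\<^sub>a g\<^sub>1\<^sup>-\<^sup>1 \<epsilon>\<^sub>2 J'\<close> with \<open>J'\<close> as in \<open>J_tail\<close>, and \<open>X_gpg\<close> applies; the correction is brought into the stated form by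
\<open>e\<^sub>1 \<epsilon>\<^sub>2 = \<epsilon>\<^sub>1 \<epsilon>\<^sub>2\<close>.\<close>
lemma \<xi>_w:
  assumes "1 \<le> k" "k \<le> m" "m < n"
  shows "\<xi> * w m k a = w m k a * \<xi> + (w m 0 0 * (c * (\<beta> k * (\<xi> * p a))) - w m 0 a * (c * (\<beta> k * \<xi>)))"
  using assms
proof (induction k)
  case (Suc k)
  show ?case
  proof (cases "k = 0")
    case False
    have gw: "g (Suc k) * (w m 0 b * z) = w m 0 b * (g k * z)" for b z
      using assoc_subst[OF g_w_far[of 0 "Suc k" m b]] False Suc.prems by (simp add: mult.assoc)
    have "\<xi> * w m (Suc k) a = g (Suc k) * (\<xi> * w m k a)"
      unfolding g_w_Suc[symmetric] using gX[of "Suc k"] False Suc.prems by (simp add: mult.assoc[symmetric])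
    also have "\<dots> = w m (Suc k) a * \<xi> + (g (Suc k) * (w m 0 0 * (c * (\<beta> k * (\<xi> * p a)))) - g (Suc k) * (w m 0 a * (c * (\<beta> k * \<xi>))))"
      using Suc False by (simp add: distrib_left right_diff_distrib assoc_subst[OF g_w_Suc])
    finally show ?thesis using False Suc.prems assoc_subst[OF g_\<beta>_Suc[of k]] gw
      by (simp add: mult.assoc mult_c[of "g k"])
  next
    case True
    have n: "2 \<le> n" "1 < n" using Suc.prems by auto
    obtain J' where J': "J m = gi 1 * J'" "\<xi> * J' = J' * \<xi>" "t 1 * J' = J' * t 1"
      using J_tail[of m] Suc.prems by auto
    define G where "G = g 1"
    define G' where "G' = gi 1"
    define k where "k = c * e 1"
    define E where "E = \<epsilon> 1"
    define F where "F = \<epsilon> 2"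
    define P where "P = p a"
    define Q where "Q = F * J' * (c * E)"
    have EJ: "E * J' = J' * E"
      unfolding E_def \<epsilon>_def by (rule avg_conj[symmetric]) (simp_all add: J'(3)[simplified] \<omega>_central)
    have EF: "E * F = F * E" unfolding E_def F_def using n by (intro \<epsilon>_\<epsilon>) auto
    have "\<epsilon> 1 * gi 1 = gi 1 * \<epsilon> 2"
      using gi_conj[of 1 "\<epsilon> 1" "\<epsilon> 2"] g_\<epsilon>[of 1] n by (simp add: numeral_2_eq_2)
    then have EG: "E * (G' * z) = G' * (F * z)" for z unfolding E_def G'_def F_def by (simp add: mult.assoc[symmetric])
    have xg: "\<xi> * (G * (P * (G' * z))) = G * (P * (G' * (\<xi> * z))) + (k * (G * (P * (\<xi> * z))) - k * (P * (G * (\<xi> * z))))" for z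
      using arg_cong[OF X_gpg[OF n(1), of a], of "\<lambda>x. x * z"]
      by (simp add: G_def G'_def k_def P_def distrib_right left_diff_distrib right_diff_distrib mult.assoc)
    have w1: "w m 1 a = G * (P * (G' * (F * J')))" and w0: "w m 0 b = p b * (G' * (F * J'))" for b
      unfolding EG[symmetric] by (simp_all add: w_def J'(1) G_def P_def E_def G'_def)
    have xF: "\<xi> * (F * J') = F * J' * \<xi>"
      using \<xi>_\<epsilon>[of 2] n J'(2) by (simp add: F_def mult.assoc[symmetric]) (simp add: mult.assoc)
    have xE: "\<xi> * (c * E) = c * E * \<xi>" using c\<epsilon>_\<xi>[of 1] n by (simp add: E_def)
    have xQ: "\<xi> * Q = Q * \<xi>" unfolding Q_def by (rule commute_mult) (use xF xE in simp_all)
    have PQ: "P * Q = Q * P" unfolding P_def by (rule p_comm[symmetric]) (simp add: xQ)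
    have Px: "P * \<xi> = \<xi> * P" unfolding P_def by (rule p_comm[symmetric]) simp
    have kQ: "k * (F * J') = Q"
    proof -
      have eF: "e 1 * F = F * E" using e_\<epsilon>(2)[of 1] n EF by (simp add: E_def F_def numeral_2_eq_2)
      have "k * (F * J') = c * (F * (E * J'))" unfolding k_def mult.assoc assoc_subst[OF eF] ..
      also have "\<dots> = Q" unfolding EJ Q_def by (simp add: mult_c[of J'] mult_c[of F] mult.assoc)
      finally show ?thesis .
    qed
    have mv: "G * k = k * G" "G' * k = k * G'" "P * k = k * P" "\<xi> * k = k * \<xi>"
      using k_mv[OF n(1)] by (simp_all add: G_def G'_def k_def P_def)
    note mv = mv mv[THEN assoc_subst, unfolded mult.assoc]
    have 1: "k * (G * (P * (\<xi> * (F * J')))) = G * (P * (\<xi> * Q))" "k * (P * (G * (\<xi> * (F * J')))) = P * (G * (\<xi> * Q))"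
      unfolding kQ[symmetric] by (simp_all add: mv)
    have "G = G' + k" by (simp add: G_def G'_def k_def gi_def)
    then have 2: "G * (P * (\<xi> * Q)) - P * (G * (\<xi> * Q)) = G' * (P * (\<xi> * Q)) - P * (G' * (\<xi> * Q))"
      by (simp add: distrib_right distrib_left mv)
    have "\<xi> * w m 1 a = w m 1 a * \<xi> + (G * (P * (\<xi> * Q)) - P * (G * (\<xi> * Q)))"
      unfolding w1 xg 1 unfolding xF by (simp add: mult.assoc)
    also have "G * (P * (\<xi> * Q)) - P * (G * (\<xi> * Q)) = G' * (Q * (\<xi> * P)) - P * (G' * (Q * \<xi>))"
      unfolding 2 using assoc_subst[OF PQ] assoc_subst[OF Px] PQ Px xQ assoc_subst[OF xQ] by (simp add: mult.assoc)
    also have "\<dots> = w m 0 0 * (c * (\<beta> 1 * (\<xi> * p a))) - w m 0 a * (c * (\<beta> 1 * \<xi>))"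
      unfolding w0 by (simp add: Q_def \<beta>_def E_def P_def mult.assoc)
    finally show ?thesis using True by simp
  qed
qed simp

lemma Y_1: "Y (Suc 0) = \<xi>" and Y_Suc: "1 \<le> k \<Longrightarrow> Y (Suc k) = g k * (Y k * g k)"
  by (simp_all add: mult.assoc)

lemma t_Y: "\<lbrakk>1 \<le> k; k \<le> n; 1 \<le> j; j \<le> n\<rbrakk> \<Longrightarrow> t j * Y k = Y k * t j"
proof (induction k arbitrary: j)
  case (Suc k)
  show ?case
  proof (cases "k = 0")
    case True then show ?thesis using tX Suc.prems by simp
  next
    case False
    let ?s = "Transposition.transpose k (k + 1)"
    have s: "1 \<le> ?s j" "?s j \<le> n" "?s (?s j) = j"
      using Suc.prems False by (auto simp: Transposition.transpose_def)
    have 1: "g k * t (?s j) = t j * g k" "g k * t j = t (?s j) * g k"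
      using gt[of k "?s j"] gt[of k j] s Suc.prems False by simp_all
    have "t j * Y (Suc k) = g k * (t (?s j) * Y k) * g k"
      using False by (simp add: mult.assoc assoc_subst[OF 1(1)[symmetric]] del: Y.simps add: Y_Suc)
    also have "t (?s j) * Y k = Y k * t (?s j)" using Suc.IH[of "?s j"] s Suc.prems False by simp
    also have "g k * (Y k * t (?s j)) * g k = Y (Suc k) * t j"
      using False by (simp add: mult.assoc 1(2) del: Y.simps add: Y_Suc)
    finally show ?thesis .
  qed
qed simp

lemma g_Y: "\<lbrakk>1 \<le> k; k \<le> n; 1 \<le> i; i < n; i \<noteq> k; Suc i \<noteq> k\<rbrakk> \<Longrightarrow> g i * Y k = Y k * g i"
proof (induction k arbitrary: i rule: less_induct)
  case (less k)
  show ?case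
  proof (cases "k = 1")
    case True then show ?thesis using gX less.prems by simp
  next
    case False
    then obtain l where l: "k = Suc l" "1 \<le> l" using less.prems by (cases k) auto
    show ?thesis
    proof (cases "Suc i = l")
      case False
      have "g i * g l = g l * g i" using less.prems l False by (intro gg_far) auto
      moreover have "g i * Y l = Y l * g i" using less.prems l False by (intro less.IH) auto
      ultimately show ?thesis using l by (simp add: Y_Suc commute_mult del: Y.simps)
    next
      case True
      have il: "1 \<le> i" "i + 1 < n" using less.prems True l by auto
      have b: "g i * (g l * g i) = g l * (g i * g l)" using braid[OF il] True by (simp add: mult.assoc)
      have Yk: "Y k = g l * (g i * (Y i * (g i * g l)))"
        using l il True by (auto simp: Y_Suc mult.assoc simp del: Y.simps)
      have c: "g l * Y i = Y i * g l" using less.prems l True by (intro less.IH) auto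
      have "g i * Y k = g l * (g i * (g l * (Y i * (g i * g l))))"
        unfolding Yk using assoc_subst[OF b] by (simp add: mult.assoc)
      also have "\<dots> = g l * (g i * (Y i * (g l * (g i * g l))))"
        using assoc_subst[OF c] by (simp add: mult.assoc)
      also have "\<dots> = Y k * g i" unfolding Yk b[symmetric] by (simp add: mult.assoc)
      finally show ?thesis .
    qed
  qed
qed

lemma \<xi>_Y: "\<lbrakk>1 \<le> k; k \<le> n\<rbrakk> \<Longrightarrow> \<xi> * Y k = Y k * \<xi>"
proof (induction k)
  case (Suc k)
  consider "k = 0" | "k = 1" | "2 \<le> k" by linarith
  then show ?case
  proof cases
    case 1 then show ?thesis by simp
  next
    case 2 then show ?thesis using gXgX Suc.prems by (simp add: mult.assoc)
  next
    case 3
    then show ?thesis using Suc gX[of k] by (simp add: Y_Suc commute_mult del: Y.simps)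
  qed
qed simp

end

section \<open>Spans over the lower level and Jucys--Murphy elements\<close>

text \<open>The additive subgroups closed under right multiplication by a subring \<open>U\<close>.  The statements below are about
membership in an arbitrary such \<open>N\<close> and not in a particular span: the preimage of \<open>N\<close> under a left multiplication is again of
this kind, and this is what makes the inductions work.\<close>
definition rsub :: "'a::ring_1 set \<Rightarrow> 'a set \<Rightarrow> bool" where
  "rsub U N \<longleftrightarrow> 0 \<in> N \<and> (\<forall>x\<in>N. \<forall>y\<in>N. x + y \<in> N) \<and> (\<forall>x\<in>N. \<forall>y\<in>U. x * y \<in> N)"

text \<open>\<open>U\<close> plays the role of the algebra of level \<open>m\<close> inside an algebra of higher level.\<close>
locale yokonuma_sub = yokonuma_eigen +
  fixes m :: nat and U :: "'a set"
  assumes m_n: "m < n"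
    and U_1: "1 \<in> U" and U_minus: "y \<in> U \<Longrightarrow> - y \<in> U"
    and U_add: "y \<in> U \<Longrightarrow> z \<in> U \<Longrightarrow> y + z \<in> U" and U_mult: "y \<in> U \<Longrightarrow> z \<in> U \<Longrightarrow> y * z \<in> U"
    and U_t: "1 \<le> j \<Longrightarrow> j \<le> m \<Longrightarrow> t j \<in> U" and U_g: "1 \<le> i \<Longrightarrow> i < m \<Longrightarrow> g i \<in> U"
    and U_\<xi>: "1 \<le> m \<Longrightarrow> \<xi> \<in> U" and U_\<xi>': "1 \<le> m \<Longrightarrow> \<xi>' \<in> U"
    and U_c: "c \<in> U" and U_\<kappa>: "\<kappa> \<in> U" and U_\<omega>: "\<omega> \<in> U"
    and U_v: "1 \<le> i \<Longrightarrow> i \<le> d \<Longrightarrow> v i \<in> U" and U_vi: "1 \<le> i \<Longrightarrow> i \<le> d \<Longrightarrow> vi i \<in> U"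
begin

lemma rsubD:
  assumes "rsub U N"
  shows "0 \<in> N" "x \<in> N \<Longrightarrow> y \<in> N \<Longrightarrow> x + y \<in> N" "x \<in> N \<Longrightarrow> z \<in> U \<Longrightarrow> x * z \<in> N"
    "x \<in> N \<Longrightarrow> - x \<in> N" "x \<in> N \<Longrightarrow> y \<in> N \<Longrightarrow> x - y \<in> N"
proof -
  show *: "0 \<in> N" "x \<in> N \<Longrightarrow> y \<in> N \<Longrightarrow> x + y \<in> N" "x \<in> N \<Longrightarrow> z \<in> U \<Longrightarrow> x * z \<in> N" for x y z
    using assms by (auto simp: rsub_def)
  show **: "x \<in> N \<Longrightarrow> - x \<in> N" for x using *(3)[of x "- 1"] U_1 U_minus by simp
  show "x \<in> N \<Longrightarrow> y \<in> N \<Longrightarrow> x - y \<in> N" using *(2)[of x "- y"] ** by simp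
qed

lemma rsub_vimage: "rsub U N \<Longrightarrow> rsub U {x. y * x \<in> N}"
  by (auto simp: rsub_def distrib_left mult.assoc[symmetric])

lemma U_0: "0 \<in> U" using U_add[OF U_1 U_minus[OF U_1]] by simp

lemma U_diff: "y \<in> U \<Longrightarrow> z \<in> U \<Longrightarrow> y - z \<in> U" using U_add[of y "- z"] U_minus by simp

lemma U_sum: "(\<And>i. i \<in> A \<Longrightarrow> f i \<in> U) \<Longrightarrow> sum f A \<in> U"
  by (induction A rule: infinite_finite_induct) (auto intro: U_0 U_add)

lemma U_pow: "y \<in> U \<Longrightarrow> y ^ k \<in> U"
  by (induction k) (auto intro: U_1 U_mult)

lemma U_avg: "y \<in> U \<Longrightarrow> z \<in> U \<Longrightarrow> avg y z \<in> U"
  unfolding avg_def by (intro U_mult U_\<kappa> U_sum U_pow)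

lemma U_p: "1 \<le> m \<Longrightarrow> a \<le> d \<Longrightarrow> p a \<in> U"
  by (induction a) (simp_all add: U_1 U_mult U_diff U_\<xi> U_v)

lemma U_\<epsilon>: "1 \<le> j \<Longrightarrow> j \<le> m \<Longrightarrow> \<epsilon> j \<in> U"
  unfolding \<epsilon>_def by (intro U_avg U_t U_\<omega>)

lemma U_gi: "1 \<le> i \<Longrightarrow> i < m \<Longrightarrow> gi i \<in> U"
  unfolding gi_def e_def by (intro U_diff U_mult U_c U_avg U_t U_g) auto

lemma U_\<pi>: "k \<le> m \<Longrightarrow> \<pi> k \<in> U"
  by (induction k) (auto simp: U_1 U_mult U_g)

lemma U_L: "k < m \<or> k = 0 \<Longrightarrow> L k \<in> U"
  by (induction k) (auto simp: U_1 U_mult U_g)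

lemma U_J: "k < m \<or> k = 0 \<Longrightarrow> J k \<in> U"
  by (induction k) (auto simp: U_1 U_mult U_gi)

lemma U_Y: "1 \<le> k \<Longrightarrow> k \<le> m \<Longrightarrow> Y k \<in> U"
proof (induction k)
  case (Suc k)
  then show ?case by (cases "k = 0") (simp_all add: U_\<xi> U_mult U_g)
qed simp

lemma U_\<tau>: "1 \<le> j \<Longrightarrow> j \<le> Suc m \<Longrightarrow> k \<le> m \<Longrightarrow> \<tau> j k \<in> U"
  by (auto simp: \<tau>_def intro: U_t U_\<omega>)

lemma w_d: "w m k d = 0" by (simp add: w_def p_d)

lemma t_w_in: "\<lbrakk>rsub U N; w m k a \<in> N; 1 \<le> j; j \<le> Suc m; k \<le> m\<rbrakk> \<Longrightarrow> t j * w m k a \<in> N"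
  using m_n by (simp add: t_w rsubD(3) U_\<tau>)

lemma g_w_in:
  assumes N: "rsub U N" and w: "\<And>k. k \<le> m \<Longrightarrow> w m k a \<in> N" and i: "1 \<le> i" "i \<le> m" "k \<le> m"
  shows "g i * w m k a \<in> N"
proof -
  obtain l where l: "i = Suc l" using i by (cases i) auto
  consider "i < k" | "i = k" | "k = l" | "k < l" using l by linarith
  then show ?thesis
  proof cases
    case 1 then show ?thesis using i m_n w[OF i(3)] by (simp add: g_w_less rsubD(3)[OF N] U_g)
  next
    case 2
    then show ?thesis using l i m_n w[of l] w[of k] g_w_eq[of l m a]
      by (auto intro!: rsubD[OF N] U_mult U_c U_\<epsilon>)
  next
    case 3 then show ?thesis using l i w[of "Suc l"] by (simp add: g_w_Suc)
  next
    case 4 then show ?thesis using l i m_n w[OF i(3)] by (simp add: g_w_far rsubD(3)[OF N] U_g)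
  qed
qed

lemma central_w_in: "\<lbrakk>rsub U N; w m k a \<in> N; y \<in> U; \<And>z. y * z = z * y\<rbrakk> \<Longrightarrow> y * w m k a \<in> N"
  by (simp add: rsubD(3))

lemma \<beta>_U: "1 \<le> k \<Longrightarrow> k \<le> m \<Longrightarrow> \<beta> k \<in> U"
  unfolding \<beta>_def by (intro U_mult U_\<epsilon> U_\<pi>)

lemma \<xi>_w0_in:
  assumes N: "rsub U N" and w: "\<And>a. a < d \<Longrightarrow> w m 0 a \<in> N" and a: "a < d"
  shows "\<xi> * w m 0 a \<in> N"
proof -
  have "w m 0 (Suc a) \<in> N" using w[of "Suc a"] a w_d rsubD(1)[OF N] by (cases "Suc a = d") auto
  moreover have "v (Suc a) * w m 0 a \<in> N" using a by (intro central_w_in N w U_v v_central) auto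
  ultimately show ?thesis by (simp add: \<xi>_w_0 rsubD(2)[OF N])
qed

lemma \<xi>_w_in:
  assumes N: "rsub U N" and w: "\<And>k a. k \<le> m \<Longrightarrow> a < d \<Longrightarrow> w m k a \<in> N" and k: "k \<le> m" and a: "a < d"
  shows "\<xi> * w m k a \<in> N"
proof (cases "k = 0")
  case True then show ?thesis using \<xi>_w0_in[OF N] w a by simp
next
  case False
  then show ?thesis using k a m_n d_pos w
    by (simp add: \<xi>_w) (intro rsubD[OF N] w U_mult U_\<xi> U_c \<beta>_U U_p; simp)
qed

text \<open>Downward induction on \<open>a\<close>: the relation \<open>\<xi> w\<^sub>0\<^sub>,\<^sub>a = w\<^sub>0\<^sub>,\<^sub>a\<^sub>+\<^sub>1 + v\<^sub>a\<^sub>+\<^sub>1 w\<^sub>0\<^sub>,\<^sub>a\<close>, multiplied by \<open>\<xi>'\<close>, can be solved for \<open>\<xi>' w\<^sub>0\<^sub>,\<^sub>a\<close> because \<open>v\<^sub>a\<^sub>+\<^sub>1\<close> is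
invertible.\<close>
lemma \<xi>'_w0_in:
  assumes N: "rsub U N" and w: "\<And>a. a < d \<Longrightarrow> w m 0 a \<in> N" and a: "a < d"
  shows "\<xi>' * w m 0 a \<in> N"
  using a
proof (induction "d - a" arbitrary: a rule: less_induct)
  case less
  have S: "\<xi>' * w m 0 (Suc a) \<in> N"
    using less.hyps[of "Suc a"] less.prems w_d rsubD(1)[OF N] by (cases "Suc a = d") auto
  have "w m 0 a = \<xi>' * (\<xi> * w m 0 a)" by (simp add: mult.assoc[symmetric] Xi_X)
  also have "\<dots> = \<xi>' * w m 0 (Suc a) + v (Suc a) * (\<xi>' * w m 0 a)"
    unfolding \<xi>_w_0 distrib_left mult.assoc[symmetric] v_central[of "Suc a" \<xi>'] ..
  finally have "w m 0 a - \<xi>' * w m 0 (Suc a) = v (Suc a) * (\<xi>' * w m 0 a)"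
    by (simp only: diff_eq_eq add.commute)
  then have "vi (Suc a) * (w m 0 a - \<xi>' * w m 0 (Suc a)) = vi (Suc a) * (v (Suc a) * (\<xi>' * w m 0 a))"
    by simp
  also have "\<dots> = \<xi>' * w m 0 a" using v_inv[of "Suc a"] less.prems by (simp add: mult.assoc[symmetric])
  finally have "\<xi>' * w m 0 a = (w m 0 a - \<xi>' * w m 0 (Suc a)) * vi (Suc a)"
    using vi_central by simp
  then show ?case using S w less.prems by (simp add: rsubD[OF N] U_vi)
qed

lemma \<xi>'_w_in:
  assumes N: "rsub U N" and w: "\<And>k a. k \<le> m \<Longrightarrow> a < d \<Longrightarrow> w m k a \<in> N" and k: "k \<le> m" and a: "a < d"
  shows "\<xi>' * w m k a \<in> N"
proof (cases "k = 0")
  case True then show ?thesis using \<xi>'_w0_in[OF N] w a by simp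
next
  case False
  have m: "1 \<le> m" using False k by simp
  define D where "D = w m 0 0 * (c * (\<beta> k * (\<xi> * p a))) - w m 0 a * (c * (\<beta> k * \<xi>))"
  have 1: "\<xi> * w m k a = w m k a * \<xi> + D" using \<xi>_w[of k m a] False k m_n by (simp add: D_def)
  have "\<xi>' * (\<xi> * w m k a) * \<xi>' = \<xi>' * (w m k a * \<xi> + D) * \<xi>'" using 1 by simp
  then have "w m k a * \<xi>' = \<xi>' * w m k a + \<xi>' * D * \<xi>'"
    by (simp add: mult.assoc distrib_left distrib_right X_Xi assoc_subst[OF Xi_X])
  then have 2: "\<xi>' * w m k a = w m k a * \<xi>' - \<xi>' * D * \<xi>'" by (simp add: algebra_simps)
  have "rsub U {x. \<xi>' * x \<in> N}" by (rule rsub_vimage[OF N])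
  moreover have "w m 0 b \<in> {x. \<xi>' * x \<in> N}" if "b < d" for b using \<xi>'_w0_in[OF N] w that by simp
  ultimately have "D \<in> {x. \<xi>' * x \<in> N}"
    unfolding D_def using d_pos a False k m by (intro rsubD[where N = "{x. \<xi>' * x \<in> N}"] U_mult U_c \<beta>_U U_\<xi> U_p) auto
  then show ?thesis unfolding 2 using w k a m by (auto intro!: rsubD[OF N] U_\<xi>')
qed

text \<open>For \<open>j = 1\<close> this is \<open>\<xi>_w\<close>.  Further on, \<open>Y\<^sub>j\<^sub>+\<^sub>1 = g\<^sub>j Y\<^sub>j g\<^sub>j\<close>, where \<open>g\<^sub>j\<close> commutes with \<open>w m k a\<close> since \<open>j < k\<close>, and \<open>g\<^sub>j\<close> carries the error
terms \<open>w m (j - 1) b\<close> to \<open>w m j b\<close>.\<close>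
lemma Y_w_low:
  assumes "1 \<le> j" "j \<le> k" "k \<le> m" "rsub U N" "w m (j - 1) 0 \<in> N" "w m (j - 1) a \<in> N" "a < d"
  shows "Y j * w m k a - w m k a * Y j \<in> N"
  using assms(1,2,4-6)
proof (induction j arbitrary: N)
  case (Suc j)
  note N = \<open>rsub U N\<close>
  show ?case
  proof (cases "j = 0")
    case True
    then show ?thesis using Suc.prems assms(3,7) m_n
      by (simp add: \<xi>_w) (intro rsubD[OF N] U_mult U_c \<beta>_U U_\<xi> U_p; simp)
  next
    case False
    then obtain l where l: "j = Suc l" by (cases j) auto
    let ?N = "{x. g j * x \<in> N}"
    have "Y j * w m k a - w m k a * Y j \<in> ?N"
      by (rule Suc.IH) (use Suc.prems False l in \<open>auto simp: g_w_Suc intro: rsub_vimage\<close>)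
    then have "g j * (Y j * w m k a - w m k a * Y j) \<in> N" by simp
    moreover have "g j \<in> U" using Suc.prems False assms by (intro U_g) auto
    ultimately have "(g j * (Y j * w m k a - w m k a * Y j)) * g j \<in> N"
      by (rule rsubD(3)[OF N])
    moreover have "g j * w m k a = w m k a * g j"
      using g_w_less[of j k m a] Suc.prems False assms m_n by simp
    ultimately show ?thesis using False
      by (simp add: Y_Suc mult.assoc right_diff_distrib left_diff_distrib assoc_subst[of "g j" "w m k a"] del: Y.simps)
  qed
qed simp

text \<open>Modulo lower terms, multiplication by the Jucys--Murphy element raises the Newton index, as multiplication by \<open>\<xi>\<close> does for
\<open>k = 0\<close>.\<close>
lemma Y_w_top:
  assumes "k \<le> m" "rsub U N" "w m k a \<in> N" "w m k 0 \<in> N"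
    "\<And>l. l < k \<Longrightarrow> w m l a \<in> N" "\<And>l. l < k \<Longrightarrow> w m l 0 \<in> N" "a < d"
  shows "Y (Suc k) * w m k a - w m k (Suc a) \<in> N"
  using assms(1-6)
proof (induction k arbitrary: N)
  case 0
  then show ?case using assms(7) by (simp add: \<xi>_w_0) (intro central_w_in U_v v_central; simp)
next
  case (Suc k)
  note N = \<open>rsub U N\<close>
  let ?N = "{x. g (Suc k) * x \<in> N}"
  have N': "rsub U ?N" by (rule rsub_vimage[OF N])
  have low: "w m l b \<in> ?N" if "l < k" "b = 0 \<or> b = a" for l b
    using Suc.prems that g_w_far[of l "Suc k" m b] m_n by (auto intro!: rsubD(3)[OF N] U_g)
  have k: "w m k b \<in> ?N" if "b = 0 \<or> b = a" for b
    using Suc.prems that by (auto simp: g_w_Suc)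
  have "Y (Suc k) * w m k a - w m k (Suc a) \<in> ?N"
    by (rule Suc.IH) (use Suc.prems low k N' in auto)
  then have 1: "g (Suc k) * (Y (Suc k) * w m k a) - w m (Suc k) (Suc a) \<in> N"
    by (simp add: right_diff_distrib g_w_Suc)
  have "Y (Suc k) * w m (Suc k) a - w m (Suc k) a * Y (Suc k) \<in> ?N"
    using Suc.prems k assms(7) N' by (intro Y_w_low) auto
  then have "g (Suc k) * (Y (Suc k) * w m (Suc k) a) - g (Suc k) * w m (Suc k) a * Y (Suc k) \<in> N"
    by (simp add: right_diff_distrib mult.assoc)
  moreover have "g (Suc k) * w m (Suc k) a * Y (Suc k) \<in> N"
    unfolding g_w_eq[OF Suc.prems(1) m_n] using Suc.prems
    by (intro rsubD[OF N] U_Y U_mult U_c U_\<epsilon>) auto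
  ultimately have "g (Suc k) * (Y (Suc k) * w m (Suc k) a) \<in> N"
    using rsubD(2)[OF N] by fastforce
  moreover have "c * \<epsilon> (Suc k) \<in> U" using Suc.prems by (intro U_mult U_c U_\<epsilon>) auto
  ultimately have 2: "g (Suc k) * (Y (Suc k) * w m (Suc k) a) * (c * \<epsilon> (Suc k)) \<in> N"
    by (rule rsubD(3)[OF N])
  have "Y (Suc (Suc k)) * w m (Suc k) a = g (Suc k) * (Y (Suc k) * (g (Suc k) * w m (Suc k) a))"
    by (simp add: Y_Suc mult.assoc del: Y.simps)
  also have "\<dots> = g (Suc k) * (Y (Suc k) * w m k a) + g (Suc k) * (Y (Suc k) * w m (Suc k) a) * (c * \<epsilon> (Suc k))"
    unfolding g_w_eq[OF Suc.prems(1) m_n] by (simp add: distrib_left mult.assoc)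
  finally show ?case using rsubD(2)[OF N 1 2] by (simp add: algebra_simps)
qed

text \<open>\<open>L m\<close> carries \<open>\<epsilon> 1\<close> to \<open>\<epsilon> (m + 1)\<close> and is inverse to \<open>J m\<close>.\<close>
lemma w_m_0: "w m m 0 = \<epsilon> (Suc m)"
proof -
  have 1: "L k * J k = 1" if "k < n" for k
    using that
  proof (induction k)
    case (Suc k)
    have "L (Suc k) * J (Suc k) = g (Suc k) * (L k * J k) * gi (Suc k)" by (simp add: mult.assoc)
    then show ?case using Suc by (simp add: g_gi)
  qed simp
  have "\<epsilon> (Suc m) * L m = L m * \<epsilon> 1"
    unfolding \<epsilon>_def using m_n by (intro avg_conj[symmetric]) (simp_all add: t_L_eq[simplified] \<omega>_central)
  from assoc_subst[OF this[symmetric], of "J m"] show ?thesis using 1[OF m_n] by (simp add: w_def mult.assoc)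
qed

text \<open>Here \<open>w m l a = x * gi m\<close> where \<open>x\<close> has level \<open>m\<close> and so commutes with \<open>Y (m + 1)\<close>, while
\<open>Y (m + 1) * gi m = g m * Y m\<close>.  Replacing \<open>g m\<close> by \<open>gi m + c * e m\<close> gives back \<open>w m l a * Y m\<close>, with an error that \<open>e m\<close> turns into a
right multiple of \<open>w m m 0\<close>.\<close>
lemma Y_w_l:
  assumes "l < m" "rsub U N" "w m l a \<in> N" "w m m 0 \<in> N" "a < d"
  shows "Y (Suc m) * w m l a \<in> N"
proof -
  note N = \<open>rsub U N\<close>
  obtain m' where m: "m = Suc m'" using assms(1) by (cases m) auto
  have mm: "1 \<le> m" "m < n" using m m_n by auto
  define x where "x = w m' l a"
  have xU: "x \<in> U" unfolding x_def w_def using assms m by (intro U_mult U_L U_p U_\<epsilon> U_J) auto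
  have wx: "w m l a = x * gi m" by (simp add: x_def w_def m mult.assoc)
  have Yx: "Y (Suc m) * x = x * Y (Suc m)"
  proof -
    have gY: "Y (Suc m) * g i = g i * Y (Suc m)" if "1 \<le> i" "i < m" for i
      using g_Y[of "Suc m" i] that mm by simp
    have Yxi: "Y (Suc m) * \<xi> = \<xi> * Y (Suc m)" using \<xi>_Y[of "Suc m"] mm by (simp del: Y.simps)
    have Yt: "Y (Suc m) * t j = t j * Y (Suc m)" if "1 \<le> j" "j \<le> m" for j
      using t_Y[of "Suc m" j] that mm by (simp del: Y.simps)
    have "Y (Suc m) * L k = L k * Y (Suc m)" if "k < m" for k
      using that
    proof (induction k)
      case (Suc k)
      then show ?case unfolding L.simps by (intro commute_mult gY) auto
    qed simp
    moreover have "Y (Suc m) * J k = J k * Y (Suc m)" if "k < m" for k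
      using that
    proof (induction k)
      case (Suc k)
      have "g (Suc k) * Y (Suc m) = Y (Suc m) * g (Suc k)" using gY[of "Suc k"] Suc.prems by simp
      from gi_comm[OF _ _ this] have "gi (Suc k) * Y (Suc m) = Y (Suc m) * gi (Suc k)" using Suc.prems mm by simp
      then show ?case unfolding J.simps using Suc by (intro commute_mult) auto
    qed simp
    moreover have "Y (Suc m) * \<epsilon> 1 = \<epsilon> 1 * Y (Suc m)"
      unfolding \<epsilon>_def using mm by (intro avg_conj Yt) (auto simp: \<omega>_central simp del: Y.simps)
    moreover have "Y (Suc m) * p a = p a * Y (Suc m)" by (rule p_comm) (rule Yxi)
    ultimately show ?thesis unfolding x_def w_def using assms(1) m by (intro commute_mult) auto
  qed
  have xe: "x * e m = \<epsilon> (Suc m) * x"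
  proof -
    have x\<epsilon>: "x * \<epsilon> m = x"
    proof -
      have "\<epsilon> 1 * \<epsilon> 1 = \<epsilon> 1" unfolding \<epsilon>_def using mm
        by (intro avg_idem) (simp_all add: \<omega>_central t_r \<omega>_r)
      then have 1: "L l * (p a * (\<epsilon> 1 * (\<epsilon> 1 * J m'))) = x"
        by (simp add: x_def w_def mult.assoc[symmetric])
      have "J m' * \<epsilon> m = \<epsilon> 1 * J m'" using \<epsilon>_J_1[of m'] m mm by simp
      then have "x * \<epsilon> m = L l * (p a * (\<epsilon> 1 * (\<epsilon> 1 * J m')))" by (simp only: x_def w_def mult.assoc)
      then show ?thesis using 1 by simp
    qed
    have "x * e m = x * (\<epsilon> m * e m)" using x\<epsilon> by (simp add: mult.assoc[symmetric])
    also have "\<epsilon> m * e m = \<epsilon> m * \<epsilon> (Suc m)" using e_\<epsilon>[of m] \<epsilon>_e[of m m] mm by simp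
    also have "x * \<dots> = x * \<epsilon> (Suc m)" using x\<epsilon> by (simp add: mult.assoc[symmetric])
    also have "\<dots> = \<epsilon> (Suc m) * x"
      unfolding \<epsilon>_def
    proof (rule avg_conj)
      have "t (Suc m) * L k = L k * t (Suc m)" if "k < m" for k
        using t_L_far[of k "Suc m"] that mm by simp
      moreover have "t (Suc m) * J m' = J m' * t (Suc m)" using t_J_far[of m' "Suc m"] m mm by simp
      moreover have "t (Suc m) * \<epsilon> 1 = \<epsilon> 1 * t (Suc m)" using t_\<epsilon>_comm[of 1 "Suc m"] mm by simp
      ultimately show "x * t (Suc m) = t (Suc m) * x"
        unfolding x_def w_def using assms(1) mm t_p[of "Suc m" a]
          by (intro commute_mult sym[OF commute_mult]) auto
    qed (rule \<omega>_central[symmetric])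
    finally show ?thesis .
  qed
  have "Y (Suc m) * gi m = g m * Y m" using mm by (simp add: Y_Suc mult.assoc g_gi del: Y.simps)
  then have "Y (Suc m) * w m l a = x * (g m * Y m)"
    unfolding wx using Yx by (simp only: mult.assoc[symmetric]) (simp only: mult.assoc)
  also have "g m = gi m + c * e m" by (simp add: gi_def)
  also have "x * ((gi m + c * e m) * Y m) = w m l a * Y m + x * e m * (c * Y m)"
    by (simp add: wx distrib_left distrib_right mult.assoc mult_c[of "e m"])
  also have "x * e m = w m m 0 * x" unfolding xe w_m_0 ..
  finally show ?thesis using assms xU mm by (auto intro!: rsubD[OF N] U_Y U_c U_mult simp del: Y.simps)
qed

text \<open>The unitriangular passage from \<open>w m m a\<close> to \<open>Y\<^sup>a \<epsilon>\<^sub>m\<^sub>+\<^sub>1\<close>; recall that \<open>w m m 0 = \<epsilon> (m + 1)\<close>.\<close>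
lemma Y_power_w:
  assumes "rsub U N" "a < d" "\<And>b. b < a \<Longrightarrow> w m m b \<in> N" "\<And>l b. l < m \<Longrightarrow> b < d \<Longrightarrow> w m l b \<in> N"
  shows "Y (Suc m) ^ a * w m m 0 - w m m a \<in> N"
  using assms
proof (induction a arbitrary: N)
  case 0
  then show ?case by (simp add: rsubD(1))
next
  case (Suc a)
  note N = \<open>rsub U N\<close>
  let ?N = "{x. Y (Suc m) * x \<in> N}"
  have top: "Y (Suc m) * w m m b - w m m (Suc b) \<in> N" if "b \<le> a" for b
    using Suc.prems that by (intro Y_w_top) auto
  have "w m m b \<in> ?N" if "b < a" for b
    using rsubD(2)[OF N top[of b], of "w m m (Suc b)"] Suc.prems that by simp
  moreover have "w m l b \<in> ?N" if "l < m" "b < d" for l b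
    using Y_w_l[OF that(1) N] Suc.prems that by simp
  ultimately have "Y (Suc m) ^ a * w m m 0 - w m m a \<in> ?N"
    using Suc.prems by (intro Suc.IH rsub_vimage) auto
  then have "Y (Suc m) * (Y (Suc m) ^ a * w m m 0) - Y (Suc m) * w m m a \<in> N"
    by (simp add: right_diff_distrib)
  from rsubD(2)[OF N this top[of a]] show ?case by (simp add: mult.assoc)
qed

end

section \<open>Induction along a free extension\<close>

context base_change
begin

lemma cl_add: "cl u = cl u' \<Longrightarrow> cl v = cl v' \<Longrightarrow> cl (u + v) = cl (u' + v')"
  unfolding cl_eq using K_closed(2)[of "u - u'" "v - v'"] by (simp add: algebra_simps)

lemma cl_diff: "cl u = cl u' \<Longrightarrow> cl v = cl v' \<Longrightarrow> cl (u - v) = cl (u' - v')"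
  unfolding cl_eq using K_closed(4)[of "u - u'" "v - v'"] by (simp add: algebra_simps)

lemma cl_sum: "(\<And>i. i \<in> I \<Longrightarrow> cl (f i) = cl (h i)) \<Longrightarrow> cl (\<Sum>i\<in>I. f i) = cl (\<Sum>i\<in>I. h i)"
proof (induction I rule: infinite_finite_induct)
  case (insert i I)
  then show ?case using cl_add[of "f i" "h i" "sum f I" "sum h I"] by simp
qed simp_all

lemma cl_frag_add1:
  "b \<in> carrier B \<Longrightarrow> b' \<in> carrier B \<Longrightarrow> x \<in> carrier M \<Longrightarrow>
    cl (frag_of (b \<oplus>\<^bsub>B\<^esub> b', x)) = cl (frag_of (b, x) + frag_of (b', x))"
  unfolding cl_eq using rel_K'(1)[of b b' x] by (simp add: algebra_simps)

lemma cl_frag_add2: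
  "b \<in> carrier B \<Longrightarrow> x \<in> carrier M \<Longrightarrow> x' \<in> carrier M \<Longrightarrow>
    cl (frag_of (b, x \<oplus>\<^bsub>M\<^esub> x')) = cl (frag_of (b, x) + frag_of (b, x'))"
  unfolding cl_eq using rel_K'(2)[of b x x'] by (simp add: algebra_simps)

lemma cl_frag_bal:
  "b \<in> carrier B \<Longrightarrow> a \<in> carrier A \<Longrightarrow> x \<in> carrier M \<Longrightarrow>
    cl (frag_of (b \<otimes>\<^bsub>B\<^esub> \<phi> a, x)) = cl (frag_of (b, a \<odot>\<^bsub>M\<^esub> x))"
  unfolding cl_eq using rel_K'(3)[of b a x] by simp

lemma cl_frag_zero1: assumes x: "x \<in> carrier M" shows "cl (frag_of (\<zero>\<^bsub>B\<^esub>, x)) = cl 0"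
  using cl_frag_add1[of "\<zero>\<^bsub>B\<^esub>" "\<zero>\<^bsub>B\<^esub>" x] x cl_diff[of "frag_of (\<zero>\<^bsub>B\<^esub>, x)" "frag_of (\<zero>\<^bsub>B\<^esub>, x) + frag_of (\<zero>\<^bsub>B\<^esub>, x)" "frag_of (\<zero>\<^bsub>B\<^esub>, x)" "frag_of (\<zero>\<^bsub>B\<^esub>, x)"]
  by simp

lemma cl_frag_finsum1:
  assumes "finite I" "b \<in> I \<rightarrow> carrier B" "x \<in> carrier M"
  shows "cl (frag_of (\<Oplus>\<^bsub>B\<^esub>i\<in>I. b i, x)) = cl (\<Sum>i\<in>I. frag_of (b i, x))"
  using assms
proof (induction I rule: finite_induct)
  case empty
  then show ?case by (simp add: cl_frag_zero1)
next
  case (insert j I)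
  then have b: "b \<in> I \<rightarrow> carrier B" "b j \<in> carrier B" by auto
  have "cl (frag_of (b j \<oplus>\<^bsub>B\<^esub> (\<Oplus>\<^bsub>B\<^esub>i\<in>I. b i), x)) = cl (frag_of (b j, x) + frag_of (\<Oplus>\<^bsub>B\<^esub>i\<in>I. b i, x))"
    using b insert by (intro cl_frag_add1 B.finsum_closed) auto
  also have "\<dots> = cl (frag_of (b j, x) + (\<Sum>i\<in>I. frag_of (b i, x)))"
    using insert b by (intro cl_add) auto
  finally show ?case using insert b by (simp add: B.finsum_insert)
qed

lemma cl_add_ind: "cl (u + v) = cl u \<oplus>\<^bsub>ind A B \<phi> M\<^esub> cl v" by (simp add: ind_simps)

text \<open>The universal property of the tensor product, for balanced maps into an arbitrary abelian group.\<close>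
lemma lift_ind:
  fixes G :: "('z, 'y) ring_scheme"
  assumes G: "abelian_group G" and f: "\<And>b x. b \<in> carrier B \<Longrightarrow> x \<in> carrier M \<Longrightarrow> f b x \<in> carrier G"
    and f1: "\<And>b b' x. b \<in> carrier B \<Longrightarrow> b' \<in> carrier B \<Longrightarrow> x \<in> carrier M \<Longrightarrow> f (b \<oplus>\<^bsub>B\<^esub> b') x = f b x \<oplus>\<^bsub>G\<^esub> f b' x"
    and f2: "\<And>b x x'. b \<in> carrier B \<Longrightarrow> x \<in> carrier M \<Longrightarrow> x' \<in> carrier M \<Longrightarrow> f b (x \<oplus>\<^bsub>M\<^esub> x') = f b x \<oplus>\<^bsub>G\<^esub> f b x'"
    and f3: "\<And>b a x. b \<in> carrier B \<Longrightarrow> a \<in> carrier A \<Longrightarrow> x \<in> carrier M \<Longrightarrow> f (b \<otimes>\<^bsub>B\<^esub> \<phi> a) x = f b (a \<odot>\<^bsub>M\<^esub> x)"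
  obtains h where "\<And>u. u \<in> C \<Longrightarrow> h (cl u) \<in> carrier G"
    "\<And>u v. u \<in> C \<Longrightarrow> v \<in> C \<Longrightarrow> h (cl (u + v)) = h (cl u) \<oplus>\<^bsub>G\<^esub> h (cl v)"
    "\<And>b x. b \<in> carrier B \<Longrightarrow> x \<in> carrier M \<Longrightarrow> h (cl (frag_of (b, x))) = f b x"
proof -
  interpret G: abelian_group G by (rule G)
  have cg: "comm_group (add_monoid G)" by (rule G.a_comm_group)
  have "case_prod f ` (carrier B \<times> carrier M) \<subseteq> carrier (add_monoid G)" using f by auto
  from comm_group.free_Abelian_group_universal[OF cg this]
  obtain h0 where h0: "h0 \<in> hom (tensor_free B M) (add_monoid G)"
    and h0f: "\<And>z. z \<in> carrier B \<times> carrier M \<Longrightarrow> h0 (frag_of z) = case_prod f z"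
    unfolding tensor_free_def by blast
  have hc: "h0 u \<in> carrier G" if "u \<in> C" for u using h0 that by (auto simp: hom_def)
  have ha: "h0 (u + v) = h0 u \<oplus>\<^bsub>G\<^esub> h0 v" if "u \<in> C" "v \<in> C" for u v
    using h0 that by (auto simp: hom_def tensor_free_def)
  have h00: "h0 0 = \<zero>\<^bsub>G\<^esub>"
    using ha[of 0 0] hc[of 0] C_closed(1) by (metis G.add.l_cancel_one' add_0)
  have hm: "h0 (u - v) = h0 u \<ominus>\<^bsub>G\<^esub> h0 v" if "u \<in> C" "v \<in> C" for u v
  proof -
    have "h0 u = h0 (u - v) \<oplus>\<^bsub>G\<^esub> h0 v" using ha[of "u - v" v] that C_closed by simp
    then show ?thesis using that hc C_closed by (simp add: G.minus_eq G.a_assoc G.r_neg)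
  qed
  have gz: "a \<oplus>\<^bsub>G\<^esub> (b \<oplus>\<^bsub>G\<^esub> (\<ominus>\<^bsub>G\<^esub> a \<oplus>\<^bsub>G\<^esub> \<ominus>\<^bsub>G\<^esub> b)) = \<zero>\<^bsub>G\<^esub>" if "a \<in> carrier G" "b \<in> carrier G" for a b
  proof -
    have "a \<oplus>\<^bsub>G\<^esub> (b \<oplus>\<^bsub>G\<^esub> (\<ominus>\<^bsub>G\<^esub> a \<oplus>\<^bsub>G\<^esub> \<ominus>\<^bsub>G\<^esub> b)) = (a \<oplus>\<^bsub>G\<^esub> b) \<oplus>\<^bsub>G\<^esub> \<ominus>\<^bsub>G\<^esub> (a \<oplus>\<^bsub>G\<^esub> b)"
      using that by (simp add: G.minus_add G.a_assoc)
    then show ?thesis using that by (simp add: G.r_neg)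
  qed
  have rel: "h0 u = \<zero>\<^bsub>G\<^esub>" if "u \<in> tensor_relations A B \<phi> M" for u
    using that unfolding tensor_relations_def
    by (auto simp: hm h0f C_of C_closed phi f1 f2 f3 f G.minus_eq G.a_assoc G.r_neg gz)
  have ker: "h0 u = \<zero>\<^bsub>G\<^esub> \<and> u \<in> C" if "u \<in> K" for u
    using that unfolding tensor_kernel_def
  proof (induction rule: generate.induct)
    case one then show ?case using h00 C_closed by (simp add: tensor_free_def)
  next
    case (incl h) then show ?case using rel rel_C by auto
  next
    case (inv u)
    then have u: "u \<in> C" using rel_C by auto
    then have "inv\<^bsub>tensor_free B M\<^esub> u = 0 - u" by (simp add: tensor_free_def)
    then show ?case using hm[of 0 u] u rel[OF inv] h00 C_closed(1) C_closed(3)[of 0 u] by (simp add: G.minus_eq)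
  next
    case (eng h1 h2)
    then show ?case using ha[of h1 h2] C_closed(2) by (simp add: tensor_free_def)
  qed
  define h where "h U = h0 (SOME u. u \<in> C \<and> cl u = U)" for U
  have h: "h (cl u) = h0 u" if "u \<in> C" for u
  proof -
    define v where "v = (SOME v. v \<in> C \<and> cl v = cl u)"
    have v: "v \<in> C \<and> cl v = cl u" unfolding v_def by (rule someI[of _ u]) (use that in simp)
    then have "h0 (v - u) = \<zero>\<^bsub>G\<^esub>" using ker[of "v - u"] cl_eq by blast
    then have "h0 v \<ominus>\<^bsub>G\<^esub> h0 u = \<zero>\<^bsub>G\<^esub>" using v that hm by simp
    moreover have "h0 v = (h0 v \<ominus>\<^bsub>G\<^esub> h0 u) \<oplus>\<^bsub>G\<^esub> h0 u"
      using v that hc by (simp add: G.minus_eq G.a_assoc G.l_neg)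
    ultimately have "h0 v = h0 u" using that hc by simp
    then show ?thesis by (simp add: h_def v_def)
  qed
  show thesis
    by (rule that[of h]) (use hc ha h0f C_of C_closed in \<open>auto simp: h\<close>)
qed

end

definition right_basis ::
  "('a, 'r) ring_scheme \<Rightarrow> ('b, 's) ring_scheme \<Rightarrow> ('a \<Rightarrow> 'b) \<Rightarrow> 'i set \<Rightarrow> ('i \<Rightarrow> 'b) \<Rightarrow> bool" where
  "right_basis A B \<phi> I w \<longleftrightarrow> finite I \<and> w \<in> I \<rightarrow> carrier B \<and>
     (\<forall>b\<in>carrier B. \<exists>!x. x \<in> I \<rightarrow>\<^sub>E carrier A \<and> b = (\<Oplus>\<^bsub>B\<^esub>i\<in>I. w i \<otimes>\<^bsub>B\<^esub> \<phi> (x i)))"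

locale free_base_change = base_change A M B \<phi>
  for A :: "('a, 'r) ring_scheme" and M :: "('a, 'm) module" and B :: "('b, 's) ring_scheme" and \<phi> +
  fixes I :: "'i set" and w :: "'i \<Rightarrow> 'b"
  assumes basis: "right_basis A B \<phi> I w"
begin

definition crd :: "'b \<Rightarrow> 'i \<Rightarrow> 'a" where
  "crd b = (THE x. x \<in> I \<rightarrow>\<^sub>E carrier A \<and> b = (\<Oplus>\<^bsub>B\<^esub>i\<in>I. w i \<otimes>\<^bsub>B\<^esub> \<phi> (x i)))"

lemma fin: "finite I" and w_closed: "i \<in> I \<Longrightarrow> w i \<in> carrier B"
  using basis by (auto simp: right_basis_def)

lemma crd: assumes "b \<in> carrier B"
  shows "crd b \<in> I \<rightarrow>\<^sub>E carrier A" "b = (\<Oplus>\<^bsub>B\<^esub>i\<in>I. w i \<otimes>\<^bsub>B\<^esub> \<phi> (crd b i))"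
proof -
  have "\<exists>!x. x \<in> I \<rightarrow>\<^sub>E carrier A \<and> b = (\<Oplus>\<^bsub>B\<^esub>i\<in>I. w i \<otimes>\<^bsub>B\<^esub> \<phi> (x i))"
    using basis assms by (auto simp: right_basis_def)
  from theI'[OF this] show "crd b \<in> I \<rightarrow>\<^sub>E carrier A" "b = (\<Oplus>\<^bsub>B\<^esub>i\<in>I. w i \<otimes>\<^bsub>B\<^esub> \<phi> (crd b i))"
    unfolding crd_def by auto
qed

lemma crd_unique:
  assumes "b \<in> carrier B" "\<And>i. i \<in> I \<Longrightarrow> x i \<in> carrier A" "b = (\<Oplus>\<^bsub>B\<^esub>i\<in>I. w i \<otimes>\<^bsub>B\<^esub> \<phi> (x i))" "i \<in> I"
  shows "crd b i = x i"
proof -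
  have "b = (\<Oplus>\<^bsub>B\<^esub>i\<in>I. w i \<otimes>\<^bsub>B\<^esub> \<phi> (restrict x I i))"
    using assms w_closed phi by (subst assms(3)) (intro B.finsum_cong', auto)
  moreover have "restrict x I \<in> I \<rightarrow>\<^sub>E carrier A" using assms by auto
  ultimately have "crd b = restrict x I" using crd[OF assms(1)] basis assms(1) unfolding right_basis_def by blast
  then show ?thesis using assms by simp
qed

lemma crd_closed: "b \<in> carrier B \<Longrightarrow> i \<in> I \<Longrightarrow> crd b i \<in> carrier A"
  using crd(1) by blast

lemma crd_add:
  assumes "b \<in> carrier B" "b' \<in> carrier B" "i \<in> I"
  shows "crd (b \<oplus>\<^bsub>B\<^esub> b') i = crd b i \<oplus>\<^bsub>A\<^esub> crd b' i"
proof (rule crd_unique[where x = "\<lambda>i. crd b i \<oplus>\<^bsub>A\<^esub> crd b' i"])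
  have "b \<oplus>\<^bsub>B\<^esub> b' = (\<Oplus>\<^bsub>B\<^esub>i\<in>I. w i \<otimes>\<^bsub>B\<^esub> \<phi> (crd b i)) \<oplus>\<^bsub>B\<^esub> (\<Oplus>\<^bsub>B\<^esub>i\<in>I. w i \<otimes>\<^bsub>B\<^esub> \<phi> (crd b' i))"
    using crd(2)[OF assms(1)] crd(2)[OF assms(2)] by simp
  also have "\<dots> = (\<Oplus>\<^bsub>B\<^esub>i\<in>I. w i \<otimes>\<^bsub>B\<^esub> \<phi> (crd b i) \<oplus>\<^bsub>B\<^esub> w i \<otimes>\<^bsub>B\<^esub> \<phi> (crd b' i))"
    using assms w_closed phi crd_closed by (intro B.finsum_addf[symmetric]) auto
  also have "\<dots> = (\<Oplus>\<^bsub>B\<^esub>i\<in>I. w i \<otimes>\<^bsub>B\<^esub> \<phi> (crd b i \<oplus>\<^bsub>A\<^esub> crd b' i))"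
    using assms w_closed phi crd_closed ring_hom_add[OF hom]
    by (intro B.finsum_cong') (auto simp: B.r_distr)
  finally show "b \<oplus>\<^bsub>B\<^esub> b' = \<dots>" .
qed (use assms crd_closed in auto)

lemma crd_mult:
  assumes "b \<in> carrier B" "a \<in> carrier A" "i \<in> I"
  shows "crd (b \<otimes>\<^bsub>B\<^esub> \<phi> a) i = crd b i \<otimes>\<^bsub>A\<^esub> a"
proof (rule crd_unique[where x = "\<lambda>i. crd b i \<otimes>\<^bsub>A\<^esub> a"])
  have "b \<otimes>\<^bsub>B\<^esub> \<phi> a = (\<Oplus>\<^bsub>B\<^esub>i\<in>I. w i \<otimes>\<^bsub>B\<^esub> \<phi> (crd b i)) \<otimes>\<^bsub>B\<^esub> \<phi> a"
    using crd(2)[OF assms(1)] by simp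
  also have "\<dots> = (\<Oplus>\<^bsub>B\<^esub>i\<in>I. w i \<otimes>\<^bsub>B\<^esub> \<phi> (crd b i) \<otimes>\<^bsub>B\<^esub> \<phi> a)"
    using assms w_closed phi crd_closed fin by (intro B.finsum_ldistr) auto
  also have "\<dots> = (\<Oplus>\<^bsub>B\<^esub>i\<in>I. w i \<otimes>\<^bsub>B\<^esub> \<phi> (crd b i \<otimes>\<^bsub>A\<^esub> a))"
    using assms w_closed phi crd_closed ring_hom_mult[OF hom]
    by (intro B.finsum_cong') (auto simp: B.m_assoc)
  finally show "b \<otimes>\<^bsub>B\<^esub> \<phi> a = \<dots>" .
qed (use assms crd_closed phi in auto)

lemma crd_w:
  assumes "j \<in> I" "i \<in> I"
  shows "crd (w j) i = (if i = j then \<one>\<^bsub>A\<^esub> else \<zero>\<^bsub>A\<^esub>)"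
proof (rule crd_unique[where x = "\<lambda>i. if i = j then \<one>\<^bsub>A\<^esub> else \<zero>\<^bsub>A\<^esub>"])
  have z: "\<phi> \<zero>\<^bsub>A\<^esub> = \<zero>\<^bsub>B\<^esub>" by (rule ring_hom_zero[OF hom R.ring_axioms B.ring_axioms])
  have "(\<Oplus>\<^bsub>B\<^esub>i\<in>I. w i \<otimes>\<^bsub>B\<^esub> \<phi> (if i = j then \<one>\<^bsub>A\<^esub> else \<zero>\<^bsub>A\<^esub>)) = (\<Oplus>\<^bsub>B\<^esub>i\<in>I. if j = i then w i else \<zero>\<^bsub>B\<^esub>)"
    using w_closed ring_hom_one[OF hom] z by (intro B.finsum_cong') auto
  also have "\<dots> = w j" using assms fin w_closed by (intro B.add.finprod_singleton) auto
  finally show "w j = (\<Oplus>\<^bsub>B\<^esub>i\<in>I. w i \<otimes>\<^bsub>B\<^esub> \<phi> (if i = j then \<one>\<^bsub>A\<^esub> else \<zero>\<^bsub>A\<^esub>))" ..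
qed (use assms w_closed in auto)

definition comb :: "('i \<Rightarrow> 'm) \<Rightarrow> ('b \<times> 'm \<Rightarrow>\<^sub>0 int) set" where
  "comb x = cl (\<Sum>i\<in>I. frag_of (w i, x i))"

lemma C_sum: "(\<And>i. i \<in> S \<Longrightarrow> f i \<in> C) \<Longrightarrow> sum f S \<in> C"
  by (induction S rule: infinite_finite_induct) (auto intro: C_closed)

lemma comb_C: "(\<And>i. i \<in> I \<Longrightarrow> x i \<in> carrier M) \<Longrightarrow> (\<Sum>i\<in>I. frag_of (w i, x i)) \<in> C"
  by (intro C_sum C_of w_closed)

lemma comb_add:
  assumes "\<And>i. i \<in> I \<Longrightarrow> x i \<in> carrier M" "\<And>i. i \<in> I \<Longrightarrow> y i \<in> carrier M"
  shows "comb (\<lambda>i. x i \<oplus>\<^bsub>M\<^esub> y i) = comb x \<oplus>\<^bsub>ind A B \<phi> M\<^esub> comb y"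
  unfolding comb_def cl_add_ind[symmetric] sum.distrib[symmetric]
  by (intro cl_sum cl_frag_add2 w_closed assms)

lemma cl_frag: "b \<in> carrier B \<Longrightarrow> x \<in> carrier M \<Longrightarrow> cl (frag_of (b, x)) = comb (\<lambda>i. crd b i \<odot>\<^bsub>M\<^esub> x)"
proof -
  assume b: "b \<in> carrier B" and x: "x \<in> carrier M"
  have "cl (frag_of (b, x)) = cl (\<Sum>i\<in>I. frag_of (w i \<otimes>\<^bsub>B\<^esub> \<phi> (crd b i), x))"
    by (subst crd(2)[OF b], rule cl_frag_finsum1) (use b x fin w_closed crd_closed phi in auto)
  also have "\<dots> = comb (\<lambda>i. crd b i \<odot>\<^bsub>M\<^esub> x)"
    unfolding comb_def by (intro cl_sum cl_frag_bal w_closed crd_closed b x)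
  finally show ?thesis .
qed

text \<open>By \<open>cl_frag\<close> a pure tensor is a combination of basis tensors, and such combinations are closed under differences.\<close>
lemma comb_surj:
  assumes "U \<in> carrier (ind A B \<phi> M)"
  shows "\<exists>x\<in>I \<rightarrow>\<^sub>E carrier M. U = comb x"
proof -
  obtain u where u: "u \<in> C" "U = cl u" using assms unfolding ind_simps by blast
  have "\<exists>x\<in>I \<rightarrow> carrier M. cl u = comb x"
    using u(1) unfolding C_iff
  proof (induction u rule: frag_induction)
    case zero
    have "comb (\<lambda>_. \<zero>\<^bsub>M\<^esub>) = cl (\<Sum>i\<in>I. 0)"
    proof (unfold comb_def, rule cl_sum)
      fix i assume "i \<in> I"
      then show "cl (frag_of (w i, \<zero>\<^bsub>M\<^esub>)) = cl 0"
        using cl_frag_add2[of "w i" "\<zero>\<^bsub>M\<^esub>" "\<zero>\<^bsub>M\<^esub>"] w_closed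
          cl_diff[of "frag_of (w i, \<zero>\<^bsub>M\<^esub>)" "frag_of (w i, \<zero>\<^bsub>M\<^esub>) + frag_of (w i, \<zero>\<^bsub>M\<^esub>)" "frag_of (w i, \<zero>\<^bsub>M\<^esub>)" "frag_of (w i, \<zero>\<^bsub>M\<^esub>)"]
        by simp
    qed
    then show ?case by (intro bexI[of _ "\<lambda>_. \<zero>\<^bsub>M\<^esub>"]) auto
  next
    case (one z)
    then show ?case using cl_frag[of "fst z" "snd z"] crd_closed
      by (intro bexI[of _ "\<lambda>i. crd (fst z) i \<odot>\<^bsub>M\<^esub> snd z"]) auto
  next
    case (diff u v)
    then obtain x y where xy: "x \<in> I \<rightarrow> carrier M" "cl u = comb x" "y \<in> I \<rightarrow> carrier M" "cl v = comb y" by blast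
    have "comb x = comb (\<lambda>i. (x i \<ominus>\<^bsub>M\<^esub> y i) \<oplus>\<^bsub>M\<^esub> y i)"
      unfolding comb_def using xy by (intro arg_cong[of _ _ cl] sum.cong) (auto simp: M.minus_eq M.a_assoc M.l_neg Pi_iff)
    also have "\<dots> = cl ((\<Sum>i\<in>I. frag_of (w i, x i \<ominus>\<^bsub>M\<^esub> y i)) + (\<Sum>i\<in>I. frag_of (w i, y i)))"
      using xy by (subst comb_add) (auto simp: comb_def cl_add_ind)
    finally have "cl (u - v) = cl ((\<Sum>i\<in>I. frag_of (w i, x i \<ominus>\<^bsub>M\<^esub> y i)) + (\<Sum>i\<in>I. frag_of (w i, y i)) - (\<Sum>i\<in>I. frag_of (w i, y i)))"
      using xy by (intro cl_diff) (auto simp: comb_def)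
    then show ?case using xy by (intro bexI[of _ "\<lambda>i. x i \<ominus>\<^bsub>M\<^esub> y i"]) (auto simp: comb_def)
  qed
  then obtain x where x: "x \<in> I \<rightarrow> carrier M" "U = comb x" using u by auto
  then show ?thesis by (intro bexI[of _ "restrict x I"]) (auto simp: comb_def)
qed

text \<open>The coordinate \<open>crd _ i\<close> is additive and compatible with right multiplication by \<open>A\<close>, so \<open>b \<otimes> x \<mapsto> crd b i \<odot> x\<close> descends to the
tensor product, where it recovers the \<open>i\<close>-th coefficient.\<close>
lemma comb_inj:
  assumes x: "x \<in> I \<rightarrow>\<^sub>E carrier M" and y: "y \<in> I \<rightarrow>\<^sub>E carrier M" and e: "comb x = comb y"
  shows "x = y"
proof (rule PiE_ext[OF x y])
  fix i assume i: "i \<in> I"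
  obtain h where h: "\<And>u. u \<in> C \<Longrightarrow> h (cl u) \<in> carrier M"
    "\<And>u v. u \<in> C \<Longrightarrow> v \<in> C \<Longrightarrow> h (cl (u + v)) = h (cl u) \<oplus>\<^bsub>M\<^esub> h (cl v)"
    "\<And>b x. b \<in> carrier B \<Longrightarrow> x \<in> carrier M \<Longrightarrow> h (cl (frag_of (b, x))) = crd b i \<odot>\<^bsub>M\<^esub> x"
  proof (rule lift_ind[of M "\<lambda>b x. crd b i \<odot>\<^bsub>M\<^esub> x"])
    show "abelian_group M" by (rule M.abelian_group_axioms)
  qed (use i crd_closed crd_add crd_mult in \<open>auto simp: smult_l_distr smult_r_distr smult_assoc1\<close>)
  have h0: "h (cl 0) = \<zero>\<^bsub>M\<^esub>"
    using h(2)[of 0 0] h(1)[of 0] C_closed(1) by (metis M.add.l_cancel_one' add_0)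
  have hx: "h (comb z) = z i" if z: "z \<in> I \<rightarrow>\<^sub>E carrier M" for z
  proof -
    have "h (cl (\<Sum>j\<in>S. frag_of (w j, z j))) = (if i \<in> S then z i else \<zero>\<^bsub>M\<^esub>)" if "finite S" "S \<subseteq> I" for S
      using that
    proof (induction S rule: finite_induct)
      case (insert j S)
      have zj: "z j \<in> carrier M" "w j \<in> carrier B" using insert z w_closed by auto
      have zi: "z i \<in> carrier M" using z i by auto
      have smz: "\<zero>\<^bsub>A\<^esub> \<odot>\<^bsub>M\<^esub> z j = \<zero>\<^bsub>M\<^esub>"
        using smult_l_distr[of "\<zero>\<^bsub>A\<^esub>" "\<zero>\<^bsub>A\<^esub>" "z j"] zj by (metis M.add.l_cancel_one' R.l_zero R.zero_closed smult_closed)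
      have "h (cl (frag_of (w j, z j))) = (if i = j then z i else \<zero>\<^bsub>M\<^esub>)"
        using h(3)[OF zj(2,1)] crd_w[of j i] insert i zi smz by auto
      moreover have "(\<Sum>j\<in>S. frag_of (w j, z j)) \<in> C"
        using insert z w_closed by (intro C_sum C_of) auto
      ultimately show ?case
        using insert zi h(2)[OF C_of[OF zj(2,1)], of "\<Sum>j\<in>S. frag_of (w j, z j)"] by auto
    qed (simp add: h0)
    from this[of I] show ?thesis using fin i by (simp add: comb_def)
  qed
  show "x i = y i" using hx[OF x] hx[OF y] e by simp
qed

end


section \<open>A Mackey decomposition\<close>

text \<open>Together with the commutation rules, the two bases express that \<open>B\<close> is, as a bimodule over \<open>A\<close>,
the direct sum of \<open>N\<close> copies of \<open>A\<close>, generated by the \<open>z i\<close>, and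
of \<open>A \<otimes> A\<close> over \<open>A0\<close>, generated by \<open>\<gamma>\<close>.\<close>
locale mackey =
  fixes A0 :: "('a0, 'r0) ring_scheme" and A :: "('a, 'r) ring_scheme" and B :: "('b, 's) ring_scheme"
    and \<phi>0 :: "'a0 \<Rightarrow> 'a" and \<phi> :: "'a \<Rightarrow> 'b" and N :: nat and z :: "nat \<Rightarrow> 'b" and I :: "'i set" and w :: "'i \<Rightarrow> 'a" and \<gamma> :: 'b
  assumes A0: "ring A0" and A: "ring A" and B: "ring B"
    and \<phi>0: "\<phi>0 \<in> ring_hom A0 A" and \<phi>: "\<phi> \<in> ring_hom A B"
    and \<gamma>: "\<gamma> \<in> carrier B"
    and \<gamma>_comm: "a0 \<in> carrier A0 \<Longrightarrow> \<phi> (\<phi>0 a0) \<otimes>\<^bsub>B\<^esub> \<gamma> = \<gamma> \<otimes>\<^bsub>B\<^esub> \<phi> (\<phi>0 a0)"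
    and z_comm: "i < N \<Longrightarrow> a \<in> carrier A \<Longrightarrow> \<phi> a \<otimes>\<^bsub>B\<^esub> z i = z i \<otimes>\<^bsub>B\<^esub> \<phi> a"
    and basis0: "right_basis A0 A \<phi>0 I w"
    and basis: "right_basis A B \<phi> ({..<N} <+> I) (case_sum z (\<lambda>i. \<phi> (w i) \<otimes>\<^bsub>B\<^esub> \<gamma>))"
begin

text \<open>The map \<open>(x, a \<otimes> y) \<mapsto> \<Sum>i<N. z i \<otimes> x i + a \<gamma> \<otimes> y\<close>.  Elements of a tensor product are classes, so the second part is
evaluated at a chosen representative; \<open>\<beta>_cl\<close> shows that the choice does not matter.\<close>
definition \<beta> :: "('a, 'm) module \<Rightarrow> (nat \<Rightarrow> 'm) \<times> ('a \<times> 'm \<Rightarrow>\<^sub>0 int) set \<Rightarrow> ('b \<times> 'm \<Rightarrow>\<^sub>0 int) set" where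
  "\<beta> M = (\<lambda>(x, U). tensor_class A B \<phi> M ((\<Sum>i<N. frag_of (z i, x i)) +
     frag_extend (\<lambda>(a, y). frag_of (\<phi> a \<otimes>\<^bsub>B\<^esub> \<gamma>, y)) (SOME u. u \<in> carrier (tensor_free A (res \<phi>0 M)) \<and>
       tensor_class A0 A \<phi>0 (res \<phi>0 M) u = U)))"

definition target :: "('a, 'm) module \<Rightarrow> ('a, (nat \<Rightarrow> 'm) \<times> ('a \<times> 'm \<Rightarrow>\<^sub>0 int) set) module" where
  "target M = dir_sum (dir_power N M) (ind A0 A \<phi>0 (res \<phi>0 M))"

definition \<eta> :: "('a, 'm) module \<Rightarrow> ('b \<times> 'm \<Rightarrow>\<^sub>0 int) set \<Rightarrow> (nat \<Rightarrow> 'm) \<times> ('a \<times> 'm \<Rightarrow>\<^sub>0 int) set" where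
  "\<eta> M = inv_into (carrier (target M)) (\<beta> M)"

lemma phi_closed: "a \<in> carrier A \<Longrightarrow> \<phi> a \<in> carrier B" using ring_hom_closed[OF \<phi>] .

lemma free0: "left_module A M \<Longrightarrow> free_base_change A0 (res \<phi>0 M) A \<phi>0 I w"
  by (intro free_base_change.intro base_change.intro base_change_axioms.intro free_base_change_axioms.intro
      left_module_res[OF _ A0 \<phi>0] A0 A \<phi>0 basis0)

lemma free1: "left_module A M \<Longrightarrow> free_base_change A M B \<phi> ({..<N} <+> I) (case_sum z (\<lambda>i. \<phi> (w i) \<otimes>\<^bsub>B\<^esub> \<gamma>))"
  by (intro free_base_change.intro base_change.intro base_change_axioms.intro free_base_change_axioms.intro
      A B \<phi> basis)

end

locale mackey_module = mackey A0 A B \<phi>0 \<phi> N z I w \<gamma>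
  for A0 :: "('a0, 'r0) ring_scheme" and A :: "('a, 'r) ring_scheme" and B :: "('b, 's) ring_scheme"
    and \<phi>0 and \<phi> and N and z and I :: "'i set" and w and \<gamma> +
  fixes M :: "('a, 'm) module"
  assumes M: "left_module A M"
begin

sublocale F0: free_base_change A0 "res \<phi>0 M" A \<phi>0 I w by (rule free0[OF M])
sublocale F1: free_base_change A M B \<phi> "{..<N} <+> I" "case_sum z (\<lambda>i. \<phi> (w i) \<otimes>\<^bsub>B\<^esub> \<gamma>)" by (rule free1[OF M])

definition Th :: "('a \<times> 'm \<Rightarrow>\<^sub>0 int) \<Rightarrow> ('b \<times> 'm \<Rightarrow>\<^sub>0 int)" where
  "Th = frag_extend (\<lambda>(a, y). frag_of (\<phi> a \<otimes>\<^bsub>B\<^esub> \<gamma>, y))"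

lemma Th_simps: "Th (u + v) = Th u + Th v" "Th (u - v) = Th u - Th v" "Th 0 = 0"
  "Th (frag_of (a, y)) = frag_of (\<phi> a \<otimes>\<^bsub>B\<^esub> \<gamma>, y)"
  by (simp_all add: Th_def frag_extend_add frag_extend_diff)

lemma Th_sum: "Th (sum f S) = (\<Sum>i\<in>S. Th (f i))"
  by (induction S rule: infinite_finite_induct) (auto simp: Th_simps)

lemma carrier_res: "carrier (res \<phi>0 M) = carrier M" "x \<oplus>\<^bsub>res \<phi>0 M\<^esub> y = x \<oplus>\<^bsub>M\<^esub> y" "a \<odot>\<^bsub>res \<phi>0 M\<^esub> x = \<phi>0 a \<odot>\<^bsub>M\<^esub> x"
  by (simp_all add: res_def)

text \<open>The map \<open>a \<otimes> y \<mapsto> a \<gamma> \<otimes> y\<close> is balanced over \<open>A0\<close> because \<open>\<gamma>\<close> commutes with \<open>A0\<close>.\<close>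
lemma Th_K: assumes "u \<in> F0.K" shows "Th u \<in> F1.K"
proof (rule F0.lift_kernel[OF Th_simps(1) _ F1.K_closed(1-3) assms])
  fix v assume "v \<in> tensor_relations A0 A \<phi>0 (res \<phi>0 M)"
  then consider
      c c' x where "v = frag_of (c \<oplus>\<^bsub>A\<^esub> c', x) - frag_of (c, x) - frag_of (c', x)"
        "c \<in> carrier A" "c' \<in> carrier A" "x \<in> carrier M"
    | c x x' where "v = frag_of (c, x \<oplus>\<^bsub>M\<^esub> x') - frag_of (c, x) - frag_of (c, x')"
        "c \<in> carrier A" "x \<in> carrier M" "x' \<in> carrier M"
    | c a x where "v = frag_of (c \<otimes>\<^bsub>A\<^esub> \<phi>0 a, x) - frag_of (c, \<phi>0 a \<odot>\<^bsub>M\<^esub> x)"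
        "c \<in> carrier A" "a \<in> carrier A0" "x \<in> carrier M"
    unfolding tensor_relations_def carrier_res by blast
  then show "Th v \<in> F1.K"
  proof cases
    case 1 then show ?thesis
      using F1.rel_K'(1)[of "\<phi> c \<otimes>\<^bsub>B\<^esub> \<gamma>" "\<phi> c' \<otimes>\<^bsub>B\<^esub> \<gamma>" x] phi_closed \<gamma>
      by (simp add: Th_simps ring_hom_add[OF \<phi>] F1.B.l_distr)
  next
    case 2 then show ?thesis
      using F1.rel_K'(2)[of "\<phi> c \<otimes>\<^bsub>B\<^esub> \<gamma>" x x'] phi_closed \<gamma> by (simp add: Th_simps)
  next
    case 3
    have "\<phi> (c \<otimes>\<^bsub>A\<^esub> \<phi>0 a) \<otimes>\<^bsub>B\<^esub> \<gamma> = \<phi> c \<otimes>\<^bsub>B\<^esub> \<gamma> \<otimes>\<^bsub>B\<^esub> \<phi> (\<phi>0 a)"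
      using 3 phi_closed F0.phi \<gamma> by (simp add: ring_hom_mult[OF \<phi>] F1.B.m_assoc \<gamma>_comm)
    then show ?thesis
      using F1.rel_K'(3)[of "\<phi> c \<otimes>\<^bsub>B\<^esub> \<gamma>" "\<phi>0 a" x] 3 phi_closed F0.phi \<gamma> by (simp add: Th_simps)
  qed
qed

lemma \<beta>_cl: assumes "u \<in> F0.C"
  shows "\<beta> M (x, F0.cl u) = F1.cl ((\<Sum>i<N. frag_of (z i, x i)) + Th u)"
proof -
  define v where "v = (SOME v. v \<in> F0.C \<and> F0.cl v = F0.cl u)"
  have v: "v \<in> F0.C \<and> F0.cl v = F0.cl u" unfolding v_def by (rule someI[of _ u]) (use assms in simp)
  then have "Th (v - u) \<in> F1.K" using Th_K F0.cl_eq by blast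
  then have "F1.cl (Th v) = F1.cl (Th u)" by (simp add: F1.cl_eq Th_simps)
  then show ?thesis unfolding \<beta>_def by (simp add: v_def[symmetric] Th_def[symmetric]) (intro F1.cl_add refl)
qed

lemma target_carrier: "carrier (target M) = ({..<N} \<rightarrow>\<^sub>E carrier M) \<times> F0.cl ` F0.C"
  by (simp add: target_def dir_sum_def dir_power_def F0.ind_simps)

lemma Th_C: "u \<in> F0.C \<Longrightarrow> Th u \<in> F1.C"
  unfolding F0.C_iff
proof (induction u rule: frag_induction)
  case zero then show ?case by (simp add: Th_simps F1.C_closed)
next
  case (one x)
  then show ?case using phi_closed \<gamma> by (cases x) (auto simp: Th_simps carrier_res intro!: F1.C_of)
next
  case (diff a b)
  then show ?case using F1.C_closed(3)[of "Th a" "Th b"] by (simp add: Th_simps)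
qed

lemma z_closed: "i < N \<Longrightarrow> z i \<in> carrier B"
  using F1.w_closed[OF InlI[of i "{..<N}" I]] by simp

lemma zx_C: "x \<in> {..<N} \<rightarrow>\<^sub>E carrier M \<Longrightarrow> (\<Sum>i<N. frag_of (z i, x i)) \<in> F1.C"
  by (intro F1.C_sum F1.C_of z_closed) auto

lemma \<beta>_closed: "Q \<in> carrier (target M) \<Longrightarrow> \<beta> M Q \<in> carrier (ind A B \<phi> M)"
  unfolding target_carrier using zx_C Th_C
  by (auto simp: \<beta>_cl F1.ind_simps intro!: imageI F1.C_closed)

lemma \<beta>_comb: "y \<in> I \<rightarrow> carrier M \<Longrightarrow> \<beta> M (x, F0.comb y) = F1.comb (case_sum x y)"
  unfolding F0.comb_def F1.comb_def using F0.fin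
  by (subst \<beta>_cl) (auto intro: F0.comb_C[unfolded carrier_res] simp: carrier_res Th_sum Th_simps sum.Plus)

text \<open>In the two bases \<open>\<beta>\<close> is the identity on coordinates (\<open>\<beta>_comb\<close>).\<close>
lemma \<beta>_bij: "bij_betw (\<beta> M) (carrier (target M)) (carrier (ind A B \<phi> M))"
proof (rule bij_betw_imageI)
  have comb: "\<exists>y\<in>I \<rightarrow>\<^sub>E carrier M. U = F0.comb y" if "U \<in> F0.cl ` F0.C" for U
    using F0.comb_surj[of U] that unfolding F0.ind_simps carrier_res by blast
  have cs: "restrict (case_sum x y) ({..<N} <+> I) \<in> ({..<N} <+> I) \<rightarrow>\<^sub>E carrier M"
    if "x \<in> {..<N} \<rightarrow>\<^sub>E carrier M" "y \<in> I \<rightarrow>\<^sub>E carrier M" for x y using that by auto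
  have rs: "F1.comb (restrict f ({..<N} <+> I)) = F1.comb f" for f
    unfolding F1.comb_def by (intro arg_cong[of _ _ F1.cl] sum.cong) auto
  show "inj_on (\<beta> M) (carrier (target M))"
  proof (rule inj_onI, clarify)
    fix x U x' U' assume 1: "(x, U) \<in> carrier (target M)" "(x', U') \<in> carrier (target M)" and e: "\<beta> M (x, U) = \<beta> M (x', U')"
    obtain y y' where y: "y \<in> I \<rightarrow>\<^sub>E carrier M" "U = F0.comb y" "y' \<in> I \<rightarrow>\<^sub>E carrier M" "U' = F0.comb y'"
      using comb 1 unfolding target_carrier by (metis mem_Sigma_iff)
    have x: "x \<in> {..<N} \<rightarrow>\<^sub>E carrier M" "x' \<in> {..<N} \<rightarrow>\<^sub>E carrier M" using 1 unfolding target_carrier by auto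
    have "y \<in> I \<rightarrow> carrier M" "y' \<in> I \<rightarrow> carrier M" using y by auto
    then have "F1.comb (case_sum x y) = F1.comb (case_sum x' y')" using e y by (simp add: \<beta>_comb)
    then have e': "restrict (case_sum x y) ({..<N} <+> I) = restrict (case_sum x' y') ({..<N} <+> I)"
      using x y by (intro F1.comb_inj cs) (simp_all add: rs)
    have "x = x'"
    proof (rule PiE_ext[OF x])
      fix i assume "i \<in> {..<N}" then show "x i = x' i" using fun_cong[OF e', of "Inl i"] InlI[of i "{..<N}" I] by auto
    qed
    moreover have "y = y'"
    proof (rule PiE_ext[OF y(1,3)])
      fix i assume "i \<in> I" then show "y i = y' i" using fun_cong[OF e', of "Inr i"] InrI[of i I "{..<N}"] by auto
    qed
    ultimately show "x = x' \<and> U = U'" using y by simp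
  qed
  show "\<beta> M ` carrier (target M) = carrier (ind A B \<phi> M)"
  proof
    show "\<beta> M ` carrier (target M) \<subseteq> carrier (ind A B \<phi> M)" using \<beta>_closed by blast
    show "carrier (ind A B \<phi> M) \<subseteq> \<beta> M ` carrier (target M)"
    proof
      fix V assume "V \<in> carrier (ind A B \<phi> M)"
      then obtain f where f: "f \<in> ({..<N} <+> I) \<rightarrow>\<^sub>E carrier M" "V = F1.comb f" using F1.comb_surj by blast
      define x where "x = (\<lambda>i\<in>{..<N}. f (Inl i))"
      define y where "y = (\<lambda>i\<in>I. f (Inr i))"
      have y: "y \<in> I \<rightarrow> carrier M" using f by (auto simp: y_def)
      have "F1.comb (case_sum x y) = V"
        unfolding f(2) F1.comb_def by (intro arg_cong[of _ _ F1.cl] sum.cong) (auto simp: x_def y_def)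
      moreover have "(x, F0.comb y) \<in> carrier (target M)"
        using f y F0.comb_C[of y] unfolding target_carrier F0.comb_def carrier_res by (auto simp: x_def)
      ultimately show "V \<in> \<beta> M ` carrier (target M)" using \<beta>_comb[OF y, of x] by (metis image_eqI)
    qed
  qed
qed

text \<open>\<open>A\<close> acts on the first summand by way of \<open>\<phi> a * z i = z i * \<phi> a\<close>; on the second it multiplies the left tensor factor on
both sides.\<close>
lemma \<beta>_hom: "\<beta> M \<in> lmod_hom A (target M) (res \<phi> (ind A B \<phi> M))"
proof -
  have add: "\<beta> M (Q \<oplus>\<^bsub>target M\<^esub> Q') = \<beta> M Q \<oplus>\<^bsub>ind A B \<phi> M\<^esub> \<beta> M Q'"
    if Q: "Q \<in> carrier (target M)" "Q' \<in> carrier (target M)" for Q Q'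
  proof -
    obtain x u x' u' where Q: "Q = (x, F0.cl u)" "u \<in> F0.C" "x \<in> {..<N} \<rightarrow>\<^sub>E carrier M"
       "Q' = (x', F0.cl u')" "u' \<in> F0.C" "x' \<in> {..<N} \<rightarrow>\<^sub>E carrier M"
      using Q unfolding target_carrier by blast
    have "Q \<oplus>\<^bsub>target M\<^esub> Q' = ((\<lambda>i\<in>{..<N}. x i \<oplus>\<^bsub>M\<^esub> x' i), F0.cl (u + u'))"
      unfolding Q by (simp add: target_def dir_sum_def dir_power_def F0.ind_simps)
    then have "\<beta> M (Q \<oplus>\<^bsub>target M\<^esub> Q') = F1.cl ((\<Sum>i<N. frag_of (z i, x i \<oplus>\<^bsub>M\<^esub> x' i)) + Th (u + u'))"
      using Q by (simp add: \<beta>_cl F0.C_closed)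
    also have "\<dots> = F1.cl ((\<Sum>i<N. frag_of (z i, x i) + frag_of (z i, x' i)) + Th (u + u'))"
      using Q by (intro F1.cl_add F1.cl_sum F1.cl_frag_add2 z_closed refl) auto
    finally show ?thesis using Q by (simp add: \<beta>_cl F1.ind_simps sum.distrib Th_simps add_ac)
  qed
  have smult: "\<beta> M (a \<odot>\<^bsub>target M\<^esub> Q) = \<phi> a \<odot>\<^bsub>ind A B \<phi> M\<^esub> \<beta> M Q"
    if Q: "Q \<in> carrier (target M)" and a: "a \<in> carrier A" for Q a
  proof -
    obtain x u where Q: "Q = (x, F0.cl u)" "u \<in> F0.C" "x \<in> {..<N} \<rightarrow>\<^sub>E carrier M"
      using Q unfolding target_carrier by blast
    have "a \<odot>\<^bsub>target M\<^esub> Q = ((\<lambda>i\<in>{..<N}. a \<odot>\<^bsub>M\<^esub> x i), F0.cl (F0.L a u))"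
      unfolding Q using F0.smult_cl[OF a, of u] by (simp add: target_def dir_sum_def dir_power_def)
    then have 1: "\<beta> M (a \<odot>\<^bsub>target M\<^esub> Q) = F1.cl ((\<Sum>i<N. frag_of (z i, a \<odot>\<^bsub>M\<^esub> x i)) + Th (F0.L a u))"
      using Q a by (simp add: \<beta>_cl F0.L_C)
    have L_sum: "F1.L b (sum f S) = (\<Sum>i\<in>S. F1.L b (f i))" for b f and S :: "nat set"
      by (induction S rule: infinite_finite_induct) (auto simp: F1.L_simps)
    have ThL: "Th (F0.L a u) = F1.L (\<phi> a) (Th u)"
      using Q(2) unfolding F0.C_iff
    proof (induction u rule: frag_induction)
      case (one q)
      then show ?case using a phi_closed \<gamma>
        by (cases q) (auto simp: Th_simps F0.L_simps F1.L_simps ring_hom_mult[OF \<phi>] F1.B.m_assoc)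
    qed (simp_all add: Th_simps F0.L_simps F1.L_simps)
    have "F1.cl (\<Sum>i<N. frag_of (z i, a \<odot>\<^bsub>M\<^esub> x i)) = F1.cl (\<Sum>i<N. frag_of (z i \<otimes>\<^bsub>B\<^esub> \<phi> a, x i))"
      using Q a z_closed by (intro F1.cl_sum F1.cl_frag_bal[symmetric]) auto
    also have "(\<Sum>i<N. frag_of (z i \<otimes>\<^bsub>B\<^esub> \<phi> a, x i)) = F1.L (\<phi> a) (\<Sum>i<N. frag_of (z i, x i))"
      unfolding L_sum by (rule sum.cong) (simp_all add: F1.L_simps z_comm a)
    finally have "\<beta> M (a \<odot>\<^bsub>target M\<^esub> Q) = F1.cl (F1.L (\<phi> a) (\<Sum>i<N. frag_of (z i, x i)) + F1.L (\<phi> a) (Th u))"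
      unfolding 1 ThL by (intro F1.cl_add refl)
    then show ?thesis using Q a phi_closed by (simp add: \<beta>_cl F1.smult_cl F1.L_simps)
  qed
  show ?thesis
    unfolding lmod_hom_def using add smult \<beta>_closed by (auto simp: res_def)
qed

lemma left_target: "left_module A (target M)"
  unfolding target_def by (intro left_module_dir_sum left_module_dir_power M F0.left_module_ind)

lemma \<eta>_iso: "\<eta> M \<in> lmod_iso A (res \<phi> (ind A B \<phi> M)) (target M)"
proof -
  interpret T: left_module A "target M" by (rule left_target)
  note b = \<beta>_bij
  have cr: "carrier (res \<phi> (ind A B \<phi> M)) = carrier (ind A B \<phi> M)" by (simp add: res_def)
  have \<eta>b: "\<eta> M (\<beta> M Q) = Q" if "Q \<in> carrier (target M)" for Q
    using b that unfolding \<eta>_def bij_betw_def by (simp add: inv_into_f_f)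
  have img: "\<exists>Q\<in>carrier (target M). V = \<beta> M Q" if "V \<in> carrier (ind A B \<phi> M)" for V
    using b that unfolding bij_betw_def by blast
  have h: "\<eta> M \<in> lmod_hom A (res \<phi> (ind A B \<phi> M)) (target M)"
    unfolding lmod_hom_def cr
  proof (intro CollectI conjI ballI funcsetI)
    fix V assume V: "V \<in> carrier (ind A B \<phi> M)"
    obtain Q where Q: "Q \<in> carrier (target M)" "V = \<beta> M Q" using img[OF V] by blast
    show "\<eta> M V \<in> carrier (target M)" using Q \<eta>b by simp
    {
      fix V' assume "V' \<in> carrier (ind A B \<phi> M)"
      then obtain Q' where Q': "Q' \<in> carrier (target M)" "V' = \<beta> M Q'" using img by blast
      have "V \<oplus>\<^bsub>res \<phi> (ind A B \<phi> M)\<^esub> V' = \<beta> M (Q \<oplus>\<^bsub>target M\<^esub> Q')"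
        using Q Q' \<beta>_hom unfolding lmod_hom_def by (auto simp: res_def)
      then show "\<eta> M (V \<oplus>\<^bsub>res \<phi> (ind A B \<phi> M)\<^esub> V') = \<eta> M V \<oplus>\<^bsub>target M\<^esub> \<eta> M V'"
        using Q Q' \<eta>b by simp
    }
  next
    fix a V assume a: "a \<in> carrier A" and V: "V \<in> carrier (ind A B \<phi> M)"
    obtain Q where Q: "Q \<in> carrier (target M)" "V = \<beta> M Q" using img[OF V] by blast
    have "a \<odot>\<^bsub>res \<phi> (ind A B \<phi> M)\<^esub> V = \<beta> M (a \<odot>\<^bsub>target M\<^esub> Q)"
      using Q a \<beta>_hom unfolding lmod_hom_def by (auto simp: res_def)
    then show "\<eta> M (a \<odot>\<^bsub>res \<phi> (ind A B \<phi> M)\<^esub> V) = a \<odot>\<^bsub>target M\<^esub> \<eta> M V"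
      using Q a \<eta>b by simp
  qed
  show ?thesis unfolding lmod_iso_def using h bij_betw_inv_into[OF b] by (simp add: cr \<eta>_def)
qed

end

context mackey
begin

lemma \<eta>_natural:
  fixes M :: "('a, 'm) module" and M' :: "('a, 'm) module"
  assumes M: "left_module A M" and M': "left_module A M'" and f: "f \<in> lmod_hom A M M'"
    and V: "V \<in> carrier (ind A B \<phi> M)"
  shows "\<eta> M' (ind_map A B \<phi> M' f V) = map_prod (dir_power_map N f) (ind_map A0 A \<phi>0 (res \<phi>0 M') f) (\<eta> M V)"
proof -
  interpret P: mackey_module A0 A B \<phi>0 \<phi> N z I w \<gamma> M by (intro mackey_module.intro mackey_axioms mackey_module_axioms.intro M)
  interpret P': mackey_module A0 A B \<phi>0 \<phi> N z I w \<gamma> M' by (intro mackey_module.intro mackey_axioms mackey_module_axioms.intro M')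
  obtain Q where Q: "Q \<in> carrier (target M)" "V = \<beta> M Q" using P.\<beta>_bij V unfolding bij_betw_def by blast
  then obtain x u where xu: "Q = (x, P.F0.cl u)" "u \<in> P.F0.C" "x \<in> {..<N} \<rightarrow>\<^sub>E carrier M"
    unfolding P.target_carrier by blast
  have fc: "f y \<in> carrier M'" if "y \<in> carrier M" for y using f that by (auto simp: lmod_hom_def)
  have f0: "f \<in> lmod_hom A0 (res \<phi>0 M) (res \<phi>0 M')"
    using f ring_hom_closed[OF \<phi>0] by (auto simp: lmod_hom_def res_def)
  define F :: "('b \<times> 'm \<Rightarrow>\<^sub>0 int) \<Rightarrow> ('b \<times> 'm \<Rightarrow>\<^sub>0 int)" where "F = frag_extend (\<lambda>(c, x). frag_of (c, f x))"
  define F0 :: "('a \<times> 'm \<Rightarrow>\<^sub>0 int) \<Rightarrow> ('a \<times> 'm \<Rightarrow>\<^sub>0 int)" where "F0 = frag_extend (\<lambda>(c, x). frag_of (c, f x))"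
  have F: "F (p + p') = F p + F p'" "F (p - p') = F p - F p'" "F (frag_of (c, x)) = frag_of (c, f x)" "F 0 = 0" for p p' c x
    by (simp_all add: F_def frag_extend_add frag_extend_diff)
  have F0: "F0 (p - p') = F0 p - F0 p'" "F0 (frag_of (c, x)) = frag_of (c, f x)" "F0 0 = 0" for p p' c x
    by (simp_all add: F0_def frag_extend_diff)
  have Fs: "F (\<Sum>i\<in>S. h i) = (\<Sum>i\<in>S. F (h i))" for h and S :: "nat set"
    by (induction S rule: infinite_finite_induct) (auto simp: F)
  have F0C: "F0 u \<in> P'.F0.C \<and> F (P.Th u) = P'.Th (F0 u)"
    using xu(2) unfolding P.F0.C_iff
  proof (induction u rule: frag_induction)
    case zero then show ?case by (simp add: F F0 P.Th_simps P'.Th_simps P'.F0.C_closed)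
  next
    case (one q)
    then show ?case using fc
      by (cases q) (auto simp: F F0 P.Th_simps P'.Th_simps P.carrier_res P'.carrier_res intro!: P'.F0.C_of)
  next
    case (diff p p')
    then show ?case using P'.F0.C_closed(3) by (auto simp: F F0 P.Th_simps P'.Th_simps)
  qed
  have 1: "ind_map A0 A \<phi>0 (res \<phi>0 M') f (P.F0.cl u) = P'.F0.cl (F0 u)"
    unfolding F0_def by (rule ind_map_class[OF P.F0.base_change_axioms P'.F0.base_change_axioms f0])
  have "ind_map A B \<phi> M' f V = P'.F1.cl (F ((\<Sum>i<N. frag_of (z i, x i)) + P.Th u))"
    unfolding Q xu(1) P.\<beta>_cl[OF xu(2)] F_def
    by (rule ind_map_class[OF P.F1.base_change_axioms P'.F1.base_change_axioms f])
  also have "\<dots> = P'.F1.cl ((\<Sum>i<N. frag_of (z i, dir_power_map N f x i)) + P'.Th (F0 u))"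
    using F0C by (simp add: F Fs dir_power_map_def)
  also have "\<dots> = \<beta> M' (dir_power_map N f x, P'.F0.cl (F0 u))"
    using F0C by (simp add: P'.\<beta>_cl)
  finally have 2: "ind_map A B \<phi> M' f V = \<beta> M' (dir_power_map N f x, P'.F0.cl (F0 u))" .
  have "(dir_power_map N f x, P'.F0.cl (F0 u)) \<in> carrier (target M')"
    using F0C xu fc unfolding P'.target_carrier by (auto simp: dir_power_map_def)
  then have 3: "\<eta> M' (ind_map A B \<phi> M' f V) = (dir_power_map N f x, P'.F0.cl (F0 u))"
    unfolding 2 \<eta>_def using P'.\<beta>_bij by (simp add: bij_betw_def inv_into_f_f)
  have "\<eta> M V = (x, P.F0.cl u)"
    unfolding Q(2) \<eta>_def using P.\<beta>_bij Q(1) xu(1) by (simp add: bij_betw_def inv_into_f_f)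
  then show ?thesis using 1 3 by simp
qed

end

section \<open>One ring type for all cyclotomic algebras\<close>

text \<open>The product of the rings \<open>cyc_YH r d n\<close> over all \<open>r\<close>, \<open>d\<close> and \<open>n\<close>.  As a type of class \<open>ring_1\<close> it admits equational
reasoning without carrier conditions, and it contains every one of these rings as a direct factor.  All levels are collected in one
type since the types cannot depend on \<open>n\<close>.\<close>
typedef yh_prod = "{F :: nat \<times> nat \<times> nat \<Rightarrow> yh_poly set set. \<forall>r d n. F (r, d, n) \<in> carrier (cyc_YH r d n)}"
  morphisms cmp Abs_yh
proof -
  have "\<zero>\<^bsub>cyc_YH r d n\<^esub> \<in> carrier (cyc_YH r d n)" for r d n
    using ring.ring_simprules(2)[OF ring_cyc_YH] .
  then show ?thesis by (intro exI[of _ "\<lambda>(r, d, n). \<zero>\<^bsub>cyc_YH r d n\<^esub>"]) simp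
qed

lemma cmp_closed: "cmp x (r, d, n) \<in> carrier (cyc_YH r d n)"
  using cmp[of x] by simp

lemma yh_eqI: "(\<And>r d n. cmp x (r, d, n) = cmp y (r, d, n)) \<Longrightarrow> x = y"
  by (rule cmp_inject[THEN iffD1]) auto

lemma cmp_Abs: "(\<And>r d n. F r d n \<in> carrier (cyc_YH r d n)) \<Longrightarrow> cmp (Abs_yh (\<lambda>(r, d, n). F r d n)) (r, d, n) = F r d n"
  by (subst Abs_yh_inverse) auto

lemma cyc_YH_distr:
  fixes a b c
  assumes "a \<in> carrier (cyc_YH r d n)" "b \<in> carrier (cyc_YH r d n)" "c \<in> carrier (cyc_YH r d n)"
  shows "a \<otimes>\<^bsub>cyc_YH r d n\<^esub> (b \<oplus>\<^bsub>cyc_YH r d n\<^esub> c) = a \<otimes>\<^bsub>cyc_YH r d n\<^esub> b \<oplus>\<^bsub>cyc_YH r d n\<^esub> a \<otimes>\<^bsub>cyc_YH r d n\<^esub> c"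
    "a \<otimes>\<^bsub>cyc_YH r d n\<^esub> \<one>\<^bsub>cyc_YH r d n\<^esub> = a"
proof -
  interpret R: ring "cyc_YH r d n" by (rule ring_cyc_YH)
  show "a \<otimes>\<^bsub>cyc_YH r d n\<^esub> (b \<oplus>\<^bsub>cyc_YH r d n\<^esub> c) = a \<otimes>\<^bsub>cyc_YH r d n\<^esub> b \<oplus>\<^bsub>cyc_YH r d n\<^esub> a \<otimes>\<^bsub>cyc_YH r d n\<^esub> c"
    "a \<otimes>\<^bsub>cyc_YH r d n\<^esub> \<one>\<^bsub>cyc_YH r d n\<^esub> = a" using assms by (simp_all add: R.r_distr)
qed

instantiation yh_prod :: ring_1
begin

definition "0 = Abs_yh (\<lambda>(r, d, n). \<zero>\<^bsub>cyc_YH r d n\<^esub>)"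
definition "1 = Abs_yh (\<lambda>(r, d, n). \<one>\<^bsub>cyc_YH r d n\<^esub>)"
definition "x + y = Abs_yh (\<lambda>(r, d, n). cmp x (r, d, n) \<oplus>\<^bsub>cyc_YH r d n\<^esub> cmp y (r, d, n))"
definition "x * y = Abs_yh (\<lambda>(r, d, n). cmp x (r, d, n) \<otimes>\<^bsub>cyc_YH r d n\<^esub> cmp y (r, d, n))"
definition "- x = Abs_yh (\<lambda>(r, d, n). \<ominus>\<^bsub>cyc_YH r d n\<^esub> cmp x (r, d, n))"
definition "x - y = x + - (y :: yh_prod)"

lemma cmp_ops:
  "cmp 0 (r, d, n) = \<zero>\<^bsub>cyc_YH r d n\<^esub>" "cmp 1 (r, d, n) = \<one>\<^bsub>cyc_YH r d n\<^esub>"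
  "cmp (x + y) (r, d, n) = cmp x (r, d, n) \<oplus>\<^bsub>cyc_YH r d n\<^esub> cmp y (r, d, n)"
  "cmp (x * y) (r, d, n) = cmp x (r, d, n) \<otimes>\<^bsub>cyc_YH r d n\<^esub> cmp y (r, d, n)"
  "cmp (- x) (r, d, n) = \<ominus>\<^bsub>cyc_YH r d n\<^esub> cmp x (r, d, n)"
  unfolding zero_yh_prod_def one_yh_prod_def plus_yh_prod_def times_yh_prod_def uminus_yh_prod_def
  by (rule cmp_Abs, intro ring.ring_simprules[OF ring_cyc_YH] cmp_closed)+

instance
proof
  fix a b c :: yh_prod
  note rs = ring.ring_simprules[OF ring_cyc_YH]
  note cl = cmp_closed
  show "a + b + c = a + (b + c)" by (rule yh_eqI) (simp add: cmp_ops rs(7) cl)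
  show "a + b = b + a" by (rule yh_eqI) (simp add: cmp_ops rs(10) cl)
  show "0 + a = a" by (rule yh_eqI) (simp add: cmp_ops rs(8) cl)
  show "- a + a = 0" by (rule yh_eqI) (simp add: cmp_ops rs(9) cl)
  show "a - b = a + - b" by (simp add: minus_yh_prod_def)
  show "a * b * c = a * (b * c)" by (rule yh_eqI) (simp add: cmp_ops rs(11) cl)
  show "1 * a = a" by (rule yh_eqI) (simp add: cmp_ops rs(12) cl)
  show "a * 1 = a" by (rule yh_eqI) (simp add: cmp_ops cyc_YH_distr(2)[OF cl cl cl])
  show "(a + b) * c = a * c + b * c" by (rule yh_eqI) (simp add: cmp_ops rs(13) cl)
  show "a * (b + c) = a * b + a * c" by (rule yh_eqI) (simp add: cmp_ops cyc_YH_distr(1)[OF cl cl cl])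
  show "(0::yh_prod) \<noteq> 1"
  proof
    assume "(0::yh_prod) = 1"
    then have "\<zero>\<^bsub>cyc_YH 0 0 0\<^esub> = \<one>\<^bsub>cyc_YH 0 0 0\<^esub>" using cmp_ops(1,2)[of 0 0 0] by simp
    moreover have iso: "(\<lambda>a. cyc_class 0 0 0 (scal a)) \<in> ring_iso (base_ring 0 0) (cyc_YH 0 0 0)"
      by (rule base_ring_iso_cyc_YH_0)
    moreover have h: "(\<lambda>a. cyc_class 0 0 0 (scal a)) \<in> ring_hom (base_ring 0 0) (cyc_YH 0 0 0)"
      and b: "inj_on (\<lambda>a. cyc_class 0 0 0 (scal a)) (carrier (base_ring 0 0))"
      using iso by (auto simp: ring_iso_def bij_betw_def)
    moreover have z: "\<zero>\<^bsub>base_ring 0 0\<^esub> = 0" "\<one>\<^bsub>base_ring 0 0\<^esub> = 1"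
      by (simp_all add: base_ring_def monoid_ring_simps)
    ultimately have "cyc_class 0 0 0 (scal 0) = cyc_class 0 0 0 (scal 1)"
      using ring_hom_zero[OF h ring_base ring_cyc_YH] ring_hom_one[OF h] by simp
    then have "(0::laurent) = 1" by (rule inj_onD[OF b _ base_mem(1,2)])
    then show False by simp
  qed
qed

end

definition emb :: "nat \<Rightarrow> nat \<Rightarrow> nat \<Rightarrow> yh_poly set set \<Rightarrow> yh_prod" where
  "emb r d n x = Abs_yh (\<lambda>(r', d', n'). if r' = r \<and> d' = d \<and> n' = n then x else \<zero>\<^bsub>cyc_YH r' d' n'\<^esub>)"

lemma cmp_emb:
  assumes "x \<in> carrier (cyc_YH r d n)"
  shows "cmp (emb r d n x) (r', d', n') = (if r' = r \<and> d' = d \<and> n' = n then x else \<zero>\<^bsub>cyc_YH r' d' n'\<^esub>)"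
  unfolding emb_def
  by (rule cmp_Abs) (use assms in \<open>auto intro: ring.ring_simprules(2)[OF ring_cyc_YH]\<close>)

lemma emb_inj: "x \<in> carrier (cyc_YH r d n) \<Longrightarrow> y \<in> carrier (cyc_YH r d n) \<Longrightarrow> emb r d n x = emb r d n y \<Longrightarrow> x = y"
  by (metis cmp_emb)

lemma emb_ops:
  assumes "x \<in> carrier (cyc_YH r d n)" "y \<in> carrier (cyc_YH r d n)"
  shows "emb r d n (x \<oplus>\<^bsub>cyc_YH r d n\<^esub> y) = emb r d n x + emb r d n y"
    "emb r d n (x \<otimes>\<^bsub>cyc_YH r d n\<^esub> y) = emb r d n x * emb r d n y"
    "emb r d n \<zero>\<^bsub>cyc_YH r d n\<^esub> = 0"
proof -
  interpret R: ring "cyc_YH r d n" by (rule ring_cyc_YH)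
  have z: "\<zero>\<^bsub>cyc_YH r' d' n'\<^esub> \<oplus>\<^bsub>cyc_YH r' d' n'\<^esub> \<zero>\<^bsub>cyc_YH r' d' n'\<^esub> = \<zero>\<^bsub>cyc_YH r' d' n'\<^esub>"
    "\<zero>\<^bsub>cyc_YH r' d' n'\<^esub> \<otimes>\<^bsub>cyc_YH r' d' n'\<^esub> \<zero>\<^bsub>cyc_YH r' d' n'\<^esub> = \<zero>\<^bsub>cyc_YH r' d' n'\<^esub>" for r' d' n'
  proof -
    interpret R': ring "cyc_YH r' d' n'" by (rule ring_cyc_YH)
    show "\<zero>\<^bsub>cyc_YH r' d' n'\<^esub> \<oplus>\<^bsub>cyc_YH r' d' n'\<^esub> \<zero>\<^bsub>cyc_YH r' d' n'\<^esub> = \<zero>\<^bsub>cyc_YH r' d' n'\<^esub>"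
    "\<zero>\<^bsub>cyc_YH r' d' n'\<^esub> \<otimes>\<^bsub>cyc_YH r' d' n'\<^esub> \<zero>\<^bsub>cyc_YH r' d' n'\<^esub> = \<zero>\<^bsub>cyc_YH r' d' n'\<^esub>" by simp_all
  qed
  show "emb r d n (x \<oplus>\<^bsub>cyc_YH r d n\<^esub> y) = emb r d n x + emb r d n y"
    by (rule yh_eqI) (use assms z in \<open>simp add: cmp_emb cmp_ops\<close>)
  show "emb r d n (x \<otimes>\<^bsub>cyc_YH r d n\<^esub> y) = emb r d n x * emb r d n y"
    by (rule yh_eqI) (use assms z in \<open>simp add: cmp_emb cmp_ops\<close>)
  show "emb r d n \<zero>\<^bsub>cyc_YH r d n\<^esub> = 0"
    by (rule yh_eqI) (simp add: cmp_emb cmp_ops)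
qed

section \<open>The generators in the product ring\<close>

lemma zeta_power: "1 \<le> r \<Longrightarrow> zeta r ^ k = cis (2 * pi * real k / real r)"
  by (simp add: zeta_def cis_conv_exp exp_of_nat_mult[symmetric] mult_ac)

lemma zeta_r: "1 \<le> r \<Longrightarrow> zeta r ^ r = 1"
  by (simp add: zeta_power)

lemma zeta_inj: "1 \<le> r \<Longrightarrow> i < r \<Longrightarrow> j < r \<Longrightarrow> zeta r ^ i = zeta r ^ j \<Longrightarrow> i = j"
  using bij_betw_roots_unity[of r] by (auto simp: zeta_power bij_betw_def inj_on_def)

text \<open>Orthogonality of the characters of the cyclic group of order \<open>r\<close>.\<close>
lemma zeta_sum:
  assumes r: "1 \<le> r" and ij: "i < r" "j < r"
  shows "(\<Sum>s<r. (zeta r ^ i) ^ s * (zeta r ^ j) ^ (r - s)) / of_nat r = (if i = j then 1 else 0)"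
proof -
  let ?x = "zeta r ^ i" and ?y = "zeta r ^ j"
  have xr: "?x ^ r = 1" "?y ^ r = 1" using zeta_r[OF r] by (simp_all add: power_mult[symmetric] mult.commute[of _ r] power_mult)
  have y0: "?y \<noteq> 0" using xr(2) r by (metis not_one_le_zero power_0_left zero_neq_one)
  have "?x ^ s * ?y ^ (r - s) = (?x / ?y) ^ s" if "s < r" for s
    using y0 xr that by (simp add: power_diff power_divide)
  then have 1: "(\<Sum>s<r. ?x ^ s * ?y ^ (r - s)) = (\<Sum>s<r. (?x / ?y) ^ s)" by simp
  show ?thesis
  proof (cases "i = j")
    case True
    then have "?x / ?y = 1" using y0 by simp
    then show ?thesis unfolding 1 using True r by (simp only: power_one) simp
  next
    case False
    then have "?x / ?y \<noteq> 1" using zeta_inj[OF r ij] y0 by auto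
    moreover have "(?x / ?y) ^ r = 1" using xr by (simp add: power_divide)
    ultimately show ?thesis unfolding 1 using False by (simp add: geometric_sum)
  qed
qed

lemma const_simps: "const 0 = 0" "const 1 = 1" "const (a + b) = const a + const b" "const (a * b) = const a * const b"
  by (simp_all add: const_def single_add mult_single)

lemma const_sum: "const (sum f S) = (\<Sum>i\<in>S. const (f i))"
  by (induction S rule: infinite_finite_induct) (auto simp: const_simps)

lemma const_power: "const (a ^ k) = const a ^ k"
  by (induction k) (auto simp: const_simps)

lemma scal_power: "scal (a ^ k) = scal a ^ k"
  by (induction k) (auto simp: scal_simps)

lemma scal_sum: "scal (sum f S) = (\<Sum>i\<in>S. scal (f i))"
  by (induction S rule: infinite_finite_induct) (auto simp: scal_simps)

lemma lvar_inv: "lvar i (-1) * lv i = 1"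
  by (simp add: lvar_def mult_single single_add[symmetric])

lemma base_coeffs_mult: "a \<in> base_coeffs r \<Longrightarrow> b \<in> base_coeffs r \<Longrightarrow> a * b \<in> base_coeffs r"
  unfolding base_coeffs_def using generate_ring.eng_mult[of a ring_of_type_algebra _ b]
  by (simp add: ring_of_type_algebra_def)

lemma zeta_base: "zeta r ^ k \<in> base_coeffs r"
proof (induction k)
  case (Suc k)
  have "zeta r \<in> base_coeffs r" unfolding base_coeffs_def by (rule generate_ring.incl) simp
  then show ?case using Suc base_coeffs_mult by simp
qed (simp add: base_coeffs_01)

lemma const_base: "a \<in> base_coeffs r \<Longrightarrow> const a \<in> carrier (base_ring r d)"
  using base_coeffs_01 by (auto simp: base_ring_def monoid_ring_simps const_def lookup_single when_def split: if_splits)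

lemma poly_mapping_expansion: "(\<Sum>v\<in>Poly_Mapping.keys f. Poly_Mapping.single v (Poly_Mapping.lookup f v)) = f"
  by (rule poly_mapping_eqI) (simp add: lookup_sum lookup_single when_def in_keys_iff)

lemma scal_comm: "scal a * f = f * scal a"
proof (rule poly_mapping_eqI)
  fix w
  have 1: "Poly_Mapping.lookup (scal a * f) w = a * Poly_Mapping.lookup f w"
    unfolding scal_def mult_map_scale_conv_mult[symmetric]
    by (simp add: Poly_Mapping.map.rep_eq when_def)
  have "f * scal a = (\<Sum>v\<in>Poly_Mapping.keys f. Poly_Mapping.single v (Poly_Mapping.lookup f v)) * scal a"
    by (simp only: poly_mapping_expansion)
  also have "\<dots> = (\<Sum>v\<in>Poly_Mapping.keys f. Poly_Mapping.single v (a * Poly_Mapping.lookup f v))"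
    by (simp add: sum_distrib_right scal_def mult_single mult.commute)
  finally have "Poly_Mapping.lookup (f * scal a) w = (\<Sum>v\<in>Poly_Mapping.keys f. (a * Poly_Mapping.lookup f v) when v = w)"
    by (simp add: lookup_sum lookup_single)
  also have "\<dots> = a * Poly_Mapping.lookup f w"
    by (simp add: when_def in_keys_iff)
  finally show "Poly_Mapping.lookup (scal a * f) w = Poly_Mapping.lookup (f * scal a) w" using 1 by simp
qed

locale yh_parameters =
  fixes r d :: nat
  assumes r: "1 \<le> r" and d: "1 \<le> d"
begin

abbreviation "F n \<equiv> carrier (free_alg r d n)"

text \<open>\<open>cl n f\<close> is the class of \<open>f\<close> at level \<open>n\<close>, with zeros in all other components, so that \<open>u n\<close> is the central idempotent of level
\<open>n\<close>.  In \<open>c1 n f\<close> the other components are \<open>1\<close>; this is used for generators, whose relations (such as invertibility) have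
to hold in every component.\<close>
definition cl :: "nat \<Rightarrow> yh_poly \<Rightarrow> yh_prod" where "cl n f = emb r d n (cyc_class r d n f)"
definition u :: "nat \<Rightarrow> yh_prod" where "u n = cl n 1"
definition c1 :: "nat \<Rightarrow> yh_poly \<Rightarrow> yh_prod" where "c1 n f = cl n f + (1 - u n)"

lemma class_closed: "f \<in> F n \<Longrightarrow> cyc_class r d n f \<in> carrier (cyc_YH r d n)"
  by (rule ring_hom_closed[OF cyc_class_hom])

lemma cl_add: "f \<in> F n \<Longrightarrow> h \<in> F n \<Longrightarrow> cl n (f + h) = cl n f + cl n h"
  and cl_mult: "f \<in> F n \<Longrightarrow> h \<in> F n \<Longrightarrow> cl n (f * h) = cl n f * cl n h"
  and cl_0: "cl n 0 = 0"
proof -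
  note h = ring_hom_memE[OF cyc_class_hom[of r d n], unfolded free_simps]
  show "f \<in> F n \<Longrightarrow> h \<in> F n \<Longrightarrow> cl n (f + h) = cl n f + cl n h"
    "f \<in> F n \<Longrightarrow> h \<in> F n \<Longrightarrow> cl n (f * h) = cl n f * cl n h"
    unfolding cl_def by (simp_all add: h emb_ops class_closed)
  have "cyc_class r d n 0 = \<zero>\<^bsub>cyc_YH r d n\<^esub>"
    using ring_hom_zero[OF cyc_class_hom ring_free_alg ring_cyc_YH, of r d n] by (simp add: free_simps)
  then show "cl n 0 = 0" unfolding cl_def
    by (simp add: emb_ops(3)[OF class_closed class_closed, OF free_closed(1) free_closed(1)])
qed

lemma cl_diff: "f \<in> F n \<Longrightarrow> h \<in> F n \<Longrightarrow> cl n (f - h) = cl n f - cl n h"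
proof -
  assume f: "f \<in> F n" "h \<in> F n"
  have "cl n (f - h + h) = cl n (f - h) + cl n h" by (intro cl_add free_closed f)
  then show ?thesis by (simp add: eq_diff_eq)
qed

lemma cl_sum: "(\<And>i. i \<in> S \<Longrightarrow> f i \<in> F n) \<Longrightarrow> cl n (sum f S) = (\<Sum>i\<in>S. cl n (f i))"
  by (induction S rule: infinite_finite_induct) (auto simp: cl_0 cl_add free_sum_closed)

lemma emb_eq_cl: "x \<in> carrier (cyc_YH r d n) \<Longrightarrow> \<exists>f\<in>F n. emb r d n x = cl n f \<and> x = cyc_class r d n f"
  unfolding cyc_class_surj cl_def by blast

lemma cl_eq: "f \<in> F n \<Longrightarrow> h \<in> F n \<Longrightarrow> cl n f = cl n h \<Longrightarrow> cyc_class r d n f = cyc_class r d n h"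
  unfolding cl_def by (rule emb_inj[OF class_closed class_closed])

lemma cl_rel: "f \<in> yh_relations r n \<Longrightarrow> cl n f = 0"
  and cl_cyc: "n \<noteq> 0 \<Longrightarrow> cl n (cyc_poly d) = 0"
  unfolding cl_def
  by (simp_all add: cyc_class_relations emb_ops(3)[OF class_closed class_closed, OF free_closed(1) free_closed(1)])

lemma u_mult: "u n * y = emb r d n (cmp y (r, d, n))" "y * u n = emb r d n (cmp y (r, d, n))"
proof -
  interpret R: ring "cyc_YH r d n" by (rule ring_cyc_YH)
  have 1: "u n = emb r d n \<one>\<^bsub>cyc_YH r d n\<^esub>"
    using ring_hom_memE(4)[OF cyc_class_hom[of r d n]] by (simp add: u_def cl_def free_simps)
  have z: "\<zero>\<^bsub>cyc_YH r' d' n'\<^esub> \<otimes>\<^bsub>cyc_YH r' d' n'\<^esub> cmp y (r', d', n') = \<zero>\<^bsub>cyc_YH r' d' n'\<^esub>"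
     "cmp y (r', d', n') \<otimes>\<^bsub>cyc_YH r' d' n'\<^esub> \<zero>\<^bsub>cyc_YH r' d' n'\<^esub> = \<zero>\<^bsub>cyc_YH r' d' n'\<^esub>" for r' d' n'
  proof -
    interpret R': ring "cyc_YH r' d' n'" by (rule ring_cyc_YH)
    show "\<zero>\<^bsub>cyc_YH r' d' n'\<^esub> \<otimes>\<^bsub>cyc_YH r' d' n'\<^esub> cmp y (r', d', n') = \<zero>\<^bsub>cyc_YH r' d' n'\<^esub>"
     "cmp y (r', d', n') \<otimes>\<^bsub>cyc_YH r' d' n'\<^esub> \<zero>\<^bsub>cyc_YH r' d' n'\<^esub> = \<zero>\<^bsub>cyc_YH r' d' n'\<^esub>" by (simp_all add: cmp_closed)
  qed
  show "u n * y = emb r d n (cmp y (r, d, n))" "y * u n = emb r d n (cmp y (r, d, n))"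
    by (rule yh_eqI; simp add: 1 cmp_emb cmp_ops cmp_closed z)+
qed

lemma u_central: "u n * y = y * u n" by (simp add: u_mult)

lemma u_ex: "\<exists>f\<in>F n. u n * y = cl n f"
  using emb_eq_cl[OF cmp_closed] unfolding u_mult by blast

lemma u_cl: "f \<in> F n \<Longrightarrow> u n * cl n f = cl n f" "f \<in> F n \<Longrightarrow> cl n f * u n = cl n f"
  unfolding u_def by (simp_all add: cl_mult[symmetric] free_closed)

lemma u_idem: "u n * u n = u n" using u_cl(1)[of 1 n] by (simp add: u_def free_closed)

lemma cl_c1: "f \<in> F n \<Longrightarrow> h \<in> F n \<Longrightarrow> cl n f * c1 n h = cl n (f * h)"
  "f \<in> F n \<Longrightarrow> h \<in> F n \<Longrightarrow> c1 n f * cl n h = cl n (f * h)"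
  "h \<in> F n \<Longrightarrow> u n * c1 n h = cl n h"
  unfolding c1_def by (simp_all add: distrib_left distrib_right right_diff_distrib left_diff_distrib u_cl cl_mult u_idem)

lemma c1_mult: "f \<in> F n \<Longrightarrow> h \<in> F n \<Longrightarrow> c1 n (f * h) = c1 n f * c1 n h"
  unfolding c1_def by (simp add: distrib_left distrib_right right_diff_distrib left_diff_distrib u_cl u_idem cl_mult)

lemma c1_1: "c1 n 1 = 1" by (simp add: c1_def u_def)

lemma c1_power: "f \<in> F n \<Longrightarrow> c1 n (f ^ k) = c1 n f ^ k"
  by (induction k) (simp_all add: c1_1 c1_mult free_closed)

lemma c1_eq: "cl n f = cl n h \<Longrightarrow> c1 n f = c1 n h" by (simp add: c1_def)

lemma c1_diff: "f \<in> F n \<Longrightarrow> h \<in> F n \<Longrightarrow> c1 n f - c1 n h = cl n (f - h)"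
  by (simp add: c1_def cl_diff)

lemma cl_rel_eq: "f - h \<in> yh_relations r n \<Longrightarrow> f \<in> F n \<Longrightarrow> h \<in> F n \<Longrightarrow> cl n f = cl n h"
  using cl_rel[of "f - h" n] cl_diff[of f n h] by simp

lemma c1_rel: "f - h \<in> yh_relations r n \<Longrightarrow> f \<in> F n \<Longrightarrow> h \<in> F n \<Longrightarrow> c1 n f = c1 n h"
  by (rule c1_eq) (rule cl_rel_eq)

lemma scal_F: "a \<in> carrier (base_ring r d) \<Longrightarrow> scal a \<in> F n" by (rule scal_closed)

lemma cl_scal_central: assumes "a \<in> carrier (base_ring r d)" shows "cl n (scal a) * y = y * cl n (scal a)"
proof -
  obtain f where f: "f \<in> F n" "u n * y = cl n f" using u_ex by blast
  have a: "scal a \<in> F n" using scal_F[OF assms] .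
  have "cl n (scal a) * y = cl n (scal a) * (u n * y)" by (simp add: mult.assoc[symmetric] u_cl a)
  also have "\<dots> = (u n * y) * cl n (scal a)" unfolding f(2) using a f by (simp add: cl_mult[symmetric] scal_comm)
  also have "\<dots> = y * cl n (scal a)" unfolding u_central by (simp add: mult.assoc u_cl a)
  finally show ?thesis .
qed

lemma c1_scal_central: "a \<in> carrier (base_ring r d) \<Longrightarrow> c1 n (scal a) * y = y * c1 n (scal a)"
  unfolding c1_def using cl_scal_central[of a n y] u_central[of n y]
  by (simp add: distrib_left distrib_right right_diff_distrib left_diff_distrib)

text \<open>The data for the locale \<open>yokonuma\<close> at level \<open>n\<close>; values outside the range of the indices are set to \<open>1\<close>.  Level \<open>0\<close> has no
\<open>X\<^sub>1\<close>, and there \<open>v\<^sub>1\<close> takes its place: it is invertible and satisfies the cyclotomic relation.  The constants \<open>1/r\<close>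
and \<open>q - q\<^sup>-\<^sup>1\<close> vanish outside level \<open>n\<close>, which reduces the quadratic relation there to \<open>1 * 1 = 1\<close>.\<close>
definition tt :: "nat \<Rightarrow> nat \<Rightarrow> yh_prod" where "tt n j = (if 1 \<le> j \<and> j \<le> n then c1 n (yt j) else 1)"
definition gg :: "nat \<Rightarrow> nat \<Rightarrow> yh_prod" where "gg n i = (if 1 \<le> i \<and> i < n then c1 n (yg i) else 1)"
definition xx :: "nat \<Rightarrow> yh_prod" where "xx n = (if n = 0 then c1 n (scal (lv 1)) else c1 n yX)"
definition xi :: "nat \<Rightarrow> yh_prod" where "xi n = (if n = 0 then c1 n (scal (lvar 1 (-1))) else c1 n yXinv)"
definition vv :: "nat \<Rightarrow> nat \<Rightarrow> yh_prod" where "vv n i = (if i \<le> d then c1 n (scal (lv i)) else 1)"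
definition vvi :: "nat \<Rightarrow> nat \<Rightarrow> yh_prod" where "vvi n i = (if i \<le> d then c1 n (scal (lvar i (-1))) else 1)"
definition kk :: "nat \<Rightarrow> yh_prod" where "kk n = cl n (scal (const (1 / of_nat r)))"
definition cc :: "nat \<Rightarrow> yh_prod" where "cc n = cl n (scal (lq - lq_inv))"
definition om :: "nat \<Rightarrow> nat \<Rightarrow> yh_prod" where "om n k = c1 n (scal (const (zeta r ^ k)))"

lemma base_mems:
  "const (1 / of_nat r) \<in> carrier (base_ring r d)" "lq - lq_inv \<in> carrier (base_ring r d)"
  "i \<le> d \<Longrightarrow> lvar i k \<in> carrier (base_ring r d)" "const (zeta r ^ k') \<in> carrier (base_ring r d)"
  by (auto intro: base_mem base_diff const_base zeta_base)

lemma letters_F: "1 \<le> j \<Longrightarrow> j \<le> n \<Longrightarrow> yt j \<in> F n" "1 \<le> i \<Longrightarrow> i < n \<Longrightarrow> yg i \<in> F n" "n \<noteq> 0 \<Longrightarrow> yX \<in> F n" "n \<noteq> 0 \<Longrightarrow> yXinv \<in> F n"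
  by (auto intro!: letter_closed simp: gens_def)

lemma kk_r: "kk n * of_nat r = u n"
proof -
  have "kk n * of_nat r = (\<Sum>s<r. kk n)" by (simp add: mult_of_nat_commute)
  also have "\<dots> = cl n (scal (const (\<Sum>s<r. 1 / of_nat r)))"
    unfolding kk_def const_sum scal_sum by (subst cl_sum) (simp_all add: scal_F base_mems)
  also have "(\<Sum>s<r. 1 / of_nat r :: complex) = 1" using r by simp
  finally show ?thesis by (simp add: const_simps scal_simps u_def)
qed

lemma ye_F: "1 \<le> i \<Longrightarrow> i < n \<Longrightarrow> ye r i \<in> F n"
  unfolding ye_def by (intro free_closed free_sum_closed scal_F base_mems letters_F) auto

lemma kk_sum:
  assumes "\<And>s. s < r \<Longrightarrow> f s \<in> F n"
  shows "kk n * (\<Sum>s<r. c1 n (f s)) = cl n (scal (const (1 / of_nat r)) * (\<Sum>s<r. f s))"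
proof -
  have "kk n * (\<Sum>s<r. c1 n (f s)) = (\<Sum>s<r. cl n (scal (const (1 / of_nat r)) * f s))"
    unfolding sum_distrib_left kk_def by (rule sum.cong) (simp_all add: cl_c1 scal_F base_mems assms)
  then show ?thesis unfolding sum_distrib_left
    by (subst cl_sum) (auto intro!: free_closed scal_F base_mems assms)
qed

lemma yokonuma: "yokonuma r d n (tt n) (gg n) (xx n) (xi n) (vv n) (vvi n) (kk n) (cc n)"
proof
  show "1 \<le> r" "1 \<le> d" by (rule r, rule d)
  show "kk n * y = y * kk n" "cc n * y = y * cc n" "vv n i * y = y * vv n i" "vvi n i * y = y * vvi n i" for y i
    unfolding kk_def cc_def vv_def vvi_def
    by (auto intro: cl_scal_central c1_scal_central base_mems)
  show "vvi n i * vv n i = 1" if "1 \<le> i" "i \<le> d" for i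
    using that unfolding vv_def vvi_def
    by (simp add: c1_mult[symmetric] scal_F base_mems scal_simps(4)[symmetric] lvar_inv) (simp add: scal_simps c1_1)
  show "kk n * of_nat r * kk n = kk n" unfolding kk_r unfolding kk_def by (simp add: u_cl scal_F base_mems)
  show "kk n * of_nat r * cc n = cc n" unfolding kk_r unfolding cc_def by (simp add: u_cl scal_F base_mems)
  show "gg n i * gg n j = gg n j * gg n i" if "1 \<le> i" "i < n" "1 \<le> j" "j < n" "i + 2 \<le> j \<or> j + 2 \<le> i" for i j
  proof -
    have "yg i * yg j - yg j * yg i \<in> yh_relations r n" using that unfolding yh_relations_def by blast
    from c1_rel[OF this] show ?thesis using that
      by (simp add: gg_def c1_mult letters_F free_closed)
  qed
  show "gg n i * gg n (i + 1) * gg n i = gg n (i + 1) * gg n i * gg n (i + 1)" if "1 \<le> i" "i + 1 < n" for i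
  proof -
    have "yg i * yg (i + 1) * yg i - yg (i + 1) * yg i * yg (i + 1) \<in> yh_relations r n"
      using that unfolding yh_relations_def by blast
    from c1_rel[OF this] show ?thesis using that
      by (simp add: gg_def c1_mult letters_F free_closed)
  qed
  show "tt n i * tt n j = tt n j * tt n i" if "1 \<le> i" "i \<le> n" "1 \<le> j" "j \<le> n" for i j
  proof -
    have "yt i * yt j - yt j * yt i \<in> yh_relations r n" using that unfolding yh_relations_def by blast
    from c1_rel[OF this] show ?thesis using that
      by (simp add: tt_def c1_mult letters_F free_closed)
  qed
  show "gg n i * tt n j = tt n (Transposition.transpose i (i + 1) j) * gg n i" if "1 \<le> i" "i < n" "1 \<le> j" "j \<le> n" for i j
  proof -
    let ?s = "Transposition.transpose i (i + 1) j"
    have s: "1 \<le> ?s" "?s \<le> n" using that by (auto simp: Transposition.transpose_def)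
    have "yg i * yt j - yt ?s * yg i \<in> yh_relations r n" using that unfolding yh_relations_def by blast
    from c1_rel[OF this] show ?thesis using that s
      by (simp add: tt_def gg_def c1_mult letters_F free_closed)
  qed
  show "tt n j ^ r = 1" if "1 \<le> j" "j \<le> n" for j
  proof -
    have "yt j ^ r - 1 \<in> yh_relations r n" using that unfolding yh_relations_def by blast
    from cl_rel_eq[OF this] have "c1 n (yt j ^ r) = c1 n 1" using that by (intro c1_eq) (simp add: letters_F free_closed)
    then show ?thesis using that by (simp add: tt_def c1_power letters_F c1_1)
  qed
  show "gg n i * gg n i = 1 + cc n * (kk n * (\<Sum>s<r. tt n i ^ s * tt n (i + 1) ^ (r - s))) * gg n i" if i: "1 \<le> i" "i < n" for i
  proof -
    have "yg i ^ 2 - (1 + scal (lq - lq_inv) * ye r i * yg i) \<in> yh_relations r n"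
      using i unfolding yh_relations_def by blast
    from cl_rel_eq[OF this] have 1: "cl n (yg i * yg i) = cl n (1 + scal (lq - lq_inv) * ye r i * yg i)"
      using i by (simp add: letters_F free_closed ye_F scal_F base_mems power2_eq_square)
    have "(\<Sum>s<r. tt n i ^ s * tt n (i + 1) ^ (r - s)) = (\<Sum>s<r. c1 n (yt i ^ s * yt (i + 1) ^ (r - s)))"
      using i by (simp add: tt_def c1_power c1_mult letters_F free_closed)
    then have 2: "kk n * (\<Sum>s<r. tt n i ^ s * tt n (i + 1) ^ (r - s)) = cl n (ye r i)"
      using i kk_sum[of "\<lambda>s. yt i ^ s * yt (i + 1) ^ (r - s)" n] by (simp add: ye_def letters_F free_closed)
    have "gg n i * gg n i = cl n (yg i * yg i) + (1 - u n)"
      using i by (simp add: gg_def c1_mult[symmetric] letters_F) (simp add: c1_def)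
    also have "\<dots> = 1 + cl n (scal (lq - lq_inv) * ye r i * yg i)"
      unfolding 1 using i by (simp add: cl_add letters_F free_closed ye_F scal_F base_mems u_def)
    also have "cl n (scal (lq - lq_inv) * ye r i * yg i) = cc n * cl n (ye r i) * gg n i"
      using i by (simp add: gg_def cc_def cl_mult[symmetric] cl_c1 letters_F free_closed ye_F scal_F base_mems)
    finally show ?thesis unfolding 2 .
  qed
  show "xx n * xi n = 1" "xi n * xx n = 1"
  proof -
    have "c1 n (yX * yXinv) = c1 n 1" "c1 n (yXinv * yX) = c1 n 1" if "n \<noteq> 0"
      using that by (intro c1_rel; simp add: yh_relations_def letters_F free_closed)+
    moreover have l: "lv 1 * lvar 1 (-1) = 1" using lvar_inv[of 1] by (simp only: mult.commute)
    have "scal (lv 1) * scal (lvar 1 (-1)) = 1" "scal (lvar 1 (-1)) * scal (lv 1) = 1"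
      unfolding scal_simps(4)[symmetric] l lvar_inv by (rule scal_simps)+
    ultimately show "xx n * xi n = 1" "xi n * xx n = 1" using d
      by (auto simp: xx_def xi_def c1_mult[symmetric] letters_F scal_F base_mems c1_1)
  qed
  show "gg n 1 * xx n * gg n 1 * xx n = xx n * gg n 1 * xx n * gg n 1" if "2 \<le> n"
  proof -
    have "yg 1 * yX * yg 1 * yX - yX * yg 1 * yX * yg 1 \<in> yh_relations r n" using that unfolding yh_relations_def by simp
    from c1_rel[OF this] show ?thesis using that
      by (simp add: gg_def xx_def c1_mult letters_F free_closed)
  qed
  show "gg n i * xx n = xx n * gg n i" if "2 \<le> i" "i < n" for i
  proof -
    have "yg i * yX - yX * yg i \<in> yh_relations r n" using that unfolding yh_relations_def by blast
    from c1_rel[OF this] show ?thesis using that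
      by (simp add: gg_def xx_def c1_mult letters_F free_closed)
  qed
  show "tt n j * xx n = xx n * tt n j" if "1 \<le> j" "j \<le> n" for j
  proof -
    have "yt j * yX - yX * yt j \<in> yh_relations r n" using that unfolding yh_relations_def by blast
    from c1_rel[OF this] show ?thesis using that
      by (simp add: tt_def xx_def c1_mult letters_F free_closed)
  qed
  show "prod_list (map (\<lambda>i. xx n - vv n i) [1..<d + 1]) = 0"
  proof (cases "n = 0")
    case True
    have "xx n - vv n 1 = 0" using True d by (simp add: xx_def vv_def)
    moreover have "[1..<d + 1] = 1 # [2..<d + 1]" using d by (simp add: upt_rec numeral_2_eq_2)
    ultimately show ?thesis by simp
  next
    case False
    have *: "prod_list (map (\<lambda>i. xx n - vv n i) (i # is)) = cl n (prod_list (map (\<lambda>i. yX - scal (lv i)) (i # is)))"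
      if "set (i # is) \<subseteq> {..d}" for i "is"
      using that
    proof (induction "is" arbitrary: i)
      case Nil
      then show ?case using False by (simp add: xx_def vv_def c1_diff letters_F scal_F base_mems)
    next
      case (Cons j js)
      have "prod_list (map (\<lambda>i. yX - scal (lv i)) (j # js)) \<in> F n"
        using Cons.prems False by (auto intro!: free_prod_list_closed free_closed letters_F scal_F base_mems)
      then show ?case using Cons.IH[of j] Cons.prems False
        by (simp add: xx_def vv_def c1_diff letters_F scal_F base_mems cl_mult free_closed)
    qed
    have "prod_list (map (\<lambda>i. xx n - vv n i) (1 # [2..<d + 1])) = cl n (prod_list (map (\<lambda>i. yX - scal (lv i)) (1 # [2..<d + 1])))"
    proof -
      have "set (1 # [2..<d + 1]) \<subseteq> {..d}"
        using d by (intro subsetI) (auto simp del: upt_Suc)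
      then show ?thesis by (rule *)
    qed
    moreover have "[1..<d + 1] = 1 # [2..<d + 1]" using d by (simp add: upt_rec numeral_2_eq_2)
    ultimately show ?thesis using cl_cyc[OF False] by (simp only: cyc_poly_def)
  qed
qed

lemma om_central: "om n k * y = y * om n k"
  unfolding om_def by (rule c1_scal_central) (rule base_mems)

lemma om_r: "om n k ^ r = 1"
proof -
  have "(zeta r ^ k) ^ r = 1" using zeta_r[OF r] by (simp add: power_mult[symmetric] mult.commute[of _ r] power_mult)
  then show ?thesis
    by (simp add: om_def c1_power[symmetric] scal_F base_mems scal_power[symmetric] const_power[symmetric])
       (simp add: const_simps scal_simps c1_1)
qed

sublocale eig: yokonuma_eigen r d n "tt n" "gg n" "xx n" "xi n" "vv n" "vvi n" "kk n" "cc n" "om n k" for n k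
  by (intro yokonuma_eigen.intro yokonuma yokonuma_eigen_axioms.intro om_central om_r)

lemma zeta_F: "scal (const ((zeta r ^ i) ^ s)) \<in> F n"
  unfolding power_mult[symmetric] by (rule scal_F) (rule base_mems)

text \<open>The idempotents for different eigenvalues are orthogonal: evaluated on scalars, \<open>avg\<close> is the character sum \<open>zeta_sum\<close>.\<close>
lemma avg_om:
  assumes "i < r" "j < r" shows "eig.avg n (om n i) (om n j) = (if i = j then u n else 0)"
proof -
  have "eig.avg n (om n i) (om n j) = kk n * (\<Sum>s<r. c1 n (scal (const ((zeta r ^ i) ^ s * (zeta r ^ j) ^ (r - s)))))"
    unfolding eig.avg_def om_def
    by (simp add: c1_power[symmetric] c1_mult[symmetric] scal_F base_mems zeta_F const_power[symmetric]
        scal_power[symmetric]) (simp add: c1_mult[symmetric] const_simps(4) scal_simps(4) zeta_F)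
  also have "\<dots> = cl n (scal (const (1 / of_nat r * (\<Sum>s<r. (zeta r ^ i) ^ s * (zeta r ^ j) ^ (r - s)))))"
    unfolding const_simps(4)[of "1 / of_nat r"] scal_simps(4)[of "const (1 / of_nat r)"] const_sum scal_sum
    by (rule kk_sum) (simp add: scal_F const_base base_coeffs_mult zeta_base power_mult[symmetric])
  also have "1 / of_nat r * (\<Sum>s<r. (zeta r ^ i) ^ s * (zeta r ^ j) ^ (r - s)) = (if i = j then 1 else 0)"
    using zeta_sum[OF r assms] by simp
  finally show ?thesis by (simp add: const_simps scal_simps u_def cl_0)
qed

text \<open>The eigenvalue idempotents add up to the identity of level \<open>n\<close>: after exchanging the sums only the power \<open>s = 0\<close> survives.\<close>
lemma sum_eps:
  assumes "1 \<le> j" "j \<le> n" shows "(\<Sum>k<r. eig.\<epsilon> n k j) = u n"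
proof -
  have 1: "kk n * (\<Sum>k<r. om n k ^ (r - s)) = (if s = 0 then u n else 0)" if "s < r" for s
  proof -
    have "kk n * (\<Sum>k<r. om n k ^ (r - s)) = kk n * (\<Sum>k<r. c1 n (scal (const ((zeta r ^ (r - s)) ^ k))))"
      unfolding om_def
      by (simp add: c1_power[symmetric] scal_F base_mems scal_power[symmetric] const_power[symmetric] power_mult[symmetric] mult.commute)
    also have "\<dots> = cl n (scal (const (1 / of_nat r * (\<Sum>k<r. (zeta r ^ (r - s)) ^ k))))"
      unfolding const_simps(4)[of "1 / of_nat r"] scal_simps(4)[of "const (1 / of_nat r)"] const_sum scal_sum
      by (rule kk_sum) (simp add: scal_F const_base zeta_base power_mult[symmetric])
    also have "(\<Sum>k<r. (zeta r ^ (r - s)) ^ k) = (if s = 0 then of_nat r else 0)"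
    proof (cases "s = 0")
      case True then show ?thesis by (simp add: zeta_r[OF r])
    next
      case False
      then have "zeta r ^ (r - s) \<noteq> 1" using zeta_inj[OF r, of "r - s" 0] that by auto
      moreover have "(zeta r ^ (r - s)) ^ r = 1"
        using zeta_r[OF r] by (simp add: power_mult[symmetric] mult.commute[of _ r] power_mult)
      ultimately show ?thesis using False by (simp add: geometric_sum)
    qed
    finally show ?thesis using r by (simp add: const_simps scal_simps u_def cl_0)
  qed
  have "(\<Sum>k<r. eig.\<epsilon> n k j) = (\<Sum>s<r. tt n j ^ s * (kk n * (\<Sum>k<r. om n k ^ (r - s))))"
    unfolding eig.\<epsilon>_def eig.avg_def sum_distrib_left eig.mult_\<kappa> by (rule sum.swap)
  also have "\<dots> = (\<Sum>s<r. if s = 0 then u n else 0)" by (rule sum.cong) (simp_all add: 1)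
  also have "\<dots> = u n" using r by simp
  finally show ?thesis .
qed

end

section \<open>The action of a cyclotomic algebra on columns over the level below\<close>

text \<open>The additive endomorphisms of \<open>V\<close>, restricted to \<open>V\<close> so that equality of functions is equality on \<open>V\<close>.  The universal
property \<open>cyc_class_factor\<close> of the cyclotomic algebra needs a target ring with a carrier set.\<close>
definition end_ring :: "'v::ab_group_add set \<Rightarrow> ('v \<Rightarrow> 'v) ring" where
  "end_ring V = \<lparr>carrier = {f \<in> V \<rightarrow>\<^sub>E V. \<forall>x\<in>V. \<forall>y\<in>V. f (x + y) = f x + f y},
     monoid.mult = (\<lambda>f h. \<lambda>x\<in>V. f (h x)), one = (\<lambda>x\<in>V. x), ring.zero = (\<lambda>x\<in>V. 0),
     add = (\<lambda>f h. \<lambda>x\<in>V. f x + h x)\<rparr>"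

lemma ring_end_ring:
  assumes V: "0 \<in> V" "\<And>x y. x \<in> V \<Longrightarrow> y \<in> V \<Longrightarrow> x + y \<in> V" "\<And>x. x \<in> V \<Longrightarrow> - x \<in> V"
  shows "ring (end_ring V)"
proof (rule ringI)
  have mem: "f x \<in> V" if "f \<in> carrier (end_ring V)" "x \<in> V" for f x using that by (auto simp: end_ring_def)
  have ad: "f (x + y) = f x + f y" if "f \<in> carrier (end_ring V)" "x \<in> V" "y \<in> V" for f x y
    using that by (auto simp: end_ring_def)
  have ext: "f = h" if "f \<in> carrier (end_ring V)" "h \<in> carrier (end_ring V)" "\<And>x. x \<in> V \<Longrightarrow> f x = h x" for f h
    using that by (intro PiE_ext[of f V "\<lambda>_. V"]) (auto simp: end_ring_def)
  have I: "(\<lambda>x\<in>V. f x) \<in> carrier (end_ring V)" if "\<And>x. x \<in> V \<Longrightarrow> f x \<in> V" "\<And>x y. x \<in> V \<Longrightarrow> y \<in> V \<Longrightarrow> f (x + y) = f x + f y" for f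
    using that V by (auto simp: end_ring_def)
  have ap: "(f \<oplus>\<^bsub>end_ring V\<^esub> h) x = f x + h x" "(f \<otimes>\<^bsub>end_ring V\<^esub> h) x = f (h x)" "\<one>\<^bsub>end_ring V\<^esub> x = x" "\<zero>\<^bsub>end_ring V\<^esub> x = 0"
    if "x \<in> V" for f h x using that by (auto simp: end_ring_def)
  have c: "f \<oplus>\<^bsub>end_ring V\<^esub> h \<in> carrier (end_ring V)" "f \<otimes>\<^bsub>end_ring V\<^esub> h \<in> carrier (end_ring V)"
    if "f \<in> carrier (end_ring V)" "h \<in> carrier (end_ring V)" for f h
  proof -
    have "(\<lambda>x\<in>V. f x + h x) \<in> carrier (end_ring V)"
      by (rule I) (simp_all add: V mem[OF that(1)] mem[OF that(2)] ad[OF that(1)] ad[OF that(2)] add_ac)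
    moreover have "(\<lambda>x\<in>V. f (h x)) \<in> carrier (end_ring V)"
      by (rule I) (simp_all add: mem[OF that(1)] mem[OF that(2)] ad[OF that(1)] ad[OF that(2)])
    ultimately show "f \<oplus>\<^bsub>end_ring V\<^esub> h \<in> carrier (end_ring V)" "f \<otimes>\<^bsub>end_ring V\<^esub> h \<in> carrier (end_ring V)"
      by (simp_all add: end_ring_def)
  qed
  have o: "\<one>\<^bsub>end_ring V\<^esub> \<in> carrier (end_ring V)" "\<zero>\<^bsub>end_ring V\<^esub> \<in> carrier (end_ring V)"
    using V by (auto simp: end_ring_def)
  show "abelian_group (end_ring V)"
  proof (rule abelian_groupI)
    fix f assume f: "f \<in> carrier (end_ring V)"
    have m: "f (- x) = - f x" if "x \<in> V" for x
    proof -
      have "f 0 = 0" using ad[OF f V(1,1)] by simp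
      moreover have "f (x + - x) = f x + f (- x)" using that V by (intro ad[OF f]) auto
      ultimately show ?thesis by (simp add: eq_neg_iff_add_eq_0 add.commute)
    qed
    have n: "(\<lambda>x\<in>V. - f x) \<in> carrier (end_ring V)" by (rule I) (simp_all add: V mem[OF f] ad[OF f])
    show "\<exists>h\<in>carrier (end_ring V). h \<oplus>\<^bsub>end_ring V\<^esub> f = \<zero>\<^bsub>end_ring V\<^esub>"
      by (rule bexI[OF _ n]) (rule ext, auto simp: ap c n f o)
  qed (auto intro!: ext simp: ap c o add_ac)
  show "Group.monoid (end_ring V)"
    by (rule monoidI) (auto intro!: ext simp: ap c o mem)
  fix f h k assume fh: "f \<in> carrier (end_ring V)" "h \<in> carrier (end_ring V)" "k \<in> carrier (end_ring V)"
  show "(f \<oplus>\<^bsub>end_ring V\<^esub> h) \<otimes>\<^bsub>end_ring V\<^esub> k = f \<otimes>\<^bsub>end_ring V\<^esub> k \<oplus>\<^bsub>end_ring V\<^esub> h \<otimes>\<^bsub>end_ring V\<^esub> k"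
    by (rule ext) (simp_all add: fh c ap mem)
  show "k \<otimes>\<^bsub>end_ring V\<^esub> (f \<oplus>\<^bsub>end_ring V\<^esub> h) = k \<otimes>\<^bsub>end_ring V\<^esub> f \<oplus>\<^bsub>end_ring V\<^esub> k \<otimes>\<^bsub>end_ring V\<^esub> h"
    by (rule ext) (simp_all add: fh c ap mem ad)
qed

lemma free_alg_induct [consumes 1, case_names zero add single]:
  assumes "f \<in> carrier (free_alg r d n)"
    and "P 0" and "\<And>f h. f \<in> carrier (free_alg r d n) \<Longrightarrow> h \<in> carrier (free_alg r d n) \<Longrightarrow> P f \<Longrightarrow> P h \<Longrightarrow> P (f + h)"
    and "\<And>ls a. set ls \<subseteq> gens n \<Longrightarrow> a \<in> carrier (base_ring r d) \<Longrightarrow> P (Poly_Mapping.single (Word ls) a)"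
  shows "P f"
proof -
  have s: "Poly_Mapping.single w (Poly_Mapping.lookup f w) \<in> carrier (free_alg r d n) \<and>
      P (Poly_Mapping.single w (Poly_Mapping.lookup f w))" if "w \<in> Poly_Mapping.keys f" for w
  proof -
    have w: "set (letters w) \<subseteq> gens n" and a: "Poly_Mapping.lookup f w \<in> carrier (base_ring r d)"
      using assms(1) that by (auto simp: free_alg_def monoid_ring_simps)
    moreover have "Poly_Mapping.single w (Poly_Mapping.lookup f w) \<in> carrier (free_alg r d n)"
      using w a base_mem(1)[of r d] by (auto simp: free_alg_def monoid_ring_simps lookup_single when_def split: if_splits)
    ultimately show ?thesis using assms(4)[OF w a] by (cases w) simp
  qed
  have "(\<Sum>w\<in>S. Poly_Mapping.single w (Poly_Mapping.lookup f w)) \<in> carrier (free_alg r d n) \<and>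
     P (\<Sum>w\<in>S. Poly_Mapping.single w (Poly_Mapping.lookup f w))" if "S \<subseteq> Poly_Mapping.keys f" for S
    using finite_subset[OF that finite_keys] that
  proof (induction S rule: finite_induct)
    case (insert w S)
    then show ?case using s[of w] assms(3) by (auto intro: free_closed)
  qed (simp add: assms(2) free_closed)
  from this[of "Poly_Mapping.keys f"] show ?thesis by (simp add: poly_mapping_expansion)
qed

context yh_parameters
begin

definition sc :: "nat \<Rightarrow> laurent \<Rightarrow> yh_prod" where "sc n a = cl n (scal a)"

primrec gop :: "nat \<Rightarrow> nat \<Rightarrow> gen \<Rightarrow> (nat \<Rightarrow> nat \<Rightarrow> yh_prod) \<Rightarrow> nat \<Rightarrow> nat \<Rightarrow> yh_prod" where
  "gop n k (gen_t j) = eig.T n k j"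
| "gop n k (gen_g i) = eig.G n k i"
| "gop n k gen_X = eig.XX n k"
| "gop n k gen_Xinv = eig.XI n k"

definition act :: "nat \<Rightarrow> nat \<Rightarrow> gen list \<Rightarrow> (nat \<Rightarrow> nat \<Rightarrow> yh_prod) \<Rightarrow> nat \<Rightarrow> nat \<Rightarrow> yh_prod" where
  "act n k ls = foldr (gop n k) ls"

text \<open>The free algebra of level \<open>n + 1\<close> acts on columns over level \<open>n\<close>: letters by the operators, scalars entrywise.\<close>
definition rho :: "nat \<Rightarrow> nat \<Rightarrow> yh_poly \<Rightarrow> (nat \<Rightarrow> nat \<Rightarrow> yh_prod) \<Rightarrow> nat \<Rightarrow> nat \<Rightarrow> yh_prod" where
  "rho n k f x = (\<Sum>w\<in>Poly_Mapping.keys f. eig.S (sc n (Poly_Mapping.lookup f w)) (act n k (letters w) x))"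

text \<open>The columns all of whose entries belong to level \<open>n\<close>; on them the unit of the free algebra acts as the identity.\<close>
definition VU :: "nat \<Rightarrow> (nat \<Rightarrow> nat \<Rightarrow> yh_prod) set" where
  "VU n = {x \<in> eig.VV n. eig.S (u n) x = x}"

lemma sc_simps: "sc n 0 = 0" "a \<in> carrier (base_ring r d) \<Longrightarrow> b \<in> carrier (base_ring r d) \<Longrightarrow> sc n (a + b) = sc n a + sc n b"
  "a \<in> carrier (base_ring r d) \<Longrightarrow> b \<in> carrier (base_ring r d) \<Longrightarrow> sc n (a * b) = sc n a * sc n b" "sc n 1 = u n"
  by (simp_all add: sc_def scal_simps cl_0 cl_add cl_mult scal_F u_def)

lemma sc_central: "a \<in> carrier (base_ring r d) \<Longrightarrow> sc n a * y = y * sc n a"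
  unfolding sc_def by (rule cl_scal_central)

lemma gop_addmap: "addmap (gop n k l)"
  by (cases l) (simp_all add: eig.addmaps)

lemma act_addmap: "addmap (act n k ls)"
  unfolding act_def by (induction ls) (auto simp: addmap_def addmapD[OF gop_addmap])

lemma S_addmap: "addmap (eig.S y)" by (rule eig.addmaps)

lemma gop_S: "(\<And>z. y * z = z * y) \<Longrightarrow> gop n k l (eig.S y x) = eig.S y (gop n k l x)"
  by (cases l) (simp_all add: eig.ops_S)

lemma act_S: "(\<And>z. y * z = z * y) \<Longrightarrow> act n k ls (eig.S y x) = eig.S y (act n k ls x)"
  unfolding act_def by (induction ls) (auto simp: gop_S)

lemma VU_closed: "0 \<in> VU n" "x \<in> VU n \<Longrightarrow> y \<in> VU n \<Longrightarrow> x + y \<in> VU n" "x \<in> VU n \<Longrightarrow> - x \<in> VU n"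
proof -
  show 0: "0 \<in> VU n" unfolding VU_def using eig.VV_closed(1)[of n] addmap_0[OF S_addmap] by blast
  show "x \<in> VU n \<Longrightarrow> y \<in> VU n \<Longrightarrow> x + y \<in> VU n" unfolding VU_def using eig.VV_closed(2)[of x n y] addmapD[OF S_addmap] by auto
  show "x \<in> VU n \<Longrightarrow> - x \<in> VU n" unfolding VU_def
    using eig.VV_closed(5)[of x n] addmap_diff[OF S_addmap, of "u n" 0 x] addmap_0[OF S_addmap, of "u n"] by auto
qed

lemma VU_S: "x \<in> VU n \<Longrightarrow> (\<And>z. y * z = z * y) \<Longrightarrow> eig.S y x \<in> VU n"
proof -
  assume x: "x \<in> VU n" and y: "\<And>z. y * z = z * y"
  have "eig.S (u n) (eig.S y x) = eig.S y (eig.S (u n) x)" by (simp only: eig.S_S u_central[of n y])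
  then show ?thesis using x eig.S_closed[of x n y] by (simp add: VU_def)
qed

lemma VU_sum: "(\<And>i. i \<in> A \<Longrightarrow> f i \<in> VU n) \<Longrightarrow> (\<Sum>i\<in>A. f i) \<in> VU n"
  by (induction A rule: infinite_finite_induct) (auto intro: VU_closed simp del: zero_fun_apply)

lemma gop_closed: "l \<in> gens (Suc n) \<Longrightarrow> x \<in> VU n \<Longrightarrow> gop n k l x \<in> VU n"
proof -
  assume l: "l \<in> gens (Suc n)" and x: "x \<in> VU n"
  have "gop n k l x \<in> eig.VV n" using l x unfolding VU_def
    by (cases l) (auto simp: gens_def intro!: eig.T_closed eig.G_closed eig.XX_closed eig.XI_closed)
  moreover have "eig.S (u n) (gop n k l x) = gop n k l (eig.S (u n) x)"
    by (rule gop_S[symmetric]) (rule u_central)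
  ultimately show ?thesis using x by (simp add: VU_def)
qed

lemma act_closed: "set ls \<subseteq> gens (Suc n) \<Longrightarrow> x \<in> VU n \<Longrightarrow> act n k ls x \<in> VU n"
  unfolding act_def by (induction ls) (auto intro: gop_closed)

lemma F_lookup: "f \<in> F n \<Longrightarrow> Poly_Mapping.lookup f w \<in> carrier (base_ring r d)"
  "f \<in> F n \<Longrightarrow> w \<in> Poly_Mapping.keys f \<Longrightarrow> set (letters w) \<subseteq> gens n"
  by (auto simp: free_alg_def monoid_ring_simps)

lemma rho_closed: "f \<in> F (Suc n) \<Longrightarrow> x \<in> VU n \<Longrightarrow> rho n k f x \<in> VU n"
  unfolding rho_def by (intro VU_sum VU_S act_closed F_lookup sc_central) auto

lemma rho_add_right: "rho n k f (x + y) = rho n k f x + rho n k f y"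
  by (simp add: rho_def addmapD[OF act_addmap] addmapD[OF S_addmap] sum.distrib)

lemma rho_addmap: "addmap (rho n k f)" by (simp add: addmap_def rho_add_right)

lemma S_0: "eig.S 0 x = 0" by (simp add: eig.S_def sm_simps zero_fun_def)

lemma S_add: "eig.S (a + b) x = eig.S a x + eig.S b x"
  by (auto simp: eig.S_def sm_simps plus_fun_apply)

lemma rho_super: "finite S \<Longrightarrow> Poly_Mapping.keys f \<subseteq> S \<Longrightarrow>
   rho n k f x = (\<Sum>w\<in>S. eig.S (sc n (Poly_Mapping.lookup f w)) (act n k (letters w) x))"
  unfolding rho_def
  by (rule sum.mono_neutral_left) (auto simp: in_keys_iff sc_simps S_0 simp del: zero_fun_apply)

lemma rho_add: assumes "f \<in> F m" "h \<in> F m" shows "rho n k (f + h) x = rho n k f x + rho n k h x"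
proof -
  let ?S = "Poly_Mapping.keys f \<union> Poly_Mapping.keys h"
  have "rho n k (f + h) x = (\<Sum>w\<in>?S. eig.S (sc n (Poly_Mapping.lookup (f + h) w)) (act n k (letters w) x))"
    using keys_add[of f h] by (intro rho_super) auto
  also have "\<dots> = (\<Sum>w\<in>?S. eig.S (sc n (Poly_Mapping.lookup f w)) (act n k (letters w) x)
      + eig.S (sc n (Poly_Mapping.lookup h w)) (act n k (letters w) x))"
    using F_lookup(1)[OF assms(1)] F_lookup(1)[OF assms(2)] by (simp add: lookup_add sc_simps S_add)
  also have "\<dots> = rho n k f x + rho n k h x"
    unfolding sum.distrib by (subst (1 2) rho_super[of ?S]) auto
  finally show ?thesis .
qed

lemma rho_0: "rho n k 0 x = 0" by (simp add: rho_def)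

lemma rho_single: "rho n k (Poly_Mapping.single w a) x = eig.S (sc n a) (act n k (letters w) x)"
  by (subst rho_super[of "{w}"]) auto

lemma rho_mult:
  assumes f: "f \<in> F m" and h: "h \<in> F m"
  shows "rho n k (f * h) x = rho n k f (rho n k h x)"
  using f
proof (induction f rule: free_alg_induct)
  case zero
  then show ?case by (simp add: rho_0 del: zero_fun_apply)
next
  case (add f f')
  then show ?case using h by (simp add: distrib_right rho_add[of _ m] free_closed)
next
  case (single ls a)
  have sF: "Poly_Mapping.single (Word ls) a \<in> F m"
    using single base_mem(1)[of r d] by (auto simp: free_alg_def monoid_ring_simps lookup_single when_def split: if_splits)
  show ?case using h
  proof (induction h rule: free_alg_induct)
    case zero
    then show ?case by (simp add: rho_0 rho_single addmap_0[OF act_addmap] addmap_0[OF S_addmap] del: zero_fun_apply)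
  next
    case (add h h')
    then show ?case using sF by (simp add: distrib_left rho_add[of _ m] free_closed rho_add_right)
  next
    case (single ls' b)
    have "act n k ls (eig.S (sc n b) (act n k ls' x)) = eig.S (sc n b) (act n k ls (act n k ls' x))"
      using single by (intro act_S sc_central)
    then show ?case using single \<open>a \<in> _\<close>
      by (simp add: mult_single rho_single plus_word_def eig.S_S sc_simps) (simp add: act_def)
  qed
qed

lemma rho_diff: assumes "f \<in> F m" "h \<in> F m" shows "rho n k (f - h) x = rho n k f x - rho n k h x"
  using rho_add[of "f - h" m h n k x] assms by (simp add: free_closed eq_diff_eq)

lemma rho_scal: "rho n k (scal a) x = eig.S (sc n a) x"
  by (simp add: scal_def rho_single zero_word_def act_def)

lemma rho_1: "x \<in> VU n \<Longrightarrow> rho n k 1 x = x"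
  using rho_scal[of n k 1 x] by (simp add: scal_simps sc_simps VU_def)

lemma rho_letter: "l \<in> gens (Suc n) \<Longrightarrow> x \<in> VU n \<Longrightarrow> rho n k (letter l) x = gop n k l x"
  using gop_closed[of l n x k] by (simp add: letter_def rho_single act_def sc_simps VU_def)

lemma rho_sum: "(\<And>i. i \<in> S \<Longrightarrow> f i \<in> F m) \<Longrightarrow> rho n k (sum f S) x = (\<Sum>i\<in>S. rho n k (f i) x)"
  by (induction S rule: infinite_finite_induct) (simp_all add: rho_0 rho_add[of _ m] free_sum_closed del: zero_fun_apply)

lemma rho_power: "f \<in> F (Suc n) \<Longrightarrow> x \<in> VU n \<Longrightarrow> rho n k (f ^ s) x = (rho n k f ^^ s) x"
  by (induction s) (simp_all add: rho_1 rho_mult[of _ "Suc n"] free_closed)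

lemma funpow_VU:
  assumes "\<And>x. x \<in> VU n \<Longrightarrow> f x = h x \<and> h x \<in> VU n" "x \<in> VU n" shows "(f ^^ s) x = (h ^^ s) x \<and> (h ^^ s) x \<in> VU n"
  using assms by (induction s) auto

lemma rho_letters:
  assumes "x \<in> VU n"
  shows "1 \<le> j \<Longrightarrow> j \<le> Suc n \<Longrightarrow> rho n k (yt j) x = eig.T n k j x"
    "1 \<le> i \<Longrightarrow> i \<le> n \<Longrightarrow> rho n k (yg i) x = eig.G n k i x"
    "rho n k yX x = eig.XX n k x" "rho n k yXinv x = eig.XI n k x"
  using assms by (auto simp: rho_letter gens_def)

lemma rho_t_power: "x \<in> VU n \<Longrightarrow> 1 \<le> j \<Longrightarrow> j \<le> Suc n \<Longrightarrow> rho n k (yt j ^ s) x = (eig.T n k j ^^ s) x"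
proof -
  assume x: "x \<in> VU n" and j: "1 \<le> j" "j \<le> Suc n"
  have "rho n k (yt j ^ s) x = (rho n k (yt j) ^^ s) x" using x j by (intro rho_power letters_F) auto
  also have "\<dots> = (eig.T n k j ^^ s) x"
    using x j rho_closed[OF letters_F(1)[OF j]]
    by (intro funpow_VU[THEN conjunct1]) (auto simp: rho_letters)
  finally show ?thesis .
qed

lemma rho_ye:
  assumes x: "x \<in> VU n" and i: "1 \<le> i" "i \<le> n"
  shows "rho n k (ye r i) x = eig.EE n k i x"
proof -
  have "rho n k (ye r i) x = eig.S (kk n) (\<Sum>s<r. rho n k (yt i ^ s * yt (i + 1) ^ (r - s)) x)"
    unfolding ye_def using i
    by (subst rho_mult[of _ "Suc n"]) (auto intro!: free_sum_closed free_closed scal_F base_mems letters_F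
        simp: rho_scal sc_def kk_def rho_sum[of _ _ "Suc n"] letters_F free_closed)
  also have "(\<Sum>s<r. rho n k (yt i ^ s * yt (i + 1) ^ (r - s)) x) =
     (\<Sum>s<r. (eig.T n k i ^^ s) ((eig.T n k (i + 1) ^^ (r - s)) x))"
  proof (rule sum.cong)
    fix s
    have 1: "(eig.T n k (i + 1) ^^ (r - s)) x \<in> VU n"
      using rho_closed[of "yt (i + 1) ^ (r - s)" n x k] x i by (simp add: rho_t_power[symmetric] free_closed letters_F)
    show "rho n k (yt i ^ s * yt (i + 1) ^ (r - s)) x = (eig.T n k i ^^ s) ((eig.T n k (i + 1) ^^ (r - s)) x)"
      using x i 1 by (subst rho_mult[of _ "Suc n"]) (simp_all add: rho_t_power letters_F free_closed)
  qed simp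
  finally show ?thesis by (simp add: eig.EE_def)
qed

lemma S_vv: "x \<in> VU n \<Longrightarrow> i \<le> d \<Longrightarrow> eig.S (vv n i) x = eig.S (sc n (lv i)) x"
proof -
  assume x: "x \<in> VU n" and i: "i \<le> d"
  have "vv n i * u n = sc n (lv i)"
    using i unfolding vv_def u_central[symmetric] by (simp add: cl_c1 scal_F base_mems sc_def)
  then show ?thesis using x by (metis (mono_tags, lifting) VU_def eig.S_S mem_Collect_eq)
qed

lemma rho_cyc:
  assumes "x \<in> VU n" "m \<le> d"
  shows "rho n k (prod_list (map (\<lambda>i. yX - scal (lv i)) [1..<m + 1])) x = eig.PX n k m x"
  using assms
proof (induction m arbitrary: x)
  case 0
  then show ?case by (simp add: rho_1)
next
  case (Suc m)
  let ?P = "prod_list (map (\<lambda>i. yX - scal (lv i)) [1..<m + 1])"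
  have P: "?P \<in> F (Suc n)" using Suc.prems
    by (auto intro!: free_prod_list_closed free_closed letters_F scal_F base_mems)
  have l: "yX - scal (lv (Suc m)) \<in> F (Suc n)"
    using Suc.prems by (intro free_closed letters_F scal_F base_mems) auto
  have "prod_list (map (\<lambda>i. yX - scal (lv i)) [1..<Suc m + 1]) = ?P * (yX - scal (lv (Suc m)))" by simp
  then have "rho n k (prod_list (map (\<lambda>i. yX - scal (lv i)) [1..<Suc m + 1])) x = rho n k ?P (rho n k (yX - scal (lv (Suc m))) x)"
    using rho_mult[OF P l] by simp
  also have "\<dots> = eig.PX n k m (rho n k (yX - scal (lv (Suc m))) x)"
    using Suc.prems by (intro Suc.IH rho_closed l) auto
  also have "rho n k (yX - scal (lv (Suc m))) x = eig.XX n k x - eig.S (vv n (Suc m)) x"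
    using Suc.prems by (subst rho_diff[of _ "Suc n"]) (auto intro!: letters_F scal_F base_mems simp: rho_letters rho_scal S_vv)
  finally show ?case by (simp only: eig.PX.simps)
qed

lemma rho_cyc_poly: "x \<in> VU n \<Longrightarrow> rho n k (cyc_poly d) x = 0"
  unfolding cyc_poly_def using rho_cyc[of x n d k] eig.PX_d[of x n k] by (simp add: VU_def del: zero_fun_apply upt_Suc)

lemma rho_rel:
  assumes f: "f \<in> yh_relations r (Suc n)" and x: "x \<in> VU n"
  shows "rho n k f x = 0"
proof -
  let ?F = "F (Suc n)"
  have V: "x \<in> eig.VV n" using x by (simp add: VU_def)
  have tF: "yt j \<in> ?F" if "1 \<le> j" "j \<le> Suc n" for j using that by (intro letters_F)
  have gF: "yg i \<in> ?F" if "1 \<le> i" "i \<le> n" for i using that by (intro letters_F) auto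
  have XF: "yX \<in> ?F" "yXinv \<in> ?F" by (simp_all add: letters_F)
  have cT: "eig.T n k j y \<in> VU n" if "1 \<le> j" "j \<le> Suc n" "y \<in> VU n" for j y
    using gop_closed[of "gen_t j" n y k] that by (auto simp: gens_def)
  have cG: "eig.G n k i y \<in> VU n" if "1 \<le> i" "i \<le> n" "y \<in> VU n" for i y
    using gop_closed[of "gen_g i" n y k] that by (auto simp: gens_def)
  have cX: "eig.XX n k y \<in> VU n" "eig.XI n k y \<in> VU n" if "y \<in> VU n" for y
    using gop_closed[of gen_X n y k] gop_closed[of gen_Xinv n y k] that by (auto simp: gens_def)
  note ms = rho_mult[of _ "Suc n"] rho_diff[of _ "Suc n"] rho_add[of _ "Suc n"] rho_letters rho_scal rho_1 
    free_closed tF gF XF cT cG cX x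
  consider (gg) i j where "f = yg i * yg j - yg j * yg i" "1 \<le> i" "i \<le> n" "1 \<le> j" "j \<le> n" "i + 2 \<le> j \<or> j + 2 \<le> i"
    | (br) i where "f = yg i * yg (i + 1) * yg i - yg (i + 1) * yg i * yg (i + 1)" "1 \<le> i" "i + 1 \<le> n"
    | (tt) i j where "f = yt i * yt j - yt j * yt i" "1 \<le> i" "i \<le> Suc n" "1 \<le> j" "j \<le> Suc n"
    | (gt) i j where "f = yg i * yt j - yt (Transposition.transpose i (i + 1) j) * yg i" "1 \<le> i" "i \<le> n" "1 \<le> j" "j \<le> Suc n"
    | (tr) j where "f = yt j ^ r - 1" "1 \<le> j" "j \<le> Suc n"
    | (sq) i where "f = yg i ^ 2 - (1 + scal (lq - lq_inv) * ye r i * yg i)" "1 \<le> i" "i \<le> n"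
    | (xi) "f = yX * yXinv - 1" | (ix) "f = yXinv * yX - 1"
    | (gx) "f = yg 1 * yX * yg 1 * yX - yX * yg 1 * yX * yg 1" "1 \<le> n"
    | (gx2) i where "f = yg i * yX - yX * yg i" "2 \<le> i" "i \<le> n"
    | (tx) j where "f = yt j * yX - yX * yt j" "1 \<le> j" "j \<le> Suc n"
    using f unfolding yh_relations_def by (auto simp: less_Suc_eq_le split: if_splits)
  then show ?thesis
  proof cases
    case gg
    have "eig.G n k i (eig.G n k j x) = eig.G n k j (eig.G n k i x)"
      using gg eig.G_far[OF V, of i j k] eig.G_far[OF V, of j i k] by auto
    then show ?thesis using gg by (simp add: ms)
  next
    case br
    then show ?thesis using eig.G_braid[OF V, of i k] by (simp add: ms)
  next
    case tt
    then show ?thesis using eig.T_T[OF V, of i j k] by (simp add: ms)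
  next
    case gt
    have "1 \<le> Transposition.transpose i (i + 1) j \<and> Transposition.transpose i (i + 1) j \<le> Suc n"
      using gt by (auto simp: Transposition.transpose_def)
    then show ?thesis using gt eig.G_T[OF V, of i j k] by (simp add: ms)
  next
    case tr
    then show ?thesis using eig.T_r[OF V, of j k] by (simp add: ms rho_t_power del: zero_fun_apply)
  next
    case sq
    have E: "ye r i \<in> ?F" using sq by (intro ye_F) auto
    have s: "scal (lq - lq_inv) \<in> ?F" by (intro scal_F base_mems)
    have c: "sc n (lq - lq_inv) = cc n" by (simp only: sc_def cc_def)
    have "rho n k f x = eig.G n k i (eig.G n k i x) - (x + eig.S (cc n) (eig.EE n k i (eig.G n k i x)))"
      using sq E s by (simp add: ms power2_eq_square rho_ye c)
    then show ?thesis using eig.G_sq[OF V, of i k] sq by (simp del: zero_fun_apply)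
  next
    case xi
    then show ?thesis using eig.XX_XI[OF V, of k] by (simp add: ms del: zero_fun_apply)
  next
    case ix
    then show ?thesis using eig.XI_XX[OF V, of k] by (simp add: ms del: zero_fun_apply)
  next
    case gx
    then show ?thesis using eig.xi_braid[OF V, of k] by (simp add: ms del: zero_fun_apply)
  next
    case gx2
    then show ?thesis using eig.G_XX[OF V, of i k] by (simp add: ms del: zero_fun_apply)
  next
    case tx
    then show ?thesis using eig.T_XX[OF V, of j k] by (simp add: ms del: zero_fun_apply)
  qed
qed

text \<open>All defining relations act by zero (\<open>rho_rel\<close>, \<open>rho_cyc_poly\<close>), so the action factors through the cyclotomic algebra.\<close>
lemma rho_cong:
  assumes f: "f \<in> F (Suc n)" "h \<in> F (Suc n)" and e: "cl (Suc n) f = cl (Suc n) h" and x: "x \<in> VU n"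
  shows "rho n k f x = rho n k h x"
proof -
  let ?h = "\<lambda>f. \<lambda>x\<in>VU n. rho n k f x"
  let ?E = "end_ring (VU n)"
  have R: "ring ?E" by (rule ring_end_ring) (rule VU_closed; assumption)+
  have c: "?h f \<in> carrier ?E" if "f \<in> F (Suc n)" for f
    using that by (auto simp: end_ring_def rho_closed rho_add_right VU_closed)
  have H: "?h \<in> ring_hom (free_alg r d (Suc n)) ?E"
  proof (rule ring_hom_memI)
    fix f h assume fh: "f \<in> F (Suc n)" "h \<in> F (Suc n)"
    show "?h (f \<otimes>\<^bsub>free_alg r d (Suc n)\<^esub> h) = ?h f \<otimes>\<^bsub>?E\<^esub> ?h h"
      "?h (f \<oplus>\<^bsub>free_alg r d (Suc n)\<^esub> h) = ?h f \<oplus>\<^bsub>?E\<^esub> ?h h"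
      using fh by (auto simp: end_ring_def free_simps rho_mult[of _ "Suc n"] rho_add[of _ "Suc n"] rho_closed intro!: restrict_ext)
  qed (use c in \<open>auto simp: end_ring_def free_simps rho_1 intro!: restrict_ext\<close>)
  have "?h f = ?h h"
  proof (rule cyc_class_factor[OF H R _ _ f cl_eq[OF f e]])
    show "?h f = \<zero>\<^bsub>?E\<^esub>" if "f \<in> yh_relations r (Suc n)" for f
      using rho_rel[OF that] by (auto simp: end_ring_def intro!: restrict_ext simp del: zero_fun_apply)
    show "?h (cyc_poly d) = \<zero>\<^bsub>?E\<^esub>"
      using rho_cyc_poly by (auto simp: end_ring_def intro!: restrict_ext simp del: zero_fun_apply)
  qed
  from fun_cong[OF this, of x] show ?thesis using x by simp
qed

end

section \<open>Independence of the basis\<close>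

context yh_parameters
begin

text \<open>The action of the component of \<open>b\<close> at level \<open>n + 1\<close>, through any polynomial that represents it; \<open>actq_cl\<close> gives the
independence of the choice.\<close>
definition actq :: "nat \<Rightarrow> nat \<Rightarrow> yh_prod \<Rightarrow> (nat \<Rightarrow> nat \<Rightarrow> yh_prod) \<Rightarrow> nat \<Rightarrow> nat \<Rightarrow> yh_prod" where
  "actq n k b x = rho n k (SOME f. f \<in> F (Suc n) \<and> u (Suc n) * b = cl (Suc n) f) x"

lemma actq_cl:
  assumes "f \<in> F (Suc n)" "u (Suc n) * b = cl (Suc n) f" "x \<in> VU n"
  shows "actq n k b x = rho n k f x"
proof -
  let ?f = "SOME f. f \<in> F (Suc n) \<and> u (Suc n) * b = cl (Suc n) f"
  have "?f \<in> F (Suc n) \<and> u (Suc n) * b = cl (Suc n) ?f" by (rule someI[of _ f]) (use assms in simp)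
  then show ?thesis unfolding actq_def using assms by (intro rho_cong) auto
qed

lemma actq_closed: "x \<in> VU n \<Longrightarrow> actq n k b x \<in> VU n"
  using u_ex[of "Suc n" b] actq_cl rho_closed by metis

lemma actq_addmap: "addmap (actq n k b)"
  unfolding actq_def by (rule rho_addmap)

lemma actq_add: "x \<in> VU n \<Longrightarrow> actq n k (b + b') x = actq n k b x + actq n k b' x"
proof -
  assume x: "x \<in> VU n"
  obtain f f' where f: "f \<in> F (Suc n)" "u (Suc n) * b = cl (Suc n) f" "f' \<in> F (Suc n)" "u (Suc n) * b' = cl (Suc n) f'"
    using u_ex by metis
  have "u (Suc n) * (b + b') = cl (Suc n) (f + f')" using f by (simp add: distrib_left cl_add)
  then show ?thesis using f x actq_cl[of "f + f'" n "b + b'" x k] by (simp add: free_closed actq_cl rho_add[of _ "Suc n"])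
qed

lemma actq_mult: "x \<in> VU n \<Longrightarrow> actq n k (b * b') x = actq n k b (actq n k b' x)"
proof -
  assume x: "x \<in> VU n"
  obtain f f' where f: "f \<in> F (Suc n)" "u (Suc n) * b = cl (Suc n) f" "f' \<in> F (Suc n)" "u (Suc n) * b' = cl (Suc n) f'"
    using u_ex by metis
  have "u (Suc n) * (b * b') = (u (Suc n) * b) * (u (Suc n) * b')"
    using u_central[of "Suc n" b] u_idem[of "Suc n"] by (metis mult.assoc)
  also have "\<dots> = cl (Suc n) (f * f')" using f by (simp add: cl_mult)
  finally have "actq n k (b * b') x = rho n k (f * f') x" using f x by (intro actq_cl free_closed)
  then show ?thesis using f x by (simp add: actq_cl rho_mult[of _ "Suc n"] rho_closed)
qed

lemma actq_1: "x \<in> VU n \<Longrightarrow> actq n k 1 x = x"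
  using actq_cl[of 1 n 1 x k] by (simp add: free_closed u_def rho_1)

lemma actq_0: "x \<in> VU n \<Longrightarrow> actq n k 0 x = 0"
  using actq_cl[of 0 n 0 x k] by (simp add: free_closed cl_0 rho_0 del: zero_fun_apply)

lemma actq_sum: "x \<in> VU n \<Longrightarrow> actq n k (sum f S) x = (\<Sum>i\<in>S. actq n k (f i) x)"
  by (induction S rule: infinite_finite_induct) (simp_all add: actq_0 actq_add del: zero_fun_apply)

lemma actq_diff: "x \<in> VU n \<Longrightarrow> actq n k (b - b') x = actq n k b x - actq n k b' x"
  using actq_add[of x n k "b - b'" b'] by (simp add: eq_diff_eq)

lemma actq_power: "x \<in> VU n \<Longrightarrow> actq n k (b ^ s) x = (actq n k b ^^ s) x"
  by (induction s) (simp_all add: actq_1 actq_mult)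

lemma actq_gens:
  assumes x: "x \<in> VU n"
  shows "1 \<le> j \<Longrightarrow> j \<le> Suc n \<Longrightarrow> actq n k (tt (Suc n) j) x = eig.T n k j x"
    "1 \<le> i \<Longrightarrow> i \<le> n \<Longrightarrow> actq n k (gg (Suc n) i) x = eig.G n k i x"
    "actq n k (xx (Suc n)) x = eig.XX n k x"
    "f \<in> F (Suc n) \<Longrightarrow> actq n k (cl (Suc n) f) x = rho n k f x"
    "f \<in> F (Suc n) \<Longrightarrow> actq n k (c1 (Suc n) f) x = rho n k f x"
proof -
  show c1: "f \<in> F (Suc n) \<Longrightarrow> actq n k (c1 (Suc n) f) x = rho n k f x" for f
    using x by (intro actq_cl) (simp_all add: cl_c1)
  show "f \<in> F (Suc n) \<Longrightarrow> actq n k (cl (Suc n) f) x = rho n k f x" for f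
    using x by (intro actq_cl) (simp_all add: u_cl)
  show "1 \<le> j \<Longrightarrow> j \<le> Suc n \<Longrightarrow> actq n k (tt (Suc n) j) x = eig.T n k j x"
    using x by (simp add: tt_def c1 letters_F rho_letters)
  show "1 \<le> i \<Longrightarrow> i \<le> n \<Longrightarrow> actq n k (gg (Suc n) i) x = eig.G n k i x"
    using x by (simp add: gg_def c1 letters_F rho_letters)
  show "actq n k (xx (Suc n)) x = eig.XX n k x"
    using x by (simp add: xx_def c1 letters_F rho_letters)
qed

lemma VU_W: "j \<le> n \<Longrightarrow> h \<in> eig.VH \<Longrightarrow> sm (u n) h = h \<Longrightarrow> W j h \<in> VU n"
  by (simp add: VU_def eig.VV_closed eig.S_W)

lemma S_c1: "x \<in> VU n \<Longrightarrow> a \<in> carrier (base_ring r d) \<Longrightarrow> eig.S (sc n a) x = eig.S (c1 n (scal a)) x"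
proof -
  assume x: "x \<in> VU n" and a: "a \<in> carrier (base_ring r d)"
  have "c1 n (scal a) * u n = sc n a"
    unfolding u_central[symmetric] using a by (simp add: cl_c1 scal_F sc_def)
  then show ?thesis using x by (metis (mono_tags, lifting) VU_def eig.S_S mem_Collect_eq)
qed

lemma actq_om: "x \<in> VU n \<Longrightarrow> actq n k (om (Suc n) k') x = eig.S (om n k') x"
  unfolding om_def by (simp add: actq_gens scal_F base_mems rho_scal S_c1)

text \<open>On block \<open>0\<close> the operator of \<open>t\<^sub>1\<close> is multiplication by the \<open>k\<close>-th eigenvalue, so \<open>\<epsilon>\<close> acts there by \<open>avg_om\<close>.\<close>
lemma actq_\<epsilon>:
  assumes h: "h \<in> eig.VH" "sm (u n) h = h" and k: "k < r" "k' < r"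
  shows "actq n k (eig.\<epsilon> (Suc n) k' 1) (W 0 h) = (if k = k' then W 0 h else 0)"
proof -
  have x: "W 0 h \<in> VU n" using h by (intro VU_W) auto
  have om: "actq n k (om (Suc n) k' ^ s) (W 0 h) = W 0 (sm (om n k' ^ s) h)" for s
  proof (induction s)
    case (Suc s)
    have "actq n k (om (Suc n) k' ^ Suc s) (W 0 h) = actq n k (om (Suc n) k') (W 0 (sm (om n k' ^ s) h))"
      unfolding power_Suc actq_mult[OF x] Suc ..
    also have "\<dots> = eig.S (om n k') (W 0 (sm (om n k' ^ s) h))"
      using actq_closed[OF x, of k "om (Suc n) k' ^ s"] unfolding Suc by (rule actq_om)
    finally show ?case by (simp add: eig.S_W sm_simps)
  qed (simp add: actq_1[OF x] sm_1)
  have t: "actq n k (tt (Suc n) 1 ^ s) y = (eig.T n k 1 ^^ s) y" if "y \<in> VU n" for s y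
    unfolding actq_power[OF that]
    by (rule funpow_VU[THEN conjunct1, OF _ that])
       (use actq_gens(1)[of _ n 1] actq_closed in \<open>auto simp flip: actq_gens(1)[simplified]\<close>)
  have "actq n k (kk (Suc n)) y = eig.S (kk n) y" if "y \<in> VU n" for y
    unfolding kk_def using that by (simp add: actq_gens scal_F base_mems rho_scal sc_def)
  moreover have "actq n k (\<Sum>s<r. tt (Suc n) 1 ^ s * om (Suc n) k' ^ (r - s)) (W 0 h) = (\<Sum>s<r. W 0 (sm (om n k ^ s * om n k' ^ (r - s)) h))"
  proof -
    have "actq n k (tt (Suc n) 1 ^ s) (W 0 (sm (om n k' ^ (r - s)) h)) = W 0 (sm (om n k ^ s * om n k' ^ (r - s)) h)" for s
      using actq_closed[OF x, of k "om (Suc n) k' ^ (r - s)"] unfolding om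
      by (simp add: t[simplified] eig.Tpow_W sm_simps eig.\<tau>_def)
    then show ?thesis by (simp add: actq_sum[OF x] actq_mult[OF x] om)
  qed
  ultimately have "actq n k (eig.\<epsilon> (Suc n) k' 1) (W 0 h) = eig.S (kk n) (\<Sum>s<r. W 0 (sm (om n k ^ s * om n k' ^ (r - s)) h))"
    unfolding eig.\<epsilon>_def eig.avg_def actq_mult[OF x]
    using actq_closed[OF x, of k "\<Sum>s<r. tt (Suc n) 1 ^ s * om (Suc n) k' ^ (r - s)"] by simp
  also have "\<dots> = W 0 (sm (eig.avg n (om n k) (om n k')) h)"
    by (simp add: eig.avg_def eig.sm_sum[symmetric] eig.W_sum[symmetric] eig.S_W sm_simps)
  also have "\<dots> = (if k = k' then W 0 h else 0)"
    unfolding avg_om[OF k] using h by (simp add: sm_simps W_simps del: zero_fun_apply)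
  finally show ?thesis .
qed

lemma actq_L:
  assumes h: "h \<in> eig.VH" "sm (u n) h = h" and j: "j \<le> n"
  shows "actq n k (eig.L (Suc n) j) (W 0 h) = W j h"
  using j
proof (induction j)
  case 0
  then show ?case using h by (simp add: actq_1 VU_W)
next
  case (Suc j)
  have x: "W 0 h \<in> VU n" "W j h \<in> VU n" using h Suc by (auto intro!: VU_W)
  then show ?case using Suc by (simp add: actq_mult actq_gens eig.G_W_Suc)
qed

lemma J_L: "j < N \<Longrightarrow> eig.J N j * eig.L N j = 1"
proof (induction j)
  case (Suc j)
  have "eig.J N (Suc j) * eig.L N (Suc j) = eig.J N j * (eig.gi N (Suc j) * gg N (Suc j)) * eig.L N j"
    by (simp add: mult.assoc)
  then show ?case using Suc eig.gi_g[of "Suc j" N] by simp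
qed simp

lemma actq_J:
  assumes h: "h \<in> eig.VH" "sm (u n) h = h"
  shows "actq n k (eig.J (Suc n) n) (W n h) = W 0 h"
proof -
  have x: "W 0 h \<in> VU n" using h by (auto intro!: VU_W)
  have "actq n k (eig.J (Suc n) n) (actq n k (eig.L (Suc n) n) (W 0 h)) = W 0 h"
    unfolding actq_mult[OF x, symmetric] by (simp add: J_L actq_1[OF x])
  then show ?thesis by (simp add: actq_L h)
qed

lemma actq_p: "x \<in> VU n \<Longrightarrow> a \<le> d \<Longrightarrow> actq n k (eig.p (Suc n) a) x = eig.PX n k a x"
proof (induction a arbitrary: x)
  case 0
  then show ?case by (simp add: actq_1)
next
  case (Suc a)
  have "actq n k (vv (Suc n) (Suc a)) x = eig.S (vv n (Suc a)) x"
    using Suc.prems by (simp add: vv_def actq_gens scal_F base_mems rho_scal S_c1)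
  then have 1: "actq n k (xx (Suc n) - vv (Suc n) (Suc a)) x = eig.XX n k x - eig.S (vv n (Suc a)) x"
    using Suc.prems by (simp only: actq_diff actq_gens)
  have "actq n k (eig.p (Suc n) (Suc a)) x = eig.PX n k a (actq n k (xx (Suc n) - vv (Suc n) (Suc a)) x)"
    unfolding eig.p.simps actq_mult[OF Suc.prems(1)] using Suc.prems by (intro Suc.IH actq_closed) auto
  then show ?case by (simp only: 1 eig.PX.simps)
qed

text \<open>The basis elements of level \<open>n + 1\<close> over level \<open>n\<close>, for all eigenvalues, indexed by position, Newton index and eigenvalue.\<close>
definition wq :: "nat \<Rightarrow> nat \<times> nat \<times> nat \<Rightarrow> yh_prod" where
  "wq n = (\<lambda>(j, a, k). eig.w (Suc n) k n j a)"

definition Ix :: "nat \<Rightarrow> (nat \<times> nat \<times> nat) set" where "Ix n = {..n} \<times> {..<d} \<times> {..<r}"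

lemma finite_Ix: "finite (Ix n)" by (simp add: Ix_def)

text \<open>The factors of \<open>w\<close> act one after the other: \<open>J\<close> moves the block from position \<open>n\<close> to \<open>0\<close>, \<open>\<epsilon>\<close> selects the eigenvalue, \<open>p a\<close> moves
the entry to position \<open>a\<close>, and \<open>L\<close> moves the block to position \<open>j\<close>.\<close>
lemma actq_wq:
  assumes "(j, a, k') \<in> Ix n" "k < r" and y: "u n * y = y"
  shows "actq n k (wq n (j, a, k')) (W n (u0 y)) = (if k = k' then W j (eig.bas a y) else 0)"
proof -
  have i: "j \<le> n" "a < d" "k' < r" using assms by (auto simp: Ix_def)
  have u0: "u0 y \<in> eig.VH" "sm (u n) (u0 y) = u0 y" using y by (auto intro: eig.VH_closed simp: u0_simps)
  have b: "eig.bas a y \<in> eig.VH" "sm (u n) (eig.bas a y) = eig.bas a y"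
    using eig.VH_closed(7)[OF i(2), of y] y by (auto simp: eig.bas_def sm_def fun_eq_iff)
  have x: "W n (u0 y) \<in> VU n" "W 0 (u0 y) \<in> VU n" using u0 by (auto intro: VU_W)
  have "actq n k (eig.\<epsilon> (Suc n) k' 1 * eig.J (Suc n) n) (W n (u0 y)) = (if k = k' then W 0 (u0 y) else 0)"
    using actq_\<epsilon>[OF u0 assms(2) i(3)] actq_J[OF u0, of k] by (simp add: actq_mult[OF x(1)])
  moreover have "actq n k b 0 = 0" for b by (rule addmap_0[OF actq_addmap])
  moreover have "actq n k (eig.p (Suc n) a) (W 0 (u0 y)) = W 0 (eig.bas a y)"
    using i x by (simp add: actq_p eig.PX_W0_bas)
  ultimately show ?thesis
    using actq_L[OF b i(1), of k]
    by (cases "k = k'") (simp_all add: wq_def eig.w_def actq_mult[OF x(1)] del: zero_fun_apply)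
qed

lemma F_mono: "f \<in> F n \<Longrightarrow> f \<in> F (Suc n)" using free_mono by blast

text \<open>The values of the letters; used to evaluate words in the product ring.\<close>
primrec gval :: "nat \<Rightarrow> gen \<Rightarrow> yh_prod" where
  "gval n (gen_t j) = tt n j" | "gval n (gen_g i) = gg n i" | "gval n gen_X = xx n" | "gval n gen_Xinv = xi n"

lemma gval_c1: "l \<in> gens m \<Longrightarrow> m \<le> n \<Longrightarrow> gval n l = c1 n (letter l)"
  by (cases l) (auto simp: gens_def tt_def gg_def xx_def xi_def split: if_splits)

lemma letter_F: "l \<in> gens m \<Longrightarrow> m \<le> n \<Longrightarrow> letter l \<in> F n"
proof -
  assume "l \<in> gens m" "m \<le> n"
  then have "l \<in> gens n" by (auto simp: gens_def split: if_splits)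
  then show ?thesis by (rule letter_closed)
qed

lemma single_letters: "Poly_Mapping.single (Word ls) a = scal a * prod_list (map letter ls)"
proof (induction ls)
  case Nil
  then show ?case by (simp add: scal_def zero_word_def)
next
  case (Cons l ls)
  have "Poly_Mapping.single (Word (l # ls)) a = letter l * Poly_Mapping.single (Word ls) a"
    by (simp add: letter_def mult_single plus_word_def)
  also have "\<dots> = scal a * (letter l * prod_list (map letter ls))"
    unfolding Cons by (simp only: mult.assoc[symmetric] scal_comm[of a "letter l"])
  finally show ?case by simp
qed

lemma cl_single:
  assumes "set ls \<subseteq> gens m" "m \<le> n" "a \<in> carrier (base_ring r d)"
  shows "cl n (Poly_Mapping.single (Word ls) a) = sc n a * prod_list (map (gval n) ls)"
proof -
  have "c1 n (prod_list (map letter ls)) = prod_list (map (gval n) ls) \<and> prod_list (map letter ls) \<in> F n"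
    using assms(1)
  proof (induction ls)
    case (Cons l ls)
    then show ?case using letter_F[of l m n] gval_c1[of l m n] assms(2) by (simp add: c1_mult free_closed)
  qed (simp add: c1_1 free_closed)
  then show ?thesis unfolding single_letters sc_def using assms(3) by (auto simp: cl_c1[symmetric] scal_F)
qed

text \<open>In block \<open>n\<close> the lower level acts by left multiplication of the first entry.\<close>
lemma rho_base:
  assumes f: "f \<in> F n"
  shows "rho n k f (W n (u0 y)) = W n (u0 (cl n f * y))"
  using f
proof (induction f rule: free_alg_induct)
  case zero
  then show ?case by (simp add: rho_0 cl_0 u0_simps W_simps del: zero_fun_apply)
next
  case (add f h)
  then show ?case by (simp add: rho_add[of _ n] cl_add distrib_right u0_simps W_simps)
next
  case (single ls a)
  have g: "gop n k l (W n (u0 z)) = W n (u0 (gval n l * z))" if l: "l \<in> gens n" for l z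
  proof (cases l)
    case (gen_t j)
    then show ?thesis using l by (auto simp: gens_def eig.T_W eig.\<tau>_def u0_simps split: if_splits)
  next
    case (gen_g i)
    then show ?thesis using l by (auto simp: gens_def eig.G_W_less u0_simps split: if_splits)
  next
    case gen_X
    then have "0 < n" using l by (auto simp: gens_def split: if_splits)
    then show ?thesis using gen_X by (simp add: eig.XX_W eig.ss_simps u0_simps sm_simps W_simps mult.assoc)
  next
    case gen_Xinv
    then have "0 < n" using l by (auto simp: gens_def split: if_splits)
    moreover have "eig.xxi n 0 = 0" using eig.xxi_diff[of n 0 0] by simp
    ultimately show ?thesis using gen_Xinv
      by (simp add: eig.XI_W eig.ss_simps u0_simps sm_simps W_simps mult.assoc del: zero_fun_apply)
  qed
  have "act n k ls (W n (u0 y)) = W n (u0 (prod_list (map (gval n) ls) * y))"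
    using single(1) unfolding act_def by (induction ls) (auto simp: g mult.assoc)
  then show ?case using single by (simp add: rho_single cl_single[of _ n n] eig.S_W u0_simps mult.assoc)
qed

lemma wq_indep:
  assumes f: "\<And>i. i \<in> Ix n \<Longrightarrow> f i \<in> F n" and z: "(\<Sum>i\<in>Ix n. wq n i * cl (Suc n) (f i)) = 0" and i: "i \<in> Ix n"
  shows "cl n (f i) = 0"
proof -
  obtain j a k where i': "i = (j, a, k)" "j \<le> n" "a < d" "k < r" using i by (auto simp: Ix_def)
  \<comment> \<open>The column of the basis element with position \<open>n\<close>, Newton index \<open>0\<close> and coefficient \<open>1\<close>.\<close>
  let ?x = "W n (u0 (u n))"
  have x: "?x \<in> VU n" by (intro VU_W) (auto intro: eig.VH_closed simp: u0_simps u_idem)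
  have t: "actq n k (wq n i * cl (Suc n) (f i)) ?x = (case i of (j', a', k') \<Rightarrow> if k = k' then W j' (eig.bas a' (cl n (f i))) else 0)"
    if "i \<in> Ix n" for i
  proof -
    obtain j' a' k' where i: "i = (j', a', k')" by (cases i)
    have "actq n k (cl (Suc n) (f i)) ?x = W n (u0 (cl n (f i)))"
      using f[OF that] x by (simp add: actq_gens F_mono rho_base u_cl)
    then have "actq n k (wq n i * cl (Suc n) (f i)) ?x = actq n k (wq n (j', a', k')) (W n (u0 (cl n (f i))))"
      unfolding actq_mult[OF x] i by simp
    then show ?thesis
      using actq_wq[of j' a' k' n k "cl n (f i)"] that i i'(4) f[OF that] by (simp add: u_cl del: zero_fun_apply)
  qed
  have "0 = actq n k (\<Sum>i\<in>Ix n. wq n i * cl (Suc n) (f i)) ?x" using z actq_0[OF x] by simp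
  also have "\<dots> = (\<Sum>i\<in>Ix n. case i of (j', a', k') \<Rightarrow> if k = k' then W j' (eig.bas a' (cl n (f i))) else 0)"
    unfolding actq_sum[OF x] by (rule sum.cong) (simp_all add: t del: zero_fun_apply)
  finally have "(\<Sum>i\<in>Ix n. case i of (j', a', k') \<Rightarrow> if k = k' then W j' (eig.bas a' (cl n (f i))) else 0) j a = 0"
    by (metis zero_fun_apply)
  moreover have "(\<Sum>i\<in>A. h i) j a = (\<Sum>i\<in>A. h i j a)" for h :: "nat \<times> nat \<times> nat \<Rightarrow> nat \<Rightarrow> nat \<Rightarrow> yh_prod" and A
    by (induction A rule: infinite_finite_induct) (auto simp: plus_fun_apply)
  ultimately have "(\<Sum>i'\<in>Ix n. (case i' of (j', a', k') \<Rightarrow> if k = k' then W j' (eig.bas a' (cl n (f i'))) else 0) j a) = 0"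
    by simp
  moreover have "(case i' of (j', a', k') \<Rightarrow> if k = k' then W j' (eig.bas a' (cl n (f i'))) else 0) j a
      = (if i' = i then cl n (f i) else 0)" for i'
    by (cases i') (auto simp: i'(1) W_def eig.bas_def)
  ultimately show ?thesis using i finite_Ix by simp
qed

end

section \<open>Spanning and the passage to Jucys--Murphy elements\<close>

definition rspan :: "'a::ring_1 set \<Rightarrow> 'i set \<Rightarrow> ('i \<Rightarrow> 'a) \<Rightarrow> 'a set" where
  "rspan U I q = {\<Sum>i\<in>I. q i * y i | y. \<forall>i\<in>I. y i \<in> U}"

lemma rspan_rsub:
  assumes "0 \<in> U" "\<And>x y. x \<in> U \<Longrightarrow> y \<in> U \<Longrightarrow> x + y \<in> U" "\<And>x y. x \<in> U \<Longrightarrow> y \<in> U \<Longrightarrow> x * y \<in> U"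
  shows "rsub U (rspan U I q)"
  unfolding rsub_def
proof (intro conjI ballI)
  show "0 \<in> rspan U I q" unfolding rspan_def using assms(1) by (intro CollectI exI[of _ "\<lambda>_. 0"]) simp
  fix x assume "x \<in> rspan U I q"
  then obtain f where f: "x = (\<Sum>i\<in>I. q i * f i)" "\<forall>i\<in>I. f i \<in> U" unfolding rspan_def by blast
  {
    fix y assume "y \<in> rspan U I q"
    then obtain h where h: "y = (\<Sum>i\<in>I. q i * h i)" "\<forall>i\<in>I. h i \<in> U" unfolding rspan_def by blast
    show "x + y \<in> rspan U I q" unfolding rspan_def using f h assms(2)
      by (intro CollectI exI[of _ "\<lambda>i. f i + h i"]) (simp add: distrib_left sum.distrib)
  next
    fix y assume "y \<in> U"
    then show "x * y \<in> rspan U I q" unfolding rspan_def using f assms(3)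
      by (intro CollectI exI[of _ "\<lambda>i. f i * y"]) (simp add: sum_distrib_right mult.assoc)
  }
qed

lemma rspan_in:
  assumes "finite I" "0 \<in> U" "1 \<in> U" "i \<in> I" shows "q i \<in> rspan U I q"
  unfolding rspan_def using assms
  by (intro CollectI exI[of _ "\<lambda>j. if j = i then 1 else 0"]) (auto simp: if_distrib[of "\<lambda>x. _ * x"] cong: if_cong)

lemma rsub_sum: "rsub U N \<Longrightarrow> (\<And>i. i \<in> I \<Longrightarrow> f i \<in> N) \<Longrightarrow> (\<Sum>i\<in>I. f i) \<in> N"
  by (induction I rule: infinite_finite_induct) (auto simp: rsub_def)

lemma rspan_left:
  assumes N: "rsub U N" and q: "\<And>i. i \<in> I \<Longrightarrow> b * q i \<in> N" and x: "x \<in> rspan U I q"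
  shows "b * x \<in> N"
proof -
  obtain f where f: "x = (\<Sum>i\<in>I. q i * f i)" "\<forall>i\<in>I. f i \<in> U" using x unfolding rspan_def by blast
  show ?thesis unfolding f sum_distrib_left mult.assoc[symmetric]
    by (rule rsub_sum[OF N]) (use f q N in \<open>auto simp: rsub_def\<close>)
qed

lemma rspan_least:
  "rsub U N \<Longrightarrow> (\<And>i. i \<in> I \<Longrightarrow> q i \<in> N) \<Longrightarrow> rspan U I q \<subseteq> N"
  using rspan_left[of U N I 1 q] by auto

context yh_parameters
begin

text \<open>The elements whose component at level \<open>n + 1\<close> comes from level \<open>n\<close>; no condition is put on the other components.\<close>
definition Uq :: "nat \<Rightarrow> yh_prod set" where
  "Uq n = {y. \<exists>f\<in>F n. u (Suc n) * y = cl (Suc n) f}"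

lemma Uq_closed: "y \<in> Uq n \<Longrightarrow> z \<in> Uq n \<Longrightarrow> y + z \<in> Uq n" "y \<in> Uq n \<Longrightarrow> z \<in> Uq n \<Longrightarrow> y * z \<in> Uq n"
  "y \<in> Uq n \<Longrightarrow> - y \<in> Uq n" "f \<in> F n \<Longrightarrow> cl (Suc n) f \<in> Uq n" "f \<in> F n \<Longrightarrow> c1 (Suc n) f \<in> Uq n" "1 \<in> Uq n" "0 \<in> Uq n"
proof -
  show "f \<in> F n \<Longrightarrow> cl (Suc n) f \<in> Uq n" for f
    unfolding Uq_def using u_cl(1)[OF F_mono] by (intro CollectI bexI[of _ f]) auto
  show "f \<in> F n \<Longrightarrow> c1 (Suc n) f \<in> Uq n" for f
    unfolding Uq_def using cl_c1(3)[OF F_mono] by (intro CollectI bexI[of _ f]) auto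
  show 1: "1 \<in> Uq n" unfolding Uq_def by (intro CollectI bexI[of _ 1]) (simp_all add: u_def free_closed)
  show "0 \<in> Uq n" unfolding Uq_def by (intro CollectI bexI[of _ 0]) (simp_all add: cl_0 free_closed)
  assume "y \<in> Uq n"
  then obtain f where f: "f \<in> F n" "u (Suc n) * y = cl (Suc n) f" unfolding Uq_def by blast
  have "u (Suc n) * - y = cl (Suc n) (0 - f)" using f by (subst cl_diff) (auto simp: F_mono free_closed cl_0)
  then show "- y \<in> Uq n" unfolding Uq_def using f free_closed(5)[OF free_closed(1) f(1)] by blast
  assume "z \<in> Uq n"
  then obtain h where h: "h \<in> F n" "u (Suc n) * z = cl (Suc n) h" unfolding Uq_def by blast
  have "u (Suc n) * (y + z) = cl (Suc n) (f + h)" using f h by (simp add: distrib_left cl_add F_mono)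
  then show "y + z \<in> Uq n" unfolding Uq_def using free_closed(3)[OF f(1) h(1)] by blast
  have "u (Suc n) * (y * z) = (u (Suc n) * y) * (u (Suc n) * z)"
    using u_central[of "Suc n" y] u_idem[of "Suc n"] by (metis mult.assoc)
  then have "u (Suc n) * (y * z) = cl (Suc n) (f * h)" using f h by (simp add: cl_mult F_mono)
  then show "y * z \<in> Uq n" unfolding Uq_def using free_closed(4)[OF f(1) h(1)] by blast
qed

sublocale sub: yokonuma_sub r d "Suc n" "tt (Suc n)" "gg (Suc n)" "xx (Suc n)" "xi (Suc n)" "vv (Suc n)" "vvi (Suc n)"
   "kk (Suc n)" "cc (Suc n)" "om (Suc n) k" n "Uq n" for n k
  by (intro yokonuma_sub.intro eig.yokonuma_eigen_axioms yokonuma_sub_axioms.intro)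
     (auto simp: tt_def gg_def xx_def xi_def cc_def kk_def om_def vv_def vvi_def
       intro!: Uq_closed letters_F scal_F base_mems)

lemma wq_rsub: "rsub (Uq n) (rspan (Uq n) I q)"
  by (rule rspan_rsub) (auto intro: Uq_closed)

lemma wq_in: "i \<in> I \<Longrightarrow> finite I \<Longrightarrow> q i \<in> rspan (Uq n) I q"
  by (rule rspan_in) (auto intro: Uq_closed)

lemma wq_mem: "j \<le> n \<Longrightarrow> a < d \<Longrightarrow> k < r \<Longrightarrow> eig.w (Suc n) k n j a \<in> rspan (Uq n) (Ix n) (wq n)"
  using wq_in[of "(j, a, k)" "Ix n" "wq n" n] finite_Ix by (simp add: Ix_def wq_def)

lemma u_in_span: "u (Suc n) \<in> rspan (Uq n) (Ix n) (wq n)"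
proof -
  have "(\<Sum>k<r. eig.w (Suc n) k n n 0) \<in> rspan (Uq n) (Ix n) (wq n)"
    using d by (intro rsub_sum[OF wq_rsub] wq_mem) auto
  also have "(\<Sum>k<r. eig.w (Suc n) k n n 0) = u (Suc n)"
    using sum_eps[of "Suc n" "Suc n"] by (simp add: sub.w_m_0)
  finally show ?thesis .
qed

lemma gval_span:
  assumes l: "l \<in> gens (Suc n)" and x: "x \<in> rspan (Uq n) (Ix n) (wq n)"
  shows "gval (Suc n) l * x \<in> rspan (Uq n) (Ix n) (wq n)"
proof (rule rspan_left[OF wq_rsub _ x])
  let ?N = "rspan (Uq n) (Ix n) (wq n)"
  fix i assume "i \<in> Ix n"
  then obtain j a k where i: "i = (j, a, k)" "j \<le> n" "a < d" "k < r" by (auto simp: Ix_def)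
  show "gval (Suc n) l * wq n i \<in> ?N"
  proof (cases l)
    case (gen_t m)
    then show ?thesis using l i sub.t_w_in[OF wq_rsub wq_mem[OF i(2-4)], of m]
      by (auto simp: wq_def gens_def)
  next
    case (gen_g m)
    have m: "1 \<le> m" "m \<le> n" using l gen_g by (auto simp: gens_def)
    have "gg (Suc n) m * eig.w (Suc n) k n j a \<in> ?N"
      by (rule sub.g_w_in[OF wq_rsub _ m i(2)]) (rule wq_mem[OF _ i(3,4)])
    then show ?thesis using gen_g i by (simp add: wq_def)
  next
    case gen_X
    then show ?thesis using i sub.\<xi>_w_in[OF wq_rsub wq_mem[OF _ _ i(4)] i(2,3)] by (simp add: wq_def)
  next
    case gen_Xinv
    then show ?thesis using i sub.\<xi>'_w_in[OF wq_rsub wq_mem[OF _ _ i(4)] i(2,3)] by (simp add: wq_def)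
  qed
qed

lemma sc_span:
  assumes a: "a \<in> carrier (base_ring r d)" and x: "x \<in> rspan (Uq n) (Ix n) (wq n)"
  shows "sc (Suc n) a * x \<in> rspan (Uq n) (Ix n) (wq n)"
proof -
  have "x * sc (Suc n) a \<in> rspan (Uq n) (Ix n) (wq n)"
    using wq_rsub[of n "Ix n" "wq n"] x Uq_closed(4)[OF scal_F[OF a]] by (auto simp: rsub_def sc_def)
  then show ?thesis using sc_central[OF a, of "Suc n" x] by simp
qed

text \<open>The span contains \<open>u (n + 1)\<close>, the identity of level \<open>n + 1\<close>, and is stable under left multiplication by letters and scalars.\<close>
lemma cl_span:
  assumes "f \<in> F (Suc n)" shows "cl (Suc n) f \<in> rspan (Uq n) (Ix n) (wq n)"
  using assms
proof (induction f rule: free_alg_induct)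
  case zero then show ?case using wq_rsub[of n "Ix n" "wq n"] by (simp add: cl_0 rsub_def)
next
  case (add f h) then show ?case using wq_rsub[of n "Ix n" "wq n"] by (simp add: cl_add rsub_def)
next
  case (single ls a)
  have "prod_list (map (gval (Suc n)) ls) * u (Suc n) \<in> rspan (Uq n) (Ix n) (wq n)"
    using single(1) by (induction ls) (auto simp: u_in_span gval_span mult.assoc)
  then have "sc (Suc n) a * (prod_list (map (gval (Suc n)) ls) * u (Suc n)) \<in> rspan (Uq n) (Ix n) (wq n)"
    by (rule sc_span[OF single(2)])
  moreover have "sc (Suc n) a * (y * u (Suc n)) = sc (Suc n) a * y" for y
    unfolding u_central[symmetric] using u_cl(2)[OF scal_F[OF single(2)]] by (simp add: mult.assoc[symmetric] sc_def)
  ultimately show ?case using single by (simp add: cl_single[of _ "Suc n"])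
qed

lemma u_eps: "u n * eig.\<epsilon> n k j = eig.\<epsilon> n k j"
  unfolding eig.\<epsilon>_def eig.avg_def mult.assoc[symmetric]
  by (simp add: kk_def u_cl scal_F base_mems)

lemma w_u: "eig.w (Suc n) k m j a * u (Suc n) = eig.w (Suc n) k m j a"
proof -
  have "eig.\<epsilon> (Suc n) k 1 * eig.J (Suc n) m * u (Suc n) = u (Suc n) * eig.\<epsilon> (Suc n) k 1 * eig.J (Suc n) m"
    by (simp only: u_central mult.assoc)
  then show ?thesis unfolding eig.w_def by (simp add: mult.assoc u_eps[of _ _ 1, simplified] mult.assoc[symmetric, of "u _"])
qed

lemma wq_u: "wq n i * u (Suc n) = wq n i"
  by (cases i) (simp add: wq_def w_u)

text \<open>The second basis: for position \<open>n\<close> the elements \<open>w\<close> are replaced by \<open>Y\<^sup>a \<epsilon>\<^sub>n\<^sub>+\<^sub>1\<close>.  The rank \<open>rk\<close> measures the order in which the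
change of basis is unitriangular: position below \<open>n\<close> comes first, then position \<open>n\<close> by Newton index.\<close>
definition Yn :: "nat \<Rightarrow> yh_prod" where "Yn n = eig.Y (Suc n) (Suc n)"

definition qb :: "nat \<Rightarrow> nat \<times> nat \<times> nat \<Rightarrow> yh_prod" where
  "qb n = (\<lambda>(j, a, k). if j < n then wq n (j, a, k) else Yn n ^ a * eig.\<epsilon> (Suc n) k (Suc n))"

definition rk :: "nat \<Rightarrow> nat \<times> nat \<times> nat \<Rightarrow> nat" where
  "rk n = (\<lambda>(j, a, k). if j < n then 0 else Suc a)"

lemma qb_triangular:
  assumes N: "rsub (Uq n) N" and i: "i \<in> Ix n" and lower: "\<And>i'. i' \<in> Ix n \<Longrightarrow> rk n i' < rk n i \<Longrightarrow> wq n i' \<in> N"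
  shows "qb n i - wq n i \<in> N"
proof -
  obtain j a k where i': "i = (j, a, k)" "j \<le> n" "a < d" "k < r" using i by (auto simp: Ix_def)
  show ?thesis
  proof (cases "j < n")
    case True
    then show ?thesis using i' N by (simp add: qb_def rsub_def)
  next
    case False
    then have j: "j = n" using i' by simp
    have "Yn n ^ a * eig.w (Suc n) k n n 0 - eig.w (Suc n) k n n a \<in> N"
      unfolding Yn_def
    proof (rule sub.Y_power_w[OF N i'(3)])
      show "eig.w (Suc n) k n n b \<in> N" if "b < a" for b
        using lower[of "(n, b, k)"] that i' j by (simp add: Ix_def rk_def wq_def)
      show "eig.w (Suc n) k n l b \<in> N" if "l < n" "b < d" for l b
        using lower[of "(l, b, k)"] that i' j by (simp add: Ix_def rk_def wq_def)
    qed
    then show ?thesis using i' j by (simp add: qb_def wq_def sub.w_m_0)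
  qed
qed

lemma span_F:
  assumes "x \<in> rspan (Uq n) I q" and qu: "\<And>i. i \<in> I \<Longrightarrow> q i * u (Suc n) = q i"
  shows "\<exists>h. (\<forall>i. h i \<in> F n) \<and> x = (\<Sum>i\<in>I. q i * cl (Suc n) (h i))"
proof -
  obtain y where y: "x = (\<Sum>i\<in>I. q i * y i)" "\<forall>i\<in>I. y i \<in> Uq n" using assms(1) unfolding rspan_def by blast
  then have "\<forall>i. \<exists>f. f \<in> F n \<and> (i \<in> I \<longrightarrow> u (Suc n) * y i = cl (Suc n) f)"
    unfolding Uq_def using free_closed(1) by blast
  then obtain h where h: "\<And>i. h i \<in> F n" "\<And>i. i \<in> I \<Longrightarrow> u (Suc n) * y i = cl (Suc n) (h i)" by metis
  have "q i * y i = q i * cl (Suc n) (h i)" if "i \<in> I" for i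
    using qu[OF that] h(2)[OF that] by (metis mult.assoc)
  then show ?thesis using h(1) y(1) by (intro exI[of _ h]) simp
qed

lemma qb_u: "qb n i * u (Suc n) = qb n i"
proof -
  obtain j a k where i: "i = (j, a, k)" by (cases i)
  have "eig.\<epsilon> (Suc n) k (Suc n) * u (Suc n) = eig.\<epsilon> (Suc n) k (Suc n)"
    using u_eps[of "Suc n" k "Suc n"] by (simp only: u_central)
  then show ?thesis by (simp add: i qb_def wq_u mult.assoc)
qed

lemma qb_span:
  assumes "f \<in> F (Suc n)"
  shows "\<exists>h. (\<forall>i. h i \<in> F n) \<and> cl (Suc n) f = (\<Sum>i\<in>Ix n. qb n i * cl (Suc n) (h i))"
proof -
  let ?N = "rspan (Uq n) (Ix n) (qb n)"
  have N: "rsub (Uq n) ?N" by (rule wq_rsub)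
  have "wq n i \<in> ?N" if "i \<in> Ix n" for i
    using that
  proof (induction "rk n i" arbitrary: i rule: less_induct)
    case less
    have "qb n i - wq n i \<in> ?N" by (rule qb_triangular[OF N less.prems]) (rule less.hyps)
    moreover have "qb n i \<in> ?N" using less.prems finite_Ix by (intro wq_in)
    ultimately have "qb n i - (qb n i - wq n i) \<in> ?N" using sub.rsubD(5)[OF N] by blast
    then show ?case by simp
  qed
  then have "rspan (Uq n) (Ix n) (wq n) \<subseteq> ?N" by (rule rspan_least[OF N])
  then have "cl (Suc n) f \<in> ?N" using cl_span[OF assms] by blast
  from span_F[OF this qb_u] show ?thesis .
qed

lemma wq_span:
  assumes "f \<in> F (Suc n)"
  shows "\<exists>h. (\<forall>i. h i \<in> F n) \<and> cl (Suc n) f = (\<Sum>i\<in>Ix n. wq n i * cl (Suc n) (h i))"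
  by (rule span_F[OF cl_span[OF assms] wq_u])

lemma qb_indep:
  assumes f: "\<And>i. i \<in> Ix n \<Longrightarrow> f i \<in> F n" and z: "(\<Sum>i\<in>Ix n. qb n i * cl (Suc n) (f i)) = 0" and i: "i \<in> Ix n"
  shows "cl n (f i) = 0"
proof -
  \<comment> \<open>The coefficients \<open>c j i\<close> of the change of basis are strictly triangular with respect to the rank.\<close>
  let ?L = "\<lambda>j. {i \<in> Ix n. rk n i < rk n j}"
  have "\<exists>h. (\<forall>i. h i \<in> F n) \<and> qb n j - wq n j = (\<Sum>i\<in>?L j. wq n i * cl (Suc n) (h i))" if "j \<in> Ix n" for j
  proof (rule span_F[OF qb_triangular[OF wq_rsub that] wq_u])
    show "wq n i' \<in> rspan (Uq n) (?L j) (wq n)" if "i' \<in> Ix n" "rk n i' < rk n j" for i'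
      using that finite_Ix by (intro wq_in) auto
  qed
  then have "\<forall>j\<in>Ix n. \<exists>h. (\<forall>i. h i \<in> F n) \<and> qb n j - wq n j = (\<Sum>i\<in>?L j. wq n i * cl (Suc n) (h i))"
    by blast
  from bchoice[OF this] obtain h where h: "\<And>j i. j \<in> Ix n \<Longrightarrow> h j i \<in> F n"
      "\<And>j. j \<in> Ix n \<Longrightarrow> qb n j - wq n j = (\<Sum>i\<in>?L j. wq n i * cl (Suc n) (h j i))"
    by blast
  define c where "c j i = (if rk n i < rk n j then h j i else 0)" for j i
  have c: "c j i \<in> F n" if "j \<in> Ix n" for j i using h(1)[OF that] by (simp add: c_def free_closed)
  have 1: "qb n j = wq n j + (\<Sum>i\<in>Ix n. wq n i * cl (Suc n) (c j i))" if "j \<in> Ix n" for j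
  proof -
    have "(\<Sum>i\<in>Ix n. wq n i * cl (Suc n) (c j i)) = (\<Sum>i\<in>?L j. wq n i * cl (Suc n) (h j i))"
      by (rule sum.mono_neutral_cong_right) (auto simp: c_def cl_0 finite_Ix)
    then show ?thesis using h(2)[OF that] by (simp add: algebra_simps)
  qed
  define g where "g i = f i + (\<Sum>j\<in>Ix n. c j i * f j)" for i
  have g: "g i \<in> F n" if "i \<in> Ix n" for i
    unfolding g_def using f c that by (intro free_closed free_sum_closed) auto
  have "(\<Sum>j\<in>Ix n. qb n j * cl (Suc n) (f j)) = (\<Sum>j\<in>Ix n. wq n j * cl (Suc n) (f j) + (\<Sum>i\<in>Ix n. wq n i * cl (Suc n) (c j i * f j)))"
    using f c by (intro sum.cong) (simp_all add: 1 distrib_right sum_distrib_right mult.assoc cl_mult F_mono)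
  also have "\<dots> = (\<Sum>i\<in>Ix n. wq n i * (cl (Suc n) (f i) + (\<Sum>j\<in>Ix n. cl (Suc n) (c j i * f j))))"
    unfolding sum.distrib distrib_left sum_distrib_left by (subst sum.swap) simp
  also have "\<dots> = (\<Sum>i\<in>Ix n. wq n i * cl (Suc n) (g i))"
  proof (rule sum.cong)
    fix i assume i: "i \<in> Ix n"
    have m: "c j i * f j \<in> F (Suc n)" if "j \<in> Ix n" for j using c f that F_mono free_closed(4) by blast
    have "cl (Suc n) (g i) = cl (Suc n) (f i) + (\<Sum>j\<in>Ix n. cl (Suc n) (c j i * f j))"
      unfolding g_def using i f m by (subst cl_add) (auto simp: F_mono cl_sum free_sum_closed)
    then show "wq n i * (cl (Suc n) (f i) + (\<Sum>j\<in>Ix n. cl (Suc n) (c j i * f j))) = wq n i * cl (Suc n) (g i)" by simp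
  qed simp
  finally have "(\<Sum>i\<in>Ix n. wq n i * cl (Suc n) (g i)) = 0" using z by simp
  then have g0: "cl n (g i) = 0" if "i \<in> Ix n" for i using wq_indep[of n g, OF g _ that] by simp
  \<comment> \<open>The coefficients \<open>g\<close> with respect to the first basis vanish, so the coefficients \<open>f\<close> vanish by induction from the highest rank
downwards.\<close>
  define b where "b = Suc (Max (rk n ` Ix n))"
  have "rk n i < b" if "i \<in> Ix n" for i
    using that finite_Ix by (auto simp: b_def less_Suc_eq_le)
  then show ?thesis using i
  proof (induction "b - rk n i" arbitrary: i rule: less_induct)
    case less
    have "cl n (c j i * f j) = 0" if "j \<in> Ix n" for j
    proof (cases "rk n i < rk n j")
      case True
      then have "b - rk n j < b - rk n i" using less.prems(1)[OF that] by linarith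
      then have "cl n (f j) = 0" using less.hyps less.prems(1) that by blast
      then show ?thesis using c f that by (simp add: cl_mult)
    qed (simp add: c_def cl_0)
    moreover have m: "c j i * f j \<in> F n" if "j \<in> Ix n" for j using c f that free_closed(4) by blast
    ultimately have "cl n (\<Sum>j\<in>Ix n. c j i * f j) = 0" by (subst cl_sum) auto
    then have "cl n (g i) = cl n (f i)"
      unfolding g_def using less.prems f m by (subst cl_add) (auto intro!: free_sum_closed)
    then show ?case using g0[OF less.prems(2)] by simp
  qed
qed

section \<open>Representing the basis by polynomials\<close>

text \<open>The inclusion \<open>A\<^sub>n \<rightarrow> A\<^sub>n\<^sub>+\<^sub>1\<close> is known on classes of polynomials, by \<open>cyc_incl_class\<close>.  These polynomials represent the
factors of the basis elements; the same polynomial gives an element and its image at the next level.\<close>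
definition fgi :: "nat \<Rightarrow> yh_poly" where "fgi i = yg i - scal (lq - lq_inv) * ye r i"
primrec fL :: "nat \<Rightarrow> yh_poly" where "fL 0 = 1" | "fL (Suc j) = yg (Suc j) * fL j"
primrec fJ :: "nat \<Rightarrow> yh_poly" where "fJ 0 = 1" | "fJ (Suc j) = fJ j * fgi (Suc j)"
primrec fp :: "nat \<Rightarrow> yh_poly" where "fp 0 = 1" | "fp (Suc a) = fp a * (yX - scal (lv (Suc a)))"
definition feps :: "nat \<Rightarrow> yh_poly" where
  "feps k = scal (const (1 / of_nat r)) * (\<Sum>s<r. yt 1 ^ s * scal (const (zeta r ^ k)) ^ (r - s))"
definition fw :: "nat \<Rightarrow> nat \<times> nat \<times> nat \<Rightarrow> yh_poly" where
  "fw m = (\<lambda>(j, a, k). fL j * (fp a * (feps k * fJ m)))"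

lemma fgi_F: "1 \<le> i \<Longrightarrow> i < n \<Longrightarrow> fgi i \<in> F n"
  unfolding fgi_def by (intro free_closed letters_F scal_F base_mems ye_F)

lemma fL_F: "j < n \<Longrightarrow> fL j \<in> F n"
  by (induction j) (simp_all add: free_closed letters_F)

lemma fJ_F: "j < n \<Longrightarrow> fJ j \<in> F n"
  by (induction j) (simp_all add: free_closed fgi_F)

lemma fp_F: "0 < n \<Longrightarrow> a \<le> d \<Longrightarrow> fp a \<in> F n"
  by (induction a) (simp_all add: free_closed letters_F scal_F base_mems)

lemma feps_F: "0 < n \<Longrightarrow> feps k \<in> F n"
  unfolding feps_def by (intro free_closed free_sum_closed scal_F base_mems letters_F) auto

lemma e_cl: "1 \<le> i \<Longrightarrow> i < n \<Longrightarrow> eig.e n i = cl n (ye r i)"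
proof -
  assume i: "1 \<le> i" "i < n"
  have "(\<Sum>s<r. tt n i ^ s * tt n (i + 1) ^ (r - s)) = (\<Sum>s<r. c1 n (yt i ^ s * yt (i + 1) ^ (r - s)))"
    using i by (simp add: tt_def c1_power c1_mult letters_F free_closed)
  then show ?thesis
    using i kk_sum[of "\<lambda>s. yt i ^ s * yt (i + 1) ^ (r - s)" n] by (simp add: ye_def letters_F free_closed eig.e_def eig.avg_def)
qed

lemma gi_c1: "1 \<le> i \<Longrightarrow> i < n \<Longrightarrow> eig.gi n i = c1 n (fgi i)"
proof -
  assume i: "1 \<le> i" "i < n"
  have s: "scal (lq - lq_inv) \<in> F n" by (intro scal_F base_mems)
  have "eig.gi n i = c1 n (yg i) - cl n (scal (lq - lq_inv) * ye r i)"
    unfolding eig.gi_def e_cl[OF i] cl_mult[OF s ye_F[OF i]] using i by (simp add: gg_def) (simp add: cc_def)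
  then show ?thesis using i s unfolding fgi_def by (simp add: c1_def cl_diff letters_F ye_F free_closed)
qed

lemma L_c1: "j < n \<Longrightarrow> eig.L n j = c1 n (fL j)"
  by (induction j) (simp_all add: c1_1 c1_mult letters_F fL_F gg_def)

lemma J_c1: "j < n \<Longrightarrow> eig.J n j = c1 n (fJ j)"
  by (induction j) (simp_all add: c1_1 c1_mult fgi_F fJ_F gi_c1)

lemma p_cl: "0 < n \<Longrightarrow> a \<le> d \<Longrightarrow> f \<in> F n \<Longrightarrow> eig.p n a * cl n f = cl n (fp a * f)"
proof (induction a arbitrary: f)
  case (Suc a)
  have l: "yX - scal (lv (Suc a)) \<in> F n" using Suc.prems by (intro free_closed letters_F scal_F base_mems) auto
  have "eig.p n (Suc a) * cl n f = eig.p n a * cl n ((yX - scal (lv (Suc a))) * f)"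
  proof -
    have "cl n ((yX - scal (lv (Suc a))) * f) = (xx n - vv n (Suc a)) * cl n f"
    proof -
      have "yX \<in> F n" "scal (lv (Suc a)) \<in> F n"
        using Suc.prems by (auto intro: letters_F scal_F base_mems)
      then have "xx n - vv n (Suc a) = cl n (yX - scal (lv (Suc a)))"
        using Suc.prems unfolding xx_def vv_def by (simp add: c1_diff)
      then show ?thesis using Suc.prems l by (simp add: cl_mult)
    qed
    then show ?thesis by (simp add: mult.assoc)
  qed
  also have "\<dots> = cl n (fp a * ((yX - scal (lv (Suc a))) * f))" using Suc.prems free_closed(4)[OF l] by (intro Suc.IH) auto
  finally show ?case by (simp add: mult.assoc)
qed simp

lemma eps_cl: "0 < n \<Longrightarrow> eig.\<epsilon> n k 1 = cl n (feps k)"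
proof -
  assume n: "0 < n"
  have z: "scal (const (zeta r ^ k)) \<in> F n" by (intro scal_F base_mems)
  have "(\<Sum>s<r. tt n 1 ^ s * om n k ^ (r - s)) = (\<Sum>s<r. c1 n (yt 1 ^ s * scal (const (zeta r ^ k)) ^ (r - s)))"
    using n z by (simp add: tt_def om_def c1_power c1_mult letters_F free_closed)
  then show ?thesis using n z kk_sum[of "\<lambda>s. yt 1 ^ s * scal (const (zeta r ^ k)) ^ (r - s)" n]
    by (simp add: feps_def letters_F free_closed eig.\<epsilon>_def eig.avg_def)
qed

lemma fw_F: "j \<le> m \<Longrightarrow> m < n \<Longrightarrow> a \<le> d \<Longrightarrow> fw m (j, a, k) \<in> F n"
  unfolding fw_def by (simp add: free_closed fL_F fJ_F fp_F feps_F)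

lemma w_cl: "j \<le> m \<Longrightarrow> m < n \<Longrightarrow> a \<le> d \<Longrightarrow> eig.w n k m j a = cl n (fw m (j, a, k))"
  unfolding eig.w_def fw_def
  by (simp add: L_c1 J_c1 eps_cl[simplified] cl_c1 p_cl fL_F fJ_F fp_F feps_F free_closed)

text \<open>To commute with the image of a lower level it suffices to commute with the letters.\<close>
lemma comm_F:
  assumes f: "f \<in> F m" and m: "m \<le> n" and y: "\<And>l. l \<in> gens m \<Longrightarrow> gval n l * y = y * gval n l"
  shows "cl n f * y = y * cl n f"
  using f
proof (induction f rule: free_alg_induct)
  case zero then show ?case by (simp add: cl_0)
next
  case (add f h)
  have "F m \<subseteq> F n" using m by (induction rule: dec_induct) (auto dest: F_mono)
  then have "f \<in> F n" "h \<in> F n" using add by auto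
  then show ?case using add by (simp add: cl_add distrib_left distrib_right)
next
  case (single ls a)
  have "prod_list (map (gval n) ls) * y = y * prod_list (map (gval n) ls)"
    using single(1)
  proof (induction ls)
    case (Cons l ls)
    then have "gval n l * y = y * gval n l" using y by auto
    then show ?case using Cons by (simp add: mult.assoc) (simp add: mult.assoc[symmetric])
  qed simp
  then show ?case using single m sc_central[OF single(2), of n y]
    by (simp add: cl_single[of _ m] mult.assoc) (simp add: mult.assoc[symmetric])
qed

end

section \<open>The restriction of an induced module\<close>

context yh_parameters
begin

lemma emb_finsum:
  assumes "finite I" "f \<in> I \<rightarrow> carrier (cyc_YH r d n)"
  shows "emb r d n (\<Oplus>\<^bsub>cyc_YH r d n\<^esub>i\<in>I. f i) = (\<Sum>i\<in>I. emb r d n (f i))"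
  using assms
proof (induction I rule: finite_induct)
  case empty
  interpret R: ring "cyc_YH r d n" by (rule ring_cyc_YH)
  show ?case using emb_ops(3)[OF R.zero_closed R.zero_closed] by simp
next
  case (insert i I)
  interpret R: ring "cyc_YH r d n" by (rule ring_cyc_YH)
  have "(\<Oplus>\<^bsub>cyc_YH r d n\<^esub>i\<in>I. f i) \<in> carrier (cyc_YH r d n)" using insert.prems by (intro R.finsum_closed) auto
  then show ?case using insert by (simp add: R.finsum_insert emb_ops Pi_iff)
qed

text \<open>Translates spanning and independence from the product ring to the cyclotomic algebras, along an enumeration \<open>g\<close> of the index set.\<close>
lemma right_basis_cyc:
  fixes g :: "'i \<Rightarrow> nat \<times> nat \<times> nat"
  assumes g: "bij_betw g I (Ix n)" and w: "\<And>i. i \<in> I \<Longrightarrow> w i \<in> carrier (cyc_YH r d (Suc n))"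
    and w_q: "\<And>i. i \<in> I \<Longrightarrow> emb r d (Suc n) (w i) = q (g i)"
    and span: "\<And>f. f \<in> F (Suc n) \<Longrightarrow> \<exists>h. (\<forall>i. h i \<in> F n) \<and> cl (Suc n) f = (\<Sum>i\<in>Ix n. q i * cl (Suc n) (h i))"
    and indep: "\<And>f i. \<lbrakk>\<And>i. i \<in> Ix n \<Longrightarrow> f i \<in> F n; (\<Sum>i\<in>Ix n. q i * cl (Suc n) (f i)) = 0; i \<in> Ix n\<rbrakk> \<Longrightarrow> cl n (f i) = 0"
  shows "right_basis (cyc_YH r d n) (cyc_YH r d (Suc n)) (cyc_incl r d n) I w"
proof -
  interpret R: ring "cyc_YH r d (Suc n)" by (rule ring_cyc_YH)
  let ?s = "\<lambda>x. \<Oplus>\<^bsub>cyc_YH r d (Suc n)\<^esub>i\<in>I. w i \<otimes>\<^bsub>cyc_YH r d (Suc n)\<^esub> cyc_incl r d n (x i)"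
  have fin: "finite I" using bij_betw_finite[OF g] finite_Ix by simp
  have incl: "cyc_incl r d n x \<in> carrier (cyc_YH r d (Suc n))" if "x \<in> carrier (cyc_YH r d n)" for x
    by (rule ring_hom_closed[OF cyc_incl_hom that])
  have sum_closed: "?s x \<in> carrier (cyc_YH r d (Suc n))" if "\<And>i. i \<in> I \<Longrightarrow> x i \<in> carrier (cyc_YH r d n)" for x
    using that w incl by (intro R.finsum_closed) auto
  have emb_sum: "emb r d (Suc n) (?s x) = (\<Sum>i\<in>I. q (g i) * cl (Suc n) (h i))"
    if h: "\<And>i. i \<in> I \<Longrightarrow> h i \<in> F n" and x: "\<And>i. i \<in> I \<Longrightarrow> x i = cyc_class r d n (h i)" for x h
  proof -
    have "emb r d (Suc n) (?s x) = (\<Sum>i\<in>I. emb r d (Suc n) (w i \<otimes>\<^bsub>cyc_YH r d (Suc n)\<^esub> cyc_incl r d n (x i)))"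
      using fin w incl x h class_closed by (intro emb_finsum) auto
    also have "\<dots> = (\<Sum>i\<in>I. q (g i) * cl (Suc n) (h i))"
    proof (rule sum.cong)
      fix i assume i: "i \<in> I"
      show "emb r d (Suc n) (w i \<otimes>\<^bsub>cyc_YH r d (Suc n)\<^esub> cyc_incl r d n (x i)) = q (g i) * cl (Suc n) (h i)"
        using i h[OF i] class_closed[OF F_mono[OF h[OF i]]]
        by (simp add: x cyc_incl_class emb_ops(2)[OF w] w_q cl_def)
    qed simp
    finally show ?thesis .
  qed
  have "\<exists>!x. x \<in> I \<rightarrow>\<^sub>E carrier (cyc_YH r d n) \<and> b = ?s x" if b: "b \<in> carrier (cyc_YH r d (Suc n))" for b
  proof (rule ex_ex1I)
    obtain f where f: "f \<in> F (Suc n)" "emb r d (Suc n) b = cl (Suc n) f" using emb_eq_cl[OF b] by blast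
    obtain h where h: "\<And>i. h i \<in> F n" "cl (Suc n) f = (\<Sum>i\<in>Ix n. q i * cl (Suc n) (h i))"
      using span[OF f(1)] by blast
    define x where "x = (\<lambda>i\<in>I. cyc_class r d n (h (g i)))"
    have x: "x \<in> I \<rightarrow>\<^sub>E carrier (cyc_YH r d n)" using h(1) class_closed by (auto simp: x_def)
    have "emb r d (Suc n) (?s x) = (\<Sum>i\<in>I. q (g i) * cl (Suc n) (h (g i)))"
      by (rule emb_sum) (simp_all add: h x_def)
    also have "\<dots> = emb r d (Suc n) b"
      unfolding f(2) h(2) by (rule sum.reindex_bij_betw[OF g])
    finally have "b = ?s x" using x by (intro emb_inj[OF b sum_closed]) auto
    with x show "\<exists>x. x \<in> I \<rightarrow>\<^sub>E carrier (cyc_YH r d n) \<and> b = ?s x" by (intro exI[of _ x] conjI)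
  next
    fix x y assume xy: "x \<in> I \<rightarrow>\<^sub>E carrier (cyc_YH r d n) \<and> b = ?s x" "y \<in> I \<rightarrow>\<^sub>E carrier (cyc_YH r d n) \<and> b = ?s y"
    have ex: "\<exists>h. \<forall>i\<in>I. h i \<in> F n \<and> x i = cyc_class r d n (h i)" if "x \<in> I \<rightarrow>\<^sub>E carrier (cyc_YH r d n)" for x
    proof (intro bchoice ballI)
      fix i assume "i \<in> I"
      then have "x i \<in> carrier (cyc_YH r d n)" using \<open>x \<in> _\<close> by (rule PiE_mem[rotated])
      then show "\<exists>f. f \<in> F n \<and> x i = cyc_class r d n f" unfolding cyc_class_surj by blast
    qed
    obtain h h' where h: "\<And>i. i \<in> I \<Longrightarrow> h i \<in> F n" "\<And>i. i \<in> I \<Longrightarrow> x i = cyc_class r d n (h i)"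
      and h': "\<And>i. i \<in> I \<Longrightarrow> h' i \<in> F n" "\<And>i. i \<in> I \<Longrightarrow> y i = cyc_class r d n (h' i)"
      using ex[OF conjunct1[OF xy(1)]] ex[OF conjunct1[OF xy(2)]] by blast
    define f where "f j = h (inv_into I g j) - h' (inv_into I g j)" for j
    have fg: "f (g i) = h i - h' i" if "i \<in> I" for i
      using that g by (simp add: f_def bij_betw_def)
    have f: "f j \<in> F n" if "j \<in> Ix n" for j
    proof -
      obtain i where "i \<in> I" "j = g i" using \<open>j \<in> Ix n\<close> g by (auto simp: bij_betw_def)
      then show ?thesis using h h' by (simp add: fg free_closed)
    qed
    have "(\<Sum>j\<in>Ix n. q j * cl (Suc n) (f j)) = (\<Sum>i\<in>I. q (g i) * cl (Suc n) (f (g i)))"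
      by (rule sum.reindex_bij_betw[OF g, symmetric])
    also have "\<dots> = (\<Sum>i\<in>I. q (g i) * cl (Suc n) (h i)) - (\<Sum>i\<in>I. q (g i) * cl (Suc n) (h' i))"
      unfolding sum_subtractf[symmetric]
      by (rule sum.cong) (simp_all add: fg cl_diff h h' F_mono right_diff_distrib)
    also have "\<dots> = 0" using emb_sum[of h x] emb_sum[of h' y] h h' xy by simp
    finally have 0: "cl n (f j) = 0" if "j \<in> Ix n" for j using indep[of f] f that by blast
    show "x = y"
    proof (rule PiE_ext[OF conjunct1[OF xy(1)] conjunct1[OF xy(2)]])
      fix i assume i: "i \<in> I"
      have "cl n (h i - h' i) = 0" using 0[of "g i"] i g fg by (auto simp: bij_betw_def)
      then have "cl n (h i) = cl n (h' i)" using i h h' by (simp add: cl_diff)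
      then show "x i = y i" using i h h' cl_eq by simp
    qed
  qed
  then show ?thesis unfolding right_basis_def using fin w by auto
qed

lemma cl_fgi: "1 \<le> i \<Longrightarrow> i < n \<Longrightarrow> f \<in> F n \<Longrightarrow> cl n f * cl n (fgi i) = cl n f * eig.gi n i"
  "1 \<le> i \<Longrightarrow> i < n \<Longrightarrow> f \<in> F n \<Longrightarrow> cl n (fgi i) * cl n f = eig.gi n i * cl n f"
  by (simp_all add: gi_c1 cl_c1 cl_mult fgi_F)

text \<open>The letters of level \<open>m\<close> commute with \<open>g\<^sub>m\<^sub>+\<^sub>1\<close>, hence with its inverse.\<close>
lemma gi_gens:
  assumes "l \<in> gens m" shows "gval (Suc (Suc m)) l * eig.gi (Suc (Suc m)) (Suc m) = eig.gi (Suc (Suc m)) (Suc m) * gval (Suc (Suc m)) l"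
proof -
  let ?n = "Suc (Suc m)"
  have gx: "gg ?n (Suc m) * xx ?n = xx ?n * gg ?n (Suc m)" if "m \<noteq> 0" using that by (intro eig.gX) auto
  have "gg ?n (Suc m) * gval ?n l = gval ?n l * gg ?n (Suc m)"
    using assms
  proof (cases l)
    case (gen_t j) then show ?thesis using assms by (auto simp: gens_def split: if_splits intro!: eig.gt_other)
  next
    case (gen_g j) then show ?thesis using assms by (auto simp: gens_def split: if_splits intro!: eig.gg_far)
  next
    case gen_X then show ?thesis using assms gx by (auto simp: gens_def split: if_splits)
  next
    case gen_Xinv then show ?thesis using assms eig.\<xi>'_comm[OF gx] by (auto simp: gens_def split: if_splits)
  qed
  then show ?thesis by (intro eig.gi_comm[symmetric]) auto
qed

lemma Y_\<epsilon>_gens: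
  assumes l: "l \<in> gens n"
  shows "gval (Suc n) l * (Yn n ^ a * eig.\<epsilon> (Suc n) k (Suc n)) = Yn n ^ a * eig.\<epsilon> (Suc n) k (Suc n) * gval (Suc n) l"
proof (rule commute_mult)
  let ?n = "Suc n"
  have x: "xx ?n * Yn n = Yn n * xx ?n" "xx ?n * eig.\<epsilon> ?n k ?n = eig.\<epsilon> ?n k ?n * xx ?n"
    unfolding Yn_def by (rule eig.\<xi>_Y; simp) (rule eig.\<xi>_\<epsilon>; simp)
  have "gval ?n l * Yn n = Yn n * gval ?n l \<and> gval ?n l * eig.\<epsilon> ?n k ?n = eig.\<epsilon> ?n k ?n * gval ?n l"
  proof (cases l)
    case (gen_t j)
    then have "1 \<le> j" "j \<le> n" using l by (auto simp: gens_def split: if_splits)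
    then show ?thesis using gen_t eig.t_Y[of ?n ?n j] eig.t_\<epsilon>_comm[of ?n ?n j] unfolding Yn_def by (simp del: eig.Y.simps)
  next
    case (gen_g j)
    then have "1 \<le> j" "j < n" using l by (auto simp: gens_def split: if_splits)
    then show ?thesis using gen_g eig.g_Y[of ?n ?n j] eig.g_\<epsilon>_other[of j ?n ?n] unfolding Yn_def by (simp del: eig.Y.simps)
  next
    case gen_X then show ?thesis using x by simp
  next
    case gen_Xinv then show ?thesis using eig.\<xi>'_comm[OF x(1)[symmetric]] eig.\<xi>'_comm[OF x(2)[symmetric]] by simp
  qed
  then show "gval ?n l * Yn n ^ a = Yn n ^ a * gval ?n l" "gval ?n l * eig.\<epsilon> ?n k ?n = eig.\<epsilon> ?n k ?n * gval ?n l"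
    using power_commuting_commutes[of "Yn n" "gval ?n l" a] by auto
qed

text \<open>The \<open>r * d\<close> basis elements in position \<open>m + 1\<close> are numbered by \<open>i = k * d + a\<close>.\<close>
lemma bij_Ix:
  "bij_betw (case_sum (\<lambda>i. (Suc m, i mod d, i div d)) id) ({..<r * d} <+> Ix m) (Ix (Suc m))"
proof (rule bij_betwI[where g = "\<lambda>(j, a, k). if j = Suc m then Inl (k * d + a) else Inr (j, a, k)"])
  show "case_sum (\<lambda>i. (Suc m, i mod d, i div d)) id \<in> {..<r * d} <+> Ix m \<rightarrow> Ix (Suc m)"
    using d by (auto simp: Ix_def less_mult_imp_div_less)
  have "k * d + a < r * d" if "k < r" "a < d" for k a
  proof -
    have "k * d + a < Suc k * d" using that by simp
    also have "\<dots> \<le> r * d" using that by (intro mult_le_mono1) simp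
    finally show ?thesis .
  qed
  then show "(\<lambda>(j, a, k). if j = Suc m then Inl (k * d + a) else Inr (j, a, k)) \<in> Ix (Suc m) \<rightarrow> {..<r * d} <+> Ix m"
    by (auto simp: Ix_def)
  show "(\<lambda>(j, a, k). if j = Suc m then Inl (k * d + a) else Inr (j, a, k)) (case_sum (\<lambda>i. (Suc m, i mod d, i div d)) id x) = x"
    if "x \<in> {..<r * d} <+> Ix m" for x using that by (auto simp: Ix_def)
  show "case_sum (\<lambda>i. (Suc m, i mod d, i div d)) id ((\<lambda>(j, a, k). if j = Suc m then Inl (k * d + a) else Inr (j, a, k)) y) = y"
    if "y \<in> Ix (Suc m)" for y using that by (auto simp: Ix_def)
qed

text \<open>The basis elements below the top position are those of the lower level times \<open>g\<^sub>m\<^sub>+\<^sub>1\<^sup>-\<^sup>1\<close>, because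
\<open>J (m + 1) = J m * gi (m + 1)\<close>; those in the top position are powers of the Jucys--Murphy element times an eigenvalue idempotent.\<close>
lemma mackey_cyc:
  "mackey (cyc_YH r d m) (cyc_YH r d (Suc m)) (cyc_YH r d (Suc (Suc m))) (cyc_incl r d m) (cyc_incl r d (Suc m)) (r * d)
     (\<lambda>i. cmp (qb (Suc m) (Suc m, i mod d, i div d)) (r, d, Suc (Suc m))) (Ix m) (\<lambda>i. cyc_class r d (Suc m) (fw m i))
     (cyc_class r d (Suc (Suc m)) (fgi (Suc m)))" (is "mackey ?C ?A ?B ?j ?i _ ?z _ ?w ?\<gamma>")
proof (rule mackey.intro)
  let ?n = "Suc (Suc m)"
  interpret B: ring ?B by (rule ring_cyc_YH)
  have w: "fw m i \<in> F (Suc m)" "cl (Suc m) (fw m i) = wq m i" "cl ?n (fw m i) * eig.gi ?n (Suc m) = qb (Suc m) i" if "i \<in> Ix m" for i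
  proof -
    obtain j a k where i: "i = (j, a, k)" "j \<le> m" "a < d" "k < r" using \<open>i \<in> Ix m\<close> by (auto simp: Ix_def)
    show "fw m i \<in> F (Suc m)" using i by (simp add: fw_F)
    show "cl (Suc m) (fw m i) = wq m i" using i by (simp add: wq_def w_cl)
    show "cl ?n (fw m i) * eig.gi ?n (Suc m) = qb (Suc m) i"
      using i by (simp add: qb_def wq_def w_cl[symmetric]) (simp add: eig.w_def mult.assoc)
  qed
  have g: "fgi (Suc m) \<in> F ?n" by (rule fgi_F) auto
  have z: "emb r d ?n (?z i) = qb (Suc m) (Suc m, i mod d, i div d)" for i
    using qb_u[of "Suc m"] by (simp add: u_mult)
  show "ring ?C" "ring ?A" "ring ?B" by (rule ring_cyc_YH)+
  show "?j \<in> ring_hom ?C ?A" "?i \<in> ring_hom ?A ?B" by (rule cyc_incl_hom)+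
  show "?\<gamma> \<in> carrier ?B" by (rule class_closed[OF g])
  show "?i (?j a) \<otimes>\<^bsub>?B\<^esub> ?\<gamma> = ?\<gamma> \<otimes>\<^bsub>?B\<^esub> ?i (?j a)" if "a \<in> carrier ?C" for a
  proof -
    obtain f where f: "f \<in> F m" "a = cyc_class r d m f" using \<open>a \<in> _\<close> unfolding cyc_class_surj by blast
    have f': "f \<in> F (Suc m)" "f \<in> F ?n" using F_mono f(1) by auto
    have "cl ?n f * cl ?n (fgi (Suc m)) = cl ?n (fgi (Suc m)) * cl ?n f"
      unfolding cl_fgi[OF _ _ f'(2), of "Suc m", simplified] by (rule comm_F[OF f(1)]) (simp_all add: gi_gens)
    then show ?thesis using f f' g class_closed
      by (intro emb_inj[of _ r d ?n]) (simp_all add: cyc_incl_class emb_ops cl_def)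
  qed
  show "?i a \<otimes>\<^bsub>?B\<^esub> ?z i = ?z i \<otimes>\<^bsub>?B\<^esub> ?i a" if "a \<in> carrier ?A" for i a
  proof -
    obtain f where f: "f \<in> F (Suc m)" "a = cyc_class r d (Suc m) f" using \<open>a \<in> _\<close> unfolding cyc_class_surj by blast
    have "cl ?n f * qb (Suc m) (Suc m, i mod d, i div d) = qb (Suc m) (Suc m, i mod d, i div d) * cl ?n f"
      unfolding qb_def by (rule comm_F[OF f(1)]) (simp_all add: Y_\<epsilon>_gens)
    then have "emb r d ?n (?i a \<otimes>\<^bsub>?B\<^esub> ?z i) = emb r d ?n (?z i \<otimes>\<^bsub>?B\<^esub> ?i a)"
      using f F_mono class_closed cmp_closed by (simp add: cyc_incl_class emb_ops(2) z) (simp add: cl_def)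
    then show ?thesis using f F_mono class_closed cmp_closed
      by (intro emb_inj[of _ r d ?n]) (simp_all add: cyc_incl_class)
  qed
  show "right_basis ?C ?A ?j (Ix m) ?w"
    by (rule right_basis_cyc[of id _ _ _ "wq m"]) (use w wq_span wq_indep in \<open>auto simp: class_closed simp flip: cl_def\<close>)
  show "right_basis ?A ?B ?i ({..<r * d} <+> Ix m) (case_sum ?z (\<lambda>i. ?i (?w i) \<otimes>\<^bsub>?B\<^esub> ?\<gamma>))"
  proof (rule right_basis_cyc[where q = "qb (Suc m)", OF bij_Ix])
    fix i assume i: "i \<in> {..<r * d} <+> Ix m"
    show "case_sum ?z (\<lambda>i. ?i (?w i) \<otimes>\<^bsub>?B\<^esub> ?\<gamma>) i \<in> carrier ?B"
      using i w g F_mono by (auto simp: cmp_closed cyc_incl_class class_closed)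
    show "emb r d ?n (case_sum ?z (\<lambda>i. ?i (?w i) \<otimes>\<^bsub>?B\<^esub> ?\<gamma>) i) = qb (Suc m) (case_sum (\<lambda>i. (Suc m, i mod d, i div d)) id i)"
    proof (cases i)
      case (Inr j)
      then have j: "j \<in> Ix m" using i by auto
      have F: "fw m j \<in> F ?n" using w(1)[OF j] F_mono by blast
      have "emb r d ?n (?i (?w j) \<otimes>\<^bsub>?B\<^esub> ?\<gamma>) = cl ?n (fw m j) * cl ?n (fgi (Suc m))"
        using w(1)[OF j] F g by (simp add: cyc_incl_class emb_ops(2) class_closed cl_def)
      also have "\<dots> = qb (Suc m) j" using w(3)[OF j] F by (simp add: cl_fgi)
      finally show ?thesis using Inr by simp
    qed (simp add: z)
  qed (use qb_span qb_indep in blast)+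
qed

end

theorem theorem3p2:
  fixes r d n :: nat
  assumes "r \<ge> 1" and "d \<ge> 1" and "n \<ge> 1"
  shows "\<exists>\<eta> :: (yh_poly set set, 'm) module \<Rightarrow> (yh_poly set set \<times> 'm \<Rightarrow>\<^sub>0 int) set \<Rightarrow>
              (nat \<Rightarrow> 'm) \<times> (yh_poly set set \<times> 'm \<Rightarrow>\<^sub>0 int) set.
    (\<forall>M. left_module (cyc_YH r d n) M \<longrightarrow>
       \<eta> M \<in> lmod_iso (cyc_YH r d n)
         (cyc_res r d n (cyc_ind r d n M))
         (dir_sum (dir_power (r * d) M) (cyc_ind r d (n - 1) (cyc_res r d (n - 1) M)))) \<and>
    (\<forall>M N f. left_module (cyc_YH r d n) M \<longrightarrow> left_module (cyc_YH r d n) N \<longrightarrow>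
       f \<in> lmod_hom (cyc_YH r d n) M N \<longrightarrow>
       (\<forall>x \<in> carrier (cyc_res r d n (cyc_ind r d n M)).
          \<eta> N (cyc_ind_map r d n N f x) =
          map_prod (dir_power_map (r * d) f)
            (cyc_ind_map r d (n - 1) (cyc_res r d (n - 1) N) f) (\<eta> M x)))"
proof -
  obtain m where n: "n = Suc m" using \<open>n \<ge> 1\<close> by (cases n) auto
  interpret yh_parameters r d using assms by unfold_locales
  interpret mackey "cyc_YH r d m" "cyc_YH r d (Suc m)" "cyc_YH r d (Suc (Suc m))" "cyc_incl r d m" "cyc_incl r d (Suc m)" "r * d"
     "\<lambda>i. cmp (qb (Suc m) (Suc m, i mod d, i div d)) (r, d, Suc (Suc m))" "Ix m" "\<lambda>i. cyc_class r d (Suc m) (fw m i)"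
     "cyc_class r d (Suc (Suc m)) (fgi (Suc m))"
    by (rule mackey_cyc)
  have iso: "\<eta> M \<in> lmod_iso (cyc_YH r d n) (cyc_res r d n (cyc_ind r d n M))
         (dir_sum (dir_power (r * d) M) (cyc_ind r d (n - 1) (cyc_res r d (n - 1) M)))"
    if "left_module (cyc_YH r d n) M" for M :: "(yh_poly set set, 'm) module"
    using mackey_module.\<eta>_iso[OF mackey_module.intro[OF mackey_axioms mackey_module_axioms.intro], of M] that
    by (simp add: n cyc_res_def cyc_ind_def target_def)
  have nat: "\<eta> N (cyc_ind_map r d n N f x) = map_prod (dir_power_map (r * d) f)
            (cyc_ind_map r d (n - 1) (cyc_res r d (n - 1) N) f) (\<eta> M x)"
    if "left_module (cyc_YH r d n) M" "left_module (cyc_YH r d n) N" "f \<in> lmod_hom (cyc_YH r d n) M N"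
       "x \<in> carrier (cyc_res r d n (cyc_ind r d n M))" for M N :: "(yh_poly set set, 'm) module" and f x
    using \<eta>_natural[of M N f x] that
    by (simp add: n cyc_res_def cyc_ind_def cyc_ind_map_def res_def)
  show ?thesis by (rule exI[of _ \<eta>]) (use iso nat in blast)
qed

end
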